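(* Let $X$ be a closed dilation surface containing at least one horizon saddle connection. Then there is an open dense subset $U$ of $\mathbb{S}^{1}$ such that the directional flow of $X$ along any direction of $U$ is Morse-Smale.
   Context: A closed dilation surface is a compact connected topological surface $X$ without boundary, with a finite set $\Sigma \subset X$ of singularities and an atlas of charts on $X \setminus \Sigma$ with values in $\mathbb{C}$ whose transition maps are of the form $z \mapsto az+b$ with $a \in \mathbb{R}_{>0}$, $b \in \mathbb{C}$, and such that near each singularity the structure is obtained from a flat cone of angle $2\pi i$ ($i\geq 1$ an integer) by cutting along a ray from the apex and identifying the two sides of the cut by a homothety of some ratio $\rho>0$. (Marked points, i.e. $i=1$, $\rho=1$, are allowed in $\Sigma$.) Directions (elements of $\mathbb{S}^1$) are globally defined on $X$. A trajectory in direction $d$ is a path in $X\setminus\Sigma$ which in charts is a straight line travelled in direction $d$, extended as far as possible (it stops if it hits a singularity). The directional flow along $d$ is the flow whose trajectories are the trajectories in direction $d$. A saddle connection is a geodesic segment (locally straight in charts) in $X \setminus \Sigma$ whose two endpoints are singularities. A horizon saddle connection is a saddle connection $L$ for which there exists a number $k$ such that no trajectory of $X$ crosses $L$ more than $k$ times; by convention, a closed geodesic crossing $L$ is considered to cross it infinitely many times. A closed geodesic is hyperbolic if the linear part of its holonomy (its dilation ratio) is different from $1$. The directional flow along a direction is Morse-Smale if every trajectory in this direction either hits a singularity or accumulates on a hyperbolic closed geodesic (a trajectory which is itself a hyperbolic closed geodesic is regarded as accumulating on it). *)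

theory Defs
  imports "HOL-Analysis.Analysis"
begin

section \<open>Closed dilation surfaces\<close>

type_synonym 'a chart = "'a set \<times> ('a \<Rightarrow> complex)"

record 'a dilation_structure =
  surface :: "'a topology"
  singularities :: "'a set"
  atlas :: "'a chart set"

definition regular_points :: "'a dilation_structure \<Rightarrow> 'a set" where
  "regular_points X = topspace (surface X) - singularities X"

text \<open>Near \<open>x\<close> the transition map from the first chart to the second one is
  \<open>z \<mapsto> a z + b\<close> for some \<open>b\<close>. The factor \<open>a\<close> is determined, because
  the charts of an atlas have open domains and images. As the overlap of two charts need not be
  connected, \<open>a\<close> and \<open>b\<close> may depend on its component.\<close>

definition transition_factor ::
    "'a dilation_structure \<Rightarrow> 'a chart \<Rightarrow> 'a chart \<Rightarrow> 'a \<Rightarrow> real \<Rightarrow> bool" where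
  "transition_factor X C D x a \<longleftrightarrow>
     (\<exists>W b. openin (surface X) W \<and> x \<in> W \<and> W \<subseteq> fst C \<inter> fst D \<and>
        (\<forall>y\<in>W. snd D y = of_real a * snd C y + b))"

definition dilation_atlas :: "'a dilation_structure \<Rightarrow> bool" where
  "dilation_atlas X \<longleftrightarrow>
     (\<forall>(U, \<phi>) \<in> atlas X. openin (surface X) U \<and> U \<subseteq> regular_points X \<and> open (\<phi> ` U) \<and>
        homeomorphic_map (subtopology (surface X) U) (top_of_set (\<phi> ` U)) \<phi>) \<and>
     \<Union> (fst ` atlas X) = regular_points X \<and>
     (\<forall>C\<in>atlas X. \<forall>D\<in>atlas X. \<forall>x \<in> fst C \<inter> fst D. \<exists>a>0. transition_factor X C D x a)"

text \<open>A neighbourhood of the apex in the flat cone of angle \<open>2 \<pi> k\<close> cut along a ray, in polar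
  coordinates \<open>(r, \<theta>)\<close>; the apex is represented by all points with \<open>r = 0\<close>.
  The bound on the radius is chosen so that the neighbourhood is invariant under the
  homothety of ratio \<open>\<rho>\<close> that glues the side \<open>\<theta> = 0\<close> of the cut to the side
  \<open>\<theta> = 2 \<pi> k\<close>.\<close>

definition cut_cone :: "nat \<Rightarrow> real \<Rightarrow> real \<Rightarrow> (real \<times> real) set" where
  "cut_cone k \<rho> \<epsilon> = {(r, \<theta>). 0 \<le> \<theta> \<and> \<theta> \<le> 2 * pi * real k \<and>
     0 \<le> r \<and> r < \<epsilon> * \<rho> powr (\<theta> / (2 * pi * real k))}"

definition glued :: "nat \<Rightarrow> real \<Rightarrow> real \<times> real \<Rightarrow> real \<times> real \<Rightarrow> bool" where
  "glued k \<rho> p q \<longleftrightarrow> p = q \<or> (fst p = 0 \<and> fst q = 0) \<or>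
     (snd p = 0 \<and> snd q = 2 * pi * real k \<and> fst q = \<rho> * fst p) \<or>
     (snd q = 0 \<and> snd p = 2 * pi * real k \<and> fst p = \<rho> * fst q)"

definition polar :: "real \<times> real \<Rightarrow> complex" where
  "polar p = of_real (fst p) * cis (snd p)"

text \<open>\<open>P\<close> identifies the glued cone with a neighbourhood \<open>N\<close> of \<open>s\<close>. In the charts
  of the surface it is locally \<open>z \<mapsto> a z + b\<close> in the flat coordinate of the cone; at a
  point of the cut, the coordinate on the side \<open>\<theta> = 0\<close> continues the one on the
  side \<open>\<theta> = 2 \<pi> k\<close> after multiplication by \<open>\<rho>\<close>.\<close>

definition cone_singularity :: "'a dilation_structure \<Rightarrow> 'a \<Rightarrow> bool" where
  "cone_singularity X s \<longleftrightarrow>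
     (\<exists>k \<rho> \<epsilon> N P. 1 \<le> k \<and> 0 < \<rho> \<and> 0 < \<epsilon> \<and>
        openin (surface X) N \<and> N \<inter> singularities X = {s} \<and>
        quotient_map (top_of_set (cut_cone k \<rho> \<epsilon>)) (subtopology (surface X) N) P \<and>
        (\<forall>p \<in> cut_cone k \<rho> \<epsilon>. \<forall>q \<in> cut_cone k \<rho> \<epsilon>. P p = P q \<longleftrightarrow> glued k \<rho> p q) \<and>
        P (0, 0) = s \<and>
        (\<forall>(U, \<phi>) \<in> atlas X. \<forall>p \<in> cut_cone k \<rho> \<epsilon>. 0 < fst p \<and> P p \<in> U \<longrightarrow>
           (\<exists>a>0. \<exists>b. \<exists>e>0. \<forall>q \<in> cut_cone k \<rho> \<epsilon>. P q \<in> U \<longrightarrow>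
              (dist q p < e \<longrightarrow> \<phi> (P q) = of_real a * polar q + b) \<and>
              (snd p = 2 * pi * real k \<and> dist q (fst p / \<rho>, 0) < e \<longrightarrow>
                 \<phi> (P q) = of_real a * (of_real \<rho> * polar q) + b))))"

definition closed_dilation_surface :: "'a dilation_structure \<Rightarrow> bool" where
  "closed_dilation_surface X \<longleftrightarrow>
     compact_space (surface X) \<and> connected_space (surface X) \<and> Hausdorff_space (surface X) \<and>
     finite (singularities X) \<and> singularities X \<subseteq> topspace (surface X) \<and>
     dilation_atlas X \<and> (\<forall>s \<in> singularities X. cone_singularity X s)"

section \<open>Trajectories and saddle connections\<close>

text \<open>Directions are unit complex numbers. Straight paths carry an affine parametrization, which
  the structure determines only up to affine changes of the parameter: in each chart the speed is
  locally constant, but it depends on the chart.\<close>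

definition straight_path ::
    "'a dilation_structure \<Rightarrow> complex \<Rightarrow> real set \<Rightarrow> (real \<Rightarrow> 'a) \<Rightarrow> bool" where
  "straight_path X d I \<gamma> \<longleftrightarrow>
     (\<forall>t\<in>I. \<gamma> t \<in> regular_points X \<and>
        (\<forall>(U, \<phi>) \<in> atlas X. \<gamma> t \<in> U \<longrightarrow>
           (\<exists>a>0. \<exists>e>0. \<forall>u\<in>I. \<bar>u - t\<bar> < e \<longrightarrow>
              \<gamma> u \<in> U \<and> \<phi> (\<gamma> u) = \<phi> (\<gamma> t) + of_real (a * (u - t)) * d)))"

text \<open>Trajectories are maximal in both directions of time. The one along a closed geodesic runs
  around it infinitely often (if the geodesic is hyperbolic, the parameter interval is a
  half-line).\<close>

definition trajectory ::
    "'a dilation_structure \<Rightarrow> complex \<Rightarrow> real set \<Rightarrow> (real \<Rightarrow> 'a) \<Rightarrow> bool" where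
  "trajectory X d I \<gamma> \<longleftrightarrow>
     I \<noteq> {} \<and> open I \<and> is_interval I \<and> straight_path X d I \<gamma> \<and>
     (\<forall>J \<gamma>'. open J \<and> is_interval J \<and> I \<subseteq> J \<and> (\<forall>t\<in>I. \<gamma>' t = \<gamma> t) \<and> straight_path X d J \<gamma>' \<longrightarrow> J = I)"

definition saddle_connection :: "'a dilation_structure \<Rightarrow> complex \<Rightarrow> (real \<Rightarrow> 'a) \<Rightarrow> bool" where
  "saddle_connection X d L \<longleftrightarrow>
     d \<in> sphere 0 1 \<and> pathin (surface X) L \<and> straight_path X d {0<..<1} L \<and>
     L 0 \<in> singularities X \<and> L 1 \<in> singularities X"

text \<open>A trajectory crosses \<open>L\<close> where it meets it in a direction not parallel to \<open>L\<close>;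
  the parallel trajectories that meet \<open>L\<close> only run along it. Crossings are counted by
  parameter values, so that a closed geodesic crossing \<open>L\<close> crosses it infinitely often.\<close>

definition horizon_saddle_connection :: "'a dilation_structure \<Rightarrow> (real \<Rightarrow> 'a) \<Rightarrow> bool" where
  "horizon_saddle_connection X L \<longleftrightarrow>
     (\<exists>d\<^sub>L. saddle_connection X d\<^sub>L L \<and>
        (\<exists>k::nat. \<forall>d I \<gamma>. d \<in> sphere 0 1 \<and> d \<noteq> d\<^sub>L \<and> d \<noteq> - d\<^sub>L \<and> trajectory X d I \<gamma> \<longrightarrow>
           finite {t\<in>I. \<gamma> t \<in> L ` {0<..<1}} \<and> card {t\<in>I. \<gamma> t \<in> L ` {0<..<1}} \<le> k))"

section \<open>Closed geodesics and Morse-Smale directions\<close>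

definition closed_geodesic :: "'a dilation_structure \<Rightarrow> complex \<Rightarrow> (real \<Rightarrow> 'a) \<Rightarrow> bool" where
  "closed_geodesic X d c \<longleftrightarrow> straight_path X d {0..1} c \<and> c 0 = c 1"

text \<open>The linear part of the holonomy of a loop: the product of the linear parts of the transition
  maps along a cyclic chain of charts that covers the loop.\<close>

definition holonomy_ratio :: "'a dilation_structure \<Rightarrow> (real \<Rightarrow> 'a) \<Rightarrow> real \<Rightarrow> bool" where
  "holonomy_ratio X c \<mu> \<longleftrightarrow>
     (\<exists>n t C a. t 0 = (0::real) \<and> t n = 1 \<and> C n = C 0 \<and>
        (\<forall>i<n. t i < t (Suc i) \<and> C i \<in> atlas X \<and> c ` {t i..t (Suc i)} \<subseteq> fst (C i) \<and>
           transition_factor X (C i) (C (Suc i)) (c (t (Suc i))) (a i)) \<and>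
        \<mu> = (\<Prod>i<n. a i))"

definition hyperbolic_closed_geodesic ::
    "'a dilation_structure \<Rightarrow> complex \<Rightarrow> (real \<Rightarrow> 'a) \<Rightarrow> bool" where
  "hyperbolic_closed_geodesic X d c \<longleftrightarrow>
     closed_geodesic X d c \<and> (\<exists>\<mu>. holonomy_ratio X c \<mu> \<and> \<mu> \<noteq> 1)"

definition hits_singularity :: "'a dilation_structure \<Rightarrow> real set \<Rightarrow> (real \<Rightarrow> 'a) \<Rightarrow> bool" where
  "hits_singularity X I \<gamma> \<longleftrightarrow>
     (\<exists>s \<in> singularities X. \<forall>W. openin (surface X) W \<and> s \<in> W \<longrightarrow>
        (\<exists>t\<^sub>0\<in>I. \<forall>t\<in>I. t\<^sub>0 \<le> t \<longrightarrow> \<gamma> t \<in> W))"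

text \<open>The forward limit set contains \<open>c\<close>; a trajectory running around \<open>c\<close> satisfies this.\<close>

definition accumulates_on ::
    "'a dilation_structure \<Rightarrow> real set \<Rightarrow> (real \<Rightarrow> 'a) \<Rightarrow> (real \<Rightarrow> 'a) \<Rightarrow> bool" where
  "accumulates_on X I \<gamma> c \<longleftrightarrow>
     (\<forall>x \<in> c ` {0..1}. \<forall>W. openin (surface X) W \<and> x \<in> W \<longrightarrow>
        (\<forall>t\<^sub>0\<in>I. \<exists>t\<in>I. t\<^sub>0 \<le> t \<and> \<gamma> t \<in> W))"

definition Morse_Smale :: "'a dilation_structure \<Rightarrow> complex \<Rightarrow> bool" where
  "Morse_Smale X d \<longleftrightarrow>
     (\<forall>I \<gamma>. trajectory X d I \<gamma> \<longrightarrow>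
        hits_singularity X I \<gamma> \<or>
        (\<exists>c. hyperbolic_closed_geodesic X d c \<and> accumulates_on X I \<gamma> c))"

end

theory Submission imports Defs begin

text \<open>Call a map from a plane domain to the surface a dilation immersion if it is locally the inverse of
 a chart. When an immersion of a convex domain cannot be extended at a boundary point, then by
 compactness either it runs into a singularity there or it factors through a homothety whose fixed
 point is close to that point. Near the finitely many singularities only finitely many germs of
 immersions of a given cone of directions occur, so on a small enough cone it is decided which of
 them extend to the whole cone. If the directions of a cone cross a horizon saddle connection, then the
 bound on the number of crossings yields a complete immersed cone at a point of the saddle connection;
 by connectedness completeness spreads to all regular points and to all germs. A complete cone is
 invariant under a homothety of ratio different from 1. So a trajectory in an opposite
 direction of the cone that does not hit a singularity runs into, or comes from, such a homothety, and
 the line through its fixed point projects to a hyperbolic closed geodesic.\<close>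

text \<open>Immersed convex regions are grown until they stop, and the proof turns on removing the
  point at which they stop. A singular end point is harmless over a decided cone \<open>K\<close>:
  once its germ is complete on some subcone, it is complete on \<open>K\<close>. A homothety is
  harmless on an invariant cone: every similarity that preserves the immersion there has the same
  fixed point (\<open>common_fixed_point\<close>), while \<open>end_trichotomy\<close> finds one
  whose fixed point is as close to the obstacle as desired. Completeness at a point only asks for
  some subcone of \<open>K\<close> (\<open>good\<close>), so it is an open condition, and it moves
  against the directions of \<open>K\<close> (\<open>forward_complete\<close>). The number of
  crossings enters through extremality: next to the last crossing of a trajectory that has the most
  of them, no line of nearby direction returns (\<open>no_return\<close>). The trajectories run
  opposite to \<open>K\<close> for this reason: seen from a limit point at 0, an obstacle ahead is a
  point \<open>P\<close> with \<open>-P\<close> in \<open>K\<close>, so the cone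
  \<open>P + K\<close> contains 0 and the backward ray from it, and it is immersed because
  completeness is known for \<open>K\<close>.\<close>

abbreviation cr :: "real \<Rightarrow> complex" where "cr == of_real"

section \<open>Dilation immersions\<close>

text \<open>A horizon saddle connection has singular end points, so \<open>singular\<close> is
  available. It is what excludes an immersion of the whole plane (\<open>plane_impossible\<close>);
  a flat torus without singularities has one.\<close>

locale dilation_surface =
 fixes X :: "'a dilation_structure"
 assumes closed_surface: "closed_dilation_surface X" and singular: "singularities X ~= {}"
begin

abbreviation "topX \<equiv> surface X"
abbreviation "Reg \<equiv> regular_points X"
abbreviation "Sing \<equiv> singularities X"

lemma compact_X: "compact_space topX" and connected_X: "connected_space topX"
 and Hausdorff_X: "Hausdorff_space topX" and finite_Sing: "finite Sing"
 and Sing_subset: "Sing \<subseteq> topspace topX" and atlas_X: "dilation_atlas X"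
 and cone_X: "s \<in> Sing ==> cone_singularity X s" using closed_surface unfolding closed_dilation_surface_def by auto

lemma chart_open: "(U, ph) \<in> atlas X ==> openin topX U"
 and chart_reg: "(U, ph) \<in> atlas X ==> U \<subseteq> Reg"
 and chart_img_open: "(U, ph) \<in> atlas X ==> open (ph ` U)"
 and chart_homeo: "(U, ph) \<in> atlas X ==> homeomorphic_map (subtopology topX U) (top_of_set (ph ` U)) ph" using atlas_X unfolding dilation_atlas_def by auto

lemma Reg_chart: assumes "x \<in> Reg" obtains U ph where "(U, ph) \<in> atlas X" "x \<in> U"
proof -
 have "x \<in> \<Union> (fst ` atlas X)" using atlas_X assms unfolding dilation_atlas_def by simp
 thus ?thesis using that by auto
qed

lemma Reg_topspace: "Reg \<subseteq> topspace topX" by (auto simp: regular_points_def)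

lemma transition:
 assumes "(U, ph) \<in> atlas X" "(V, xi) \<in> atlas X" "x \<in> U" "x \<in> V"
 obtains a b W where "a > 0" "openin topX W" "x \<in> W" "W \<subseteq> U Int V" "!!y. y \<in> W ==> xi y = cr a * ph y + b"
  "transition_factor X (U,ph) (V,xi) x a"
proof -
 have "\<forall>C\<in>atlas X. \<forall>D\<in>atlas X. \<forall>x\<in>fst C Int fst D. \<exists>a>0. transition_factor X C D x a" using atlas_X unfolding dilation_atlas_def by blast
 then obtain a where a: "a > 0" "transition_factor X (U,ph) (V,xi) x a" using assms by (metis Int_iff fst_conv)
 then obtain W b where "openin topX W" "x \<in> W" "W \<subseteq> U Int V" "!!y. y \<in> W ==> xi y = cr a * ph y + b" unfolding transition_factor_def by auto
 with a show ?thesis using that by blast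
qed

lemma chart_inj: "(U, ph) \<in> atlas X ==> inj_on ph U" using chart_homeo[of U ph] chart_open[of U ph] openin_subset[of topX U] unfolding homeomorphic_eq_everything_map by (auto simp: Int_absorb1 inj_on_def)

lemma chart_mem: "(U, ph) \<in> atlas X ==> x \<in> U ==> W \<subseteq> U ==> ph x \<in> ph ` W ==> x \<in> W" using inj_on_image_mem_iff[OF chart_inj] by blast

lemma chart_open_image:
 assumes "(U, ph) \<in> atlas X" "openin topX W" "W \<subseteq> U" shows "open (ph ` W)" using assms using chart_homeo[OF assms(1)] unfolding homeomorphic_eq_everything_map open_map_def using chart_img_open[OF assms(1)] openin_open_eq by (simp add: openin_open_subtopology chart_open)

lemma chart_open_vimage:
 assumes "(U, ph) \<in> atlas X" "open V" shows "openin topX {x\<in>U. ph x \<in> V}"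
proof -
 have "openin (subtopology topX U) {x \<in> topspace (subtopology topX U). ph x \<in> (ph ` U) Int V}" using chart_homeo[OF assms(1)] unfolding homeomorphic_eq_everything_map using assms(2) by (intro openin_continuous_map_preimage) (auto intro: openin_open_Int)
 moreover have "{x \<in> topspace (subtopology topX U). ph x \<in> (ph ` U) Int V} = {x\<in>U. ph x \<in> V}" using chart_open[OF assms(1)] openin_subset by fastforce
 ultimately show ?thesis using chart_open[OF assms(1)] by (simp add: openin_open_subtopology)
qed

text \<open>An inverse developing map. Working with maps out of the plane makes convexity and
  homotheties available. One chart is enough here; \<open>dimm_at_chart\<close> passes to every
  other chart at \<open>E z\<close>.\<close>

definition dimm_at :: "(complex => 'a) => complex => bool" where
 "dimm_at E z \<longleftrightarrow> (\<exists>(U,ph)\<in>atlas X. \<exists>a>0. \<exists>b. \<exists>e>0. \<forall>w\<in>ball z e. E w \<in> U & ph (E w) = cr a * w + b)"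

definition dimm :: "complex set => (complex => 'a) => bool" where
 "dimm D E \<longleftrightarrow> open D & (\<forall>z\<in>D. dimm_at E z)"

lemma dimm_atI:
 assumes "(U,ph)\<in>atlas X" "a > 0" "e > 0" "!!w. w \<in> ball z e ==> E w \<in> U" "!!w. w \<in> ball z e ==> ph (E w) = cr a * w + b"
 shows "dimm_at E z" using assms unfolding dimm_at_def by blast

lemma dimm_at_reg: "dimm_at E z ==> E z \<in> Reg" unfolding dimm_at_def using chart_reg by fastforce

lemma dimm_at_chart:
 assumes "dimm_at E z" "(V,xi) \<in> atlas X" "E z \<in> V"
 obtains a b e where "a > 0" "e > 0" "!!w. w \<in> ball z e ==> E w \<in> V & xi (E w) = cr a * w + b"
proof -
 obtain U ph a b e where U: "(U,ph)\<in>atlas X" "a > 0" "e > 0" "!!w. w \<in> ball z e ==> E w \<in> U & ph (E w) = cr a * w + b" using assms(1) unfolding dimm_at_def by blast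
 have z: "E z \<in> U" using U by auto
 obtain a' b' W where W: "a' > 0" "openin topX W" "E z \<in> W" "W \<subseteq> U Int V" "!!y. y \<in> W ==> xi y = cr a' * ph y + b'" using transition[OF U(1) assms(2) z assms(3)] by metis
 have "open ((%w. cr a * w + b) -` (ph ` W))" using chart_open_image[OF U(1) W(2)] W(4) by (simp add: open_vimage continuous_on_eq_continuous_at)
 moreover have "z \<in> (%w. cr a * w + b) -` (ph ` W)" proof -
  have e: "cr a * z + b = ph (E z)" using U(4)[of z] U(3) by simp
  show ?thesis unfolding vimage_def mem_Collect_eq e using W(3) by (rule imageI)
 qed
 ultimately obtain e' where e': "e' > 0" "ball z e' \<subseteq> (%w. cr a * w + b) -` (ph ` W)" using open_contains_ball by blast
 show ?thesis proof (rule that[of "a'*a" "min e e'" "cr a' * b + b'"])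
  fix w assume w: "w \<in> ball z (min e e')"
  have 1: "E w \<in> U" "ph (E w) = cr a * w + b" using U(4) w by auto
  have "E w \<in> W" using e' w chart_mem[OF U(1), of "E w" W] 1 W(4) by auto
  thus "E w \<in> V & xi (E w) = cr (a' * a) * w + (cr a' * b + b')" using W(4,5) 1 by (auto simp: algebra_simps)
 qed (use U e' W in auto)
qed

lemma dimm_open: "dimm D E ==> open D" and dimm_atD: "dimm D E ==> z \<in> D ==> dimm_at E z" by (auto simp: dimm_def)

lemma dimm_reg: "dimm D E ==> z \<in> D ==> E z \<in> Reg" by (meson dimm_atD dimm_at_reg)

lemma dimm_subset: "dimm D E ==> open D' ==> D' \<subseteq> D ==> dimm D' E" by (auto simp: dimm_def)

lemma dimm_at_cong: "dimm_at E z ==> e > 0 ==> (!!w. w \<in> ball z e ==> F w = E w) ==> dimm_at F z"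
proof -
 assume a: "dimm_at E z" "e > 0" "!!w. w \<in> ball z e ==> F w = E w"
 obtain U ph a b e' where U: "(U,ph)\<in>atlas X" "a > 0" "e' > 0" "!!w. w \<in> ball z e' ==> E w \<in> U & ph (E w) = cr a * w + b" using a(1) unfolding dimm_at_def by blast
 show ?thesis by (rule dimm_atI[OF U(1,2), of "min e e'" _ _ b]) (use U a in auto)
qed

lemma dimm_at_ball: assumes "dimm_at E z" obtains e where "e > 0" "dimm (ball z e) E"
proof -
 obtain U ph a b e where U: "(U,ph)\<in>atlas X" "a > 0" "e > 0" "!!w. w \<in> ball z e ==> E w \<in> U & ph (E w) = cr a * w + b" using assms(1) unfolding dimm_at_def by blast
 have "dimm_at E w" if w: "w \<in> ball z e" for w proof -
  have "v \<in> ball z e" if "v \<in> ball w (e - dist z w)" for v using that dist_triangle[of z v w] by simp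
  thus ?thesis using U w by (intro dimm_atI[OF U(1,2), of "e - dist z w" _ _ b]) auto
 qed
 thus ?thesis using that[of e] U(3) unfolding dimm_def by auto
qed

lemma dimm_cong: "dimm D E ==> (!!w. w \<in> D ==> F w = E w) ==> dimm D F" unfolding dimm_def by (metis dimm_at_cong open_contains_ball subsetD)

lemma dimm_glue:
 assumes "!!i. i \<in> I ==> dimm (S i) (F i)"
  and "!!i j z. i \<in> I ==> j \<in> I ==> z \<in> S i ==> z \<in> S j ==> F i z = F j z"
 obtains E where "dimm (\<Union>i\<in>I. S i) E" "!!i z. i \<in> I ==> z \<in> S i ==> E z = F i z"
proof
 let ?E = "%z. F (SOME i. i \<in> I & z \<in> S i) z"
 have eq: "?E z = F i z" if "i \<in> I" "z \<in> S i" for i z using someI[of "%i. i \<in> I & z \<in> S i" i] that assms(2) by blast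
 thus "!!i z. i \<in> I ==> z \<in> S i ==> ?E z = F i z" by blast
 have "dimm_at ?E z" if i: "i \<in> I" "z \<in> S i" for i z proof -
  have "dimm (S i) ?E" by (rule dimm_cong[OF assms(1)[OF i(1)]]) (use eq i in auto)
  thus ?thesis using i by (simp add: dimm_atD)
 qed
 thus "dimm (\<Union>i\<in>I. S i) ?E" using assms(1) unfolding dimm_def by blast
qed

lemma dimm_glue2:
 assumes "dimm A F" "dimm B G" "!!z. z \<in> A ==> z \<in> B ==> F z = G z"
 obtains E where "dimm (A Un B) E" "!!z. z \<in> A ==> E z = F z" "!!z. z \<in> B ==> E z = G z"
proof -
 let ?E = "%z. if z \<in> A then F z else G z"
 have 1: "dimm A ?E" by (rule dimm_cong[OF assms(1)]) auto
 have 2: "dimm B ?E" by (rule dimm_cong[OF assms(2)]) (use assms(3) in auto)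
 have "dimm (A Un B) ?E" using 1 2 unfolding dimm_def by auto
 thus ?thesis using that[of ?E] assms(3) by auto
qed

lemma dimm_affine:
 assumes "dimm D E" "c > 0" shows "dimm {z. cr c * z + b \<in> D} (%z. E (cr c * z + b))" unfolding dimm_def
proof safe
 have "open ((%w. cr c * w + b) -` D)" using dimm_open[OF assms(1)] by (simp add: open_vimage continuous_on_eq_continuous_at)
 thus "open {z. cr c * z + b \<in> D}" by (simp add: vimage_def)
next
 fix z assume z: "cr c * z + b \<in> D"
 obtain U ph a b' e where U: "(U,ph)\<in>atlas X" "a > 0" "e > 0" "!!w. w \<in> ball (cr c * z + b) e ==> E w \<in> U & ph (E w) = cr a * w + b'" using dimm_atD[OF assms(1) z] unfolding dimm_at_def by blast
 have *: "cr c * w + b \<in> ball (cr c * z + b) e" if "w \<in> ball z (e/c)" for w proof -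
  have "dist (cr c * z + b) (cr c * w + b) = c * dist z w" using assms(2) by (simp add: dist_norm norm_mult flip: right_diff_distrib)
  thus ?thesis using that assms(2) by (simp add: field_simps)
 qed
 show "dimm_at (%z. E (cr c * z + b)) z" by (rule dimm_atI[OF U(1), of "a*c" "e/c" _ _ "cr a * b + b'"]) (use U * assms(2) in \<open>auto simp: algebra_simps\<close>)
qed

lemma dimm_shift: "dimm D E ==> dimm {z. z + b \<in> D} (%z. E (z + b))" using dimm_affine[of D E 1 b] by simp

lemma dimm_continuous:
 assumes "dimm D E" shows "continuous_map (top_of_set D) topX E" unfolding continuous_map_def
proof safe
 show "E x \<in> topspace topX" if "x \<in> topspace (top_of_set D)" for x using dimm_reg[OF assms] Reg_topspace that by auto
next
 fix W assume W: "openin topX W"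
 have "open {x\<in>D. E x \<in> W}" proof (subst open_contains_ball, safe)
  fix z assume z: "z \<in> D" "E z \<in> W"
  obtain U ph a b e where U: "(U,ph)\<in>atlas X" "a > 0" "e > 0" "!!w. w \<in> ball z e ==> E w \<in> U & ph (E w) = cr a * w + b" using dimm_atD[OF assms z(1)] unfolding dimm_at_def by blast
  have zU: "E z \<in> U" using U by auto
  have "open ((%w. cr a * w + b) -` (ph ` (W Int U)))" using chart_open_image[OF U(1), of "W Int U"] W chart_open[OF U(1)] by (fastforce simp: open_vimage continuous_on_eq_continuous_at)
  moreover have "z \<in> (%w. cr a * w + b) -` (ph ` (W Int U))" proof -
   have e: "cr a * z + b = ph (E z)" using U(4)[of z] U(3) by simp
   show ?thesis unfolding vimage_def mem_Collect_eq e by (rule imageI) (use z zU in simp)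
  qed
  ultimately obtain e' where e': "e' > 0" "ball z e' \<subseteq> (%w. cr a * w + b) -` (ph ` (W Int U))" using open_contains_ball by blast
  obtain e2 where e2: "e2 > 0" "ball z e2 \<subseteq> D" using z dimm_open[OF assms] open_contains_ball by blast
  have "ball z (min e2 (min e e')) \<subseteq> {x\<in>D. E x \<in> W}" proof
   fix w assume w: "w \<in> ball z (min e2 (min e e'))"
   have 1: "E w \<in> U" "ph (E w) = cr a * w + b" using U(4) w by auto
   show "w \<in> {x\<in>D. E x \<in> W}" using e' chart_mem[OF U(1), of "E w" "W Int U"] 1 e2 w by auto
  qed
  thus "\<exists>e>0. ball z e \<subseteq> {x \<in> D. E x \<in> W}" using U e' e2 by (intro exI[of _ "min e2 (min e e')"]) auto
 qed
 thus "openin (top_of_set D) {x \<in> topspace (top_of_set D). E x \<in> W}" by (simp add: openin_open_eq dimm_open[OF assms])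
qed

lemma dimm_open_vimage: "dimm D E ==> openin topX W ==> open {z\<in>D. E z \<in> W}" using openin_continuous_map_preimage[OF dimm_continuous, of D E W] dimm_open[of D E] by (simp add: openin_open_eq)

section \<open>Rigidity of immersions: germs and the identity principle\<close>

lemma dimm_germ:
 assumes "dimm_at E z" "dimm_at G w" "E z = G w"
 obtains mu e where "mu > 0" "e > 0" "!!h. norm h < e ==> E (z + h) = G (w + cr mu * h)"
proof -
 obtain U ph a b e where U: "(U,ph)\<in>atlas X" "a > 0" "e > 0" "!!w. w \<in> ball z e ==> E w \<in> U & ph (E w) = cr a * w + b" using assms(1) unfolding dimm_at_def by blast
 have wU: "G w \<in> U" using U(3) U(4)[of z] assms(3) by auto
 obtain a' b' e' where U': "a' > 0" "e' > 0" "!!v. v \<in> ball w e' ==> G v \<in> U & ph (G v) = cr a' * v + b'" using dimm_at_chart[OF assms(2) U(1) wU] by metis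
 let ?mu = "a / a'"
 show ?thesis proof (rule that[of ?mu "min e (e' / ?mu)"])
  fix h :: complex assume h: "norm h < min e (e' / ?mu)"
  have 1: "E (z + h) \<in> U" "ph (E (z+h)) = cr a * (z + h) + b" using U(4)[of "z+h"] h by (auto simp: dist_norm)
  have "norm (cr ?mu * h) < e'" using h U(2) U'(1) by (simp add: norm_mult norm_divide field_simps)
  hence 2: "G (w + cr ?mu * h) \<in> U" "ph (G (w + cr ?mu * h)) = cr a' * (w + cr ?mu * h) + b'" using U'(3)[of "w + cr ?mu * h"] by (auto simp: dist_norm simp del: of_real_divide)
  show "E (z + h) = G (w + cr ?mu * h)" using U(3) U(4)[of z] U'(2) U'(3)[of w] assms(3) 1 2 U'(1) using chart_inj[OF U(1)] 1 2 unfolding inj_on_def by (simp add: algebra_simps)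
 qed (use U U' in auto)
qed

lemma dimm_at_inj: assumes "dimm_at E z" obtains e where "e > 0" "inj_on E (ball z e)"
proof -
 obtain U ph a b e where U: "(U,ph)\<in>atlas X" "a > 0" "e > 0" "!!w. w \<in> ball z e ==> E w \<in> U & ph (E w) = cr a * w + b" using assms(1) unfolding dimm_at_def by blast
 have "inj_on E (ball z e)" proof (rule inj_onI)
  fix x y assume "x \<in> ball z e" "y \<in> ball z e" "E x = E y"
  hence "cr a * x + b = cr a * y + b" using U(4) by metis
  thus "x = y" using U(2) by simp
 qed
 with U show ?thesis using that by blast
qed

text \<open>By \<open>dimm_germ\<close> the germs differ by a homothety of ratio \<open>mu\<close>
  about \<open>z\<close>. A second common value arbitrarily near \<open>z\<close> forces
  \<open>mu = 1\<close>, because \<open>G\<close> is injective near \<open>z\<close>. Agreement at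
  \<open>z\<close> alone leaves \<open>mu\<close> free.\<close>

lemma dimm_unique_local:
 assumes "dimm_at E z" "dimm_at G z" "E z = G z" "!!e. e > 0 ==> \<exists>w. w \<in> ball z e & w ~= z & E w = G w"
 obtains e where "e > 0" "!!w. w \<in> ball z e ==> E w = G w"
proof -
 obtain mu e where e: "mu > 0" "e > 0" "!!h. norm h < e ==> E (z + h) = G (z + cr mu * h)" using dimm_germ[OF assms(1-3)] by blast
 obtain e2 where e2: "e2 > 0" "inj_on G (ball z e2)" using dimm_at_inj[OF assms(2)] by blast
 \<comment> \<open>The three bounds put \<open>w\<close> where the germ identity holds, and put both
   \<open>w\<close> and \<open>z + mu * (w - z)\<close> into the disc on which \<open>G\<close> is
   injective.\<close>
 obtain w where w: "w \<in> ball z (min e (min e2 (e2/mu)))" "w ~= z" "E w = G w" using assms(4)[of "min e (min e2 (e2/mu))"] e e2 by auto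
 have n: "norm (w - z) < min e (min e2 (e2/mu))" using w by (simp add: dist_norm norm_minus_commute)
 have "G w = G (z + cr mu * (w - z))" using e(3)[of "w - z"] n w(3) by simp
 moreover have "norm (cr mu * (w - z)) < e2" using n e by (simp only: norm_mult norm_of_real) (simp add: field_simps)
 hence "z + cr mu * (w - z) \<in> ball z e2" by (simp add: dist_norm)
 moreover have "w \<in> ball z e2" using w by auto
 ultimately have "cr (1 - mu) * (w - z) = 0" using e2(2) unfolding inj_on_def by (fastforce simp: algebra_simps)
 thus ?thesis using w(2) that[of e] e(2) e(3)[of "x - z" for x] by (auto simp: dist_norm norm_minus_commute)
qed

lemma dimm_closed_agree:
 assumes "dimm_at E z" "dimm_at G z" "!!e. e > 0 ==> \<exists>w\<in>ball z e. E w = G w"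
 shows "E z = G z"
proof (rule ccontr)
 assume ne: "E z ~= G z"
 have "E z \<in> topspace topX" "G z \<in> topspace topX" using assms dimm_at_reg Reg_topspace by blast+
 then obtain W1 W2 where W: "openin topX W1" "openin topX W2" "E z \<in> W1" "G z \<in> W2" "disjnt W1 W2" using Hausdorff_X ne unfolding Hausdorff_space_def by metis
 obtain e1 where e1: "e1 > 0" "dimm (ball z e1) E" using dimm_at_ball[OF assms(1)] by blast
 obtain e2 where e2: "e2 > 0" "dimm (ball z e2) G" using dimm_at_ball[OF assms(2)] by blast
 have "open ({w\<in>ball z e1. E w \<in> W1} Int {w\<in>ball z e2. G w \<in> W2})" using dimm_open_vimage e1 e2 W by blast
 moreover have "z \<in> {w\<in>ball z e1. E w \<in> W1} Int {w\<in>ball z e2. G w \<in> W2}" using W e1 e2 by auto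
 ultimately obtain e where "e > 0" "ball z e \<subseteq> {w\<in>ball z e1. E w \<in> W1} Int {w\<in>ball z e2. G w \<in> W2}" using open_contains_ball by blast
 thus False using assms(3)[of e] W(5) unfolding disjnt_def by fastforce
qed

text \<open>Local agreement is an open condition, and it is closed by
  \<open>dimm_unique_local\<close>, whose hypothesis holds at every limit point of the set of
  agreement.\<close>

lemma dimm_unique:
 assumes "connected D" "dimm D E" "dimm D G" "open V" "V ~= {}" "V \<subseteq> D" "!!w. w \<in> V ==> E w = G w" "z \<in> D"
 shows "E z = G z"
proof -
 define A where "A = {z\<in>D. \<exists>e>0. \<forall>w\<in>ball z e. E w = G w}"
 have oD: "open D" using assms dimm_open by blast
 have "openin (top_of_set D) A" proof -
  have "open A" proof (subst open_contains_ball, safe)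
   fix z assume "z \<in> A"
   then obtain e where z: "z \<in> D" "e > 0" "\<forall>w\<in>ball z e. E w = G w" by (auto simp: A_def)
   obtain e' where e': "e' > 0" "ball z e' \<subseteq> D" using z oD open_contains_ball by blast
   have "ball z (min e e') \<subseteq> A" proof
    fix w assume w: "w \<in> ball z (min e e')"
    obtain e'' where "e'' > 0" "ball w e'' \<subseteq> ball z (min e e')" using w open_contains_ball by blast
    thus "w \<in> A" unfolding A_def using w z e' by force
   qed
   thus "\<exists>e>0. ball z e \<subseteq> A" using z e' by (intro exI[of _ "min e e'"]) auto
  qed
  thus ?thesis using oD by (simp add: openin_open_eq A_def subset_iff)
 qed
 moreover have "closedin (top_of_set D) A" unfolding closedin_limpt proof safe
  fix z assume z: "z islimpt A" "z \<in> D"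
  have ex: "\<exists>w. w \<in> ball z e & w ~= z & E w = G w" if epos: "e > 0" for e proof -
   obtain w where "w \<in> A" "w \<in> ball z e" "w ~= z" using z(1) epos unfolding islimpt_approachable by (metis dist_commute mem_ball)
   thus ?thesis unfolding A_def by auto
  qed
  have EG: "dimm_at E z" "dimm_at G z" using assms(2,3) z(2) dimm_atD by auto
  have eq: "E z = G z" by (rule dimm_closed_agree[OF EG]) (use ex in blast)
  obtain e where e: "e > 0" "!!w. w \<in> ball z e ==> E w = G w" by (rule dimm_unique_local[OF EG eq]) (use ex in auto)
  thus "z \<in> A" using z(2) unfolding A_def by auto
 qed (auto simp: A_def)
 moreover have "A ~= {}" proof -
  obtain v where "v \<in> V" using assms by auto
  moreover obtain e where "e > 0" "ball v e \<subseteq> V" using calculation assms(4) open_contains_ball by blast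
  ultimately show ?thesis using assms(6,7) unfolding A_def by blast
 qed
 ultimately obtain e where "e>0" "\<forall>w\<in>ball z e. E w = G w" using assms(1) unfolding connected_clopen using assms(8) unfolding A_def by blast
 thus ?thesis by simp
qed

end

text \<open>The homothety with centre \<open>P\<close> and ratio \<open>t\<close> takes the ball
  around \<open>q\<close> to a ball of radius \<open>t * ka\<close>. Convexity keeps it in
  \<open>D\<close> although \<open>P\<close> only lies in the closure.\<close>

lemma convex_shrink_mem:
 fixes P q w :: complex
 assumes "convex D" "P \<in> closure D" "ball q ka \<subseteq> D" "0 < t" "t <= 1" "norm w < t * ka"
 shows "P + cr t * (q - P) + w \<in> D"
proof -
 let ?c = "q + cr (1/t) * w"
 have "?c \<in> ball q ka" using assms(4,6) by (simp add: norm_mult norm_divide field_simps dist_norm)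
 hence "P - t *\<^sub>R (P - ?c) \<in> interior D" using assms(3) interior_maximal[of "ball q ka" D] mem_interior_closure_convex_shrink[OF assms(1) _ assms(2) assms(4,5)] by blast
 moreover have "P - t *\<^sub>R (P - ?c) = P + cr t * (q - P) + w" using assms(4) by (simp add: scaleR_conv_of_real algebra_simps)
 ultimately have "P + cr t * (q - P) + w \<in> interior D" by (simp only:)
 thus ?thesis using interior_subset by (rule subsetD[rotated])
qed

lemma convex_shrink_mem0:
 fixes P q :: complex
 assumes "convex D" "open D" "P \<in> closure D" "q \<in> D" "0 < t" "t <= 1"
 shows "P + cr t * (q - P) \<in> D"
proof -
 obtain ka where "ka > 0" "ball q ka \<subseteq> D" using assms(2,4) open_contains_ball by blast
 thus ?thesis using convex_shrink_mem[OF assms(1,3) _ assms(5,6), of q ka 0] assms(5) by simp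
qed

section \<open>Limits of paths in the compact surface, and the scale of an immersion\<close>

context dilation_surface begin

definition ends_at :: "real set => (real => 'a) => 'a => bool" where
 "ends_at I f s \<longleftrightarrow> (\<forall>W. openin topX W & s \<in> W --> (\<exists>t\<^sub>0\<in>I. \<forall>t\<in>I. t\<^sub>0 <= t --> f t \<in> W))"

definition clusters :: "real set => (real => 'a) => 'a => bool" where
 "clusters I f y \<longleftrightarrow> (\<forall>W. openin topX W & y \<in> W --> (\<forall>t\<^sub>0\<in>I. \<exists>t\<in>I. t\<^sub>0 <= t & f t \<in> W))"

text \<open>Together with \<open>V\<close>, the open sets that the path eventually leaves cover the
  surface. In a finite subcover there is a largest escape time, after which only \<open>V\<close>
  remains.\<close>

lemma tail_cover:
 assumes "I ~= {}" "f ` I \<subseteq> topspace topX" "openin topX V"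
  and cov: "!!y. y \<in> topspace topX - V ==> \<not> clusters I f y"
 shows "\<exists>t0\<in>I. \<forall>t\<in>I. t0 <= t --> f t \<in> V"
proof -
 let ?esc = "%W. \<exists>t0\<in>I. \<forall>t\<in>I. t0 <= t --> f t ~: W"
 let ?C = "insert V {W. openin topX W & ?esc W}"
 have "topspace topX \<subseteq> \<Union> ?C" proof
  fix y assume y: "y \<in> topspace topX"
  show "y \<in> \<Union> ?C" proof (cases "y \<in> V")
   case False
   hence "\<not> clusters I f y" using cov y by auto
   then obtain W where "openin topX W" "y \<in> W" "?esc W" unfolding clusters_def by blast
   thus ?thesis by blast
  qed auto
 qed
 moreover have "\<forall>W\<in>?C. openin topX W" using assms by auto
 ultimately obtain F where F: "finite F" "F \<subseteq> ?C" "topspace topX \<subseteq> \<Union> F" using compact_X unfolding compact_space_alt by meson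
 have "\<forall>W\<in>F - {V}. \<exists>t0\<in>I. \<forall>t\<in>I. t0 <= t --> f t ~: W" using F(2) by auto
 then obtain ta where ta: "!!W. W \<in> F - {V} ==> ta W \<in> I & (\<forall>t\<in>I. ta W <= t --> f t ~: W)" by metis
 obtain i where i: "i \<in> I" using assms(1) by auto
 let ?T = "insert i (ta ` (F - {V}))"
 have T: "finite ?T" "?T ~= {}" "?T \<subseteq> I" using F(1) ta i by auto
 have "Max ?T \<in> I" using Max_in[OF T(1,2)] T(3) by blast
 moreover have "f t \<in> V" if t: "t \<in> I" "Max ?T <= t" for t proof -
  obtain W where W: "W \<in> F" "f t \<in> W" using F(3) assms(2) t(1) by blast
  have "W = V" proof (rule ccontr)
   assume "W ~= V"
   hence "W \<in> F - {V}" using W by auto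
   moreover have "ta W <= t" using Max_ge[OF T(1), of "ta W"] calculation t(2) by auto
   ultimately show False using ta t W by blast
  qed
  thus ?thesis using W by simp
 qed
 ultimately show ?thesis by blast
qed

text \<open>Without regular cluster points the tails of the path lie in any neighbourhood of
  \<open>Sing\<close>. A tail is connected and a singularity can be separated from the others, so
  the tail stays near one of them.\<close>

lemma cluster_or_end:
 assumes I: "is_interval I" "I ~= {}" and f: "continuous_map (top_of_set I) topX f"
 shows "(\<exists>s\<in>Sing. ends_at I f s) \<or> (\<exists>y\<in>Reg. clusters I f y)"
proof (rule disjCI)
 assume no: "\<not> (\<exists>y\<in>Reg. clusters I f y)"
 have fI: "f ` I \<subseteq> topspace topX" using f unfolding continuous_map_def by auto
 have "\<exists>s\<in>topspace topX. clusters I f s" proof (rule ccontr)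
  assume "\<not> ?thesis"
  hence "\<exists>t0\<in>I. \<forall>t\<in>I. t0 <= t --> f t \<in> {}" by (intro tail_cover[OF I(2) fI]) auto
  thus False by auto
 qed
 then obtain s where s: "s \<in> Sing" "clusters I f s" using no by (auto simp: regular_points_def)
 have "ends_at I f s" unfolding ends_at_def proof safe
  fix W assume W: "openin topX W" "s \<in> W"
  have "compactin topX {s}" "compactin topX (Sing - {s})" using s Sing_subset finite_Sing by (auto intro: finite_imp_compactin)
  then obtain V V' where V: "openin topX V" "openin topX V'" "{s} \<subseteq> V" "Sing - {s} \<subseteq> V'" "disjnt V V'" using Hausdorff_space_compact_separation[OF Hausdorff_X, of "{s}" "Sing - {s}"] by (auto simp: disjnt_def)
  have oW: "openin topX (V Int W)" using V W by auto
  hence "openin topX ((V Int W) Un V')" using V by auto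
  hence "\<exists>t0\<in>I. \<forall>t\<in>I. t0 <= t --> f t \<in> (V Int W) Un V'" proof (rule tail_cover[OF I(2) fI])
   fix y assume "y \<in> topspace topX - (V Int W Un V')"
   thus "\<not> clusters I f y" using V W no by (auto simp: regular_points_def)
  qed
  then obtain t0 where t0: "t0 \<in> I" "!!t. t \<in> I ==> t0 <= t ==> f t \<in> (V Int W) Un V'" by blast
  let ?J = "I Int {t0..}"
  have "connectedin topX (f ` ?J)" using I(1) is_interval_connected_1 connectedin_continuous_map_image[OF f, of ?J] by (fastforce simp: is_interval_Int is_interval_ci connectedin_subtopology)
  moreover have "f ` ?J \<subseteq> (V Int W) Un V'" using t0 by auto
  moreover have "disjnt (V Int W) V'" using V by (auto simp: disjnt_def)
  ultimately have d: "(V Int W) Int f ` ?J = {} \<or> V' Int f ` ?J = {}" using connectedinD[OF _ oW V(2)] unfolding disjnt_def by blast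
  obtain t where "t \<in> I" "t0 <= t" "f t \<in> V Int W" using s(2) oW t0(1) V(3) W(2) unfolding clusters_def by blast
  thus "\<exists>t0\<in>I. \<forall>t\<in>I. t0 <= t --> f t \<in> W" using d \<open>f ` ?J \<subseteq> (V Int W) Un V'\<close> t0(1) by auto
 qed
 thus "\<exists>s\<in>Sing. ends_at I f s" using s by blast
qed

lemma chart_inverse:
 assumes "y \<in> Reg"
 obtains U ph ps r where "(U,ph) \<in> atlas X" "y \<in> U" "r > 0" "dimm (ball (ph y) (4*r)) ps"
  "!!v. v \<in> ball (ph y) (4*r) ==> ps v \<in> U & ph (ps v) = v" "!!x. x \<in> U ==> ps (ph x) = x"
proof -
 obtain U ph where U: "(U,ph) \<in> atlas X" "y \<in> U" using Reg_chart[OF assms] by blast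
 let ?ps = "inv_into U ph"
 obtain rh where r: "rh > 0" "ball (ph y) rh \<subseteq> ph ` U" using chart_img_open[OF U(1)] U(2) open_contains_ball by blast
 have *: "?ps v \<in> U & ph (?ps v) = v" if "v \<in> ph ` U" for v using that by (simp add: f_inv_into_f inv_into_into)
 have "dimm (ball (ph y) rh) ?ps" unfolding dimm_def proof safe
  fix z assume z: "z \<in> ball (ph y) rh"
  then obtain e where e: "e > 0" "ball z e \<subseteq> ball (ph y) rh" using open_ball open_contains_ball by blast
  have m: "w \<in> ph ` U" if "w \<in> ball z e" for w using e r that by blast
  show "dimm_at ?ps z" by (rule dimm_atI[OF U(1), of 1 e _ _ 0]) (use e * m in auto)
 qed auto
 moreover have "?ps v \<in> U & ph (?ps v) = v" if "v \<in> ball (ph y) (4 * (rh/4))" for v using * r that by auto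
 moreover have "?ps (ph x) = x" if "x \<in> U" for x using that chart_inj[OF U(1)] by simp
 ultimately show ?thesis using r(1) by (intro that[OF U, of "rh/4" ?ps]) auto
qed

text \<open>The number \<open>a\<close> is the scale of \<open>E\<close> at \<open>z\<close>. The
  chart inverse is defined on radius \<open>4*r\<close> and at most \<open>r\<close> is lost by the
  position of \<open>E z\<close>, so radius \<open>3*r\<close> in the chart, that is
  \<open>3*r/a\<close> in the plane, remains. A small scale thus means a large disc on which
  \<open>E\<close> is determined.\<close>

lemma scale_extension:
 assumes D: "convex D" "dimm D E" "z \<in> D" and U: "(U,ph) \<in> atlas X" "r > 0" "dimm (ball c (4*r)) ps"
  "!!v. v \<in> ball c (4*r) ==> ps v \<in> U & ph (ps v) = v" "!!x. x \<in> U ==> ps (ph x) = x"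
  and z: "E z \<in> U" "ph (E z) \<in> ball c r"
 obtains a where "a > 0" "dimm (ball z (3*r/a)) (%w. ps (cr a * (w - z) + ph (E z)))"
  "!!w. w \<in> D ==> w \<in> ball z (3*r/a) ==> E w = ps (cr a * (w - z) + ph (E z))"
proof -
 obtain a b e where a: "a > 0" "e > 0" "!!w. w \<in> ball z e ==> E w \<in> U & ph (E w) = cr a * w + b" using dimm_at_chart[OF dimm_atD[OF D(2,3)] U(1) z(1)] by metis
 let ?F = "%w. ps (cr a * (w - z) + ph (E z))"
 have in_ball: "cr a * (w - z) + ph (E z) \<in> ball c (4*r)" if "w \<in> ball z (3*r/a)" for w proof -
  have "a * dist w z < 3 * r" using that a(1) by (simp add: dist_commute field_simps)
  hence "norm (cr a * (w - z)) < 3*r" using a(1) by (simp add: norm_mult dist_norm)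
  moreover have "norm (c - ph (E z)) < r" using z(2) by (simp add: dist_norm)
  ultimately have "norm ((c - ph (E z)) - cr a * (w - z)) < 4*r" by norm
  thus ?thesis by (simp add: dist_norm algebra_simps)
 qed
 have F: "dimm (ball z (3*r/a)) ?F" proof -
  have "dimm {w. cr a * w + (ph (E z) - cr a * z) \<in> ball c (4*r)} (%w. ps (cr a * w + (ph (E z) - cr a * z)))" by (rule dimm_affine[OF U(3) a(1)])
  moreover have "(%w. ps (cr a * w + (ph (E z) - cr a * z))) = ?F" by (auto simp: algebra_simps)
  ultimately have "dimm {w. cr a * w + (ph (E z) - cr a * z) \<in> ball c (4*r)} ?F" by simp
  thus ?thesis by (rule dimm_subset) (use in_ball in \<open>auto simp: algebra_simps\<close>)
 qed
 have "E w = ?F w" if w: "w \<in> D" "w \<in> ball z (3*r/a)" for w proof (rule dimm_unique[of "D Int ball z (3*r/a)" E ?F "D Int ball z (min e (3*r/a))"])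
  show "connected (D Int ball z (3*r/a))" using D(1) by (simp add: convex_Int convex_connected)
  show "dimm (D Int ball z (3*r/a)) E" "dimm (D Int ball z (3*r/a)) ?F" using dimm_open[OF D(2)] by (auto intro: dimm_subset[OF D(2)] dimm_subset[OF F])
  show "open (D Int ball z (min e (3*r/a)))" using dimm_open[OF D(2)] by auto
  show "D Int ball z (min e (3*r/a)) ~= {}" using D(3) a U(2) by (auto intro!: exI[of _ z])
  fix w assume w: "w \<in> D Int ball z (min e (3*r/a))"
  show "E w = ?F w" using a(3)[of z] a(2) a(3)[of w] w U(5)[of "E w"] a(3)[of w] w by (simp add: algebra_simps)
 qed (use w in auto)
 with F a(1) that show ?thesis by blast
qed

lemma cluster_points:
 assumes "clusters I f y" "(U,ph) \<in> atlas X" "y \<in> U" "t0 \<in> I" "e > 0"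
 obtains t where "t \<in> I" "t0 <= t" "f t \<in> U" "ph (f t) \<in> ball (ph y) e"
proof -
 have "openin topX {x\<in>U. ph x \<in> ball (ph y) e}" by (rule chart_open_vimage[OF assms(2)]) auto
 moreover have "y \<in> {x\<in>U. ph x \<in> ball (ph y) e}" using assms by auto
 ultimately obtain t where "t \<in> I" "t0 <= t" "f t \<in> {x\<in>U. ph x \<in> ball (ph y) e}" using assms(1,4) unfolding clusters_def by blast
 thus ?thesis using that by blast
qed

lemma continuous_map_path_dimm:
 assumes "dimm D E" "continuous_on I p" "p ` I \<subseteq> D"
 shows "continuous_map (top_of_set I) topX (%t. E (p t))" using continuous_map_compose[OF _ dimm_continuous[OF assms(1)], of "top_of_set I" p] assms(2,3) by (simp add: comp_def image_subset_iff_funcset)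

end

section \<open>Cones and boundary points of immersed convex domains\<close>

definition ocone :: "complex set => bool" where
 "ocone K \<longleftrightarrow> open K & convex K & K ~= {} & 0 ~: K & (\<forall>z\<in>K. \<forall>t>0. cr t * z \<in> K)"

lemma oconeD: "ocone K ==> open K" "ocone K ==> convex K" "ocone K ==> K ~= {}" "ocone K ==> 0 ~: K"
 "ocone K ==> z \<in> K ==> t > 0 ==> cr t * z \<in> K" by (auto simp: ocone_def)

lemma ocone_add: assumes "ocone K" "x \<in> K" "y \<in> K" shows "x + y \<in> K"
proof -
 have "(1/2) *\<^sub>R x + (1/2) *\<^sub>R y \<in> K" using assms(2,3) oconeD(2)[OF assms(1)] by (intro convexD) auto
 hence "cr 2 * ((1/2) *\<^sub>R x + (1/2) *\<^sub>R y) \<in> K" by (intro oconeD(5)[OF assms(1)]) auto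
 thus ?thesis by (simp add: scaleR_conv_of_real algebra_simps)
qed

lemma ocone_far: assumes "ocone K" "x \<in> K"
 obtains T where "T > 0" "!!t. t >= T ==> w + cr t * x \<in> K"
proof -
 obtain e where e: "e > 0" "ball x e \<subseteq> K" using assms oconeD(1) open_contains_ball by blast
 show ?thesis proof (rule that[of "(norm w + 1) / e"])
  show "(norm w + 1)/e > 0" using e by (simp add: add_nonneg_pos)
  fix t assume t: "t >= (norm w + 1) / e"
  hence tp: "t > 0" using e(1) by (smt (verit) divide_pos_pos norm_ge_zero)
  have "x + cr (1/t) * w \<in> K" using t tp e(1) e(2) by (auto simp: norm_mult norm_divide field_simps dist_norm)
  thus "w + cr t * x \<in> K" using oconeD(5)[OF assms(1)] tp tp by (fastforce simp: algebra_simps)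
 qed
qed

lemma open_translate_preimage: "open K ==> open {z::complex. z - p \<in> K}" using open_vimage[of K "%z. z - p"] by (simp add: vimage_def continuous_intros)

lemma convex_translate_preimage: "convex K ==> convex {z::complex. z - p \<in> K}"
proof -
 assume "convex K"
 hence "convex ((%z. p + z) ` K)" by (rule convex_translation)
 moreover have "(%z. p + z) ` K = {z. z - p \<in> K}" by (auto simp: image_iff) (metis add.commute diff_add_cancel)
 ultimately show ?thesis by simp
qed

lemma open_affine_preimage: "open K ==> open {z::complex. cr l * z + c \<in> K}"
proof -
 assume K: "open K"
 have "continuous_on UNIV (%z::complex. cr l * z + c)" by (intro continuous_intros)
 thus ?thesis using open_vimage[OF K] unfolding vimage_def by blast
qed

lemma convex_affine_preimage: "convex K ==> convex {z::complex. cr l * z + c \<in> K}"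
proof (rule convexI, clarsimp)
 fix x y and u v :: real assume K: "convex K" and a: "cr l * x + c \<in> K" "cr l * y + c \<in> K" "0 <= u" "0 <= v" "u + v = 1"
 have "u *\<^sub>R (cr l * x + c) + v *\<^sub>R (cr l * y + c) \<in> K" using K a by (intro convexD) auto
 moreover have "u *\<^sub>R (cr l * x + c) + v *\<^sub>R (cr l * y + c) = cr l * (u *\<^sub>R x + v *\<^sub>R y) + (u+v) *\<^sub>R c" by (simp add: scaleR_conv_of_real algebra_simps)
 ultimately show "cr l * (u *\<^sub>R x + v *\<^sub>R y) + c \<in> K" using a(5) by simp
qed

section \<open>Extension over boundary points, and return maps\<close>

context dilation_surface begin

lemma dimm_affine_unique:
 assumes D: "convex D1" "dimm D1 E" "convex D2" "dimm D2 F" "l > 0"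
  and V: "open V" "V ~= {}" "!!w. w \<in> V ==> w \<in> D1 & cr l * w + c \<in> D2 & F (cr l * w + c) = E w"
  and w: "w \<in> D1" "cr l * w + c \<in> D2"
 shows "F (cr l * w + c) = E w"
proof -
 let ?D = "D1 Int {z. cr l * z + c \<in> D2}"
 have "connected ?D" using D convex_affine_preimage by (intro convex_connected convex_Int) auto
 moreover have op: "open ?D" using D dimm_open open_affine_preimage by auto
 moreover have "dimm ?D E" using op by (rule dimm_subset[OF D(2)]) auto
 moreover have "dimm ?D (%w. F (cr l * w + c))" using op by (rule dimm_subset[OF dimm_affine[OF D(4,5)]]) auto
 ultimately show ?thesis using dimm_unique[of ?D "%w. F (cr l * w + c)" E V w] V w by auto
qed

definition extendable :: "complex set => (complex => 'a) => complex => bool" where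
 "extendable D E P \<longleftrightarrow> (\<exists>e>0. \<exists>F. dimm (ball P e) F & (\<forall>w\<in>D Int ball P e. F w = E w))"

lemma extendableI:
 assumes "dimm U F" "P \<in> U" "!!w. w \<in> D ==> w \<in> U ==> F w = E w" shows "extendable D E P"
proof -
 obtain e where e: "e > 0" "ball P e \<subseteq> U" using assms dimm_open open_contains_ball by blast
 hence "dimm (ball P e) F" by (intro dimm_subset[OF assms(1)]) auto
 thus ?thesis unfolding extendable_def using e assms(3) by blast
qed

text \<open>The discs have to agree where they overlap. Two overlapping discs with centres in
  \<open>closure D\<close> also meet inside \<open>D\<close>: the point that divides the segment of
  the centres in the ratio of the radii lies in both discs and in \<open>closure D\<close>.\<close>

lemma extend_over:
 assumes D: "convex D" "dimm D E"
  and F: "!!i. i \<in> I ==> P i \<in> closure D" "!!i. i \<in> I ==> 0 < rh i" "!!i. i \<in> I ==> dimm (ball (P i) (rh i)) (F i)"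
   "!!i w. i \<in> I ==> w \<in> D ==> w \<in> ball (P i) (rh i) ==> F i w = E w"
 obtains E' where "dimm (D Un (\<Union>i\<in>I. ball (P i) (rh i))) E'" "!!w. w \<in> D ==> E' w = E w"
  "!!i w. i \<in> I ==> w \<in> ball (P i) (rh i) ==> E' w = F i w"
proof -
 let ?B = "%i. ball (P i) (rh i)"
 have agree: "F i z = F j z" if ij: "i \<in> I" "j \<in> I" "z \<in> ?B i" "z \<in> ?B j" for i j z proof (rule dimm_unique[of "?B i Int ?B j" _ _ "D Int (?B i Int ?B j)"])
  show "connected (?B i Int ?B j)" by (intro convex_connected convex_Int) auto
  show "dimm (?B i Int ?B j) (F i)" "dimm (?B i Int ?B j) (F j)" by (rule dimm_subset[OF F(3)[OF ij(1)]]; auto) (rule dimm_subset[OF F(3)[OF ij(2)]]; auto)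
  show "open (D Int (?B i Int ?B j))" using dimm_open[OF D(2)] by auto
  have d: "dist (P i) (P j) < rh i + rh j" using ij dist_triangle_lt[of "P i" z "P j"] dist_triangle[of "P i" "P j" z] by (auto simp: dist_commute)
  define s where "s = rh i / (rh i + rh j)"
  have pos: "rh i > 0" "rh j > 0" using F(2) ij by auto
  let ?x = "(1 - s) *\<^sub>R P i + s *\<^sub>R P j"
  have s: "0 <= s" "s <= 1" using pos by (auto simp: s_def)
  have "?x \<in> closure D" using F(1) ij s convex_closure[OF D(1)] by (intro convexD) auto
  moreover have "?x \<in> ?B i Int ?B j" proof -
   have "P i - ?x = cr s * (P i - P j)" by (simp add: scaleR_conv_of_real algebra_simps)
   hence "dist (P i) ?x = s * dist (P i) (P j)" using s by (simp add: dist_norm norm_mult)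
   also have "... < s * (rh i + rh j)" using d pos by (intro mult_strict_left_mono) (auto simp: s_def)
   also have "... = rh i" using pos by (simp add: s_def)
   finally have 1: "dist (P i) ?x < rh i" .
   have "P j - ?x = cr (1 - s) * (P j - P i)" by (simp add: scaleR_conv_of_real algebra_simps)
   hence "dist (P j) ?x = (1 - s) * dist (P i) (P j)" using s by (simp only: dist_norm norm_mult norm_of_real) (simp add: norm_minus_commute)
   also have "... < (1 - s) * (rh i + rh j)" using d pos by (intro mult_strict_left_mono) (auto simp: s_def)
   also have "... = rh j" using pos by (simp add: s_def field_simps)
   finally show ?thesis using 1 by simp
  qed
  ultimately show "D Int (?B i Int ?B j) ~= {}" using open_Int_closure_eq_empty[of "?B i Int ?B j" D] by blast
 qed (use F(4) ij in auto)
 let ?S = "%k. case k of None => D | Some i => ?B i"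
 let ?F = "%k. case k of None => E | Some i => F i"
 obtain E' where E': "dimm (\<Union>k\<in>insert None (Some ` I). ?S k) E'" "!!k z. k \<in> insert None (Some ` I) ==> z \<in> ?S k ==> E' z = ?F k z" proof (rule dimm_glue[of "insert None (Some ` I)" ?S ?F])
  show "dimm (?S k) (?F k)" if "k \<in> insert None (Some ` I)" for k using that D F(3) by auto
  show "?F k z = ?F j z" if "k \<in> insert None (Some ` I)" "j \<in> insert None (Some ` I)" "z \<in> ?S k" "z \<in> ?S j" for k j z proof (cases k)
   case None
   thus ?thesis using that F(4) by (cases j) auto
  next case (Some i)
   show ?thesis proof (cases j)
    case None
    thus ?thesis using that F(4)[of i z] Some by auto
   next case (Some j')
    show ?thesis using that \<open>k = Some i\<close> Some agree[of i j' z] \<open>k = Some i\<close> Some by auto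
   qed
  qed
 qed blast
 have eq: "(\<Union>k\<in>insert None (Some ` I). ?S k) = D Un (\<Union>i\<in>I. ?B i)" by auto
 show ?thesis proof (rule that[of E'])
  show "dimm (D Un (\<Union>i\<in>I. ?B i)) E'" using E'(1) unfolding eq .
  show "E' w = E w" if "w \<in> D" for w using E'(2)[of None w] that by simp
  show "E' w = F i w" if "i \<in> I" "w \<in> ?B i" for i w using E'(2)[of "Some i" w] that by simp
 qed
qed

text \<open>Near \<open>z1\<close> and near \<open>z2\<close> the immersion is the same chart
  inverse \<open>ps\<close>, read with different scales. The affine map matches the two readings, so
  it preserves \<open>E\<close> near \<open>z1\<close>, and by the identity principle wherever
  source and target lie in \<open>D\<close>.\<close>

lemma return_map:
 assumes D: "convex D" "dimm D E" "z1 \<in> D" "z2 \<in> D" and a: "a1 > 0" "a2 > 0" "r > 0"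
  and 1: "!!w. w \<in> D ==> w \<in> ball z1 (3*r/a1) ==> E w = ps (cr a1 * (w - z1) + x1)"
  and 2: "!!w. w \<in> D ==> w \<in> ball z2 (3*r/a2) ==> E w = ps (cr a2 * (w - z2) + x2)"
  and x: "dist x1 x2 < 2 * r" and c: "c = z2 + (x1 - x2) / cr a2 - cr (a1/a2) * z1"
  and in_D: "cr (a1/a2) * z1 + c \<in> D"
  and w: "w \<in> D" "cr (a1/a2) * w + c \<in> D"
 shows "E (cr (a1/a2) * w + c) = E w"
proof -
 let ?l = "a1/a2"
 let ?V = "(D Int ball z1 (3*r/a1)) Int {z. cr ?l * z + c \<in> D Int ball z2 (3*r/a2)}"
 show ?thesis proof (rule dimm_affine_unique[OF D(1,2) D(1,2), of ?l ?V])
  show "?l > 0" using a by simp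
  show "open ?V" by (intro open_Int open_affine_preimage) (use dimm_open[OF D(2)] in auto)
  have "cr ?l * z1 + c \<in> ball z2 (3*r/a2)" using x a unfolding c by (simp add: norm_divide dist_norm divide_strict_right_mono)
  thus "?V ~= {}" using in_D D(3) a by (intro ex_in_conv[THEN iffD1] exI[of _ z1]) auto
  fix v assume v: "v \<in> ?V"
  have "E (cr ?l * v + c) = ps (cr a2 * (cr ?l * v + c - z2) + x2)" using 2[of "cr ?l * v + c"] v by auto
  also have "cr a2 * (cr ?l * v + c - z2) + x2 = cr a1 * (v - z1) + x1" unfolding c using a by (simp add: field_simps)
  also have "ps ... = E v" using 1[of v] v by auto
  finally show "v \<in> D & cr ?l * v + c \<in> D & E (cr ?l * v + c) = E v" using v by auto
 qed (use w in auto)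
qed

text \<open>A point arbitrarily close to the fixed point \<open>z\<close> and its image under the
  homothety would have the same value, against the local injectivity of \<open>E\<close>.\<close>

lemma fixed_point_impossible:
 assumes D: "convex D" "dimm D E" "0 < l" "l ~= 1" "z \<in> D" "cr l * z + c = z"
  and inv: "!!w. w \<in> D ==> cr l * w + c \<in> D ==> E (cr l * w + c) = E w"
 shows False
proof -
 obtain e where e: "e > 0" "inj_on E (ball z e)" using dimm_at_inj dimm_atD[OF D(2,5)] by blast
 obtain e2 where e2: "e2 > 0" "ball z e2 \<subseteq> D" using D(5) dimm_open[OF D(2)] open_contains_ball by blast
 \<comment> \<open>Both \<open>d\<close> and \<open>l * d\<close> have to stay below
   \<open>min e e2\<close>.\<close>
 define d where "d = min e e2 / (2 * (1 + l))"
 have d: "d > 0" using e e2 D(3) by (simp add: d_def)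
 let ?w = "z + cr d"
 have A: "cr l * ?w + c = z + cr (l * d)" using D(6) by (simp add: algebra_simps)
 have dl: "d < min e e2" "l * d < min e e2" proof -
  have m: "min e e2 > 0" using e e2 by simp
  have l: "2 * (1 + l) > 0" using D(3) by simp
  have "min e e2 * 1 < min e e2 * (2 * (1 + l))" using m D(3) by (intro mult_strict_left_mono) auto
  thus "d < min e e2" unfolding d_def by (simp only: pos_divide_less_eq[OF l] mult_1_right)
  have "min e e2 * l < min e e2 * (2 * (1 + l))" using m D(3) by (intro mult_strict_left_mono) auto
  hence "(min e e2 * l) / (2 * (1 + l)) < min e e2" by (simp only: pos_divide_less_eq[OF l])
  thus "l * d < min e e2" unfolding d_def by (simp only: times_divide_eq_right mult.commute)
 qed
 have 1: "dist z ?w < min e e2" using dl(1) d by (simp add: dist_norm)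
 have 2: "dist z (z + cr (l*d)) < min e e2" using dl(2) d D(3) by (simp add: dist_norm abs_mult norm_mult)
 show False using 1 2 e2(2) using inv[of ?w] unfolding A unfolding A using 1 2 using e(2) unfolding inj_on_def using A using d D(4) by fastforce
qed

text \<open>The segment from \<open>q\<close> to \<open>P\<close> clusters at a regular point, so it
  visits a small chart disc at two distances \<open>s1\<close> and \<open>s2\<close> from
  \<open>P\<close>. The return map moves the segment almost into itself. Were the image or the
  preimage of \<open>P\<close> in \<open>D\<close>, the map would carry \<open>E\<close> over
  \<open>P\<close>; hence \<open>P\<close> is nearly fixed and lies close to the exact fixed
  point.\<close>

lemma end_trichotomy:
 assumes D: "convex D" "dimm D E" and P: "P \<in> closure D" and q: "q \<in> D"
  and not_end: "!!s. s \<in> Sing ==> \<not> ends_at {-1<..<0} (%t. E (P + cr (-t) * (q - P))) s"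
  and not_ext: "\<not> extendable D E P" and et: "et > 0"
 obtains l c where "0 < l" "l < 1" "!!w. w \<in> D ==> cr l * w + c \<in> D ==> E (cr l * w + c) = E w"
  "cr l * q + c \<in> D" "norm (c / cr (1 - l) - P) < et" "c / cr (1 - l) ~: D"
proof -
 let ?I = "{-1<..<0::real}"
 let ?z = "%s::real. P + cr s * (q - P)"
 have oD: "open D" using D(2) by (rule dimm_open)
 obtain ka where ka: "ka > 0" "ball q ka \<subseteq> D" using q oD open_contains_ball by blast
 have zD: "?z s \<in> D" if "0 < s" "s <= 1" for s using convex_shrink_mem0[OF D(1) oD P q that] .
 have zD': "?z s + w \<in> D" if "0 < s" "s <= 1" "norm w < s * ka" for s w using convex_shrink_mem[OF D(1) P ka(2) that] .
 define d0 where "d0 = norm (q - P)"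
 have d0: "d0 > 0" using not_ext extendableI[OF D(2), of P D E] q by (auto simp: d0_def)
 have "continuous_map (top_of_set ?I) topX (%t. E (?z (-t)))" by (rule continuous_map_path_dimm[OF D(2)]) (auto intro!: continuous_intros zD simp del: of_real_minus)
 hence "(\<exists>s\<in>Sing. ends_at ?I (%t. E (?z (-t))) s) \<or> (\<exists>y\<in>Reg. clusters ?I (%t. E (?z (-t))) y)" by (intro cluster_or_end) auto
 then obtain y where y: "y \<in> Reg" "clusters ?I (%t. E (?z (-t))) y" using not_end by blast
 obtain U ph ps r where U: "(U,ph) \<in> atlas X" "y \<in> U" "r > 0" "dimm (ball (ph y) (4*r)) ps"
  "!!v. v \<in> ball (ph y) (4*r) ==> ps v \<in> U & ph (ps v) = v" "!!x. x \<in> U ==> ps (ph x) = x" using chart_inverse[OF y(1)] by metis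
 \<comment> \<open>The relative error of the return map; the fixed point ends up within
   \<open>2 * ep * (d0 + ka)\<close> of \<open>P\<close>.\<close>
 define ep where "ep = min (1/4) (et / (4 * (d0 + ka)))"
 have ep: "0 < ep" "ep <= 1/4" "2 * ep * (d0 + ka) < et" proof -
  have pos: "d0 + ka > 0" using d0 ka by simp
  show "0 < ep" using pos et by (auto simp: ep_def)
  show "ep <= 1/4" unfolding ep_def by (rule min.cobounded1)
  have "ep <= et / (4 * (d0 + ka))" by (simp add: ep_def)
  thus "2 * ep * (d0 + ka) < et" using pos et by (simp add: field_simps)
 qed
 \<comment> \<open>Together with \<open>3 * r <= a2 * (s2 * d0)\<close> this size makes the
   translation error \<open>o'\<close> smaller than \<open>ka * ep * s2\<close>, a fraction of the
   distance of the second visit from the boundary.\<close>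
 define de where "de = min r (ka * ep * r / d0)"
 have de: "de > 0" "de <= r" "2 * de * d0 < 3 * r * (ka * ep)" proof -
  show "de > 0" "de <= r" using U(3) ka ep d0 by (auto simp: de_def)
  have "de <= ka * ep * r / d0" by (simp add: de_def)
  hence "de * d0 <= ka * ep * r" using d0 by (simp add: field_simps)
  moreover have "ka * ep * r > 0" using ka ep U by simp
  ultimately show "2 * de * d0 < 3 * r * (ka * ep)" by (simp add: algebra_simps)
 qed
 \<comment> \<open>The disc of radius \<open>3*r/a\<close> cannot contain \<open>P\<close>, or
   \<open>E\<close> would extend over \<open>P\<close>. So the scale at distance
   \<open>s * d0\<close> from \<open>P\<close> is at least of the order of the inverse
   distance.\<close>
 have sc: "\<exists>a>0. (\<forall>w\<in>D Int ball (?z s) (3*r/a). E w = ps (cr a * (w - ?z s) + ph (E (?z s)))) & 3 * r <= a * (s * d0)"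
  if s: "0 < s" "s < 1" "E (?z s) \<in> U" "ph (E (?z s)) \<in> ball (ph y) de" for s proof -
  have zs: "?z s \<in> D" using zD s by simp
  obtain a where a: "a > 0" "dimm (ball (?z s) (3*r/a)) (%w. ps (cr a * (w - ?z s) + ph (E (?z s))))"
   "!!w. w \<in> D ==> w \<in> ball (?z s) (3*r/a) ==> E w = ps (cr a * (w - ?z s) + ph (E (?z s)))" using s(4) de scale_extension[OF D zs U(1,3,4,5,6) s(3)] by auto
  have "3*r/a <= s * d0" using not_ext extendableI[OF a(2), of P D E] a(3) s by (fastforce simp: dist_norm norm_mult d0_def)
  thus ?thesis using a(1) a by (auto simp: field_simps)
 qed
 have ex: "\<exists>t. t \<in> ?I & t0 <= t & E (?z (-t)) \<in> U & ph (E (?z (-t))) \<in> ball (ph y) de" if "t0 \<in> ?I" for t0 by (rule cluster_points[OF y(2) U(1,2) that de(1)]) blast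
 obtain t1 where t1: "t1 \<in> ?I" "E (?z (-t1)) \<in> U" "ph (E (?z (-t1))) \<in> ball (ph y) de" using ex[of "-1/2"] by auto
 \<comment> \<open>The factor 1/4 brings the ratio \<open>l\<close> below 1/2 in the end, which
   makes the return map a contraction.\<close>
 obtain t2 where t2: "t2 \<in> ?I" "t1 / 4 <= t2" "E (?z (-t2)) \<in> U" "ph (E (?z (-t2))) \<in> ball (ph y) de" using t1(1) ex[of "t1/4"] by auto
 define s1 where "s1 = - t1"
 define s2 where "s2 = - t2"
 have s: "0 < s1" "s1 < 1" "0 < s2" "s2 < 1" "s2 <= s1 / 4" using t1 t2 by (auto simp: s1_def s2_def)
 obtain a1 where a1: "a1 > 0" "!!w. w \<in> D ==> w \<in> ball (?z s1) (3*r/a1) ==> E w = ps (cr a1 * (w - ?z s1) + ph (E (?z s1)))" using sc[of s1] s t1 by (auto simp: s1_def)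
 obtain a2 where a2: "a2 > 0" "!!w. w \<in> D ==> w \<in> ball (?z s2) (3*r/a2) ==> E w = ps (cr a2 * (w - ?z s2) + ph (E (?z s2)))"
  "3 * r <= a2 * (s2 * d0)" using sc[of s2] s t2 by (auto simp: s2_def)
 define x1 where "x1 = ph (E (?z s1))"
 define x2 where "x2 = ph (E (?z s2))"
 define l where "l = a1/a2"
 define o' where "o' = (x1 - x2) / cr a2"
 define c where "c = ?z s2 + o' - cr l * ?z s1"
 have l: "l > 0" using a1 a2 by (simp add: l_def)
 have dx: "dist x1 x2 < 2 * de" using t1(3) t2(4) dist_triangle3[of x1 x2 "ph y"] by (simp add: x1_def x2_def s1_def s2_def)
 have no: "norm o' < ka * ep * s2" proof -
  have "norm o' = dist x1 x2 / a2" using a2 by (simp add: o'_def norm_divide dist_norm)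
  also have "... < 2 * de / a2" using dx a2 by (simp add: divide_strict_right_mono)
  also have "... <= ka * ep * s2" proof -
   have "2 * de * d0 * (3 * r) <= (3 * r * (ka * ep)) * (a2 * (s2 * d0))" by (rule mult_mono[OF less_imp_le[OF de(3)] a2(3)]) (use U(3) ka ep in auto)
   hence "(3 * r * d0) * (2 * de) <= (3 * r * d0) * (ka * ep * s2 * a2)" by (simp add: algebra_simps)
   moreover have "3 * r * d0 > 0" using U(3) d0 by simp
   ultimately have "2 * de <= ka * ep * s2 * a2" by (simp only: mult_le_cancel_left_pos)
   thus ?thesis using a2 by (simp add: field_simps)
  qed
  finally show ?thesis .
 qed
 have A: "cr l * (P + cr t * (q - P)) + c = P + cr (s2 + l * (t - s1)) * (q - P) + o'" for t unfolding c_def by (simp add: algebra_simps)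
 have Az1: "cr l * ?z s1 + c \<in> D" proof -
  have "(ka * s2) * ep <= (ka * s2) * 1" using s ka(1) ep by (intro mult_left_mono) auto
  hence "norm o' < s2 * ka" using no by (simp add: algebra_simps)
  thus ?thesis using zD'[of s2 o'] s A[of s1] by simp
 qed
 have inv: "E (cr l * w + c) = E w" if "w \<in> D" "cr l * w + c \<in> D" for w unfolding l_def proof (rule return_map[OF D, of "?z s1" "?z s2" a1 a2 r ps x1 x2 c])
  show "dist x1 x2 < 2 * r" using dx de by simp
  show "c = ?z s2 + (x1 - x2) / cr a2 - cr (a1 / a2) * ?z s1" by (simp add: c_def o'_def l_def)
  show "?z s1 \<in> D" "?z s2 \<in> D" using zD s by simp_all
  show "a1 > 0" "a2 > 0" "r > 0" using a1 a2 U(3) by simp_all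
  show "E w = ps (cr a1 * (w - ?z s1) + x1)" if "w \<in> D" "w \<in> ball (?z s1) (3*r/a1)" for w unfolding x1_def by (rule a1(2)[OF that])
  show "E w = ps (cr a2 * (w - ?z s2) + x2)" if "w \<in> D" "w \<in> ball (?z s2) (3*r/a2)" for w unfolding x2_def by (rule a2(2)[OF that])
  show "cr (a1/a2) * ?z s1 + c \<in> D" using Az1 unfolding l_def .
  show "w \<in> D" "cr (a1/a2) * w + c \<in> D" using that unfolding l_def by blast+
 qed
 have AP: "cr l * P + c = P + cr (s2 - l * s1) * (q - P) + o'" using A[of 0] by simp
 \<comment> \<open>If the return map moved \<open>P\<close> inward by at least
   \<open>ep * s2\<close>, its image would be in \<open>D\<close> in spite of the error
   \<open>o'\<close>, and \<open>E\<close> composed with the map would extend over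
   \<open>P\<close>.\<close>
 have up: "s2 - l * s1 < ep * s2" proof (rule ccontr)
  assume "\<not> ?thesis"
  hence ge: "ep * s2 <= s2 - l * s1" by simp
  have "ep * s2 * ka <= (s2 - l * s1) * ka" using ge ka by (intro mult_right_mono) auto
  hence "norm o' < (s2 - l * s1) * ka" using no by (simp add: algebra_simps)
  moreover have "0 < s2 - l * s1" using ge ep s by (smt (verit) mult_pos_pos)
  moreover have "s2 - l * s1 <= 1" using l s by (smt (verit) mult_pos_pos)
  ultimately have "cr l * P + c \<in> D" unfolding AP by (intro zD')
  hence "extendable D E P" by (intro extendableI[OF dimm_affine[OF D(2) l, of c]]) (use inv in auto)
  thus False using not_ext by simp
 qed
 \<comment> \<open>The same argument for the inverse map. It takes \<open>P\<close> to the position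
   \<open>t\<close> on the segment, up to the error \<open>- o' / l\<close>.\<close>
 have low: "l * s1 - s2 < ep * s2" proof (rule ccontr)
  assume "\<not> ?thesis"
  hence ge: "ep * s2 <= l * s1 - s2" by simp
  define t where "t = (l * s1 - s2) / l"
  have "ep * s2 * ka <= (l * s1 - s2) * ka" using ge ka by (intro mult_right_mono) auto
  hence "norm o' < (l * s1 - s2) * ka" using no by (simp add: algebra_simps)
  hence "norm (- o' / cr l) < t * ka" using l by (simp add: norm_divide t_def field_simps)
  moreover have "0 < t" using ge ep s l by (smt (verit) divide_pos_pos mult_pos_pos t_def)
  moreover have "t <= 1" using l s by (simp add: t_def field_simps) (smt (verit) mult_less_cancel_left2)
  ultimately have "P + cr t * (q - P) + (- o' / cr l) \<in> D" by (intro zD')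
  moreover have "P + cr t * (q - P) + (- o' / cr l) = cr (1/l) * P + (- c / cr l)" proof -
   define M where "M = P + cr t * (q - P) + (- o' / cr l)"
   have lne: "cr l ~= 0" using l by simp
   have lt: "cr l * cr t = cr (l * s1 - s2)" using l by (simp add: t_def)
   have "cr l * M = cr l * P + (cr l * cr t) * (q - P) - o'" using lne unfolding M_def by (simp add: algebra_simps)
   also have "... = cr l * P + cr (l * s1 - s2) * (q - P) - o'" by (simp only: lt)
   also have "... = P - c" using AP by (simp add: algebra_simps)
   finally have "M * cr l = P - c" by (simp only: mult.commute)
   hence "M = (P - c) / cr l" by (simp only: nonzero_eq_divide_eq[OF lne])
   hence "M = cr (1/l) * P + (- c / cr l)" by (simp add: diff_divide_distrib)
   thus ?thesis unfolding M_def .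
  qed
  ultimately have m: "cr (1/l) * P + (- c / cr l) \<in> D" by simp
  have "extendable D E P" proof (rule extendableI[OF dimm_affine[OF D(2), of "1/l" "- c / cr l"]])
   show "1/l > 0" using l by simp
   show "P \<in> {z. cr (1/l) * z + (- c / cr l) \<in> D}" using m by simp
   fix w assume w: "w \<in> D" "w \<in> {z. cr (1/l) * z + (- c / cr l) \<in> D}"
   show "E (cr (1/l) * w + (- c / cr l)) = E w" using l inv[of "cr (1/l) * w + (- c / cr l)"] w by (simp add: field_simps)
  qed
  thus False using not_ext by simp
 qed
 have l2: "l < 1/2" proof -
  have "l * s1 < (1 + ep) * s2" using low by (simp add: algebra_simps)
  also have "... <= (1 + 1/4) * (s1 / 4)" using ep s by (intro mult_mono) auto
  finally show ?thesis using s s(1) by simp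
 qed
 let ?f = "c / cr (1 - l)"
 have ne: "cr (1 - l) ~= 0" using l2 by (simp only: of_real_eq_0_iff)
 have "?f ~: D" using ne fixed_point_impossible[OF D l _ _ ] l2 inv by (fastforce simp: field_simps)
 moreover have "norm (?f - P) < et" proof -
  have "?f - P = (cr (s2 - l * s1) * (q - P) + o') / cr (1 - l)" using AP ne by (simp add: field_simps)
  hence "norm (?f - P) = norm (cr (s2 - l * s1) * (q - P) + o') / (1 - l)" using l2 by (simp add: norm_divide del: of_real_diff)
  also have "... <= (\<bar>s2 - l * s1\<bar> * d0 + norm o') / (1 - l)" using l2 by (intro divide_right_mono) (auto simp: d0_def norm_mult simp del: of_real_diff intro!: norm_triangle_mono)
  also have "... <= (ep * d0 + ka * ep) / (1/2)" proof (rule frac_le)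
   have "\<bar>s2 - l * s1\<bar> * d0 <= ep * s2 * d0" using up low d0 by (intro mult_right_mono) auto
   also have "... <= ep * d0" using s ep d0 by simp
   finally have 1: "\<bar>s2 - l * s1\<bar> * d0 <= ep * d0" .
   have "ka * ep * s2 <= ka * ep" using s ka ep by simp
   thus "\<bar>s2 - l * s1\<bar> * d0 + norm o' <= ep * d0 + ka * ep" using 1 no by simp
  qed (use l2 ep d0 ka in auto)
  also have "... < et" using ep(3) by (simp add: algebra_simps)
  finally show ?thesis .
 qed
 moreover have "cr l * q + c \<in> D" proof -
  have "s2 + l * (1 - s1) <= 1" proof -
   have "s2 + l * (1 - s1) <= 1/4 + (1/2) * 1" using s l l2 by (intro add_mono mult_mono) auto
   thus ?thesis by simp
  qed
  moreover have "s2 * ka <= (s2 + l * (1 - s1)) * ka" using s l ka by (intro mult_right_mono) auto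
  moreover have "ka * ep * s2 <= s2 * ka" using s ka ep by (simp add: algebra_simps)
  moreover have "0 < s2 + l * (1 - s1)" using s l by (simp add: add_pos_nonneg)
  ultimately have "P + cr (s2 + l * (1 - s1)) * (q - P) + o' \<in> D" using no by (intro zD') auto
  thus ?thesis using A[of 1] by simp
 qed
 ultimately show ?thesis using that[of l c] l l2 inv by simp
qed

text \<open>Conjugate the similarity by powers of the homothety about \<open>z0\<close>. If the
  displacement \<open>c\<close> of \<open>z0\<close> were nonzero, the points
  \<open>z0 + m * k + c / L^i\<close> would be distinct, have the same value
  \<open>E (z0 + k)\<close> and converge to a point of the cone, against local injectivity.\<close>

lemma common_fixed_point:
 assumes K: "ocone K" "dimm {z. z - z0 \<in> K} E" "0 < l" "l ~= 1"
  and A: "!!z. z - z0 \<in> K ==> E (z0 + cr l * (z - z0)) = E z"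
  and B: "0 < m" "!!w. w - z0 \<in> K ==> cr m * w + b - z0 \<in> K ==> E (cr m * w + b) = E w"
 shows "cr m * z0 + b = z0"
proof (rule ccontr)
 assume ne: "cr m * z0 + b ~= z0"
 define c where "c = cr m * z0 + b - z0"
 have c: "c ~= 0" using ne by (simp add: c_def)
 \<comment> \<open>\<open>L\<close> is whichever of \<open>l\<close> and \<open>1/l\<close> exceeds
   1.\<close>
 obtain L where L: "L > 1" "!!z. z - z0 \<in> K ==> E (z0 + cr L * (z - z0)) = E z" proof (cases "l > 1")
  case False
  show ?thesis proof (rule that[of "1/l"])
   fix z assume z: "z - z0 \<in> K"
   have "cr (1/l) * (z - z0) \<in> K" by (rule oconeD(5)[OF K(1) z]) (use K in simp)
   thus "E (z0 + cr (1/l) * (z - z0)) = E z" using A[of "z0 + cr (1/l) * (z - z0)"] K(3) by simp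
  qed (use False K in auto)
 qed (use A that in auto)
 have LK: "E (z0 + cr (L^j) * k) = E (z0 + k)" if "k \<in> K" for j k proof (induction j)
  case (Suc j)
  have "cr (L^j) * k \<in> K" by (rule oconeD(5)[OF K(1) that]) (use L in simp)
  thus ?case using L(2)[of "z0 + cr (L^j) * k"] Suc by (simp add: algebra_simps)
 qed simp
 obtain k where k: "k \<in> K" using oconeD(3)[OF K(1)] by auto
 have mk: "cr m * k \<in> K" using oconeD(5)[OF K(1) k B(1)] .
 obtain T where T: "T > 0" "!!t. t >= T ==> c + cr t * (cr m * k) \<in> K" using ocone_far[OF K(1) mk] by blast
 have mkD: "z0 + cr m * k \<in> {z. z - z0 \<in> K}" using mk by simp
 obtain e where e: "e > 0" "inj_on E (ball (z0 + cr m * k) e)" using dimm_at_inj dimm_atD[OF K(2) mkD] by blast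
 have lim: "filterlim (%j. L^j) at_top sequentially" using L(1) filterlim_realpow_sequentially_gt1[of L] by (simp add: filterlim_at_infinity_imp_filterlim_at_top)
 obtain j where j: "!!i. i >= j ==> L^i >= max T (2 * norm c / e)" using lim unfolding filterlim_at_top unfolding eventually_sequentially by blast
 have eq: "E (z0 + cr m * k + cr (1/L^i) * c) = E (z0 + k)"
  and inb: "z0 + cr m * k + cr (1/L^i) * c \<in> ball (z0 + cr m * k) e" if i: "i >= j" for i proof -
  have Li: "L^i > 0" using L by simp
  let ?w = "z0 + cr (L^i) * k"
  have B1: "cr m * ?w + b = z0 + (c + cr (L^i) * (cr m * k))" by (simp add: c_def algebra_simps)
  have inK: "c + cr (L^i) * (cr m * k) \<in> K" by (rule T(2)) (use j[OF i] in simp)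
  have "cr (L^i) * k \<in> K" using oconeD(5)[OF K(1) k Li] .
  hence "E (cr m * ?w + b) = E ?w" using B(2)[of ?w] inK unfolding B1 by simp
  also have "... = E (z0 + k)" by (rule LK[OF k])
  finally have 1: "E (z0 + (c + cr (L^i) * (cr m * k))) = E (z0 + k)" unfolding B1 .
  let ?k' = "cr (1/L^i) * (c + cr (L^i) * (cr m * k))"
  have "?k' \<in> K" by (rule oconeD(5)[OF K(1) inK]) (use Li in simp)
  hence "E (z0 + cr (L^i) * ?k') = E (z0 + ?k')" by (rule LK)
  moreover have "cr (L^i) * ?k' = c + cr (L^i) * (cr m * k)" "?k' = cr m * k + cr (1/L^i) * c" proof -
   have "cr (L^i) * cr (1/L^i) = cr (L^i * (1/L^i))" by (simp only: of_real_mult)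
   moreover have "L^i ~= 0" using Li by linarith
   hence "L^i * (1/L^i) = 1" by (simp only: times_divide_eq_right mult_1_right divide_self_if if_False)
   ultimately have one: "cr (L^i) * cr (1/L^i) = 1" by (simp only: of_real_1)
   have "cr (L^i) * ?k' = (cr (L^i) * cr (1/L^i)) * (c + cr (L^i) * (cr m * k))" by (simp only: mult.assoc)
   thus "cr (L^i) * ?k' = c + cr (L^i) * (cr m * k)" unfolding one by simp
   have "?k' = cr (1/L^i) * c + (cr (L^i) * cr (1/L^i)) * (cr m * k)" by (simp only: algebra_simps)
   thus "?k' = cr m * k + cr (1/L^i) * c" unfolding one by simp
  qed
  ultimately show "E (z0 + cr m * k + cr (1/L^i) * c) = E (z0 + k)" using 1 by (simp add: add.assoc)
  have "2 * norm c <= L^i * e" using j[OF i] e(1) by (simp add: field_simps)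
  hence "norm c < L^i * e" using c by (smt (verit) zero_less_norm_iff)
  hence "norm c / L^i < e" using Li by (simp only: pos_divide_less_eq mult.commute)
  moreover have "norm (cr (1/L^i) * c) = norm c / L^i" using Li by (simp only: norm_mult norm_of_real) simp
  ultimately show "z0 + cr m * k + cr (1/L^i) * c \<in> ball (z0 + cr m * k) e" by (simp add: dist_norm)
 qed
 show False using e(2) inb[of j] inb[of "Suc j"] eq[of j] eq[of "Suc j"] unfolding inj_on_def using c using L(1) by fastforce
qed

text \<open>Unlike \<open>dimm_unique\<close>, this needs no open domain. It continues an identity
  along a line, although the domains of the two immersions need not meet in a connected set.\<close>

lemma dimm_unique_on:
 assumes C: "connected C" "!!z. z \<in> C ==> dimm_at E z" "!!z. z \<in> C ==> dimm_at G z"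
  and z0: "z0 \<in> C" "e0 > 0" "!!w. w \<in> ball z0 e0 ==> E w = G w" and z: "z \<in> C"
 shows "\<exists>e>0. \<forall>w\<in>ball z e. E w = G w"
proof -
 define A where "A = {z\<in>C. \<exists>e>0. \<forall>w\<in>ball z e. E w = G w}"
 have "openin (top_of_set C) A" proof (subst openin_contains_ball, intro conjI ballI)
  fix z assume "z \<in> A"
  then obtain e where z: "z \<in> C" "e > 0" "\<forall>w\<in>ball z e. E w = G w" by (auto simp: A_def)
  have "ball z e Int C \<subseteq> A" proof
   fix w assume w: "w \<in> ball z e Int C"
   then obtain e'' where "e'' > 0" "ball w e'' \<subseteq> ball z e" using open_ball open_contains_ball by blast
   thus "w \<in> A" unfolding A_def using w z by blast
  qed
  thus "\<exists>e>0. ball z e Int C \<subseteq> A" using z by blast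
 qed (auto simp: A_def)
 moreover have "closedin (top_of_set C) A" unfolding closedin_limpt proof safe
  fix z assume z: "z islimpt A" "z \<in> C"
  have ex: "\<exists>w. w \<in> ball z e & w ~= z & E w = G w" if epos: "e > 0" for e proof -
   obtain w where "w \<in> A" "w \<in> ball z e" "w ~= z" using z(1) epos unfolding islimpt_approachable by (metis dist_commute mem_ball)
   thus ?thesis unfolding A_def by auto
  qed
  have eq: "E z = G z" by (rule dimm_closed_agree[OF C(2,3)[OF z(2)]]) (use ex in blast)
  obtain e where e: "e > 0" "!!w. w \<in> ball z e ==> E w = G w" by (rule dimm_unique_local[OF C(2,3)[OF z(2)] eq]) (use ex in auto)
  thus "z \<in> A" using z(2) unfolding A_def by auto
 qed (auto simp: A_def)
 ultimately show ?thesis using z0 unfolding A_def using C(1) unfolding connected_clopen using z unfolding A_def by blast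
qed

end

lemma polar_branch: "w ~= 0 ==> cr (norm w) * cis (ph + Arg (w * cis (-ph))) = w"
proof -
 assume w: "w ~= 0"
 have "cr (norm w) * cis (Arg (w * cis (-ph))) * cis ph = w * (cis (-ph) * cis ph)" using rcis_cmod_Arg[of "w * cis (-ph)"] by (simp add: rcis_def norm_mult)
 thus ?thesis by (simp add: cis_mult add.commute mult.assoc)
qed

section \<open>Conical singularities\<close>

locale cone_point = dilation_surface X for X :: "'a dilation_structure" +
 fixes s :: 'a and k :: nat and rh ep :: real and N :: "'a set" and P :: "real \<times> real => 'a"
 assumes k: "1 <= k" and rho: "0 < rh" and eps: "0 < ep" and N_open: "openin (surface X) N"
  and N_Sing: "N Int singularities X = {s}"
  and quot: "quotient_map (top_of_set (cut_cone k rh ep)) (subtopology (surface X) N) P"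
  and glue: "!!p q. p \<in> cut_cone k rh ep ==> q \<in> cut_cone k rh ep ==> P p = P q \<longleftrightarrow> glued k rh p q"
  and apex: "P (0, 0) = s"
  and charts: "!!U ph p. (U, ph) \<in> atlas X ==> p \<in> cut_cone k rh ep ==> 0 < fst p ==> P p \<in> U ==>
     (\<exists>a>0. \<exists>b. \<exists>e>0. \<forall>q \<in> cut_cone k rh ep. P q \<in> U -->
       (dist q p < e --> ph (P q) = cr a * polar q + b) &
       (snd p = 2 * pi * real k & dist q (fst p / rh, 0) < e -->
        ph (P q) = cr a * (cr rh * polar q) + b))"
begin

definition "ka = 2 * pi * real k"
definition "cc = cut_cone k rh ep"
text \<open>\<open>hn\<close> is the radius normalized so that the gluing homothety preserves it. \<open>Pt R te\<close> has the angle
 \<open>te\<close> in the universal cover of the punctured cone, and \<open>QQ ph\<close> is the inverse of the flat coordinate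
 around the angle \<open>ph\<close>.\<close>

definition "hn p = fst p * rh powr (- (snd p / ka))"
definition "Nh et = P ` {p\<in>cc. hn p < et}"
definition "Pt R te = P (R * rh powr (- of_int \<lfloor>te / ka\<rfloor>), te - ka * of_int \<lfloor>te / ka\<rfloor>)"
definition "QQ ph w = Pt (norm w) (ph + Arg (w * cis (- ph)))"

lemma kappa: "ka > 0" using k by (simp add: ka_def)

lemma cc_iff: "(r, te) \<in> cc \<longleftrightarrow> 0 <= te & te <= ka & 0 <= r & r < ep * rh powr (te / ka)" by (simp add: cc_def cut_cone_def ka_def)

lemma hn_less: "hn (r, te) < et \<longleftrightarrow> r < et * rh powr (te / ka)" using rho by (simp add: hn_def powr_minus field_simps)

lemma P_cont: "continuous_map (top_of_set cc) topX P" using quotient_imp_continuous_map[OF quot] continuous_map_into_fulltopology unfolding cc_def by blast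

lemma P_image: "P ` cc = N" using quot N_open openin_subset unfolding quotient_map_def cc_def by fastforce

lemma hn_glued: assumes "p \<in> cc" "q \<in> cc" "P p = P q" shows "hn p = hn q"
proof -
 have kap: "2 * pi * real k = ka" by (simp add: ka_def)
 show ?thesis using glue assms unfolding cc_def using rho kappa unfolding glued_def hn_def kap by (auto simp: powr_minus field_simps)
qed

lemma N_top: "N \<subseteq> topspace topX" using N_open openin_subset by blast

lemma Nh_open: assumes "et > 0" shows "openin topX (Nh et)" "s \<in> Nh et" "Nh et \<subseteq> N"
proof -
 show sub: "Nh et \<subseteq> N" using P_image unfolding Nh_def by blast
 show "s \<in> Nh et" using eps kappa rho unfolding Nh_def using apex assms by (auto simp: cc_iff hn_def)
 have eq: "{p\<in>topspace (top_of_set cc). P p \<in> Nh et} = {p\<in>cc. hn p < et}" proof (intro equalityI subsetI)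
  fix p assume "p \<in> {p\<in>topspace (top_of_set cc). P p \<in> Nh et}"
  then obtain q where "p \<in> cc" "q \<in> cc" "hn q < et" "P p = P q" unfolding Nh_def by auto
  thus "p \<in> {p\<in>cc. hn p < et}" using hn_glued[of p q] by simp
 qed (auto simp: Nh_def)
 have "continuous_on cc hn" unfolding hn_def using rho kappa by (auto intro!: continuous_intros)
 hence "openin (top_of_set cc) {p\<in>cc. hn p \<in> {..<et}}" using continuous_openin_preimage[of cc hn UNIV "{..<et}"] continuous_openin_preimage_gen[of cc hn "{..<et}"] by (simp add: vimage_def Int_def conj_commute)
 hence "openin (top_of_set cc) {p\<in>topspace (top_of_set cc). P p \<in> Nh et}" unfolding eq by simp
 hence "openin (subtopology topX N) (Nh et)" using quot sub N_top unfolding quotient_map_def cc_def by auto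
 thus "openin topX (Nh et)" using N_open by (simp add: openin_open_subtopology)
qed

lemma P_reg: assumes "p \<in> cc" "fst p > 0" shows "P p \<in> Reg" "P p ~= s"
proof -
 have z: "(0,0) \<in> cc" using eps kappa rho by (simp add: cc_iff)
 have "\<not> glued k rh p (0,0)" using assms(2) kappa rho unfolding glued_def by (auto simp: ka_def)
 thus ne: "P p ~= s" using glue[of p "(0,0)"] assms(1) z apex unfolding cc_def by auto
 show "P p \<in> Reg" using assms P_image ne N_Sing N_top by (auto simp: regular_points_def)
qed

lemma norm_pt: assumes "te \<in> {0..ka}" "(r,te) \<in> cc" shows "Pt r te = P (r, te)"
proof (cases "te = ka")
 case True
 \<comment> \<open>At \<open>te = ka\<close> the floor already counts a full turn, so
   \<open>Pt\<close> takes the point on the side 0 with radius \<open>r / rh\<close>, which is glued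
   to \<open>(r, te)\<close>.\<close>
 have f: "\<lfloor>te / ka\<rfloor> = 1" using True kappa by simp
 have m: "(r / rh, 0) \<in> cc" using assms(2) rho kappa True by (simp add: cc_iff field_simps)
 have "glued k rh (r / rh, 0) (r, te)" unfolding glued_def using True rho by (simp add: ka_def)
 hence "P (r/rh, 0) = P (r, te)" using glue m assms(2) unfolding cc_def by blast
 thus ?thesis unfolding Pt_def f using True rho by (simp add: powr_minus field_simps)
next case False
 hence "\<lfloor>te / ka\<rfloor> = 0" using assms(1) kappa by (simp add: floor_eq_iff)
 thus ?thesis unfolding Pt_def using rho by simp
qed

lemma Pt_mem: assumes "0 < R" "R < ep * rh powr (te / ka)"
 shows "(R * rh powr (- of_int \<lfloor>te / ka\<rfloor>), te - ka * of_int \<lfloor>te / ka\<rfloor>) \<in> cc"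
  "hn (R * rh powr (- of_int \<lfloor>te / ka\<rfloor>), te - ka * of_int \<lfloor>te / ka\<rfloor>) = R * rh powr (- (te / ka))"
proof -
 let ?m = "real_of_int \<lfloor>te / ka\<rfloor>"
 have m: "?m <= te / ka" "te / ka < ?m + 1" by linarith+
 hence "?m * ka <= te" "te < (?m + 1) * ka" using kappa by (simp_all only: pos_le_divide_eq pos_divide_less_eq)
 hence 1: "0 <= te - ka * ?m" "te - ka * ?m <= ka" by (simp_all add: algebra_simps)
 have e: "(te - ka * ?m) / ka = te/ka + - ?m" using kappa by (simp add: field_simps)
 have "rh powr ((te - ka * ?m) / ka) = rh powr (te/ka) * rh powr (- ?m)" unfolding e by (rule powr_add)
 thus "(R * rh powr (- ?m), te - ka * ?m) \<in> cc" using 1 assms rho by (simp add: cc_iff)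
 have "rh powr (- ?m) * rh powr (- ((te - ka * ?m) / ka)) = rh powr (- (te/ka))" unfolding e by (simp flip: powr_add)
 thus "hn (R * rh powr (- ?m), te - ka * ?m) = R * rh powr (- (te / ka))" unfolding hn_def by (simp only: fst_conv snd_conv mult.assoc)
qed

lemma Pt_Nh: assumes "0 < R" "R < ep * rh powr (te / ka)" "Pt R te \<in> Nh et"
 shows "R < et * rh powr (te / ka)"
proof -
 obtain q where q: "q \<in> cc" "hn q < et" "Pt R te = P q" using assms(3) unfolding Nh_def by blast
 show ?thesis using hn_glued[OF Pt_mem(1)[OF assms(1,2)] q(1)] q(3) Pt_mem(2)[OF assms(1,2)] unfolding Pt_def using q(2) using rho by (auto simp: powr_minus field_simps)
qed

lemma Nh_Pt: assumes "x \<in> Nh et" "x ~= s"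
 obtains r te where "0 <= te" "te <= ka" "r > 0" "r < ep * rh powr (te / ka)" "r < et * rh powr (te / ka)" "x = Pt r te"
proof -
 obtain p where p: "p \<in> cc" "hn p < et" "x = P p" using assms unfolding Nh_def by blast
 obtain r te where rt: "p = (r,te)" by (cases p)
 have "r ~= 0" proof
  assume "r = 0"
  hence "glued k rh p (0,0)" unfolding glued_def rt by simp
  moreover have "(0,0) \<in> cc" using eps kappa rho by (simp add: cc_iff)
  ultimately show False using glue p(1) apex unfolding cc_def using p assms by metis
 qed
 thus ?thesis using p(1) unfolding rt cc_iff using that[of te r] p norm_pt[of te r] unfolding rt hn_less by auto
qed

text \<open>Every point of radius 0 represents the apex, so a neighbourhood of \<open>s\<close>
  pulls back to a neighbourhood of a whole segment of angles. Compactness of the segment gives a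
  uniform radius, and \<open>Mx\<close> bounds the factor between a radius and its
  normalization.\<close>

lemma apex_nbhd: assumes "openin topX W" "s \<in> W" obtains et where "et > 0" "Nh et \<subseteq> W"
proof -
 define Mx where "Mx = max 1 rh"
 define mn where "mn = min 1 rh"
 have powb: "mn <= rh powr t & rh powr t <= Mx" if "0 <= t" "t <= 1" for t using powr_mono[of 0 t rh] powr_mono[of t 1 rh] that powr_mono'[of 0 t rh] powr_mono'[of t 1 rh] that rho rho by (cases "rh >= 1") (simp_all add: Mx_def mn_def)
 have Mx: "Mx > 0" "mn > 0" using rho by (auto simp: Mx_def mn_def)
 define r0 where "r0 = ep * mn / 2"
 have r0: "r0 > 0" using eps Mx by (simp add: r0_def)
 let ?A = "{p\<in>cc. P p \<in> W}"
 obtain V where V: "open V" "?A = cc Int V" using openin_continuous_map_preimage[OF P_cont assms(1)] by (auto simp: openin_open)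
 have line: "(0, te) \<in> V" if "te \<in> {0..ka}" for te proof -
  have m: "(0,te) \<in> cc" "(0,0) \<in> cc" using that eps rho by (auto simp: cc_iff)
  show ?thesis using glue m apex unfolding cc_def using V(2) m assms(2) by (fastforce simp: glued_def)
 qed
 have sw: "open (prod.swap -` V)" by (rule open_vimage[OF V(1)]) (auto simp: prod.swap_def intro!: continuous_intros)
 have opS: "openin (top_of_set ({0..ka} \<times> UNIV)) (({0..ka} \<times> UNIV) Int prod.swap -` V)" using sw by (rule openin_open_Int)
 have kne: "{0..ka} ~= {}" using kappa by simp
 have imS: "(%x. (x, 0)) ` {0..ka} \<subseteq> ({0..ka} \<times> UNIV) Int prod.swap -` V" using line by auto
 obtain Y where Y': "openin (top_of_set UNIV) Y" "0 \<in> Y" "{0..ka} \<times> Y \<subseteq> ({0..ka} \<times> UNIV) Int prod.swap -` V" by (rule tube_lemma[OF compact_Icc kne imS opS])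
 have Y: "0 \<in> Y" "open Y" "Y \<times> {0..ka} \<subseteq> V" using Y' by (auto simp: subset_iff)
 obtain d where d: "d > 0" "ball 0 d \<subseteq> Y" using Y open_contains_ball by blast
 show ?thesis proof (rule that[of "d / Mx"])
  show "d / Mx > 0" using d Mx by simp
  show "Nh (d / Mx) \<subseteq> W" proof
   fix x assume "x \<in> Nh (d / Mx)"
   then obtain r te where p: "(r,te) \<in> cc" "hn (r,te) < d / Mx" "x = P (r,te)" unfolding Nh_def by auto
   have c: "0 <= te" "te <= ka" "0 <= r" using p(1) unfolding cc_iff by auto
   have "r < d / Mx * rh powr (te / ka)" using p(2) unfolding hn_less .
   also have "... <= d / Mx * Mx" using powb[of "te/ka"] c kappa d Mx by (intro mult_left_mono) auto
   also have "... = d" using Mx by simp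
   finally have "(r,te) \<in> V" using d c Y c by fastforce
   thus "x \<in> W" using p V(2) by auto
  qed
 qed
qed

lemma cis_kappa: "cis (te - ka * of_int m) = cis te"
proof -
 have "te - ka * of_int m = te - 2 * pi * of_int (int k * m)" by (simp add: ka_def)
 also have "cis ... = cis te * cis (- (2 * pi * of_int (int k * m)))" by (simp add: cis_mult)
 also have "cis (- (2 * pi * of_int (int k * m))) = 1" using cis_multiple_2pi[of "of_int (- (int k * m))"] by simp
 finally show ?thesis by simp
qed

text \<open>Away from the cut a single sheet of the cone contains all points near \<open>w\<close>.
  On the cut, the two sides belong to the sheets \<open>m\<close> and \<open>m - 1\<close>; the
  clause on the cut in \<open>charts\<close> supplies the factor \<open>rh\<close> that turns the
  two readings into one affine map.\<close>

lemma QQ_dimm_at: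
 assumes w: "w * cis (-ph) ~: \<real>\<^sub>\<le>\<^sub>0" "norm w < ep * rh powr ((ph + Arg (w * cis (-ph))) / ka)"
 shows "dimm_at (QQ ph) w"
proof -
 define th where "th = (%w. ph + Arg (w * cis (-ph)))"
 have w0: "w ~= 0" using w(1) by auto
 have c1: "isCont (%w. w * cis (-ph)) w" by (intro isCont_mult continuous_const continuous_ident)
 have c2: "isCont Arg (w * cis (-ph))" using continuous_at_Arg[OF w(1)] .
 have cth: "isCont th w" unfolding th_def using isCont_o2[OF c1 c2] by (intro isCont_add continuous_const)
 define m where "m = \<lfloor>th w / ka\<rfloor>"
 have mm: "of_int m <= th w / ka" "th w / ka < of_int m + 1" unfolding m_def by linarith+
 have kth: "ka * of_int m <= th w" "th w < ka * (of_int m + 1)" using mm kappa by (simp_all add: field_simps)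
 have norm_lt: "norm w < ep * rh powr (th w / ka)" using w(2) by (simp add: th_def)
 have ev_cc: "\<forall>\<^sub>F v in nhds w. v ~= 0 & norm v < ep * rh powr (th v / ka)" proof -
  have t: "(th \<longlongrightarrow> th w) (nhds w)" using cth by (simp add: continuous_at tendsto_nhds_iff isCont_def)
  have 1: "((%v. ep * rh powr (th v / ka) - norm v) \<longlongrightarrow> ep * rh powr (th w / ka) - norm w) (nhds w)" by (intro tendsto_intros t) (use rho kappa in \<open>auto intro: tendsto_ident_at filterlim_ident\<close>)
  hence "\<forall>\<^sub>F v in nhds w. 0 < ep * rh powr (th v / ka) - norm v" using norm_lt by (intro order_tendstoD(1)[OF 1]) auto
  moreover have "\<forall>\<^sub>F v in nhds w. v ~= 0" using w0 by (rule t1_space_nhds)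
  ultimately show ?thesis by eventually_elim auto
 qed
 have tth: "(th \<longlongrightarrow> th w) (nhds w)" using cth by (simp add: continuous_at tendsto_nhds_iff isCont_def)
 have tn: "(norm \<longlongrightarrow> norm w) (nhds w)" by (intro tendsto_intros filterlim_ident)
 define pp where "pp j v = (norm v * rh powr (- of_int j), th v - ka * of_int j)" for j v
 have tpp: "(pp j \<longlongrightarrow> pp j w) (nhds w)" for j unfolding pp_def by (intro tendsto_intros tth tn)
 have QQe: "QQ ph v = P (pp \<lfloor>th v / ka\<rfloor> v)" for v unfolding QQ_def Pt_def pp_def th_def ..
 have ppcc: "pp \<lfloor>th v / ka\<rfloor> v \<in> cc" if "v ~= 0 & norm v < ep * rh powr (th v / ka)" for v unfolding pp_def using Pt_mem(1)[of "norm v" "th v"] that by auto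
 have wcc: "pp m w \<in> cc" using ppcc[of w] w0 norm_lt by (simp add: m_def)
 have wpos: "fst (pp m w) > 0" using w0 rho by (simp add: pp_def)
 obtain U ps where U: "(U,ps) \<in> atlas X" "QQ ph w \<in> U" using Reg_chart[OF P_reg(1)[OF wcc wpos]] QQe[of w] by (metis m_def)
 have polar_pp: "polar (pp j v) = cr (rh powr (- of_int j)) * v" if "v ~= 0" for j v proof -
  show ?thesis using polar_branch[OF that, of ph] unfolding polar_def pp_def by (simp add: th_def cis_kappa mult.assoc mult.left_commute)
 qed
 have PU: "\<forall>\<^sub>F v in nhds w. pp j v \<in> cc --> P (pp j v) \<in> U" if pj: "pp j w \<in> cc" "P (pp j w) \<in> U" for j proof -
  obtain V where V: "open V" "{p\<in>cc. P p \<in> U} = cc Int V" using openin_continuous_map_preimage[OF P_cont chart_open[OF U(1)]] by (auto simp: openin_open)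
  have "\<forall>\<^sub>F v in nhds w. pp j v \<in> V" using V pj topological_tendstoD[OF tpp V(1)] by blast
  thus ?thesis by eventually_elim (use V(2) in blast)
 qed
 have fin: "\<exists>a>0. \<exists>b. \<forall>\<^sub>F v in nhds w. QQ ph v \<in> U & ps (QQ ph v) = cr a * v + b" proof (cases "th w = ka * of_int m")
  case False
  obtain a b e where ab: "a > 0" "e > 0" "!!q. q \<in> cc ==> P q \<in> U ==> dist q (pp m w) < e ==> ps (P q) = cr a * polar q + b" using charts[OF U(1), of "pp m w"] wcc wpos U(2) QQe[of w] unfolding cc_def m_def by metis
  have "\<forall>\<^sub>F v in nhds w. ka * of_int m < th v & th v < ka * (of_int m + 1)" using order_tendstoD[OF tth, of "ka * of_int m"] order_tendstoD[OF tth, of "ka * (of_int m + 1)"] False kth by (intro eventually_conj) auto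
  moreover have "\<forall>\<^sub>F v in nhds w. dist (pp m v) (pp m w) < e" using tendstoD[OF tpp ab(2)] .
  moreover have "\<forall>\<^sub>F v in nhds w. pp m v \<in> cc --> P (pp m v) \<in> U" using PU[OF wcc] U(2) QQe[of w] by (simp add: m_def)
  ultimately have "\<forall>\<^sub>F v in nhds w. QQ ph v \<in> U & ps (QQ ph v) = cr (a * rh powr (- of_int m)) * v + b" using ev_cc proof eventually_elim
   case (elim v)
   have f: "\<lfloor>th v / ka\<rfloor> = m" using elim(1) kappa by (simp add: field_simps floor_eq_iff)
   have c: "pp m v \<in> cc" using ppcc[of v] elim(4) f by simp
   have Q: "QQ ph v = P (pp m v)" using QQe[of v] f by simp
   thus ?case using elim(2,3) c ab(3)[of "pp m v"] polar_pp[of v m] elim(4) by (simp add: mult.assoc)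
  qed
  thus ?thesis using ab(1) rho by (intro exI[of _ "a * rh powr (- of_int m)"]) auto
 next case True
  let ?n = "m - 1"
  have eq: "rh powr (- of_int ?n) = rh * rh powr (- of_int m)" using rho by (simp add: powr_add[of rh 1, simplified] powr_minus field_simps powr_diff)
  have nth: "snd (pp ?n w) = ka" "fst (pp ?n w) = rh * fst (pp m w)" "snd (pp m w) = 0" using True eq by (simp_all add: pp_def algebra_simps)
  define r where "r = fst (pp m w)"
  have pe: "pp m w = (r, 0)" "pp ?n w = (rh * r, ka)" using nth by (auto simp: r_def intro!: prod_eqI)
  have ncc: "pp ?n w \<in> cc" proof -
   show ?thesis using wcc wpos rho unfolding pe cc_iff using rho kappa unfolding pe cc_iff by simp
  qed
  have "glued k rh (pp m w) (pp ?n w)" unfolding glued_def using nth by (simp add: ka_def)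
  hence same: "P (pp ?n w) = P (pp m w)" using glue[OF wcc[unfolded cc_def] ncc[unfolded cc_def]] by simp
  have PwU: "P (pp m w) \<in> U" using U(2) QQe[of w] by (simp add: m_def)
  have base: "(fst (pp ?n w) / rh, 0) = pp m w" using nth rho by (intro prod_eqI) auto
  obtain a b e where ab: "a > 0" "e > 0"
   "!!q. q \<in> cc ==> P q \<in> U ==> dist q (pp ?n w) < e ==> ps (P q) = cr a * polar q + b"
   "!!q. q \<in> cc ==> P q \<in> U ==> dist q (pp m w) < e ==> ps (P q) = cr a * (cr rh * polar q) + b" using nth wpos rho using charts[OF U(1) ncc[unfolded cc_def] ] same PwU nth(1) base unfolding cc_def ka_def by auto
  have "\<forall>\<^sub>F v in nhds w. ka * (of_int m - 1) < th v & th v < ka * (of_int m + 1)" using order_tendstoD[OF tth, of "ka * (of_int m - 1)"] order_tendstoD[OF tth, of "ka * (of_int m + 1)"] True kappa by (intro eventually_conj) (auto simp: algebra_simps)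
  moreover have "\<forall>\<^sub>F v in nhds w. dist (pp m v) (pp m w) < e" "\<forall>\<^sub>F v in nhds w. dist (pp ?n v) (pp ?n w) < e" using tendstoD[OF tpp ab(2)] by blast+
  moreover have "\<forall>\<^sub>F v in nhds w. pp m v \<in> cc --> P (pp m v) \<in> U" "\<forall>\<^sub>F v in nhds w. pp ?n v \<in> cc --> P (pp ?n v) \<in> U" using PU[OF wcc PwU] PU[OF ncc] same PwU by simp_all
  ultimately have "\<forall>\<^sub>F v in nhds w. QQ ph v \<in> U & ps (QQ ph v) = cr (a * rh * rh powr (- of_int m)) * v + b" using ev_cc proof eventually_elim
   case (elim v)
   have lo: "of_int m - 1 < th v / ka" and hi: "th v / ka < of_int m + 1" using elim(1) kappa by (auto simp: field_simps)
   show ?case proof (cases "of_int m <= th v / ka")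
    case True
    hence f: "\<lfloor>th v / ka\<rfloor> = m" using hi by (simp add: floor_eq_iff)
    have c: "pp m v \<in> cc" using ppcc[of v] elim(6) f by simp
    have Q: "QQ ph v = P (pp m v)" using QQe[of v] f by simp
    thus ?thesis using elim(2,4) c ab(4)[of "pp m v"] polar_pp[of v m] elim(6) by (simp add: mult.assoc)
   next case False
    hence f: "\<lfloor>th v / ka\<rfloor> = ?n" using lo by (simp add: floor_eq_iff)
    have c: "pp ?n v \<in> cc" using ppcc[of v] elim(6) f by simp
    have Q: "QQ ph v = P (pp ?n v)" using QQe[of v] f by simp
    have pe: "polar (pp ?n v) = cr (rh * rh powr (- of_int m)) * v" using polar_pp[of v ?n] elim(6) unfolding eq by simp
    show ?thesis using Q elim(3,5) c ab(3)[of "pp ?n v"] pe by (simp add: mult.assoc)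
   qed
  qed
  thus ?thesis using ab(1) rho by (intro exI[of _ "a * rh * rh powr (- of_int m)"]) auto
 qed
 then obtain a b where ab: "a > 0" "\<forall>\<^sub>F v in nhds w. QQ ph v \<in> U & ps (QQ ph v) = cr a * v + b" by blast
 then obtain e where "e > 0" "!!v. dist v w < e ==> QQ ph v \<in> U & ps (QQ ph v) = cr a * v + b" unfolding eventually_nhds_metric by blast
 thus ?thesis using U(1) ab(1) by (intro dimm_atI[of U ps a e]) (auto simp: dist_commute)
qed

lemma punctured_connected: "connectedin topX (N - {s})"
proof -
 let ?f = "%x::real\<times>real. (fst x * rh powr (snd x / ka), snd x)"
 have "connected ({0<..<ep} \<times> {0..ka})" by (intro connected_Times) auto
 moreover have "continuous_on ({0<..<ep} \<times> {0..ka}) ?f" using rho kappa by (auto intro!: continuous_intros)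
 ultimately have "connected (?f ` ({0<..<ep} \<times> {0..ka}))" by (rule connected_continuous_image[rotated])
 moreover have im: "?f ` ({0<..<ep} \<times> {0..ka}) = {p\<in>cc. fst p > 0}" proof safe
  fix r te :: real assume p: "(r,te) \<in> cc" "fst (r,te) > 0"
  hence "r * rh powr (- (te/ka)) < ep" using hn_less[of r te ep] unfolding cc_iff hn_def by simp
  moreover have "r = r * rh powr (- (te/ka)) * rh powr (te/ka)" using rho by (simp add: powr_minus field_simps)
  ultimately show "(r,te) \<in> ?f ` ({0<..<ep} \<times> {0..ka})" using p rho unfolding cc_iff by (intro image_eqI[of _ _ "(r * rh powr (- (te/ka)), te)"]) auto
 qed (use rho in \<open>auto simp: cc_iff\<close>)
 ultimately have "connectedin (top_of_set cc) {p\<in>cc. fst p > 0}" by (auto simp: connectedin_subtopology)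
 hence "connectedin topX (P ` {p\<in>cc. fst p > 0})" by (rule connectedin_continuous_map_image[OF P_cont])
 moreover have "P ` {p\<in>cc. fst p > 0} = N - {s}" proof (intro equalityI subsetI)
  fix x assume x: "x \<in> N - {s}"
  then obtain p where p: "p \<in> cc" "x = P p" using P_image by blast
  have "fst p > 0" proof (rule ccontr)
   assume "\<not> fst p > 0"
   hence "glued k rh p (0,0)" using p(1) cc_iff[of "fst p" "snd p"] by (simp add: glued_def)
   moreover have "(0,0) \<in> cc" using eps kappa rho by (simp add: cc_iff)
   ultimately show False using glue p apex unfolding cc_def using x by fastforce
  qed
  thus "x \<in> P ` {p\<in>cc. fst p > 0}" using p by blast
 next
  fix x assume "x \<in> P ` {p\<in>cc. fst p > 0}"
  thus "x \<in> N - {s}" using P_reg(2) P_image by blast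
 qed
 ultimately show ?thesis by simp
qed

end

context dilation_surface begin

lemma dimm_at_affine: assumes "dimm_at E (cr c * z + b)" "c > 0" shows "dimm_at (%z. E (cr c * z + b)) z"
proof -
 obtain e where "e > 0" "dimm (ball (cr c * z + b) e) E" using dimm_at_ball[OF assms(1)] by blast
 thus ?thesis using dimm_affine[OF _ assms(2)] by (intro dimm_atD) auto
qed

end

section \<open>Straight lines near a conical singularity\<close>

context cone_point begin

text \<open>All angles in use are at most \<open>4 * ka\<close> in absolute value
  (\<open>angle_bound\<close>), so \<open>BB\<close> and \<open>1 / BB\<close> bound the factor
  between a flat radius and the normalized radius \<open>hn\<close>.\<close>

definition "BB = (max rh (1/rh)) ^ 4"

lemma BB: "BB >= 1" "\<bar>t\<bar> <= 4 ==> rh powr t <= BB" "\<bar>t\<bar> <= 4 ==> 1 / BB <= rh powr t"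
proof -
 let ?m = "max rh (1/rh)"
 have "rh >= 1 \<or> 1/rh >= 1" using rho by (auto simp: field_simps)
 hence m: "?m >= 1" by linarith
 show B1: "BB >= 1" unfolding BB_def using m by (rule one_le_power)
 have up: "rh powr t <= BB" if "\<bar>t\<bar> <= 4" for t proof -
  have "rh powr t <= ?m powr \<bar>t\<bar>" proof (cases "t >= 0")
   case True
   thus ?thesis using rho by (intro order_trans[OF powr_mono2[of t rh ?m]]) auto
  next case False
   have "rh powr t = (1/rh) powr (-t)" using rho by (simp add: powr_divide powr_minus_divide)
   also have "... <= ?m powr (-t)" using False rho by (intro powr_mono2) auto
   finally show ?thesis using False by simp
  qed
  also have "... <= ?m powr 4" using m that by (intro powr_mono) auto
  finally show ?thesis unfolding BB_def using m by simp
 qed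
 show "\<bar>t\<bar> <= 4 ==> rh powr t <= BB" by (rule up)
 assume t: "\<bar>t\<bar> <= 4"
 show "1 / BB <= rh powr t" using up[of "-t"] t rho B1 by (simp add: powr_minus field_simps)
qed

lemma Pt_in_Nh: assumes "0 < R" "R < ep * rh powr (te / ka)" "R < et * rh powr (te / ka)" shows "Pt R te \<in> Nh et"
proof -
 have "R * rh powr (- (te / ka)) < et" using assms(3) rho by (simp add: powr_minus field_simps)
 thus ?thesis unfolding Nh_def Pt_def using Pt_mem[OF assms(1,2)] by (intro imageI) auto
qed

text \<open>The domain on which \<open>QQ ph\<close> is an immersion: the plane cut along the ray
  opposite to \<open>ph\<close>, up to the radius that the cone has at the respective angle.\<close>

definition "slit ph = {w. w * cis (-ph) ~: \<real>\<^sub>\<le>\<^sub>0 & norm w < ep * rh powr ((ph + Arg (w * cis (-ph))) / ka)}"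

lemma slit_dimm_at: "w \<in> slit ph ==> dimm_at (QQ ph) w" using QQ_dimm_at unfolding slit_def by blast

lemma angle_bound: assumes "\<bar>ph\<bar> <= ka + 5 * pi" shows "\<bar>(ph + Arg z) / ka\<bar> <= 4"
proof -
 have "\<bar>ph + Arg z\<bar> <= ka + 6 * pi" using Arg_bounded[of z] assms by linarith
 also have "6 * pi <= 3 * ka" using k by (simp add: ka_def)
 finally show ?thesis using kappa by (simp add: abs_divide pos_divide_le_eq)
qed

lemma slit_small: assumes "\<bar>ph\<bar> <= ka + 5 * pi" "w * cis (-ph) ~: \<real>\<^sub>\<le>\<^sub>0" "norm w < ep / BB" shows "w \<in> slit ph" using mult_left_mono[OF BB(3)[OF angle_bound[OF assms(1), of "w * cis (-ph)"]], of ep] eps using assms unfolding slit_def by auto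

lemma QQ_tends: assumes "openin topX W" "s \<in> W" "\<bar>ph\<bar> <= ka + 5 * pi"
 obtains de where "de > 0" "!!w. w ~= 0 ==> norm w < de ==> QQ ph w \<in> W"
proof -
 obtain et where e: "et > 0" "Nh et \<subseteq> W" using apex_nbhd[OF assms(1,2)] by blast
 let ?d = "min (ep / BB) (et / BB)"
 show ?thesis proof (rule that[of ?d])
  show "?d > 0" using eps e BB(1) by simp
  fix w :: complex assume w: "w ~= 0" "norm w < ?d"
  let ?t = "(ph + Arg (w * cis (-ph))) / ka"
  have "ep / BB <= ep * rh powr ?t" "et / BB <= et * rh powr ?t" using BB(3) angle_bound[OF assms(3)] mult_left_mono[of "1/BB" "rh powr ?t"] eps e by (simp_all add: less_imp_le)
  hence "Pt (norm w) (ph + Arg (w * cis (-ph))) \<in> Nh et" using w by (intro Pt_in_Nh) auto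
  thus "QQ ph w \<in> W" using e unfolding QQ_def by blast
 qed
qed

lemma QQ_Pt: assumes "r > 0" shows "QQ te (cr r * cis te) = Pt r te" "cr r * cis te * cis (-te) = cr r" using assms by (simp_all add: QQ_def mult.assoc cis_mult norm_mult)

lemma slit_base: assumes "r > 0" "r < ep * rh powr (te / ka)" shows "cr r * cis te \<in> slit te" using assms unfolding slit_def mem_Collect_eq QQ_Pt(2)[OF assms(1)] by (simp add: norm_mult complex_nonpos_Reals_iff)

lemma line_continuation:
 assumes "dimm D E" "is_interval J" "(0::real) \<in> J" "!!t. t \<in> J ==> c0 + cr t * v \<in> D"
  "!!t. t \<in> J ==> w1 + cr (mu * t) * v \<in> slit ph" "mu > 0" "e0 > 0"
  "!!h. norm h < e0 ==> E (c0 + h) = QQ ph (w1 + cr mu * h)" "t \<in> J"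
 shows "E (c0 + cr t * v) = QQ ph (w1 + cr (mu * t) * v)"
proof -
 let ?z = "%t. c0 + cr t * v"
 let ?G = "%z. QQ ph (cr mu * z + (w1 - cr mu * c0))"
 have aff: "cr mu * ?z t + (w1 - cr mu * c0) = w1 + cr (mu * t) * v" for t by (simp add: algebra_simps)
 have "\<exists>e>0. \<forall>w\<in>ball (?z t) e. E w = ?G w" proof (rule dimm_unique_on[of "?z ` J" E ?G "?z 0" e0])
  have "connected J" using assms(2) is_interval_connected_1 by blast
  thus "connected (?z ` J)" by (intro connected_continuous_image continuous_intros)
  show "dimm_at E z" if "z \<in> ?z ` J" for z using that assms(4) dimm_atD[OF assms(1)] by blast
  show "dimm_at ?G z" if zz: "z \<in> ?z ` J" for z proof -
   obtain u where u: "u \<in> J" "z = ?z u" using zz by blast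
   have "dimm_at (QQ ph) (cr mu * z + (w1 - cr mu * c0))" unfolding u(2) aff using slit_dimm_at assms(5)[OF u(1)] by blast
   thus ?thesis using dimm_at_affine assms(6) by blast
  qed
  show "E w = ?G w" if "w \<in> ball (?z 0) e0" for w proof -
   have "E (c0 + (w - c0)) = QQ ph (w1 + cr mu * (w - c0))" by (rule assms(8)) (use that in \<open>simp add: dist_norm norm_minus_commute\<close>)
   thus ?thesis by (simp add: algebra_simps)
  qed
 qed (use assms in auto)
 then obtain e where "e > 0" "\<forall>w\<in>ball (?z t) e. E w = ?G w" by blast
 hence "E (?z t) = ?G (?z t)" by simp
 thus ?thesis unfolding aff .
qed

text \<open>In the flat coordinate the line runs straight into the apex and reaches it at parameter
  1. Its values converge to \<open>s\<close>, although an immersion has only regular values.\<close>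

lemma inward_impossible:
 assumes "dimm D E" "!!t. t \<in> {0..1} ==> c0 + cr t * v \<in> D" "w1 \<in> slit te" "\<bar>te\<bar> <= ka + 5 * pi"
  "w1 * cis (-te) = cr r" "r > 0" "mu > 0" "e0 > 0"
  "!!h. norm h < e0 ==> E (c0 + h) = QQ te (w1 + cr mu * h)" "cr mu * v = - w1"
 shows False
proof -
 let ?z = "%t. c0 + cr t * v"
 have w1t: "w1 + cr (mu * t) * v = cr (1 - t) * w1" for t proof -
  have "cr (mu * t) * v = cr t * (cr mu * v)" by (simp add: mult_ac)
  thus ?thesis unfolding assms(10) by (simp add: algebra_simps)
 qed
 have sl: "cr (1 - t) * w1 \<in> slit te" if "0 <= t" "t < 1" for t proof -
  have e: "cr (1 - t) * w1 * cis (-te) = cr ((1 - t) * r)" using assms(5) by (simp add: mult.assoc)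
  have Arg0: "Arg (cr x) = 0" if "x >= 0" for x using that by (simp add: Arg_of_real)
  have A0: "Arg (w1 * cis (-te)) = 0" "Arg (cr (1 - t) * w1 * cis (-te)) = 0" unfolding e assms(5) using Arg0[of r] Arg0[of "(1 - t) * r"] assms(6) that by (simp_all del: of_real_mult of_real_diff)
  have "norm (cr (1 - t) * w1) <= norm w1" using that by (simp add: norm_mult mult_left_le_one_le del: of_real_diff)
  thus ?thesis using assms(3) e that assms(6) unfolding slit_def mem_Collect_eq A0 by (auto simp: complex_nonpos_Reals_iff mult_le_0_iff simp del: of_real_diff of_real_mult)
 qed
 have eq: "E (?z t) = QQ te (cr (1 - t) * w1)" if "0 <= t" "t < 1" for t using line_continuation[OF assms(1), of "{0..<1}" c0 v w1 mu te e0 t] assms(2,7,8,9) sl that unfolding w1t by (auto simp: is_interval_co)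
 have z1: "?z 1 \<in> D" using assms(2)[of 1] by simp
 have "E (?z 1) \<in> Reg" using dimm_reg[OF assms(1) z1] .
 moreover have "s \<in> Sing" using N_Sing by auto
 ultimately have ne: "E (?z 1) ~= s" "E (?z 1) \<in> topspace topX" "s \<in> topspace topX" using Sing_subset by (auto simp: regular_points_def)
 then obtain W1 W2 where W: "openin topX W1" "openin topX W2" "E (?z 1) \<in> W1" "s \<in> W2" "disjnt W1 W2" using Hausdorff_X unfolding Hausdorff_space_def by metis
 have "open {z\<in>D. E z \<in> W1}" using dimm_open_vimage[OF assms(1) W(1)] .
 then obtain d1 where d1: "d1 > 0" "ball (?z 1) d1 \<subseteq> {z\<in>D. E z \<in> W1}" using z1 W(3) open_contains_ball by blast
 obtain d2 where d2: "d2 > 0" "!!w. w ~= 0 ==> norm w < d2 ==> QQ te w \<in> W2" using QQ_tends[OF W(2,4) assms(4)] by blast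
 define t where "t = min (1/2) (min (d1 / (2 * (norm v + 1))) (d2 / (2 * (norm w1 + 1))))"
 have tp: "0 < t" using d1 d2 by (auto simp: t_def add_nonneg_pos)
 have tp2: "t <= 1/2" unfolding t_def by (rule min.cobounded1)
 note tp = tp tp2
 have sm: "t * x < d" if "0 <= x" "0 < d" "t <= d / (2 * (x + 1))" for x d :: real using that tp that tp by (simp add: field_simps)
 have "t * norm v < d1" by (rule sm) (use d1 in \<open>auto simp: t_def\<close>)
 hence "?z (1 - t) \<in> ball (?z 1) d1" using tp by (simp add: dist_norm algebra_simps norm_mult)
 hence "E (?z (1 - t)) \<in> W1" using d1 by blast
 moreover have "E (?z (1 - t)) \<in> W2" proof -
  have w0: "w1 ~= 0" using assms(5,6) by auto
  have "t * norm w1 < d2" by (rule sm) (use d2 in \<open>auto simp: t_def\<close>)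
  hence "QQ te (cr t * w1) \<in> W2" using tp w0 by (intro d2) (auto simp: norm_mult)
  thus ?thesis using eq[of "1 - t"] tp by simp
 qed
 ultimately show False using W(5) by (auto simp: disjnt_def)
qed

text \<open>In the flat coordinate around the angle of its first point, a line reaches the opposite
  ray only through the apex, which \<open>inward_impossible\<close> excludes. It therefore stays in
  one branch, where \<open>Nh et\<close> bounds its norm by \<open>et * BB\<close>. The gap between
  \<open>et * BB\<close> and \<open>ep / BB\<close> keeps it from leaving the domain of the
  branch.\<close>

lemma line_bounded:
 assumes E: "dimm D E" and J: "is_interval J" "0 \<in> J" "!!t. t \<in> J ==> 0 <= t"
  and z: "!!t. t \<in> J ==> c0 + cr t * v \<in> D & E (c0 + cr t * v) \<in> Nh et"
  and eta: "0 < et" "et * BB * BB < ep"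
  and th: "0 <= te" "te <= ka" "0 < r" "r < ep * rh powr (te / ka)" "w1 = cr r * cis te"
  and germ: "mu > 0" "e0 > 0" "!!h. norm h < e0 ==> E (c0 + h) = QQ te (w1 + cr mu * h)"
  and t: "t \<in> J"
 shows "w1 + cr (mu * t) * v \<in> slit te" "E (c0 + cr t * v) = QQ te (w1 + cr (mu * t) * v)"
  "norm (w1 + cr (mu * t) * v) < et * BB"
proof -
 let ?w = "%t. w1 + cr (mu * t) * v"
 have thb: "\<bar>te\<bar> <= ka + 5 * pi" using th(1,2) pi_gt_zero by linarith
 have w1: "w1 \<in> slit te" "w1 * cis (-te) = cr r" unfolding th(5) using slit_base[OF th(3,4)] QQ_Pt(2)[OF th(3)] by auto
 have noslit: "?w t * cis (-te) ~: \<real>\<^sub>\<le>\<^sub>0" if t: "t \<in> J" for t proof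
  assume neg: "?w t * cis (-te) \<in> \<real>\<^sub>\<le>\<^sub>0"
  define u where "u = cr mu * v * cis (-te)"
  have we: "?w x * cis (-te) = cr r + cr x * u" for x using w1(2) by (simp add: u_def algebra_simps)
  have i: "t * Im u = 0" "r + t * Re u <= 0" using neg unfolding we complex_nonpos_Reals_iff by auto
  have tp: "t > 0" using J(3)[OF t] i th(3) by (cases "t = 0") auto
  have Im: "Im u = 0" using i tp by simp
  have Re: "Re u < 0" using i tp th(3) by (smt (verit) mult_nonneg_nonneg)
  define t1 where "t1 = r / (- Re u)"
  have t1: "0 < t1" "t1 <= t" using Re th(3) i by (auto simp: t1_def field_simps)
  have inJ: "x * t1 \<in> J" if "x \<in> {0..1}" for x proof -
   have "0 <= x * t1" "x * t1 <= t" using that t1 by (auto intro: order_trans[OF mult_left_le_one_le])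
   thus ?thesis using J(1,2) t unfolding is_interval_1 by blast
  qed
  have "cr t1 * u = - cr r" using Re Im by (simp add: t1_def complex_eq_iff)
  hence "cr mu * (cr t1 * v) * cis (-te) = - w1 * cis (-te)" using w1(2) by (simp add: u_def mult_ac)
  hence v1: "cr mu * (cr t1 * v) = - w1" using cis_neq_zero mult_right_cancel by blast
  show False proof (rule inward_impossible[OF E, of c0 "cr t1 * v" w1 te r mu e0])
   fix x :: real assume "x \<in> {0..1}"
   thus "c0 + cr x * (cr t1 * v) \<in> D" using z[OF inJ] by (simp add: mult.assoc)
  qed (use w1 thb th germ v1 in auto)
 qed
 have main: "norm (?w t) < ep / BB" if t: "t \<in> J" for t proof (rule ccontr)
  assume nt: "\<not> norm (?w t) < ep / BB"
  \<comment> \<open>A value that the norm would have to take on the way out: too large for a point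
    of \<open>Nh et\<close>, but still inside the domain of the branch.\<close>
  define y where "y = (et * BB + ep / BB) / 2"
  have gen: "a < (a + b) / 2 & (a + b) / 2 < b" if "a < b" for a b :: real using that by auto
  have y: "et * BB < y" "y < ep / BB" using BB(1) eta(2) using gen[OF ] unfolding y_def by (auto simp: field_simps)
  have n0: "norm (?w 0) < et * BB" proof -
   have "r < et * rh powr (te / ka)" using germ(3)[of 0] germ(2) QQ_Pt(1)[OF th(3), of te] z[OF J(2)] Pt_Nh[OF th(3,4)] by (simp add: th(5))
   also have "... <= et * BB" using eta angle_bound[OF thb, of 1] by (intro mult_left_mono BB) auto
   finally show ?thesis using th(3,5) by (simp add: norm_mult)
  qed
  have "\<exists>x\<ge>0. x <= t & norm (?w x) = y" by (rule IVT'[of "%x. norm (?w x)"]) (use n0 y nt J(3)[OF t] in \<open>auto intro!: continuous_intros\<close>)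
  then obtain x where x: "0 <= x" "x <= t" "norm (?w x) = y" by blast
  have xJ: "x' \<in> J" if "0 <= x'" "x' <= x" for x' using that x J(1,2) t unfolding is_interval_1 by (meson order_trans)
  have small: "norm (?w x') < ep / BB" if x': "0 <= x'" "x' <= x" for x' proof (cases "x = 0")
   case True
   thus ?thesis using x' x y by simp
  next case False
   define l where "l = x' / x"
   have l: "0 <= l" "l <= 1" "l * x = x'" using x' x(1) False by (auto simp: l_def field_simps)
   have "?w x' = cr (1 - l) * ?w 0 + cr l * ?w x" unfolding l(3)[symmetric] by (simp add: algebra_simps)
   hence "norm (?w x') <= (1 - l) * norm (?w 0) + l * norm (?w x)" using norm_triangle_ineq[of "cr (1 - l) * ?w 0" "cr l * ?w x"] l by (simp add: norm_mult del: of_real_diff)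
   also have "... <= (1 - l) * y + l * y" using l n0 y x by (intro add_mono mult_left_mono) auto
   also have "... = y" by (simp add: algebra_simps)
   finally show ?thesis using y by simp
  qed
  have "E (c0 + cr x * v) = QQ te (?w x)" proof (rule line_continuation[OF E, of "{0..x}" c0 v w1 mu te e0 x])
   fix x' assume "x' \<in> {0..x}"
   thus "c0 + cr x' * v \<in> D" "?w x' \<in> slit te" using xJ small z slit_small[OF thb noslit] by auto
  qed (use germ x in \<open>auto simp: is_interval_cc\<close>)
  hence inN: "Pt (norm (?w x)) (te + Arg (?w x * cis (-te))) \<in> Nh et" using z[OF xJ[OF x(1) order_refl]] by (simp add: QQ_def)
  have "norm (?w x) < et * rh powr ((te + Arg (?w x * cis (-te))) / ka)" using slit_small[OF thb noslit small] xJ x using noslit[OF xJ[OF x(1) order_refl]] using Pt_Nh[OF _ _ inN] unfolding slit_def by fastforce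
  also have "... <= et * BB" using eta angle_bound[OF thb] by (intro mult_left_mono BB) auto
  finally show False using x y by simp
 qed
 have sl: "?w t \<in> slit te" if "t \<in> J" for t using slit_small[OF thb noslit main] that by blast
 thus 1: "?w t \<in> slit te" using t by blast
 show 2: "E (c0 + cr t * v) = QQ te (?w t)" by (rule line_continuation[OF E J(1,2), of c0 v w1 mu te e0 t]) (use sl z germ t in blast)+
 have inN: "Pt (norm (?w t)) (te + Arg (?w t * cis (-te))) \<in> Nh et" using z[OF t] unfolding 2 by (simp add: QQ_def)
 have "norm (?w t) < et * rh powr ((te + Arg (?w t * cis (-te))) / ka)" using noslit[OF t] using Pt_Nh[OF _ _ inN] 1 unfolding slit_def by fastforce
 also have "... <= et * BB" using eta angle_bound[OF thb] by (intro mult_left_mono BB) auto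
 finally show "norm (?w t) < et * BB" .
qed

text \<open>By \<open>line_bounded\<close>, a line that stays near \<open>s\<close> is bounded in
  the flat coordinate; but there it has constant speed.\<close>

lemma no_infinite_end:
 assumes E: "dimm D E" and z: "!!t. t > 0 ==> cr t * v \<in> D" and v: "v ~= 0"
  and ends: "ends_at {0<..} (%t. E (cr t * v)) s"
 shows False
proof -
 have Bp: "BB > 0" using BB(1) by simp
 define et where "et = ep / (2 * BB * BB)"
 have eta: "0 < et" "et * BB * BB < ep" using eps Bp by (auto simp: et_def)
 obtain t0 where t0: "t0 > 0" "!!t. t >= t0 ==> E (cr t * v) \<in> Nh et" using ends Nh_open(1,2)[OF eta(1)] unfolding ends_at_def by auto
 let ?c = "cr t0 * v"
 have c: "?c \<in> D" using z t0 by blast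
 have "E ?c ~= s" using dimm_reg[OF E c] N_Sing by (auto simp: regular_points_def)
 then obtain r te where th: "0 <= te" "te <= ka" "r > 0" "r < ep * rh powr (te / ka)" "E ?c = Pt r te" using Nh_Pt[OF t0(2)[OF order_refl]] by metis
 let ?w1 = "cr r * cis te"
 obtain mu e0 where g: "mu > 0" "e0 > 0" "!!h. norm h < e0 ==> E (?c + h) = QQ te (?w1 + cr mu * h)" using th QQ_Pt(1) dimm_germ[OF dimm_atD[OF E c] slit_dimm_at[OF slit_base[OF th(3,4)]]] by metis
 \<comment> \<open>At this parameter the line has moved by \<open>et * BB + r\<close> from a point
   of norm \<open>r\<close>, so its norm is at least the forbidden value
   \<open>et * BB\<close>.\<close>
 define t where "t = (et * BB + r) / (mu * norm v)"
 have t: "t >= 0" using eta Bp th g v by (simp add: t_def)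
 have zz: "?c + cr x * v \<in> D & E (?c + cr x * v) \<in> Nh et" if "x \<in> {0..}" for x proof -
  have e: "?c + cr x * v = cr (t0 + x) * v" by (simp add: algebra_simps)
  show ?thesis unfolding e using z[of "t0 + x"] t0(1) t0(2)[of "t0 + x"] that by simp
 qed
 have "norm (?w1 + cr (mu * t) * v) < et * BB" by (rule line_bounded(3)[OF E, of "{0..}" ?c v et te r ?w1 mu e0]) (use zz eta th g t in \<open>auto simp: is_interval_ci\<close>)
 moreover have "norm (cr (mu * t) * v) = mu * t * norm v" using g(1) t by (simp add: norm_mult)
 moreover have "mu * t * norm v = et * BB + r" using g(1) v by (simp add: t_def)
 moreover have "norm ?w1 = r" using th by (simp add: norm_mult)
 moreover have "norm (cr (mu * t) * v) <= norm (?w1 + cr (mu * t) * v) + norm ?w1" using norm_triangle_ineq4[of "?w1 + cr (mu * t) * v" ?w1] by simp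
 ultimately show False by linarith
qed

text \<open>If \<open>w\<close> were opposite to \<open>e\<close>, a positive combination of the two
  would be 0, which a convex cone without 0 does not allow.\<close>

lemma Arg_cone: assumes "ocone K" "e \<in> K" "w \<in> K" shows "w * cis (- Arg e) ~: \<real>\<^sub>\<le>\<^sub>0"
proof
 assume n: "w * cis (- Arg e) \<in> \<real>\<^sub>\<le>\<^sub>0"
 obtain x where x: "x <= 0" "w * cis (- Arg e) = cr x" using n by (auto elim!: nonpos_Reals_cases)
 have "w * (cis (- Arg e) * cis (Arg e)) = cr x * cis (Arg e)" using x(2) by (simp only: mult.assoc[symmetric])
 hence w: "w = cr x * cis (Arg e)" by (simp add: cis_mult)
 have eq: "cr (norm e) * w + cr (- x) * e = 0" using rcis_cmod_Arg[of e] unfolding w by (simp add: rcis_def)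
 have ne: "norm e > 0" using assms oconeD(4) by auto
 have inK: "cr (norm e) * w \<in> K" using oconeD(5)[OF assms(1,3) ne] .
 have "0 \<in> K" proof (cases "x = 0")
  case True
  thus ?thesis using eq inK by auto
 next case False
  thus ?thesis using oconeD(5)[OF assms(1,2), of "-x"] x ocone_add[OF assms(1) inK] eq by fastforce
 qed
 thus False using oconeD(4)[OF assms(1)] by simp
qed

text \<open>The two angles differ by a multiple of \<open>2 * pi\<close> that varies continuously
  and vanishes at \<open>w1\<close>, hence vanishes near \<open>w1\<close>.\<close>

lemma QQ_branch_eq:
 assumes "w1 * cis (-te) ~: \<real>\<^sub>\<le>\<^sub>0" "w1 * cis (-ph) ~: \<real>\<^sub>\<le>\<^sub>0" "te + Arg (w1 * cis (-te)) = ph + Arg (w1 * cis (-ph))"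
 obtains e where "e > 0" "!!w. dist w w1 < e ==> QQ te w = QQ ph w"
proof -
 let ?f = "%te w. te + Arg (w * cis (-te))"
 have cont: "isCont (?f te) w1" if "w1 * cis (-te) ~: \<real>\<^sub>\<le>\<^sub>0" for te proof -
  have c1: "isCont (%w. w * cis (-te)) w1" by (intro isCont_mult continuous_const continuous_ident)
  show ?thesis using isCont_o2[OF c1 continuous_at_Arg[OF that]] by (intro isCont_add continuous_const)
 qed
 have "isCont (%w. ?f te w - ?f ph w) w1" using cont[OF assms(1)] cont[OF assms(2)] by (rule isCont_diff)
 hence "((%w. ?f te w - ?f ph w) \<longlongrightarrow> 0) (nhds w1)" using assms(3) by (simp add: continuous_at tendsto_nhds_iff isCont_def)
 hence "\<forall>\<^sub>F w in nhds w1. dist (?f te w - ?f ph w) 0 < 2 * pi" by (rule tendstoD) simp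
 moreover have "w1 ~= 0" using assms(1) by auto
 hence "\<forall>\<^sub>F w in nhds w1. w ~= 0" by (rule t1_space_nhds)
 ultimately have "\<forall>\<^sub>F w in nhds w1. ?f te w = ?f ph w" proof eventually_elim
  case (elim w)
  have "cr (norm w) * cis (?f te w) = cr (norm w) * cis (?f ph w)" using polar_branch[OF elim(2), of te] polar_branch[OF elim(2), of ph] by simp
  hence "cis (?f te w) = cis (?f ph w)" using elim(2) by simp
  hence "sin (?f te w) = sin (?f ph w) & cos (?f te w) = cos (?f ph w)" by (simp add: complex_eq_iff)
  then obtain n :: int where n: "?f te w = ?f ph w + 2 * pi * n" unfolding sin_cos_eq_iff by blast
  show ?case using elim(1) unfolding n using n by (simp add: abs_mult)
 qed
 then obtain e where "e > 0" "!!w. dist w w1 < e ==> ?f te w = ?f ph w" unfolding eventually_nhds_metric by blast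
 thus ?thesis using that[of e] by (simp add: QQ_def)
qed

text \<open>The index \<open>j\<close> counts turns around the cone. The branch of a line that hits
  \<open>s\<close> has \<open>j\<close> between -1 and \<open>k + 1\<close>, so the range has some
  slack; the bound is the one under which \<open>BB\<close> applies.\<close>

lemma angle_index:
 assumes "j \<in> {- (int k + 2)..int k + 2}"
 shows "\<bar>Arg e + 2 * pi * of_int j\<bar> <= ka + 5 * pi"
proof -
 have "\<bar>Arg e\<bar> <= pi" using Arg_bounded[of e] by auto
 moreover have "\<bar>2 * pi * real_of_int j\<bar> <= 2 * pi * (real k + 2)" using assms by (auto simp: abs_mult)
 ultimately show ?thesis using abs_triangle_ineq[of "Arg e" "2 * pi * of_int j"] by (simp add: ka_def algebra_simps)
qed

lemma cis_index: "cis (- (x + 2 * pi * of_int j)) = cis (- x)"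
proof -
 have "cis (2 * pi * of_int (- j)) = 1" by (rule cis_multiple_2pi) simp
 hence "cis (- x) * cis (2 * pi * of_int (- j)) = cis (- x)" by simp
 thus ?thesis unfolding cis_mult by (simp add: algebra_simps)
qed

lemma germ_dimm:
 assumes K: "ocone K" "e \<in> K" and j: "j \<in> {- (int k + 2)..int k + 2}"
 shows "dimm (K Int ball 0 (ep / BB)) (QQ (Arg e + 2 * pi * of_int j))" unfolding dimm_def
proof safe
 show "open (K Int ball 0 (ep / BB))" using oconeD(1)[OF K(1)] by auto
 fix w assume w: "w \<in> K" "w \<in> ball 0 (ep / BB)"
 have "w * cis (- (Arg e + 2 * pi * of_int j)) ~: \<real>\<^sub>\<le>\<^sub>0" unfolding cis_index by (rule Arg_cone[OF K w(1)])
 thus "dimm_at (QQ (Arg e + 2 * pi * of_int j)) w" using slit_dimm_at[OF slit_small[OF angle_index[OF j]]] w by simp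
qed

text \<open>A segment that ends at \<open>s\<close> is, in the flat coordinate, a segment that ends
  at 0, so \<open>E (P0 + w)\<close> is a branch at \<open>mu * w\<close>. The direction
  \<open>e\<close> determines the branch up to whole turns, and there are finitely many of these
  because the cone has finite total angle.\<close>

lemma hit_germ:
 assumes K: "ocone K" "e \<in> K" and D: "convex D" "dimm D E" "P0 \<in> closure D" "q \<in> D" "q - P0 \<in> K"
  and ends: "ends_at {-1<..<0} (%t. E (P0 + cr (-t) * (q - P0))) s"
 obtains j mu de where "j \<in> {- (int k + 2)..int k + 2}" "mu > 0" "de > 0"
  "!!w. w \<in> K ==> norm w < de ==> P0 + w \<in> D ==> E (P0 + w) = QQ (Arg e + 2 * pi * of_int j) (cr mu * w)"
proof -
 have oD: "open D" using dimm_open[OF D(2)] .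
 have Bp: "BB > 0" using BB(1) by simp
 define et where "et = ep / (2 * BB * BB)"
 have eta: "0 < et" "et * BB * BB < ep" using eps Bp by (auto simp: et_def)
 define e0 where "e0 = q - P0"
 have e0K: "e0 \<in> K" using D(5) by (simp add: e0_def)
 have e0: "e0 ~= 0" using e0K oconeD(4)[OF K(1)] by auto
 have ex: "\<exists>t0\<in>{-1<..<0}. \<forall>t\<in>{-1<..<0}. t0 <= t --> E (P0 + cr (-t) * e0) \<in> Nh et'" if "et' > 0" for et' using ends Nh_open(1,2)[OF that] unfolding ends_at_def e0_def by blast
 then obtain t0 where t0: "-1 < t0" "t0 < 0" "!!t. t0 <= t ==> t < 0 ==> E (P0 + cr (-t) * e0) \<in> Nh et" using eta(1) by (metis greaterThanLessThan_iff less_le_trans)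
 define t1 where "t1 = - t0"
 have t1: "0 < t1" "t1 < 1" "!!t. 0 < t ==> t <= t1 ==> E (P0 + cr t * e0) \<in> Nh et" using t0 t0(3)[of "- t" for t] by (auto simp: t1_def)
 have zD: "P0 + cr t * e0 \<in> D" if "0 < t" "t <= 1" for t unfolding e0_def by (rule convex_shrink_mem0[OF D(1) oD D(3,4) that])
 let ?c = "P0 + cr t1 * e0"
 have c: "?c \<in> D" using zD t1 by simp
 have "E ?c ~= s" using dimm_reg[OF D(2) c] N_Sing by (auto simp: regular_points_def)
 then obtain r te where th: "0 <= te" "te <= ka" "r > 0" "r < ep * rh powr (te / ka)" "r < et * rh powr (te / ka)" "E ?c = Pt r te" using Nh_Pt[OF t1(3)[OF t1(1) order_refl]] by metis
 define w1 where "w1 = cr r * cis te"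
 have w1s: "w1 \<in> slit te" "w1 * cis (-te) = cr r" unfolding w1_def using slit_base[OF th(3,4)] QQ_Pt(2)[OF th(3)] by auto
 have "E ?c = QQ te w1" using th QQ_Pt(1) by (simp add: w1_def)
 then obtain mu d0 where g: "mu > 0" "d0 > 0" "!!h. norm h < d0 ==> E (?c + h) = QQ te (w1 + cr mu * h)" using dimm_germ[OF dimm_atD[OF D(2) c] slit_dimm_at[OF w1s(1)]] by blast
 have zz: "?c + cr t * (- e0) \<in> D & E (?c + cr t * (- e0)) \<in> Nh et" if "t \<in> {0..<t1}" for t proof -
  have e: "?c + cr t * (- e0) = P0 + cr (t1 - t) * e0" by (simp add: algebra_simps)
  show ?thesis unfolding e using zD[of "t1 - t"] t1(3)[of "t1 - t"] t1 that by auto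
 qed
 have lb: "w1 + cr (mu * t) * (- e0) \<in> slit te" "E (?c + cr t * (- e0)) = QQ te (w1 + cr (mu * t) * (- e0))" if "t \<in> {0..<t1}" for t by (rule line_bounded[OF D(2), of "{0..<t1}" ?c "- e0" et te r w1 mu d0]; use zz eta th g t1 that in \<open>auto simp: is_interval_co w1_def\<close>)+
 have thb: "\<bar>te\<bar> <= ka + 5 * pi" using th(1,2) pi_gt_zero by linarith
 \<comment> \<open>If the flat segment ended at distance \<open>d\<close> from 0, a point near its
   end would have norm below \<open>d / 2\<close> by its neighbourhood and at least
   \<open>d / 2\<close> by its position.\<close>
 have w1e: "w1 = cr (mu * t1) * e0" proof (rule ccontr)
  assume ne: "\<not> ?thesis"
  define d where "d = norm (w1 - cr (mu * t1) * e0)"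
  have d: "d > 0" using ne by (simp add: d_def)
  define et' where "et' = d / (2 * BB)"
  have eta': "et' > 0" "et' * BB = d / 2" using d Bp by (auto simp: et'_def)
  obtain t2 where t2: "-1 < t2" "t2 < 0" "!!t. t2 <= t ==> t < 0 ==> E (P0 + cr (-t) * e0) \<in> Nh et'" using ex[OF eta'(1)] by (metis greaterThanLessThan_iff less_le_trans)
  define x where "x = min (min t1 (- t2)) (d / (2 * mu * norm e0))"
  have x: "0 < x" "x <= t1" "x <= - t2" "x <= d / (2 * mu * norm e0)" using t1 t2 d g e0 by (auto simp: x_def)
  have tx: "t1 - x \<in> {0..<t1}" using x by auto
  have eq: "?c + cr (t1 - x) * (- e0) = P0 + cr x * e0" by (simp add: algebra_simps)
  let ?w = "w1 + cr (mu * (t1 - x)) * (- e0)"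
  have sl: "?w \<in> slit te" using lb(1)[OF tx] .
  hence "norm ?w < et' * rh powr ((te + Arg (?w * cis (-te))) / ka)" using lb(2)[OF tx] t2(3)[of "- x"] x unfolding eq unfolding slit_def using Pt_Nh[of "norm ?w"] sl unfolding slit_def QQ_def by fastforce
  also have "... <= et' * BB" using eta' angle_bound[OF thb] by (intro mult_left_mono BB) auto
  finally have 1: "norm ?w < d / 2" using eta' by simp
  have "norm (cr (mu * x) * e0) = mu * x * norm e0" using g x by (simp add: norm_mult)
  also have "... <= d / 2" using x(4) g e0 by (simp add: field_simps)
  finally have 2: "norm (cr (mu * x) * e0) <= d / 2" .
  have "d <= norm ?w + norm (cr (mu * x) * e0)" unfolding d_def using norm_triangle_ineq4[of ?w "cr (mu * x) * e0"] by (simp add: algebra_simps)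
  thus False using 1 2 by simp
 qed
 have w1K: "w1 \<in> K" unfolding w1e by (rule oconeD(5)[OF K(1) e0K]) (use g t1 in simp)
 have w10: "w1 ~= 0" using w1K oconeD(4)[OF K(1)] by auto
 have nw1: "norm w1 = r" using th by (simp add: w1_def norm_mult)
 let ?A = "Arg e + Arg (w1 * cis (- Arg e))"
 have "cr (norm w1) * cis ?A = w1" using polar_branch[OF w10] .
 hence "cis ?A = cis te" unfolding nw1 using th(3) by (simp add: w1_def)
 hence "sin te = sin ?A & cos te = cos ?A" by (simp add: complex_eq_iff)
 then obtain j :: int where j: "te = ?A + 2 * pi * j" unfolding sin_cos_eq_iff by blast
 have jr: "j \<in> {- (int k + 2)..int k + 2}" proof -
  have "2 * pi * j <= ka + 2 * pi" "- (2 * pi) <= 2 * pi * j" using Arg_bounded[of e] Arg_bounded[of "w1 * cis (- Arg e)"] j th(1,2) by linarith+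
  hence "2 * pi * j <= 2 * pi * (real k + 1)" "2 * pi * (-1) <= 2 * pi * j" by (simp_all add: ka_def algebra_simps)
  hence "j <= real k + 1" "-1 <= real_of_int j" using mult_le_cancel_left_pos[of "2 * pi" "-1" "real_of_int j"] pi_gt_zero by simp_all
  thus ?thesis by simp
 qed
 define ph where "ph = Arg e + 2 * pi * of_int j"
 have cphi: "cis (-ph) = cis (- Arg e)" unfolding ph_def by (rule cis_index)
 have nn: "w1 * cis (-ph) ~: \<real>\<^sub>\<le>\<^sub>0" unfolding cphi by (rule Arg_cone[OF K w1K])
 have same: "te + Arg (w1 * cis (-te)) = ph + Arg (w1 * cis (-ph))" proof -
  show ?thesis unfolding w1s(2) using th(3) unfolding cphi using j by (simp add: ph_def)
 qed
 have ns: "w1 * cis (-te) ~: \<real>\<^sub>\<le>\<^sub>0" using w1s(1) unfolding slit_def by simp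
 obtain d1 where d1: "d1 > 0" "!!w. dist w w1 < d1 ==> QQ te w = QQ ph w" using QQ_branch_eq[OF ns nn same] by blast
 define de where "de = ep / BB / mu"
 have del: "de > 0" using eps Bp g by (simp add: de_def)
 have small: "norm (cr t1 * e0) < de" proof -
  have "mu * norm (cr t1 * e0) = r" using nw1 unfolding w1e using g t1 by (simp add: norm_mult)
  also have "r < et * rh powr (te / ka)" using th by simp
  also have "... <= et * BB" using eta angle_bound[OF thb, of 1] by (intro mult_left_mono BB) auto
  also have "... < ep / BB" using eta(2) Bp by (simp add: field_simps)
  finally have "mu * norm (cr t1 * e0) < ep / BB" .
  thus ?thesis unfolding de_def pos_less_divide_eq[OF g(1)] by (simp only: mult.commute)
 qed
 let ?D = "{w. w \<in> K Int ball 0 de & w + P0 \<in> D}"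
 let ?G = "%w. QQ ph (cr mu * w)"
 have oDD: "open ?D" proof -
  have "?D = K Int ball 0 de Int {w. cr 1 * w + P0 \<in> D}" by auto
  thus ?thesis using open_affine_preimage[OF oD, of 1 P0] oconeD(1)[OF K(1)] by auto
 qed
 have cDD: "convex ?D" proof -
  have "?D = K Int ball 0 de Int {w. cr 1 * w + P0 \<in> D}" by auto
  thus ?thesis using convex_affine_preimage[OF D(1), of 1 P0] oconeD(2)[OF K(1)] by (auto intro!: convex_Int)
 qed
 have dE: "dimm ?D (%w. E (w + P0))" by (rule dimm_subset[OF dimm_shift[OF D(2)] oDD]) auto
 have dG: "dimm ?D ?G" proof -
  have "dimm {z. cr mu * z + 0 \<in> K Int ball 0 (ep / BB)} (%z. QQ ph (cr mu * z + 0))" unfolding ph_def by (rule dimm_affine[OF germ_dimm[OF K jr] g(1)])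
  hence "dimm {z. cr mu * z \<in> K Int ball 0 (ep / BB)} ?G" by simp
  thus ?thesis proof (rule dimm_subset[OF _ oDD], intro subsetI)
   fix w assume w: "w \<in> ?D"
   have "cr mu * w \<in> K" using oconeD(5)[OF K(1) _ g(1)] w by auto
   moreover have "norm w < ep / BB / mu" using w by (simp add: de_def)
   hence "norm (cr mu * w) < ep / BB" unfolding pos_less_divide_eq[OF g(1)] using g(1) by (simp only: norm_mult) (simp add: mult.commute)
   ultimately show "w \<in> {z. cr mu * z \<in> K Int ball 0 (ep / BB)}" by simp
  qed
 qed
 have base: "cr t1 * e0 \<in> ?D" using small c oconeD(5)[OF K(1) e0K t1(1)] by (simp add: add.commute)
 have fin: "E (P0 + w) = ?G w" if w: "w \<in> K" "norm w < de" "P0 + w \<in> D" for w proof -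
  let ?V = "?D Int ball (cr t1 * e0) (min d0 (d1 / mu))"
  have "E (w + P0) = ?G w" proof (rule dimm_unique[OF convex_connected[OF cDD] dE dG, of ?V])
   show "open ?V" using oDD by auto
   show "?V ~= {}" using base g d1 by (intro ex_in_conv[THEN iffD1] exI[of _ "cr t1 * e0"]) auto
   fix v assume v: "v \<in> ?V"
   define h where "h = v - cr t1 * e0"
   have h: "norm h < d0" "norm h < d1 / mu" using v by (auto simp: h_def dist_norm norm_minus_commute)
   have vc: "v + P0 = ?c + h" by (simp add: h_def)
   have "E (v + P0) = QQ te (w1 + cr mu * h)" unfolding vc by (rule g(3)[OF h(1)])
   also have "... = QQ ph (w1 + cr mu * h)" using h(2) g(1) by (intro d1(2)) (simp add: dist_norm norm_mult field_simps)
   also have "w1 + cr mu * h = cr mu * v" unfolding w1e h_def by (simp add: algebra_simps)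
   finally show "E (v + P0) = ?G v" .
  qed (use w in \<open>auto simp: add.commute\<close>)
  thus ?thesis by (simp add: add.commute)
 qed
 show ?thesis by (rule that[OF jr g(1) del]) (use fin in \<open>simp add: ph_def\<close>)
qed

text \<open>From a point with value near the singularity, the plane contains the line that runs
  straight into the apex.\<close>

lemma plane_avoids: assumes "dimm UNIV E" shows "E z ~: Nh et"
proof
 assume inN: "E z \<in> Nh et"
 have "E z ~= s" using dimm_reg[OF assms, of z] N_Sing by (auto simp: regular_points_def)
 then obtain r te where th: "0 <= te" "te <= ka" "r > 0" "r < ep * rh powr (te / ka)" "E z = Pt r te" using Nh_Pt[OF inN] by metis
 let ?w1 = "cr r * cis te"
 have "E z = QQ te ?w1" using th QQ_Pt(1) by simp
 then obtain mu e0 where g: "mu > 0" "e0 > 0" "!!h. norm h < e0 ==> E (z + h) = QQ te (?w1 + cr mu * h)" using dimm_germ[OF dimm_atD[OF assms, of z] slit_dimm_at[OF slit_base[OF th(3,4)]]] by blast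
 have "\<bar>te\<bar> <= ka + 5 * pi" using th(1,2) pi_gt_zero by linarith
 thus False using inward_impossible[OF assms, of z "- ?w1 / cr mu" ?w1 te r mu e0] slit_base[OF th(3,4)] QQ_Pt(2)[OF th(3)] th(3) g by auto
qed

end

section \<open>Germs at singularities, and the exclusion of immersed planes\<close>

context dilation_surface begin

lemma cone_pointE: assumes "s \<in> Sing" obtains k rh ep N P where "cone_point X s k rh ep N P"
proof -
 obtain k rh ep N P where h: "1 <= k" "0 < rh" "0 < ep"
    "openin (surface X) N" "N Int singularities X = {s}"
    "quotient_map (top_of_set (cut_cone k rh ep)) (subtopology (surface X) N) P"
    "\<forall>p \<in> cut_cone k rh ep. \<forall>q \<in> cut_cone k rh ep. P p = P q \<longleftrightarrow> glued k rh p q"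
    "P (0, 0) = s"
    "\<forall>(U, ph) \<in> atlas X. \<forall>p \<in> cut_cone k rh ep. 0 < fst p & P p \<in> U -->
     (\<exists>a>0. \<exists>b. \<exists>e>0. \<forall>q \<in> cut_cone k rh ep. P q \<in> U -->
       (dist q p < e --> ph (P q) = cr a * polar q + b) &
       (snd p = 2 * pi * real k & dist q (fst p / rh, 0) < e -->
        ph (P q) = cr a * (cr rh * polar q) + b))" using cone_X[OF assms] unfolding cone_singularity_def by blast
 have "cone_point X s k rh ep N P" by unfold_locales (use h in \<open>blast+\<close>)
 thus ?thesis using that by blast
qed

text \<open>The segment from \<open>q\<close> to \<open>P\<close> has its parameter in the interval
  from -1 to 0, because \<open>ends_at\<close> looks at the upper end of an interval.\<close>

definition ends_radially :: "(complex => 'a) => complex => complex => bool" where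
 "ends_radially E P q \<longleftrightarrow> (\<exists>s\<in>Sing. ends_at {-1<..<0} (%t. E (P + cr (-t) * (q - P))) s)"

definition tends_sing :: "complex set => (complex => 'a) => bool" where
 "tends_sing K g \<longleftrightarrow> (\<exists>s\<in>Sing. \<forall>W. openin topX W & s \<in> W --> (\<exists>de>0. \<forall>w\<in>K. norm w < de --> g w \<in> W))"

text \<open>The scale \<open>mu\<close> is left free: only up to scale are the germs at a
  singularity finitely many.\<close>

definition matches :: "complex set => (complex => 'a) => complex set => (complex => 'a) => complex => bool" where
 "matches K g D E P \<longleftrightarrow> (\<exists>mu>0. \<exists>de>0. \<forall>w\<in>K. norm w < de --> P + w \<in> D --> E (P + w) = g (cr mu * w))"

lemma finite_germs:
 assumes K: "ocone K"
 obtains G where "finite G" "!!g. g \<in> G ==> \<exists>de>0. dimm (K Int ball 0 de) g" "!!g. g \<in> G ==> tends_sing K g"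
  "!!D E P q. convex D ==> dimm D E ==> P \<in> closure D ==> q \<in> D ==> q - P \<in> K ==> ends_radially E P q ==>
   \<exists>g\<in>G. matches K g D E P"
proof -
 obtain e where e: "e \<in> K" using oconeD(3)[OF K] by auto
 have "\<forall>s\<in>Sing. \<exists>G. finite G & (\<forall>g\<in>G. (\<exists>de>0. dimm (K Int ball 0 de) g) & tends_sing K g) &
  (\<forall>D E P q. convex D & dimm D E & P \<in> closure D & q \<in> D & q - P \<in> K &
    ends_at {-1<..<0} (%t. E (P + cr (-t) * (q - P))) s --> (\<exists>g\<in>G. matches K g D E P))" proof
  fix s assume s: "s \<in> Sing"
  obtain k rh ep N Q where "cone_point X s k rh ep N Q" using cone_pointE[OF s] by blast
  then interpret cone_point X s k rh ep N Q .
  let ?G = "(%j. QQ (Arg e + 2 * pi * of_int j)) ` {- (int k + 2)..int k + 2}"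
  show "\<exists>G. finite G & (\<forall>g\<in>G. (\<exists>de>0. dimm (K Int ball 0 de) g) & tends_sing K g) &
  (\<forall>D E P q. convex D & dimm D E & P \<in> closure D & q \<in> D & q - P \<in> K &
    ends_at {-1<..<0} (%t. E (P + cr (-t) * (q - P))) s --> (\<exists>g\<in>G. matches K g D E P))" proof (intro exI[of _ ?G] conjI ballI allI impI)
   fix g assume "g \<in> ?G"
   then obtain j where j: "j \<in> {- (int k + 2)..int k + 2}" "g = QQ (Arg e + 2 * pi * of_int j)" by blast
   have "ep / BB > 0" using eps BB(1) by simp
   thus "\<exists>de>0. dimm (K Int ball 0 de) g" using germ_dimm[OF K e j(1)] j(2) by blast
   show "tends_sing K g" unfolding tends_sing_def proof (intro bexI[of _ s] allI impI)
    fix W assume W: "openin topX W & s \<in> W"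
    obtain de where d: "de > 0" "!!w. w ~= 0 ==> norm w < de ==> g w \<in> W" by (rule QQ_tends[OF conjunct1[OF W] conjunct2[OF W] angle_index[OF j(1), of e]], rule that, unfold j(2))
    have "w ~= 0" if "w \<in> K" for w using oconeD(4)[OF K] that by auto
    thus "\<exists>de>0. \<forall>w\<in>K. norm w < de --> g w \<in> W" using d by (intro exI[of _ de]) simp
   qed (rule s)
  next
   fix D E P q assume h: "convex D & dimm D E & P \<in> closure D & q \<in> D & q - P \<in> K &
    ends_at {-1<..<0} (%t. E (P + cr (-t) * (q - P))) s"
   hence h': "convex D" "dimm D E" "P \<in> closure D" "q \<in> D" "q - P \<in> K" "ends_at {-1<..<0} (%t. E (P + cr (-t) * (q - P))) s" by blast+
   obtain j mu de where "j \<in> {- (int k + 2)..int k + 2}" "mu > 0" "de > 0"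
    "!!w. w \<in> K ==> norm w < de ==> P + w \<in> D ==> E (P + w) = QQ (Arg e + 2 * pi * of_int j) (cr mu * w)" by (rule hit_germ[OF K e h'], rule that)
   thus "\<exists>g\<in>?G. matches K g D E P" unfolding matches_def by blast
  qed simp
 qed
 from bchoice[OF this] obtain G where G0: "\<forall>s\<in>Sing. finite (G s) & (\<forall>g\<in>G s. (\<exists>de>0. dimm (K Int ball 0 de) g) & tends_sing K g) &
  (\<forall>D E P q. convex D & dimm D E & P \<in> closure D & q \<in> D & q - P \<in> K &
    ends_at {-1<..<0} (%t. E (P + cr (-t) * (q - P))) s --> (\<exists>g\<in>G s. matches K g D E P))" ..
 have G: "!!s. s \<in> Sing ==> finite (G s)" "!!s g. s \<in> Sing ==> g \<in> G s ==> (\<exists>de>0. dimm (K Int ball 0 de) g) & tends_sing K g"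
  "!!s D E P q. s \<in> Sing ==> convex D & dimm D E & P \<in> closure D & q \<in> D & q - P \<in> K &
    ends_at {-1<..<0} (%t. E (P + cr (-t) * (q - P))) s ==> \<exists>g\<in>G s. matches K g D E P"
  subgoal for s using G0 by blast
  subgoal for s g using G0 by blast
  subgoal for s D E P q by (rule conjunct2[OF conjunct2[OF bspec[OF G0]], rule_format, of s D E P q])
  done
 show ?thesis proof (rule that[of "\<Union>s\<in>Sing. G s"])
  show "finite (\<Union>s\<in>Sing. G s)" using finite_Sing G(1) by blast
  show "\<exists>de>0. dimm (K Int ball 0 de) g" "tends_sing K g" if "g \<in> (\<Union>s\<in>Sing. G s)" for g using that G(2) by blast+
  fix D E P q assume "convex D" "dimm D E" "P \<in> closure D" "q \<in> D" "q - P \<in> K" "ends_radially E P q"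
  note h = this
  obtain s where s: "s \<in> Sing" "ends_at {-1<..<0} (%t. E (P + cr (-t) * (q - P))) s" using h(6) unfolding ends_radially_def ..
  have "\<exists>g\<in>G s. matches K g D E P" by (rule G(3)[OF s(1), of D E P q]) (intro conjI h s(2))
  thus "\<exists>g\<in>(\<Union>s\<in>Sing. G s). matches K g D E P" using s(1) by blast
 qed
qed

lemma ray_no_end:
 assumes "dimm D E" "!!t. t > 0 ==> cr t * v \<in> D" "v ~= 0" "s \<in> Sing"
 shows "\<not> ends_at {0<..} (%t. E (cr t * v)) s"
proof
 assume e: "ends_at {0<..} (%t. E (cr t * v)) s"
 obtain k rh ep N Q where "cone_point X s k rh ep N Q" using cone_pointE[OF assms(4)] by blast
 then interpret cone_point X s k rh ep N Q .
 show False using no_infinite_end[OF assms(1,2,3) e] by blast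
qed

text \<open>The image would be open and closed. It is closed because the plane contains the disc of
  radius \<open>3*r/a\<close> whatever the scale \<open>a\<close> is, so a regular limit point is
  attained, while \<open>plane_avoids\<close> keeps the image away from singularities. So the image
  would be the whole surface, yet all its points are regular.\<close>

lemma plane_impossible: "\<not> dimm UNIV E"
proof
 assume E: "dimm UNIV E"
 have "openin topX (range E)" proof (subst openin_subopen, safe)
  fix z
  obtain U ph a b e where U: "(U,ph)\<in>atlas X" "a > 0" "e > 0" "!!w. w \<in> ball z e ==> E w \<in> U & ph (E w) = cr a * w + b" using dimm_atD[OF E, of z] unfolding dimm_at_def by auto
  let ?W = "{x\<in>U. ph x \<in> ball (cr a * z + b) (a * e)}"
  have "openin topX ?W" by (rule chart_open_vimage[OF U(1)]) auto
  moreover have "E z \<in> ?W" using U(4)[of z] U(2,3) by simp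
  moreover have "?W \<subseteq> range E" proof
   fix x assume x: "x \<in> ?W"
   define w where "w = (ph x - b) / cr a"
   have aw: "cr a * w + b = ph x" using U(2) by (simp add: w_def)
   have "a * dist z w = dist (cr a * z + b) (ph x)" unfolding aw[symmetric] using U(2) by (simp add: dist_norm norm_mult flip: right_diff_distrib)
   moreover have "dist (cr a * z + b) (ph x) < a * e" using x by simp
   ultimately have "a * dist z w < a * e" by linarith
   hence "E w \<in> U" "ph (E w) = ph x" using U(2) U(4) aw by auto
   thus "x \<in> range E" using chart_inj[OF U(1)] x by (auto dest: inj_onD)
  qed
  ultimately show "\<exists>T. openin topX T & E z \<in> T & T \<subseteq> range E" by blast
 qed
 moreover have "closedin topX (range E)" proof -
  have "openin topX (topspace topX - range E)" proof (subst openin_subopen, safe)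
   fix y assume y: "y \<in> topspace topX" "y ~: range E"
   show "\<exists>T. openin topX T & y \<in> T & T \<subseteq> topspace topX - range E" proof (cases "y \<in> Sing")
    case True
    obtain k rh ep N Q where "cone_point X y k rh ep N Q" using cone_pointE[OF True] by blast
    then interpret cone_point X y k rh ep N Q .
    have "openin topX (Nh 1)" "y \<in> Nh 1" using Nh_open[of 1] by auto
    moreover have "Nh 1 Int range E = {}" using plane_avoids[OF E] by blast
    ultimately show ?thesis using openin_subset by blast
   next case False
    hence yR: "y \<in> Reg" using y by (simp add: regular_points_def)
    obtain U ph ps r where U: "(U,ph) \<in> atlas X" "y \<in> U" "r > 0" "dimm (ball (ph y) (4*r)) ps"
     "!!v. v \<in> ball (ph y) (4*r) ==> ps v \<in> U & ph (ps v) = v" "!!x. x \<in> U ==> ps (ph x) = x" using chart_inverse[OF yR] by metis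
    let ?W = "{x\<in>U. ph x \<in> ball (ph y) r}"
    have W: "openin topX ?W" "y \<in> ?W" using chart_open_vimage[OF U(1), of "ball (ph y) r"] U(2,3) by auto
    have "E z ~: ?W" for z proof
     assume z: "E z \<in> ?W"
     have zU: "z \<in> UNIV" "E z \<in> U" "ph (E z) \<in> ball (ph y) r" using z by auto
     obtain a where a: "a > 0" "dimm (ball z (3*r/a)) (%w. ps (cr a * (w - z) + ph (E z)))"
      "!!w. w \<in> UNIV ==> w \<in> ball z (3*r/a) ==> E w = ps (cr a * (w - z) + ph (E z))" using scale_extension[OF convex_UNIV E zU(1) U(1,3,4,5,6) zU(2,3)] by blast
     let ?w = "z + (ph y - ph (E z)) / cr a"
     have "E ?w = y" using zU(3) a(1) U(3) a(3)[of ?w] a(1) U(2,6) by (simp add: norm_divide dist_norm divide_strict_right_mono)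
     thus False using y(2) rangeI[of E ?w] by simp
    qed
    thus ?thesis using openin_subset[OF W(1)] W by blast
   qed
  qed
  moreover have "range E \<subseteq> topspace topX" using dimm_reg[OF E] Reg_topspace by blast
  ultimately show ?thesis by (simp add: closedin_def)
 qed
 ultimately have "range E = {} \<or> range E = topspace topX" using connected_X unfolding connected_space_clopen_in by blast
 moreover have "range E \<subseteq> Reg" using dimm_reg[OF E] by blast
 ultimately show False using singular Sing_subset by (auto simp: regular_points_def)
qed

end

section \<open>Gluing immersions\<close>

text \<open>Cramer's rule: the coefficient of \<open>u\<close> when \<open>z\<close> is written in
  the basis \<open>u\<close>, \<open>v\<close>.\<close>

definition crd :: "complex => complex => complex => real" where
 "crd u v z = Im (cnj v * z) / Im (cnj v * u)"

lemma crd_linear: "linear (crd u v)" by (rule linearI) (simp_all add: crd_def algebra_simps add_divide_distrib diff_divide_distrib)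

lemma crd_eq:
 assumes "Im (cnj v * u) ~= 0" shows "cr (crd u v z) * u + cr (crd v u z) * v = z"
proof -
 define D where "D = Re v * Im u - Im v * Re u"
 have D: "D ~= 0" using assms by (simp add: D_def)
 have a: "crd u v z = (Re v * Im z - Im v * Re z) / D" by (simp add: crd_def D_def)
 have b: "crd v u z = (Im u * Re z - Re u * Im z) / D" using D by (simp add: crd_def D_def algebra_simps field_simps)
 show ?thesis using D using D unfolding complex_eq_iff a b by (simp add: D_def add_divide_distrib[symmetric]) (auto simp: field_simps)
qed

lemma crd_of:
 assumes "Im (cnj v * u) ~= 0"
 shows "crd u v (cr a * u + cr b * v) = a" "crd v u (cr a * u + cr b * v) = b"
proof -
 have 1: "Im (cnj v * (cr a * u + cr b * v)) = a * Im (cnj v * u)" by (simp add: algebra_simps)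
 have 2: "Im (cnj u * v) = - Im (cnj v * u)" by simp
 have 3: "Im (cnj u * (cr a * u + cr b * v)) = b * Im (cnj u * v)" by (simp add: algebra_simps)
 show "crd u v (cr a * u + cr b * v) = a" unfolding crd_def 1 using assms by simp
 have 4: "Im (cnj u * v) ~= 0" unfolding 2 using assms by (simp only: neg_equal_0_iff_equal not_False_eq_True)
 show "crd v u (cr a * u + cr b * v) = b" unfolding crd_def 3 by (rule nonzero_mult_div_cancel_right[OF 4])
qed

lemma halfplane: assumes "linear (f :: complex => real)" shows "open {z. f z < c}" "convex {z. f z < c}"
proof -
 have "open (f -` {..<c})" using assms linear_conv_bounded_linear linear_continuous_on by (intro open_vimage) auto
 thus "open {z. f z < c}" by (simp add: vimage_def)
 show "convex {z. f z < c}" using convex_linear_vimage[OF assms, of "{..<c}"] by (simp add: vimage_def)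
qed

lemma convex_line_mem:
 fixes z d :: complex
 assumes "convex D" "z + cr x1 * d \<in> D" "z + cr x2 * d \<in> D" "x1 <= x" "x <= x2"
 shows "z + cr x * d \<in> D"
proof (cases "x1 = x2")
 case True
 thus ?thesis using assms by simp
next case False
 define t where "t = (x - x1) / (x2 - x1)"
 have xx: "x2 - x1 > 0" using False assms(4,5) by simp
 have t: "0 <= t" "t <= 1" using xx assms(4,5) by (auto simp: t_def)
 have "t * (x2 - x1) = x - x1" using xx by (simp add: t_def)
 hence "x = (1 - t) * x1 + t * x2" by (simp add: algebra_simps)
 note t = t this
 have "(1 - t) *\<^sub>R (z + cr x1 * d) + t *\<^sub>R (z + cr x2 * d) \<in> D" using assms(1,2,3) t by (intro convexD) auto
 moreover have "(1 - t) *\<^sub>R (z + cr x1 * d) + t *\<^sub>R (z + cr x2 * d) = z + cr x * d" unfolding t(3) by (simp add: scaleR_conv_of_real algebra_simps)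
 ultimately show ?thesis by simp
qed

section \<open>Gluing over convex pieces, sweeping, and the homothety of a complete cone\<close>

context dilation_surface begin

text \<open>The pieces are compared through the common base point \<open>p\<close>: two convex sets
  that contain \<open>p\<close> have a connected intersection, so the common germ at
  \<open>p\<close> determines the values on it.\<close>

lemma glue_convex:
 assumes W: "open W" and loc: "!!w. w \<in> W ==> \<exists>S F. w \<in> S & convex S & dimm S F & p \<in> S & (\<exists>e>0. \<forall>z\<in>ball p e. F z = E z)"
 obtains G where "dimm W G" "!!S F w. convex S ==> dimm S F ==> p \<in> S ==> \<exists>e>0. \<forall>z\<in>ball p e. F z = E z ==> w \<in> S ==> w \<in> W ==> G w = F w"
proof -
 have agree: "F1 w = F2 w" if h: "convex S1" "dimm S1 F1" "p \<in> S1" "\<exists>e>0. \<forall>z\<in>ball p e. F1 z = E z" "w \<in> S1"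
  "convex S2" "dimm S2 F2" "p \<in> S2" "\<exists>e>0. \<forall>z\<in>ball p e. F2 z = E z" "w \<in> S2" for S1 F1 S2 F2 w proof -
  obtain e1 where e1: "e1 > 0" "!!z. z \<in> ball p e1 ==> F1 z = E z" using h(4) by blast
  obtain e2 where e2: "e2 > 0" "!!z. z \<in> ball p e2 ==> F2 z = E z" using h(9) by blast
  have o: "open (S1 Int S2)" using h dimm_open by blast
  show ?thesis proof (rule dimm_unique[of "S1 Int S2" F1 F2 "S1 Int S2 Int ball p (min e1 e2)"])
   show "connected (S1 Int S2)" using h by (intro convex_connected convex_Int)
   show "dimm (S1 Int S2) F1" by (rule dimm_subset[OF h(2) o]) blast
   show "dimm (S1 Int S2) F2" by (rule dimm_subset[OF h(7) o]) blast
   show "open (S1 Int S2 Int ball p (min e1 e2))" using o by blast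
   show "S1 Int S2 Int ball p (min e1 e2) ~= {}" using h e1 e2 by auto
   show "F1 z = F2 z" if "z \<in> S1 Int S2 Int ball p (min e1 e2)" for z using that e1(2)[of z] e2(2)[of z] by simp
  qed (use h in auto)
 qed
 have "\<forall>w\<in>W. \<exists>SF. w \<in> fst SF & convex (fst SF) & dimm (fst SF) (snd SF) & p \<in> fst SF & (\<exists>e>0. \<forall>z\<in>ball p e. snd SF z = E z)" proof
  fix w assume "w \<in> W"
  then obtain S F where "w \<in> S & convex S & dimm S F & p \<in> S & (\<exists>e>0. \<forall>z\<in>ball p e. F z = E z)" using loc[OF \<open>w \<in> W\<close>] by (elim exE)
  thus "\<exists>SF. w \<in> fst SF & convex (fst SF) & dimm (fst SF) (snd SF) & p \<in> fst SF & (\<exists>e>0. \<forall>z\<in>ball p e. snd SF z = E z)" by (intro exI[of _ "(S, F)"]) simp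
 qed
 from bchoice[OF this] obtain SF where SF: "!!w. w \<in> W ==> w \<in> fst (SF w) & convex (fst (SF w)) & dimm (fst (SF w)) (snd (SF w)) & p \<in> fst (SF w) & (\<exists>e>0. \<forall>z\<in>ball p e. snd (SF w) z = E z)" by blast
 let ?G = "%w. snd (SF w) w"
 have G: "?G w = F w" if "convex S" "dimm S F" "p \<in> S" "\<exists>e>0. \<forall>z\<in>ball p e. F z = E z" "w \<in> S" "w \<in> W" for S F w using SF[OF that(6)] that by (intro agree[of "fst (SF w)" _ w S]) auto
 have "dimm W ?G" unfolding dimm_def proof (intro conjI W ballI)
  fix z assume z: "z \<in> W"
  note s = SF[OF z]
  have "open (fst (SF z) Int W)" using s W dimm_open by blast
  then obtain e where e: "e > 0" "ball z e \<subseteq> fst (SF z) Int W" using s z open_contains_ball by blast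
  have "dimm_at (snd (SF z)) z" using s dimm_atD by blast
  thus "dimm_at ?G z" proof (rule dimm_at_cong[OF _ e(1)])
   fix w assume "w \<in> ball z e"
   thus "?G w = snd (SF z) w" using e s by (intro G[of "fst (SF z)"]) auto
  qed
 qed
 thus ?thesis using that G by blast
qed

text \<open>The pieces are \<open>E\<close> composed with the powers of the homothety. Two of them
  agree because the intermediate powers of a point lie on a segment between points of
  \<open>D\<close>, so the invariance can be applied one step at a time.\<close>

lemma glue_homothety:
 assumes D: "convex D" "dimm D E" and l: "0 < l"
  and inv: "!!w. w \<in> D ==> z0 + cr l * (w - z0) \<in> D ==> E (z0 + cr l * (w - z0)) = E w"
 obtains F where "dimm (\<Union>n::int. {z. z0 + cr (l powi n) * (z - z0) \<in> D}) F"
  "!!n z. z0 + cr (l powi n) * (z - z0) \<in> D ==> F z = E (z0 + cr (l powi n) * (z - z0))"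
proof -
 have pw: "E (z0 + cr (l ^ k) * (w - z0)) = E w" if "w \<in> D" "z0 + cr (l ^ k) * (w - z0) \<in> D" for k w using that proof (induction k arbitrary: w)
  case 0
  thus ?case by simp
 next case (Suc k)
  let ?w = "z0 + cr l * (w - z0)"
  have e: "z0 + cr (l ^ k) * (?w - z0) = z0 + cr (l ^ Suc k) * (w - z0)" by (simp add: mult_ac)
  have one: "z0 + cr 1 * (w - z0) \<in> D" using Suc.prems(1) by simp
  have "?w \<in> D" using self_le_power[of l "Suc k"] convex_line_mem[OF D(1) one Suc.prems(2) ] l power_Suc_le_self[of l k] convex_line_mem[OF D(1) Suc.prems(2) one _] by (cases "l >= 1") auto
  thus ?case using Suc.IH[of ?w] Suc.prems inv e by metis
 qed
 let ?S = "%n::int. {z. z0 + cr (l powi n) * (z - z0) \<in> D}"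
 let ?F = "%n::int. %z. E (z0 + cr (l powi n) * (z - z0))"
 have dS: "dimm (?S n) (?F n)" for n proof -
  have "dimm {z. cr (l powi n) * z + (z0 - cr (l powi n) * z0) \<in> D} (%z. E (cr (l powi n) * z + (z0 - cr (l powi n) * z0)))" by (rule dimm_affine[OF D(2)]) (use l in simp)
  moreover have "cr (l powi n) * z + (z0 - cr (l powi n) * z0) = z0 + cr (l powi n) * (z - z0)" for z by (simp only: algebra_simps)
  ultimately show ?thesis by (simp only:)
 qed
 have ag: "?F n z = ?F m z" if nm: "n <= m" "z \<in> ?S n" "z \<in> ?S m" for n m z proof -
  let ?w = "z0 + cr (l powi n) * (z - z0)"
  have e: "z0 + cr (l powi m) * (z - z0) = z0 + cr (l ^ nat (m - n)) * (?w - z0)" using nm l power_int_add[of l "m - n" n] by (simp add: power_int_def[of l "m - n"] del: power_int_add)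
  have w: "?w \<in> D" using nm(2) by (simp only: mem_Collect_eq)
  have "z0 + cr (l ^ nat (m - n)) * (?w - z0) \<in> D" using nm(3) by (simp only: mem_Collect_eq e)
  from pw[OF w this] show ?thesis unfolding e by (rule sym)
 qed
 have ag2: "?F n z = ?F m z" if "n \<in> UNIV" "m \<in> UNIV" "z \<in> ?S n" "z \<in> ?S m" for n m z proof (cases "n <= m")
  case True
  thus ?thesis by (rule ag[OF _ that(3,4)])
 next case False
  hence "m <= n" by simp
  thus ?thesis by (rule ag[OF _ that(4,3), symmetric])
 qed
 obtain F where F: "dimm (\<Union>n\<in>UNIV. ?S n) F" "!!n z. n \<in> UNIV ==> z \<in> ?S n ==> F z = ?F n z" by (rule dimm_glue[of UNIV ?S ?F, OF dS ag2], assumption+) blast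
 show ?thesis by (rule that[OF F(1)]) (use F(2) in blast)
qed

lemma extend_over_compact:
 assumes D: "convex D" "dimm D E" and C: "compact C" "C \<subseteq> closure D" "!!P. P \<in> C ==> extendable D E P"
 obtains e E' where "e > 0" "dimm (D Un (\<Union>x\<in>C. ball x e)) E'" "!!w. w \<in> D ==> E' w = E w"
proof -
 have "\<forall>P\<in>C. \<exists>eF. fst eF > 0 & dimm (ball P (fst eF)) (snd eF) & (\<forall>w\<in>D Int ball P (fst eF). snd eF w = E w)" proof
  fix P assume "P \<in> C"
  then obtain e F where "e > 0" "dimm (ball P e) F" "\<forall>w\<in>D Int ball P e. F w = E w" using C(3) unfolding extendable_def by blast
  thus "\<exists>eF. fst eF > 0 & dimm (ball P (fst eF)) (snd eF) & (\<forall>w\<in>D Int ball P (fst eF). snd eF w = E w)" by (intro exI[of _ "(e, F)"]) simp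
 qed
 from bchoice[OF this] obtain eF where eF: "\<forall>P\<in>C. fst (eF P) > 0 & dimm (ball P (fst (eF P))) (snd (eF P)) & (\<forall>w\<in>D Int ball P (fst (eF P)). snd (eF P) w = E w)" ..
 obtain E' where E': "dimm (D Un (\<Union>P\<in>C. ball P (fst (eF P)))) E'" "!!w. w \<in> D ==> E' w = E w" by (rule extend_over[OF D, of C "%P. P" "%P. fst (eF P)" "%P. snd (eF P)"]) (use C(2) eF in blast)+
 have "C \<subseteq> (\<Union>P\<in>C. ball P (fst (eF P)))" using eF by force
 then obtain e where e: "e > 0" "(\<Union>x\<in>C. ball x e) \<subseteq> (\<Union>P\<in>C. ball P (fst (eF P)))" using compact_subset_open_imp_ball_epsilon_subset[OF C(1), of "\<Union>P\<in>C. ball P (fst (eF P))"] by blast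
 have "open (D Un (\<Union>x\<in>C. ball x e))" using dimm_open[OF D(2)] by blast
 hence "dimm (D Un (\<Union>x\<in>C. ball x e)) E'" by (rule dimm_subset[OF E'(1)]) (use e in blast)
 thus ?thesis using that e(1) E'(2) by blast
qed

text \<open>\<open>C ta\<close> is the front of the growing domain \<open>S ta\<close>. The supremum
  of the parameters that are reached is itself reached, by \<open>left\<close>. If it is below
  \<open>b\<close>, the compact front has a uniform neighbourhood to which the immersion extends,
  unless one of its points is an obstacle.\<close>

lemma sweep:
 fixes S :: "real => complex set"
 assumes ab: "a < b" and S: "!!ta. a <= ta ==> ta <= b ==> open (S ta) & convex (S ta)" and ne: "S a ~= {}"
  and mono: "!!si ta. a <= si ==> si <= ta ==> ta <= b ==> S si \<subseteq> S ta"
  and left: "!!ta z. a < ta ==> ta <= b ==> z \<in> S ta ==> \<exists>si. a <= si & si < ta & z \<in> S si"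
  and C: "!!ta. a <= ta ==> ta < b ==> compact (C ta) & C ta \<subseteq> closure (S ta)"
  and step: "!!ta e. a <= ta ==> ta < b ==> e > 0 ==> \<exists>ta'>ta. ta' <= b & S ta' \<subseteq> S ta Un (\<Union>x\<in>C ta. ball x e)"
  and E0: "dimm (S a) E0"
 obtains (complete) E where "dimm (S b) E" "!!w. w \<in> S a ==> E w = E0 w"
 | (obstacle) ta E P where "a <= ta" "ta < b" "dimm (S ta) E" "!!w. w \<in> S a ==> E w = E0 w" "P \<in> C ta" "\<not> extendable (S ta) E P"
proof (cases "\<exists>ta E P. a <= ta & ta < b & dimm (S ta) E & (\<forall>w\<in>S a. E w = E0 w) & P \<in> C ta & \<not> extendable (S ta) E P")
 case True
 thus ?thesis using obstacle by blast
next case False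
 hence ext: "extendable (S ta) E P" if "a <= ta" "ta < b" "dimm (S ta) E" "\<forall>w\<in>S a. E w = E0 w" "P \<in> C ta" for ta E P using that by blast
 define T where "T = {ta. a <= ta & ta <= b & (\<exists>E. dimm (S ta) E & (\<forall>w\<in>S a. E w = E0 w))}"
 have aT: "a \<in> T" using ab E0 unfolding T_def by auto
 have bd: "bdd_above T" unfolding T_def by (rule bdd_aboveI[of _ b]) auto
 define s where "s = Sup T"
 have s1: "a <= s" unfolding s_def using cSup_upper[OF aT bd] .
 have "T ~= {}" using aT by blast
 hence s2: "s <= b" unfolding s_def by (rule cSup_least) (simp add: T_def)
 note s = s1 s2
 obtain p where p: "p \<in> S a" using ne by blast
 have oa: "open (S a)" using S ab by simp
 obtain e0 where e0: "e0 > 0" "ball p e0 \<subseteq> S a" using p oa open_contains_ball by blast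
 have nearp: "\<exists>e>0. \<forall>z\<in>ball p e. E z = E0 z" if "\<forall>w\<in>S a. E w = E0 w" for E using that e0 by blast
 have sT: "s \<in> T" proof (cases "s = a")
  case True
  thus ?thesis using aT by simp
 next case False
  have os: "open (S s)" using S s by simp
  have loc: "\<exists>S' F. w \<in> S' & convex S' & dimm S' F & p \<in> S' & (\<exists>e>0. \<forall>z\<in>ball p e. F z = E0 z)" if w: "w \<in> S s" for w proof -
   obtain si where si: "a <= si" "si < s" "w \<in> S si" using left[OF _ s(2) w] False s by auto
   then obtain ta where ta: "ta \<in> T" "si < ta" using less_cSup_iff[OF _ bd, of si] aT unfolding s_def by blast
   then obtain E where E: "dimm (S ta) E" "\<forall>w\<in>S a. E w = E0 w" "a <= ta" "ta <= b" unfolding T_def by blast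
   have "w \<in> S ta" using mono[of si ta] si ta E by auto
   moreover have "p \<in> S ta" using mono[of a ta] p E by auto
   moreover have "convex (S ta)" using S E(3,4) by blast
   ultimately show ?thesis using E(1) nearp[OF E(2)] by (intro exI[of _ "S ta"] exI[of _ E] conjI)
  qed
  obtain G where G: "dimm (S s) G" "!!S' F w. convex S' ==> dimm S' F ==> p \<in> S' ==> \<exists>e>0. \<forall>z\<in>ball p e. F z = E0 z ==> w \<in> S' ==> w \<in> S s ==> G w = F w" by (rule glue_convex[OF os loc], assumption, rule that)
  have "G w = E0 w" if "w \<in> S a" for w using G(2)[of "S a" E0 w] S[of a] ab E0 p that mono[of a s] s e0(1) by auto
  thus ?thesis using G(1) s unfolding T_def by blast
 qed
 have "s = b" proof (rule ccontr)
  assume "s ~= b"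
  hence sb: "s < b" using s by simp
  obtain E where E: "dimm (S s) E" "\<forall>w\<in>S a. E w = E0 w" using sT unfolding T_def by blast
  have cs: "convex (S s)" using S s by simp
  have Cs: "compact (C s)" "C s \<subseteq> closure (S s)" using C[OF s(1) sb] by auto
  obtain e E' where E': "e > 0" "dimm (S s Un (\<Union>x\<in>C s. ball x e)) E'" "!!w. w \<in> S s ==> E' w = E w" using extend_over_compact[OF cs E(1) Cs ext[OF s(1) sb E]] by metis
  obtain t where t: "t > s" "t <= b" "S t \<subseteq> S s Un (\<Union>x\<in>C s. ball x e)" using step[OF s(1) sb E'(1)] by blast
  have "dimm (S t) E'" by (rule dimm_subset[OF E'(2) _ t(3)]) (use S t s in simp)
  moreover have "E' w = E0 w" if "w \<in> S a" for w using E'(3)[of w] E(2) mono[of a s] s that by auto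
  ultimately have "t \<in> T" using t s unfolding T_def by auto
  thus False using cSup_upper[OF _ bd, of t] t unfolding s_def by simp
 qed
 thus ?thesis using sT complete unfolding T_def by blast
qed

text \<open>A ray in the cone does not end at a singularity (\<open>ray_no_end\<close>), so it comes
  close to one regular point at arbitrarily large parameters \<open>t\<close>. If the discs of
  \<open>scale_extension\<close> had radius at least \<open>2 * t * norm e\<close> for arbitrarily
  large such \<open>t\<close>, they would cover the plane. Otherwise the error of a return is small
  against the distance to the boundary of the cone.\<close>

lemma ocone_return:
 assumes K: "ocone K" "dimm K E"
 obtains l c where "0 < l" "!!w. w \<in> K ==> cr l * w + c \<in> K ==> E (cr l * w + c) = E w" "l <= 1 ==> c \<in> K"
proof -
 obtain e where e: "e \<in> K" using oconeD(3)[OF K(1)] by blast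
 have e0: "e ~= 0" using e oconeD(4)[OF K(1)] by auto
 have te: "cr t * e \<in> K" if "t > 0" for t using oconeD(5)[OF K(1) e that] .
 have cK: "convex K" using oconeD(2)[OF K(1)] .
 let ?f = "%t. E (cr t * e)"
 have "continuous_map (top_of_set {0<..}) topX ?f" by (rule continuous_map_path_dimm[OF K(2)]) (use te in \<open>auto intro!: continuous_intros\<close>)
 hence "(\<exists>s\<in>Sing. ends_at {0<..} ?f s) \<or> (\<exists>y\<in>Reg. clusters {0<..} ?f y)" by (intro cluster_or_end) (auto simp: is_interval_oi)
 moreover have "\<not> ends_at {0<..} ?f s" if "s \<in> Sing" for s by (rule ray_no_end[OF K(2) te e0 that])
 ultimately obtain y where y: "y \<in> Reg" "clusters {0<..} ?f y" by blast
 obtain U ph ps r where U: "(U,ph) \<in> atlas X" "y \<in> U" "r > 0" "dimm (ball (ph y) (4*r)) ps"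
  "!!v. v \<in> ball (ph y) (4*r) ==> ps v \<in> U & ph (ps v) = v" "!!x. x \<in> U ==> ps (ph x) = x" using chart_inverse[OF y(1)] by metis
 obtain d0 where d0: "d0 > 0" "ball e d0 \<subseteq> K" using e oconeD(1)[OF K(1)] open_contains_ball by blast
 \<comment> \<open>So small that the error \<open>h\<close> of the return stays below
   \<open>t2 * d0 / 4\<close>, while the ball of radius \<open>t2 * d0\<close> around
   \<open>cr t2 * e\<close> is in \<open>K\<close>.\<close>
 define de where "de = min r (min d0 (norm e) * 3 * r / (16 * norm e))"
 have del: "de > 0" "de <= r" using U(3) d0 e0 by (auto simp: de_def)
 let ?ok = "%t. t > 0 & ?f t \<in> U & ph (?f t) \<in> ball (ph y) de"
 have ok: "\<exists>t\<ge>T. ?ok t" if "T > 0" for T proof -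
  obtain t where "t \<in> {0<..}" "T <= t" "?f t \<in> U" "ph (?f t) \<in> ball (ph y) de" by (rule cluster_points[OF y(2) U(1,2), of T de]) (use \<open>T > 0\<close> del in auto)
  thus ?thesis by auto
 qed
 let ?P = "%t a. a > 0 & dimm (ball (cr t * e) (3*r/a)) (%w. ps (cr a * (w - cr t * e) + ph (?f t))) &
  (\<forall>w\<in>K. w \<in> ball (cr t * e) (3*r/a) --> E w = ps (cr a * (w - cr t * e) + ph (?f t)))"
 have sc: "\<exists>a. ?P t a" if t: "?ok t" for t proof -
  have b: "ph (?f t) \<in> ball (ph y) r" using t del by auto
  have tp: "cr t * e \<in> K" using te t by blast
  obtain a where "a > 0" "dimm (ball (cr t * e) (3*r/a)) (%w. ps (cr a * (w - cr t * e) + ph (?f t)))"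
   "!!w. w \<in> K ==> w \<in> ball (cr t * e) (3*r/a) ==> E w = ps (cr a * (w - cr t * e) + ph (?f t))" by (rule scale_extension[OF cK K(2) tp U(1,3,4,5,6) _ b]) (use t in auto)
  thus ?thesis by blast
 qed
 show ?thesis proof (cases "\<forall>T>0. \<exists>t\<ge>T. \<exists>a. ?ok t & ?P t a & 3*r/a >= 2 * t * norm e")
  case True
  have loc: "\<exists>S F. w \<in> S & convex S & dimm S F & e \<in> S & (\<exists>d>0. \<forall>z\<in>ball e d. F z = E z)" for w proof -
   define T where "T = (norm w + norm e + 1) / norm e"
   have T: "T > 0" "T * norm e > norm w" "T * norm e > norm e" using e0 by (auto simp: T_def add_nonneg_pos)
   obtain t a where ta: "t >= T" "?ok t" "?P t a" "3*r/a >= 2 * t * norm e" using True T(1) by blast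
   let ?B = "ball (cr t * e) (3*r/a)"
   have inB: "z \<in> ?B" if "norm z < T * norm e" for z proof -
    have "T * norm e <= t * norm e" using ta e0 by simp
    hence "norm z < t * norm e" using that by linarith
    moreover have "dist (cr t * e) z <= t * norm e + norm z" using norm_triangle_ineq4[of "cr t * e" z] ta by (simp add: dist_norm norm_mult)
    ultimately show ?thesis using ta(4) by simp
   qed
   have wB: "w \<in> ?B" "e \<in> ?B" using inB T by auto
   obtain d where d: "d > 0" "ball e d \<subseteq> ?B Int K" using oconeD(1)[OF K(1)] wB e open_contains_ball by blast
   show ?thesis proof (intro exI[of _ ?B] exI[of _ "%w. ps (cr a * (w - cr t * e) + ph (?f t))"] conjI exI[of _ d] ballI)
    fix z assume "z \<in> ball e d"
    thus "ps (cr a * (z - cr t * e) + ph (?f t)) = E z" using d ta(3) by fastforce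
   qed (use wB ta(3) d in auto)
  qed
  obtain G where "dimm UNIV G" using glue_convex[OF open_UNIV loc] by metis
  thus ?thesis using plane_impossible by blast
 next case False
  then obtain T where T: "T > 0" "!!t a. t >= T ==> ?ok t ==> ?P t a ==> 3*r/a < 2 * t * norm e" by force
  obtain t1 where t1: "t1 >= T" "?ok t1" using ok[OF T(1)] by blast
  \<comment> \<open>Doubling the parameter gives \<open>t2 - l * t1 >= t2 / 2\<close> when
    \<open>l <= 1\<close>, which puts \<open>c\<close> into the cone.\<close>
  obtain t2 where t2: "t2 >= 2 * t1" "?ok t2" using ok[of "2*t1"] t1 by auto
  obtain a1 where a1: "?P t1 a1" using sc[OF t1(2)] by blast
  obtain a2 where a2: "?P t2 a2" using sc[OF t2(2)] by blast
  have big: "3*r/a2 < 2 * t2 * norm e" using t1 t2 T T(2) t2(2) a2 by auto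
  define l where "l = a1 / a2"
  let ?z1 = "cr t1 * e" let ?z2 = "cr t2 * e"
  let ?x1 = "ph (?f t1)" let ?x2 = "ph (?f t2)"
  define c where "c = ?z2 + (?x1 - ?x2) / cr a2 - cr l * ?z1"
  have lp: "l > 0" using a1 a2 by (simp add: l_def)
  have dx: "norm (?x1 - ?x2) < 2 * de" proof -
   have "dist ?x1 ?x2 <= dist (ph y) ?x1 + dist (ph y) ?x2" using dist_triangle3[of ?x1 ?x2 "ph y"] .
   moreover have "dist (ph y) ?x1 < de" "dist (ph y) ?x2 < de" using t1(2) t2(2) by auto
   ultimately show ?thesis by (simp add: dist_norm)
  qed
  define h where "h = (?x1 - ?x2) / cr a2"
  have hs: "norm h < t2 * (d0 / 4)" proof -
   have a2p: "a2 > 0" using a2 by blast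
   have "norm h < 2 * de / a2" using dx a2p by (simp add: h_def norm_divide divide_strict_right_mono)
   also have "... <= 2 * (d0 * 3 * r / (16 * norm e)) / a2" proof -
    have "de <= d0 * 3 * r / (16 * norm e)" using U(3) unfolding de_def using e0 by (intro min.coboundedI2 divide_right_mono) auto
    thus ?thesis using a2p by (intro divide_right_mono mult_left_mono) auto
   qed
   also have "... = (3 * r / a2) * (d0 / (8 * norm e))" by (simp add: mult_ac)
   also have "... <= (2 * t2 * norm e) * (d0 / (8 * norm e))" using big d0(1) e0 by (intro mult_right_mono) auto
   also have "... = t2 * (d0 / 4)" using e0 by simp
   finally show ?thesis .
  qed
  have near: "cr x * e + h \<in> K" if x: "x >= t2 / 2" for x proof -
   have xp: "x > 0" using x t2 by linarith
   have "t2 / 2 * d0 <= x * d0" using x d0(1) by (intro mult_right_mono) auto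
   moreover have "t2 * d0 > 0" using t2(2) d0(1) by simp
   ultimately have "norm h < x * d0" using hs by simp
   hence "e + h / cr x \<in> K" using xp d0(2) by (auto simp: norm_divide field_simps dist_norm)
   thus ?thesis using oconeD(5)[OF K(1) _ xp] xp by (fastforce simp: algebra_simps)
  qed
  have inv: "E (cr l * w + c) = E w" if "w \<in> K" "cr l * w + c \<in> K" for w unfolding l_def proof (rule return_map[OF cK K(2), of ?z1 ?z2 a1 a2 r ps ?x1 ?x2])
   show "dist ?x1 ?x2 < 2 * r" using dx del by (simp add: dist_norm)
   have "cr (a1/a2) * ?z1 + c = cr t2 * e + h" unfolding c_def h_def l_def by simp
   thus "cr (a1/a2) * ?z1 + c \<in> K" using near[of t2] t2 by simp
   show "c = ?z2 + (?x1 - ?x2) / cr a2 - cr (a1/a2) * ?z1" by (simp add: c_def l_def)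
   show "?z1 \<in> K" "?z2 \<in> K" using te t1(2) t2(2) by blast+
   show "a1 > 0" "a2 > 0" "r > 0" using a1 a2 U(3) by blast+
   show "E w = ps (cr a1 * (w - ?z1) + ?x1)" if "w \<in> K" "w \<in> ball ?z1 (3*r/a1)" for w using a1 that by blast
   show "E w = ps (cr a2 * (w - ?z2) + ?x2)" if "w \<in> K" "w \<in> ball ?z2 (3*r/a2)" for w using a2 that by blast
   show "w \<in> K" "cr (a1/a2) * w + c \<in> K" using that unfolding l_def by blast+
  qed
  moreover have "c \<in> K" if "l <= 1" proof -
   have "c = cr (t2 - l * t1) * e + h" unfolding c_def h_def by (simp add: algebra_simps)
   moreover have "l * t1 <= t1" using that t1(2) by simp
   hence "t2 - l * t1 >= t2 / 2" using t2 by linarith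
   from near[OF this] show ?thesis using calculation by (simp only:)
  qed
  ultimately show ?thesis using that lp by blast
 qed
qed

text \<open>A contracting return map would have its fixed point in the cone, and a translation would
  spread \<open>E\<close> over the plane; so the ratio exceeds 1. The powers of the expanding
  homothety take each point of the cone with apex \<open>z0\<close> into \<open>K\<close>, and this
  transports the immersion to that cone.\<close>

lemma ocone_homothety:
 assumes K: "ocone K" "dimm K E"
 obtains l z0 F where "l > 1" "dimm {z. z - z0 \<in> K} F" "!!z. z - z0 \<in> K ==> F (z0 + cr l * (z - z0)) = F z"
  "!!z. z \<in> K ==> z - z0 \<in> K ==> F z = E z"
proof -
 obtain l c where l: "0 < l" "!!w. w \<in> K ==> cr l * w + c \<in> K ==> E (cr l * w + c) = E w" "l <= 1 ==> c \<in> K" using ocone_return[OF K] by metis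
 have cK: "convex K" using oconeD(2)[OF K(1)] .
 obtain e where e: "e \<in> K" using oconeD(3)[OF K(1)] by blast
 have "l > 1" proof (rule ccontr)
  assume "\<not> l > 1"
  hence l1: "l <= 1" by simp
  have c: "c \<in> K" using l(3) l1 by simp
  show False proof (cases "l = 1")
   case False
   hence l2: "l < 1" using l1 by simp
   have "cr (1 / (1 - l)) * c \<in> K" by (rule oconeD(5)[OF K(1) c]) (use l2 in simp)
   moreover have "cr l * (cr (1 / (1 - l)) * c) + c = cr (1 / (1 - l)) * c" proof -
    show ?thesis using l2 by (simp add: field_simps)
   qed
   ultimately show False using fixed_point_impossible[OF cK K(2) l(1) _ _ _ l(2)] l2 by blast
  next case True
   have per: "E (w + of_nat n * c) = E w & w + of_nat n * c \<in> K" if "w \<in> K" for w n proof (induction n)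
    case 0
    thus ?case using that by simp
   next case (Suc n)
    show ?case using ocone_add[OF K(1)] Suc c l(2)[of "w + of_nat n * c"] Suc True by (simp add: algebra_simps)
   qed
   have loc: "\<exists>S F. w \<in> S & convex S & dimm S F & e \<in> S & (\<exists>d>0. \<forall>z\<in>ball e d. F z = E z)" for w proof -
    obtain T where T: "T > 0" "!!t. t >= T ==> w + cr t * c \<in> K" using ocone_far[OF K(1) c] by metis
    obtain n :: nat where "real n >= T" using real_arch_simple by blast
    hence w: "w + of_nat n * c \<in> K" using T(2)[of "real n"] by simp
    obtain d where d: "d > 0" "ball e d \<subseteq> K" using e oconeD(1)[OF K(1)] open_contains_ball by blast
    show ?thesis proof (intro exI[of _ "{z. z + of_nat n * c \<in> K}"] exI[of _ "%z. E (z + of_nat n * c)"] conjI exI[of _ d] ballI)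
     show "dimm {z. z + of_nat n * c \<in> K} (%z. E (z + of_nat n * c))" by (rule dimm_shift[OF K(2)])
     show "convex {z. z + of_nat n * c \<in> K}" using convex_affine_preimage[OF cK, of 1 "of_nat n * c"] by simp
    qed (use w per e d in auto)
   qed
   obtain G where "dimm UNIV G" using glue_convex[OF open_UNIV loc] by metis
   thus ?thesis using plane_impossible by blast
  qed
 qed
 define z0 where "z0 = c / cr (1 - l)"
 have A: "z0 + cr l * (z - z0) = cr l * z + c" for z proof -
  have "cr (1 - l) * z0 = c" using \<open>l > 1\<close> by (simp add: z0_def del: of_real_diff)
  thus ?thesis by (simp add: algebra_simps)
 qed
 obtain F where F: "dimm (\<Union>n::int. {z. z0 + cr (l powi n) * (z - z0) \<in> K}) F"
  "!!n z. z0 + cr (l powi n) * (z - z0) \<in> K ==> F z = E (z0 + cr (l powi n) * (z - z0))" by (rule glue_homothety[OF cK K(2) l(1), of z0]) (use l(2) in \<open>unfold A, blast+\<close>)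
 have ex: "\<exists>n::nat. z0 + cr (l ^ n) * (z - z0) \<in> K & z0 + cr (l ^ Suc n) * (z - z0) \<in> K" if z: "z - z0 \<in> K" for z proof -
  obtain T where T: "T > 0" "!!t. t >= T ==> z0 + cr t * (z - z0) \<in> K" using ocone_far[OF K(1) z] by metis
  obtain n where n: "l ^ n > T" using real_arch_pow[OF \<open>l > 1\<close>] by blast
  have "l ^ Suc n >= l ^ n" using \<open>l > 1\<close> by simp
  thus ?thesis using T(2)[of "l ^ n"] T(2)[of "l ^ Suc n"] n by (intro exI[of _ n]) auto
 qed
 show ?thesis proof (rule that[OF \<open>l > 1\<close>])
  have op: "open {z. z - z0 \<in> K}" using open_translate_preimage oconeD(1)[OF K(1)] .
  have sub: "{z. z - z0 \<in> K} \<subseteq> (\<Union>n::int. {z. z0 + cr (l powi n) * (z - z0) \<in> K})" proof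
   fix z assume "z \<in> {z. z - z0 \<in> K}"
   then obtain n :: nat where "z0 + cr (l ^ n) * (z - z0) \<in> K" using ex[of z] by auto
   hence "z0 + cr (l powi (int n)) * (z - z0) \<in> K" by (simp only: power_int_of_nat)
   thus "z \<in> (\<Union>n::int. {z. z0 + cr (l powi n) * (z - z0) \<in> K})" by blast
  qed
  show "dimm {z. z - z0 \<in> K} F" by (rule dimm_subset[OF F(1) op sub])
  show "F (z0 + cr l * (z - z0)) = F z" if z: "z - z0 \<in> K" for z proof -
   obtain n :: nat where n: "z0 + cr (l ^ n) * (z - z0) \<in> K" "z0 + cr (l ^ Suc n) * (z - z0) \<in> K" using ex[OF z] by blast
   let ?z = "z0 + cr l * (z - z0)"
   have e1: "z0 + cr (l powi int n) * (?z - z0) = z0 + cr (l powi int (Suc n)) * (z - z0)" unfolding power_int_of_nat by (simp add: mult_ac)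
   have 1: "z0 + cr (l powi int (Suc n)) * (z - z0) \<in> K" using n(2) by (simp only: power_int_of_nat)
   have "F ?z = E (z0 + cr (l powi int n) * (?z - z0))" by (rule F(2)) (unfold e1, rule 1)
   also have "... = F z" unfolding e1 by (rule F(2)[OF 1, symmetric])
   finally show ?thesis .
  qed
  show "F z = E z" if "z \<in> K" "z - z0 \<in> K" for z using F(2)[of 0 z] that by simp
 qed
qed

end

lemma powi_window: fixes l x :: real assumes "l > 1" "x > 0" obtains n :: int where "1 < l powi n * x" "l powi n * x <= l"
proof -
 define m where "m = \<lfloor>log l x\<rfloor>"
 have m: "of_int m <= log l x" "log l x < of_int m + 1" unfolding m_def by linarith+
 have x: "l powr (log l x) = x" using assms by simp
 have "l powr of_int m <= x" using powr_mono[OF m(1), of l] assms x by simp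
 moreover have "x < l powr (of_int m + 1)" using powr_less_mono[OF m(2), of l] assms x by simp
 moreover have e: "l powi (1 - m) = l powr (1 - of_int m)" using assms powr_real_of_int'[of l "1 - m"] by simp
 moreover have "l powr (1 - of_int m) * x >= l powr (1 - of_int m) * l powr of_int m" using calculation(1) by (intro mult_left_mono) auto
 hence "l powr (1 - of_int m) * x >= l" using assms by (simp add: powr_add[symmetric])
 moreover have "l powr (- of_int m) * x < l powr (- of_int m) * l powr (of_int m + 1)" using calculation(2) assms by (intro mult_strict_left_mono) auto
 hence 2: "l powr (- of_int m) * x < l" using assms by (simp add: powr_add[symmetric])
 have 1: "l powr (- of_int m) * x >= l powr (- of_int m) * l powr of_int m" using \<open>l powr of_int m <= x\<close> by (intro mult_left_mono) auto
 hence 1: "l powr (- of_int m) * x >= 1" using assms by (simp add: powr_add[symmetric])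
 have e2: "l powi (- m) = l powr (- of_int m)" using assms powr_real_of_int'[of l "- m"] by simp
 show ?thesis using that[of "-m"] 1 2 unfolding e2 using powr_add[of l 1 "- of_int m"] assms that[of "1 - m"] e assms by (cases "l powr (- of_int m) * x = 1") (simp_all add: mult.assoc)
qed

lemma ray_closure: fixes P q :: complex assumes "!!t. 0 < t ==> t <= 1 ==> P + cr t * (q - P) \<in> D" shows "P \<in> closure D"
proof (unfold closure_approachable, intro allI impI)
 fix e :: real assume e: "e > 0"
 define t where "t = min 1 (e / (2 * (norm (q - P) + 1)))"
 have n: "2 * (norm (q - P) + 1) > 0" by (simp add: add_nonneg_pos)
 have t: "0 < t" "t <= 1" using e n by (simp_all add: t_def)
 have "t * norm (q - P) <= e / (2 * (norm (q - P) + 1)) * (norm (q - P) + 1)" using t e n by (intro mult_mono) (auto simp: t_def)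
 also have "... = e / 2" using n by (simp add: field_simps)
 finally have "dist (P + cr t * (q - P)) P < e" using e t by (simp add: dist_norm norm_mult)
 thus "\<exists>y\<in>D. dist y P < e" using assms t by blast
qed

lemma ocone_small: assumes "ocone K" "e > 0" "k \<in> K" obtains t where "0 < t" "t <= 1" "!!s. 0 < s ==> s <= t ==> cr s * k \<in> K & norm (cr s * k) < e"
proof
 have n: "norm k + 1 > 0" by (simp add: add_nonneg_pos)
 show "0 < min 1 (e / (norm k + 1))" using assms n by simp
 show "min 1 (e / (norm k + 1)) <= 1" by simp
 fix s assume s: "0 < s" "s <= min 1 (e / (norm k + 1))"
 show "cr s * k \<in> K & norm (cr s * k) < e" using s n s oconeD(5)[OF assms(1,3) s(1)] s by (simp add: field_simps norm_mult)
qed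

lemma ocone_closure: assumes "ocone K" shows "P \<in> closure {z. z - P \<in> K}"
proof -
 obtain k where k: "k \<in> K" using oconeD(3)[OF assms] by blast
 show ?thesis by (rule ray_closure[of P "P + k"]) (use oconeD(5)[OF assms k] in simp)
qed

section \<open>Decided cones, and enlarging a complete cone around its apex\<close>

context dilation_surface begin

lemma convex_agree:
 assumes "convex A" "dimm A E" "convex B" "dimm B F" "open V" "V ~= {}" "V \<subseteq> A" "V \<subseteq> B" "!!w. w \<in> V ==> E w = F w" "z \<in> A" "z \<in> B"
 shows "E z = F z"
proof -
 have o: "open (A Int B)" using assms(2,4) dimm_open by blast
 show ?thesis proof (rule dimm_unique[of "A Int B" E F V])
  show "connected (A Int B)" using assms by (intro convex_connected convex_Int)
  show "dimm (A Int B) E" by (rule dimm_subset[OF assms(2) o]) blast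
  show "dimm (A Int B) F" by (rule dimm_subset[OF assms(4) o]) blast
 qed (use assms in auto)
qed

lemma extendable_transfer:
 assumes "extendable D1 E1 P" "dimm D1 E1" "convex D2" "dimm D2 E2" "!!e. e > 0 ==> \<exists>z\<in>ball P e. z \<in> D1 & z \<in> D2" "!!z. z \<in> D1 ==> z \<in> D2 ==> E1 z = E2 z"
 shows "extendable D2 E2 P"
proof -
 obtain e H where H: "e > 0" "dimm (ball P e) H" "!!w. w \<in> D1 ==> w \<in> ball P e ==> H w = E1 w" using assms(1) unfolding extendable_def by blast
 let ?V = "ball P e Int D1 Int D2"
 have V: "open ?V" "?V ~= {}" using assms(5)[OF H(1)] dimm_open[OF assms(2)] dimm_open[OF assms(4)] by auto
 have "H w = E2 w" if "w \<in> D2" "w \<in> ball P e" for w by (rule convex_agree[OF convex_ball H(2) assms(3,4) V]) (use that H(3) assms(6) in auto)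
 thus ?thesis unfolding extendable_def using H(1,2) by blast
qed

lemma extendable_mono: assumes "extendable D E P" "D' \<subseteq> D" "!!z. z \<in> D' ==> E' z = E z" shows "extendable D' E' P"
proof -
 obtain e F where "e > 0" "dimm (ball P e) F" "\<forall>w\<in>D Int ball P e. F w = E w" using assms(1) unfolding extendable_def by blast
 thus ?thesis unfolding extendable_def using assms(2,3) by (intro exI[of _ e] exI[of _ F] conjI ballI) auto
qed

text \<open>The extension agrees with \<open>g\<close> only near the apex: \<open>g\<close> stands
  for its germ there and may be arbitrary elsewhere.\<close>

definition complete :: "(complex => 'a) => complex set => bool" where
 "complete g K \<longleftrightarrow> (\<exists>F. dimm K F & (\<exists>de>0. \<forall>w\<in>K. norm w < de --> F w = g w))"

definition germ_family :: "complex set => (complex => 'a) set => bool" where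
 "germ_family K G \<longleftrightarrow> finite G & (\<forall>g\<in>G. (\<exists>de>0. dimm (K Int ball 0 de) g) & tends_sing K g) &
  (\<forall>D E P q. convex D --> dimm D E --> P \<in> closure D --> q \<in> D --> q - P \<in> K --> ends_radially E P q --> (\<exists>g\<in>G. matches K g D E P))"

text \<open>As the germs are finitely many, every cone contains a decided one: shrink it whenever a subcone
 makes a further germ complete.\<close>

definition decided :: "complex set => (complex => 'a) set => bool" where
 "decided K G \<longleftrightarrow> ocone K & germ_family K G & (\<forall>g\<in>G. \<forall>K'. ocone K' --> K' \<subseteq> K --> complete g K' --> complete g K)"

lemma complete_subset: assumes "complete g K" "open K'" "K' \<subseteq> K" shows "complete g K'"
proof -
 obtain F de where "dimm K F" "de > 0" "\<forall>w\<in>K. norm w < de --> F w = g w" using assms(1) unfolding complete_def by blast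
 thus ?thesis unfolding complete_def using dimm_subset[OF _ assms(2,3)] assms(3) by blast
qed

lemma germ_family_exists: assumes "ocone K" obtains G where "germ_family K G"
proof -
 obtain G where G: "finite G" "!!g. g \<in> G ==> \<exists>de>0. dimm (K Int ball 0 de) g" "!!g. g \<in> G ==> tends_sing K g"
  "!!D E P q. convex D ==> dimm D E ==> P \<in> closure D ==> q \<in> D ==> q - P \<in> K ==> ends_radially E P q ==>
   \<exists>g\<in>G. matches K g D E P" by (rule finite_germs[OF assms], rule that)
 have "germ_family K G" unfolding germ_family_def by (intro conjI G(1) ballI allI impI; (rule G(2) G(3) G(4); assumption))
 thus ?thesis by (rule that)
qed

lemma germ_family_subset: assumes "germ_family K G" "open K'" "K' \<subseteq> K" shows "germ_family K' G"
proof -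
 have 1: "\<exists>de>0. dimm (K' Int ball 0 de) g" if "g \<in> G" for g proof -
  obtain de where "de > 0" "dimm (K Int ball 0 de) g" using assms(1) \<open>g \<in> G\<close> unfolding germ_family_def by blast
  hence "dimm (K' Int ball 0 de) g" by - (rule dimm_subset[OF _ open_Int[OF assms(2) open_ball]], use assms(3) in auto)
  thus ?thesis using \<open>de > 0\<close> by blast
 qed
 have 2: "tends_sing K' g" if "tends_sing K g" for g using that assms(3) unfolding tends_sing_def by (meson subsetD)
 have 3: "matches K' g D E P" if "matches K g D E P" for g D E P using that assms(3) unfolding matches_def by (meson subsetD)
 show ?thesis unfolding germ_family_def proof (intro conjI ballI allI impI)
  show "finite G" using assms(1) unfolding germ_family_def by simp
  show "\<exists>de>0. dimm (K' Int ball 0 de) g" if "g \<in> G" for g by (rule 1[OF that])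
  show "tends_sing K' g" if "g \<in> G" for g by (rule 2) (use assms(1) that in \<open>simp add: germ_family_def\<close>)
  fix D E P q assume h: "convex D" "dimm D E" "P \<in> closure D" "q \<in> D" "q - P \<in> K'" "ends_radially E P q"
  have qK: "q - P \<in> K" using h(5) assms(3) by blast
  have "\<exists>g\<in>G. matches K g D E P" using assms(1) unfolding germ_family_def by (elim conjE, elim allE impE) (rule h qK | assumption)+
  thus "\<exists>g\<in>G. matches K' g D E P" using 3 by blast
 qed
qed

lemma germ_familyD: "germ_family K G ==> convex D ==> dimm D E ==> P \<in> closure D ==> q \<in> D ==> q - P \<in> K ==> ends_radially E P q ==> \<exists>g\<in>G. matches K g D E P" unfolding germ_family_def by (elim conjE allE impE)

lemma decidedD: assumes "decided K G" shows "ocone K" "germ_family K G" "!!g K'. g \<in> G ==> ocone K' ==> K' \<subseteq> K ==> complete g K' ==> complete g K" using assms unfolding decided_def by blast+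

lemma decided_exists: assumes "ocone K0" obtains K G where "K \<subseteq> K0" "decided K G"
proof -
 obtain G where G: "germ_family K0 G" using germ_family_exists[OF assms] .
 let ?m = "%K. card {g\<in>G. \<not> complete g K}"
 obtain K where K: "ocone K & K \<subseteq> K0" "!!K'. ocone K' & K' \<subseteq> K0 ==> ?m K <= ?m K'" using ex_has_least_nat[of "%K. ocone K & K \<subseteq> K0" K0 ?m] assms by blast
 have "complete g K" if h: "g \<in> G" "ocone K'" "K' \<subseteq> K" "complete g K'" for g K' proof (rule ccontr)
  assume n: "\<not> complete g K"
  have "?m K' < ?m K" using G unfolding germ_family_def using complete_subset[OF _ oconeD(1)[OF h(2)] h(3)] h n by (intro psubset_card_mono) auto
  thus False using K(2)[of K'] h K(1) by auto
 qed
 moreover have "germ_family K G" using germ_family_subset[OF G] K(1) oconeD(1) by blast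
 ultimately have "decided K G" using K(1) unfolding decided_def by blast
 thus ?thesis using that K(1) by blast
qed

text \<open>Rescaling the complete germ by \<open>mu\<close> gives an immersion of the cone at
  \<open>P\<close> that equals \<open>E\<close> close to \<open>P\<close>. The common domain of the
  two is convex, so the equality spreads.\<close>

lemma matches_extends:
 assumes K: "ocone K" and D: "convex D" "dimm D E" "P \<in> closure D" "q \<in> D" "q - P \<in> K" and g: "matches K g D E P" "complete g K"
 obtains F where "dimm {z. z - P \<in> K} F" "!!z. z \<in> D ==> z - P \<in> K ==> F z = E z"
proof -
 obtain mu de where m: "mu > 0" "de > 0" "!!w. w \<in> K ==> norm w < de ==> P + w \<in> D ==> E (P + w) = g (cr mu * w)" using g(1) unfolding matches_def by blast
 obtain F0 de0 where F0: "dimm K F0" "de0 > 0" "!!w. w \<in> K ==> norm w < de0 ==> F0 w = g w" using g(2) unfolding complete_def by blast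
 let ?F = "%z. F0 (cr mu * z + (- cr mu * P))"
 have aff: "cr mu * z + (- cr mu * P) = cr mu * (z - P)" for z by (simp add: algebra_simps)
 have inK: "cr mu * x \<in> K \<longleftrightarrow> x \<in> K" for x proof
  assume "cr mu * x \<in> K"
  hence "cr (1/mu) * (cr mu * x) \<in> K" by (rule oconeD(5)[OF K]) (use m(1) in simp)
  moreover have "cr (1/mu) * (cr mu * x) = x" using m(1) by simp
  ultimately show "x \<in> K" by (simp only:)
 qed (use oconeD(5)[OF K] m(1) in simp)
 have dF: "dimm {z. z - P \<in> K} ?F" using dimm_affine[OF F0(1) m(1), of "- cr mu * P"] unfolding aff inK .
 have oK: "open {z. z - P \<in> K}" "convex {z. z - P \<in> K}" using dimm_open[OF dF] convex_translate_preimage[OF oconeD(2)[OF K]] by auto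
 let ?d = "min de (de0 / mu)"
 let ?V = "D Int {z. z - P \<in> K} Int ball P ?d"
 have dp: "?d > 0" using m F0 by simp
 obtain t where t: "0 < t" "t <= 1" "!!s. 0 < s ==> s <= t ==> cr s * (q - P) \<in> K & norm (cr s * (q - P)) < ?d" using ocone_small[OF K dp D(5)] by blast
 have Vne: "?V ~= {}" using convex_shrink_mem0[OF D(1) dimm_open[OF D(2)] D(3,4) t(1,2)] t(3)[of t] t(1) by (auto simp: dist_norm)
 have Vo: "open ?V" using oK dimm_open[OF D(2)] by blast
 have "?F z = E z" if "z \<in> D" "z - P \<in> K" for z proof (rule convex_agree[OF oK(2) dF D(1,2) Vo Vne])
  fix w assume w: "w \<in> ?V"
  hence "norm (w - P) < de" and n: "norm (w - P) < de0 / mu" by (auto simp: dist_norm norm_minus_commute)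
  hence "E (P + (w - P)) = g (cr mu * (w - P))" using w by (intro m(3)) auto
  moreover have "F0 (cr mu * (w - P)) = g (cr mu * (w - P))" proof (rule F0(3))
   show "cr mu * (w - P) \<in> K" using w inK by blast
   show "norm (cr mu * (w - P)) < de0" using n m(1) by (simp add: norm_mult pos_less_divide_eq mult.commute)
  qed
  ultimately show "?F w = E w" unfolding aff by simp
 qed (use that in auto)
 thus ?thesis using that dF by blast
qed

text \<open>The counterpart of \<open>matches_extends\<close>: where a whole cone at
  \<open>P\<close> is immersed, undoing the scale \<open>mu\<close> turns it into an extension of
  the germ.\<close>

lemma matches_complete:
 assumes "matches K g D E P" "ocone K'" "K' \<subseteq> K" "dimm D E" "!!w. w \<in> K' ==> P + w \<in> D"
 shows "complete g K'"
proof -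
 obtain mu de where m: "mu > 0" "de > 0" "!!w. w \<in> K ==> norm w < de ==> P + w \<in> D ==> E (P + w) = g (cr mu * w)" using assms(1) unfolding matches_def by blast
 have dF: "dimm K' (%w. E (cr (1/mu) * w + P))" proof (rule dimm_subset[OF dimm_affine[OF assms(4)]])
  show "open K'" using oconeD(1)[OF assms(2)] .
  show "K' \<subseteq> {z. cr (1/mu) * z + P \<in> D}" proof
   fix w assume "w \<in> K'"
   hence "cr (1/mu) * w \<in> K'" using oconeD(5)[OF assms(2), of w "1/mu"] m(1) by simp
   from assms(5)[OF this] show "w \<in> {z. cr (1/mu) * z + P \<in> D}" by (simp add: add.commute)
  qed
 qed (use m(1) in simp)
 have "E (cr (1/mu) * w + P) = g w" if w: "w \<in> K'" "norm w < de * mu" for w proof -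
  have k: "cr (1/mu) * w \<in> K'" by (rule oconeD(5)[OF assms(2) w(1)]) (use m(1) in simp)
  have "norm (cr (1/mu) * w) < de" using w(2) m(1) by (simp add: norm_mult norm_divide field_simps)
  hence "E (P + cr (1/mu) * w) = g (cr mu * (cr (1/mu) * w))" using k assms(3,5) by (intro m(3)) auto
  thus ?thesis using m(1) by (simp add: add.commute)
 qed
 thus ?thesis unfolding complete_def using dF m(1,2) by (intro exI conjI exI[of _ "de * mu"]) auto
qed

text \<open>Invariance replaces the unbounded cone by a bounded piece, over which a compact front is
  swept sideways from \<open>d\<close> towards \<open>w\<close>. An obstacle \<open>P\<close> cannot
  be singular: its germ would be complete on \<open>K\<close> and give an immersion around
  \<open>l * P\<close>, which the invariance carries back to \<open>P\<close>. It cannot come from a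
  homothety either: that homothety would fix 0, whereas its fixed point is closer to
  \<open>P\<close> than \<open>norm P\<close>.\<close>

lemma cone_extension:
 assumes dec: "decided K G" and K': "ocone K'" "K' \<subseteq> K" and E: "dimm K' E" and l: "l > 1"
  and inv: "!!z. z \<in> K' ==> E (cr l * z) = E z"
 obtains F where "dimm K F" "!!z. z \<in> K' ==> F z = E z" "!!z. z \<in> K ==> F (cr l * z) = F z"
proof -
 have K: "ocone K" using decidedD(1)[OF dec] .
 obtain d where d: "d \<in> K'" using oconeD(3)[OF K'(1)] by blast
 have dK: "d \<in> K" using d K' by blast
 have loc: "\<exists>S F. w \<in> S & convex S & dimm S F & d \<in> S & (\<exists>e>0. \<forall>z\<in>ball d e. F z = E z)" if w: "w \<in> K" for w proof (cases "Im (cnj d * w) = 0")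
  \<comment> \<open>A real multiple of \<open>d\<close> in \<open>K\<close> is a positive one,
    because 0 is not in \<open>K\<close>; so \<open>w\<close> is already in
    \<open>K'\<close>.\<close>
  case True
  have d0: "d ~= 0" using dK oconeD(4)[OF K] by auto
  have "cnj d * w = cr (Re (cnj d * w))" using True by (simp add: complex_eq_iff)
  hence "d * cnj d * w = cr (Re (cnj d * w)) * d" by (simp only: mult_ac)
  hence e1: "cr ((norm d)\<^sup>2) * w = cr (Re (cnj d * w)) * d" by (simp only: complex_norm_square)
  define r where "r = Re (cnj d * w) / (norm d)\<^sup>2"
  have wr: "w = cr r * d" proof -
   have "cr ((norm d)\<^sup>2) * w = cr ((norm d)\<^sup>2) * (cr r * d)" unfolding e1 using d0 by (simp add: r_def)
   thus ?thesis using d0 by (simp del: of_real_power)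
  qed
  have "r > 0" proof (rule ccontr)
   assume nr: "\<not> r > 0"
   have "w + cr (- r) * d = 0" unfolding wr by simp
   moreover have "w + cr (- r) * d \<in> K" using w ocone_add[OF K w oconeD(5)[OF K dK, of "-r"]] nr by (cases "r = 0") auto
   ultimately show False using oconeD(4)[OF K] by simp
  qed
  thus ?thesis unfolding wr using oconeD(5)[OF K'(1) d] using E d oconeD(2)[OF K'(1)] by (intro exI[of _ K'] exI[of _ E]) (auto intro: exI[of _ 1])
 next case False
  obtain e1 where e1: "e1 > 0" "ball w e1 \<subseteq> K" using w oconeD(1)[OF K] open_contains_ball by blast
  define xi where "xi = e1 / (2 * (norm (w - d) + 1))"
  have xi: "xi > 0" using e1 by (simp add: xi_def add_nonneg_pos)
  \<comment> \<open>Slightly beyond \<open>w\<close>, so that \<open>w\<close> is an interior point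
    of the swept cone.\<close>
  define w1 where "w1 = w + cr xi * (w - d)"
  have w1K: "w1 \<in> K" proof -
   have "xi * norm (w - d) <= xi * (norm (w - d) + 1)" using xi by simp
   also have "... = e1 / 2" unfolding xi_def by (simp add: field_simps add_nonneg_eq_0_iff)
   finally show ?thesis using xi e1(1) using e1(2) unfolding w1_def by (auto simp: norm_mult dist_norm)
  qed
  define v where "v = w1 - d"
  have vw: "v = cr (1 + xi) * (w - d)" unfolding v_def w1_def by (simp add: algebra_simps)
  have ind: "Im (cnj v * d) ~= 0" proof -
   have "Im (cnj v * d) = (1 + xi) * Im (cnj (w - d) * d)" unfolding vw by (simp add: algebra_simps)
   also have "Im (cnj (w - d) * d) = - Im (cnj d * w)" by (simp add: algebra_simps)
   finally show ?thesis using False xi by simp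
  qed
  define A where "A = crd d v"
  define B where "B = crd v d"
  have AB: "cr (A z) * d + cr (B z) * v = z" for z unfolding A_def B_def by (rule crd_eq[OF ind])
  have ABo: "A (cr a * d + cr b * v) = a" "B (cr a * d + cr b * v) = b" for a b unfolding A_def B_def by (rule crd_of[OF ind])+
  have lin: "linear A" "linear B" unfolding A_def B_def by (rule crd_linear)+
  have As: "A (cr t * z) = t * A z" "B (cr t * z) = t * B z" "A (x + y) = A x + A y" "B (x + y) = B x + B y" for t z x y using linear_scale[OF lin(1), of t z] linear_scale[OF lin(2), of t z] linear_add[OF lin(1)] linear_add[OF lin(2)] by (auto simp: scaleR_conv_of_real)
  obtain e2 where e2: "e2 > 0" "ball d e2 \<subseteq> K'" using d oconeD(1)[OF K'(1)] open_contains_ball by blast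
  \<comment> \<open>The slope of a cone around \<open>d\<close> inside \<open>K'\<close>, from which
    the sweep starts.\<close>
  define be where "be = min (1/2) (e2 / (2 * (norm v + 1)))"
  have nv: "norm v + 1 > 0" by (simp add: add_nonneg_pos)
  have "be <= 1/2" unfolding be_def by (rule min.cobounded1)
  moreover have "be > 0" using e2 nv by (simp add: be_def)
  ultimately have be: "be > 0" "be <= 1/2" "be < 1" by simp_all
  have bev: "be * norm v < e2" proof -
   have "be * (norm v + 1) <= e2 / (2 * (norm v + 1)) * (norm v + 1)" using nv by (intro mult_right_mono) (auto simp: be_def)
   also have "... = e2 / 2" using nv by (simp add: field_simps)
   finally show ?thesis using be e2(1) by (simp add: algebra_simps)
  qed
  have inK': "z \<in> K'" if "A z > 0" "\<bar>B z\<bar> <= be * A z" for z proof -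
   have "\<bar>B z / A z\<bar> <= be" using that by (simp add: field_simps abs_if split: if_splits)
   hence "\<bar>B z / A z\<bar> * norm v <= be * norm v" by (intro mult_right_mono) auto
   hence "norm (cr (B z / A z) * v) < e2" using bev by (simp only: norm_mult norm_of_real)
   hence "d + cr (B z / A z) * v \<in> K'" using e2(2) by (auto simp: dist_norm)
   hence "cr (A z) * (d + cr (B z / A z) * v) \<in> K'" using oconeD(5)[OF K'(1) _ that(1)] by blast
   moreover have "cr (A z) * (d + cr (B z / A z) * v) = z" using AB[of z] that(1) by (simp add: distrib_left)
   ultimately show ?thesis by simp
  qed
  define C where "C ta = {z. 0 < A z & - be * A z < B z & B z < ta * A z}" for ta
  \<comment> \<open>One period of the homothety is \<open>1 < A z < l\<close>. Going up to the
    square of \<open>l\<close> makes \<open>R ta\<close> overlap its own image in an open set, which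
    is needed to see that the swept immersion is invariant.\<close>
  define R where "R ta = {z. 1 < A z & A z < l\<^sup>2 & - be * A z < B z & B z < ta * A z}" for ta
  have l2: "1 < l\<^sup>2" "l < l\<^sup>2" using l less_1_mult[of l l] by (simp_all add: power2_eq_square)
  have Copen: "open (C ta) & convex (C ta)" and Ropen: "open (R ta) & convex (R ta)" for ta proof -
   have l1: "linear (%z. - A z)" "linear (%z. - be * A z - B z)" "linear (%z. B z - ta * A z)" by (rule linearI; simp add: linear_add[OF lin(1)] linear_add[OF lin(2)] linear_scale[OF lin(1)] linear_scale[OF lin(2)] algebra_simps)+
   have C: "C ta = {z. - A z < 0} Int {z. - be * A z - B z < 0} Int {z. B z - ta * A z < 0}" unfolding C_def by auto
   have R: "R ta = {z. - A z < - 1} Int {z. A z < l\<^sup>2} Int {z. - be * A z - B z < 0} Int {z. B z - ta * A z < 0}" unfolding R_def by auto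
   show "open (C ta) & convex (C ta)" unfolding C using halfplane[OF l1(1)] halfplane[OF l1(2)] halfplane[OF l1(3)] by (intro conjI open_Int convex_Int)
   show "open (R ta) & convex (R ta)" unfolding R using halfplane[OF l1(1)] halfplane[OF l1(2)] halfplane[OF l1(3)] halfplane[OF lin(1)] by (intro conjI open_Int convex_Int)
  qed
  have dC: "A d = 1" "B d = 0" using ABo[of 1 0] by simp_all
  have Cocone: "ocone (C ta)" if "ta > 0" for ta proof -
   have "d \<in> C ta" unfolding C_def using dC that be by simp
   moreover have "cr t * z \<in> C ta" if "z \<in> C ta" "t > 0" for t z proof -
    have "t * (- be * A z) < t * B z" "t * B z < t * (ta * A z)" "0 < t * A z" by (intro mult_strict_left_mono mult_pos_pos; use that in \<open>simp add: C_def\<close>)+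
    thus ?thesis unfolding C_def mem_Collect_eq As by (simp add: mult_ac)
   qed
   ultimately show ?thesis using As(1)[of 0 0] unfolding ocone_def using Copen[of ta] by (auto simp: C_def)
  qed
  have CK: "C ta \<subseteq> K" if "ta <= 1" for ta proof
   fix z assume z: "z \<in> C ta"
   hence a: "0 < A z" "- be * A z < B z" "B z < ta * A z" unfolding C_def by auto
   have "ta * A z <= 1 * A z" using a(1) by (intro mult_right_mono[OF that]) simp
   hence a4: "B z < A z" using a(3) by linarith
   show "z \<in> K" proof (cases "B z > 0")
    case True
    have "cr (A z - B z) * d + cr (B z) * w1 \<in> K" by (rule ocone_add[OF K oconeD(5)[OF K dK] oconeD(5)[OF K w1K]]) (use a4 True in auto)
    moreover have "cr (A z - B z) * d + cr (B z) * w1 = z" using AB[of z] by (simp add: v_def algebra_simps)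
    ultimately show ?thesis by simp
   next case False
    hence "z \<in> K'" using a by (intro inK') auto
    thus ?thesis using K'(2) by blast
   qed
  qed
  have RC: "R ta \<subseteq> C ta" for ta using l unfolding R_def C_def by auto
  have RK': "R be \<subseteq> K'" using inK' l unfolding R_def by force
  have CK': "C be \<subseteq> K'" using inK' unfolding C_def by force
  have Cmono: "C si \<subseteq> C ta" and Rmono: "R si \<subseteq> R ta" if "si <= ta" for si ta proof -
   have m: "b < ta * a" if "0 < a" "b < si * a" for a b :: real using mult_right_mono[OF \<open>si <= ta\<close>, of a] that by linarith
   show "C si \<subseteq> C ta" unfolding C_def using m by blast
   show "R si \<subseteq> R ta" unfolding R_def using m order.strict_trans[OF zero_less_one] by blast
  qed
  define x0 where "x0 = (1 + l\<^sup>2) / 2"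
  have x0: "1 < x0" "x0 < l\<^sup>2" using l2 by (auto simp: x0_def)
  have x0R: "cr x0 * d \<in> R ta" if "ta > 0" for ta unfolding R_def mem_Collect_eq As dC using x0 be that by auto
  let ?C = "%ta. (%x. cr x * (d + cr ta * v)) ` {1..l\<^sup>2}"
  have Cv: "A (cr x * (d + cr ta * v)) = x" "B (cr x * (d + cr ta * v)) = ta * x" for x ta using ABo[of x "x * ta"] by (simp_all add: algebra_simps)
  \<comment> \<open>The invariance is known on the initial part and spreads over \<open>R ta\<close>
    by the identity principle; the powers of the homothety then carry the immersion to
    \<open>C ta\<close>.\<close>
  have glue: "\<exists>F. dimm (C ta) F & (\<forall>z\<in>R ta. F z = E' z) & (\<forall>z\<in>C be. F z = E z) & (\<forall>z\<in>C ta. F (cr l * z) = F z)"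
   if t: "be <= ta" and E': "dimm (R ta) E'" "!!z. z \<in> R be ==> E' z = E z" for ta E' proof -
   have cR: "convex (R ta)" using Ropen by blast
   have E'inv: "E' (cr l * z + 0) = E' z" if z: "z \<in> R ta" "cr l * z + 0 \<in> R ta" for z proof (rule dimm_affine_unique[OF cR E'(1) cR E'(1), of l "R be Int {z. cr l * z + 0 \<in> R be}"])
    show "open (R be Int {z. cr l * z + 0 \<in> R be})" using open_affine_preimage[of "R be" l 0] Ropen by blast
    have "cr ((1 + l) / 2) * d \<in> R be Int {z. cr l * z + 0 \<in> R be}" proof -
     have "1 < (1 + l)/2" "(1 + l)/2 < l" using l by auto
     moreover have "l * ((1 + l) / 2) < l\<^sup>2" using l by (simp add: power2_eq_square)
     moreover have "1 < l * ((1 + l)/2)" using l by (intro less_1_mult) auto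
     ultimately show ?thesis using be l2 unfolding R_def Int_iff mem_Collect_eq add_0_right As dC by auto
    qed
    thus "R be Int {z. cr l * z + 0 \<in> R be} ~= {}" by blast
    fix w assume w: "w \<in> R be Int {z. cr l * z + 0 \<in> R be}"
    thus "w \<in> R ta & cr l * w + 0 \<in> R ta & E' (cr l * w + 0) = E' w" using E'(2) RK' w inv Rmono[OF t] by auto
   qed (use l z in auto)
   have E'inv0: "E' (0 + cr l * (z - 0)) = E' z" if "z \<in> R ta" "0 + cr l * (z - 0) \<in> R ta" for z using E'inv[of z] that by simp
   have l0: "0 < l" using l by simp
   obtain F where F: "dimm (\<Union>n::int. {z. 0 + cr (l powi n) * (z - 0) \<in> R ta}) F"
    "!!n z. 0 + cr (l powi n) * (z - 0) \<in> R ta ==> F z = E' (0 + cr (l powi n) * (z - 0))" using glue_homothety[OF cR E'(1) l0 E'inv0] by blast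
   have F2: "F z = E' (cr (l powi n) * z)" if "cr (l powi n) * z \<in> R ta" for n z using F(2)[of n z] that by (simp only: diff_0_right add_0)
   have win: "\<exists>n. cr (l powi n) * z \<in> R ta" if z: "z \<in> C ta" for z proof -
    have a: "A z > 0" using z unfolding C_def by simp
    obtain n where n: "1 < l powi n * A z" "l powi n * A z <= l" using powi_window[OF l a] .
    show ?thesis using oconeD(5)[OF Cocone z, of "l powi n"] t be l using n l2 unfolding R_def C_def mem_Collect_eq As by auto
   qed
   have dF: "dimm (C ta) F" proof (rule dimm_subset[OF F(1)])
    show "open (C ta)" using Copen by blast
    show "C ta \<subseteq> (\<Union>n::int. {z. 0 + cr (l powi n) * (z - 0) \<in> R ta})" using win by (auto simp only: diff_0_right add_0 UN_iff mem_Collect_eq UNIV_I subset_iff)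
   qed
   have FR: "F z = E' z" if "z \<in> R ta" for z using F2[of 0 z] that by simp
   have "F (cr l * z) = F z" if z: "z \<in> C ta" for z proof -
    obtain n where n: "cr (l powi n) * (cr l * z) \<in> R ta" using win[of "cr l * z"] oconeD(5)[OF Cocone z l0] t be by auto
    have e: "cr (l powi n) * (cr l * z) = cr (l powi (n + 1)) * z" using l by (simp add: power_int_add mult_ac)
    show ?thesis using F2[OF n] F2[of "n+1" z] n unfolding e by simp
   qed
   moreover have "F z = E z" if z: "z \<in> C be" for z proof (rule convex_agree[of "C ta" F "K'" E "R be"])
    show "R be ~= {}" using x0R be by blast
    show "F w = E w" if "w \<in> R be" for w using FR[of w] E'(2)[of w] Rmono[OF t] that by auto
    show "R be \<subseteq> C ta" using RC Cmono[OF t] by blast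
   qed (use z dF E Copen Ropen oconeD(2)[OF K'(1)] RK' CK' Cmono[OF t] in auto)
   ultimately show ?thesis using dF FR by blast
  qed
  have E0: "dimm (R be) E" by (rule dimm_subset[OF E _ RK']) (use Ropen in blast)
  show ?thesis proof (rule sweep[of be 1 R ?C E])
   show "be < 1" by fact
   show "open (R ta) & convex (R ta)" for ta by (rule Ropen)
   show "R be ~= {}" using x0R be by blast
   show "R si \<subseteq> R ta" if "si <= ta" for si ta by (rule Rmono[OF that])
   show "\<exists>si. be <= si & si < ta & z \<in> R si" if "be < ta" "z \<in> R ta" for ta z proof -
    have a: "A z > 0" "B z / A z < ta" using that(2) l unfolding R_def by (auto simp: field_simps)
    define si where "si = max be ((B z / A z + ta) / 2)"
    have gen: "u < (u + ta) / 2 & (u + ta) / 2 < ta" if "u < ta" for u using that by auto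
    have "B z / A z < si" "si < ta" "be <= si" unfolding si_def using gen[OF a(2)] that(1) by (auto simp del: add_divide_distrib intro: less_le_trans[OF _ max.cobounded2])
    thus ?thesis using that(2) a(1) unfolding R_def by (intro exI[of _ si]) (auto simp: field_simps)
   qed
   show "compact (?C ta) & ?C ta \<subseteq> closure (R ta)" if "be <= ta" for ta proof
    show "compact (?C ta)" by (intro compact_continuous_image continuous_intros) simp
    show "?C ta \<subseteq> closure (R ta)" proof
     fix P assume "P \<in> ?C ta"
     then obtain x where x: "1 <= x" "x <= l\<^sup>2" "P = cr x * (d + cr ta * v)" by auto
     show "P \<in> closure (R ta)" proof (rule ray_closure[of P "cr x0 * d"])
      fix t :: real assume t: "0 < t" "t <= 1"
      have eq: "P + cr t * (cr x0 * d - P) = cr ((1 - t) * x + t * x0) * d + cr ((1 - t) * (ta * x)) * v" unfolding x(3) by (simp add: algebra_simps)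
      have "(1 - t) * 1 + t * 1 < (1 - t) * x + t * x0" using t x x0 by (intro add_le_less_mono mult_left_mono mult_strict_left_mono) auto
      moreover have "(1 - t) * x + t * x0 < (1 - t) * l\<^sup>2 + t * l\<^sup>2" using t x x0 by (intro add_le_less_mono mult_left_mono mult_strict_left_mono) auto
      moreover have "(1 - t) * (ta * x) < ta * ((1 - t) * x + t * x0)" using t that be x0 by (simp add: algebra_simps)
      moreover have "(1 - t) * (ta * x) >= 0" using t that be x by simp
      ultimately show "P + cr t * (cr x0 * d - P) \<in> R ta" unfolding eq R_def mem_Collect_eq ABo using be mult_pos_pos[of be "(1 - t) * x + t * x0"] by (simp add: algebra_simps)
     qed
    qed
   qed
   show "\<exists>ta'>ta. ta' <= 1 & R ta' \<subseteq> R ta Un (\<Union>x\<in>?C ta. ball x e)" if "ta < 1" "0 < e" for ta e proof -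
    define ta' where "ta' = min 1 (ta + e / (2 * l\<^sup>2 * (norm v + 1)))"
    have p: "2 * l\<^sup>2 * (norm v + 1) > 0" using l2 nv by (intro mult_pos_pos) auto
    have t': "ta < ta'" "ta' <= 1" "ta' - ta <= e / (2 * l\<^sup>2 * (norm v + 1))" using that p by (auto simp: ta'_def)
    have "R ta' \<subseteq> R ta Un (\<Union>x\<in>?C ta. ball x e)" proof
     fix z assume z: "z \<in> R ta'"
     show "z \<in> R ta Un (\<Union>x\<in>?C ta. ball x e)" proof (cases "B z < ta * A z")
      case True
      thus ?thesis using z unfolding R_def by auto
     next case nb: False
      have a: "1 < A z" "A z < l\<^sup>2" "B z < ta' * A z" using z unfolding R_def by auto
      let ?x = "cr (A z) * (d + cr ta * v)"
      have "z - ?x = cr (B z - ta * A z) * v" using AB[of z] by (simp add: algebra_simps)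
      hence "dist ?x z = (B z - ta * A z) * norm v" using nb by (simp add: dist_norm norm_minus_commute norm_mult del: of_real_diff)
      also have "... <= ((ta' - ta) * l\<^sup>2) * (norm v + 1)" proof (rule mult_mono)
       have "B z - ta * A z <= (ta' - ta) * A z" using a by (simp add: algebra_simps)
       also have "... <= (ta' - ta) * l\<^sup>2" using a t' by (intro mult_left_mono) auto
       finally show "B z - ta * A z <= (ta' - ta) * l\<^sup>2" .
      qed (use t' in auto)
      also have "... <= (e / (2 * l\<^sup>2 * (norm v + 1)) * l\<^sup>2) * (norm v + 1)" using t' nv by (intro mult_right_mono) auto
      also have "... = e / 2" using p by (simp add: field_simps)
      finally have "dist ?x z < e" using that by simp
      moreover have "?x \<in> ?C ta" using a by (intro imageI) auto
      ultimately show ?thesis by auto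
     qed
    qed
    thus ?thesis using t' by blast
   qed
   show "dimm (R be) E" by (rule E0)
  next
   fix E' assume E': "dimm (R 1) E'" "!!w. w \<in> R be ==> E' w = E w"
   have b1: "be <= 1" using be by simp
   obtain F where F: "dimm (C 1) F" "\<forall>z\<in>C be. F z = E z" using glue[OF b1 E'] by blast
   have "open (C be)" "d \<in> C be" using Copen dC be unfolding C_def by auto
   then obtain e where e: "e > 0" "ball d e \<subseteq> C be" using open_contains_ball by blast
   have ww: "w = cr 1 * d + cr (1 / (1 + xi)) * v" unfolding vw using xi by (simp add: field_simps add_nonneg_eq_0_iff del: of_real_add)
   have "A w = 1" "B w = 1 / (1 + xi)" using ABo[of 1 "1 / (1 + xi)"] unfolding ww[symmetric] by auto
   moreover have "1 / (1 + xi) > 0" "1 / (1 + xi) < 1" using xi by auto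
   moreover have "- be < 1 / (1 + xi)" using be calculation(3) by linarith
   ultimately have "w \<in> C 1" unfolding C_def by simp
   moreover have "d \<in> C 1" unfolding C_def using dC be by simp
   ultimately show ?thesis using F e Copen[of 1] by (intro exI[of _ "C 1"] exI[of _ F]) blast
  next
   fix ta E' P assume t: "be <= ta" "ta < 1" and E': "dimm (R ta) E'" "!!w. w \<in> R be ==> E' w = E w"
    and P: "P \<in> ?C ta" "\<not> extendable (R ta) E' P"
   obtain F where F: "dimm (C ta) F" "!!z. z \<in> R ta ==> F z = E' z" "!!z. z \<in> C ta ==> F (cr l * z) = F z" using glue[OF t(1) E'] by blast
   obtain x where x: "1 <= x" "x <= l\<^sup>2" "P = cr x * (d + cr ta * v)" using P(1) by auto
   have PAB: "A P = x" "B P = ta * x" unfolding x(3) by (rule Cv)+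
   have tp: "ta > 0" using t be by simp
   have nF: "\<not> extendable (C ta) F P" proof
    assume "extendable (C ta) F P"
    hence "extendable (R ta) E' P" by (rule extendable_mono) (use RC F(2) in auto)
    thus False using P(2) by blast
   qed
   \<comment> \<open>The translated cone \<open>P + C ta\<close> stays in \<open>C ta\<close>, so a
     singular germ at \<open>P\<close> is complete on the subcone \<open>C ta\<close>.\<close>
   have PCw: "P + w \<in> C ta" if "w \<in> C ta" for w proof -
    have "0 <= be * x" "0 <= ta * x" using x(1) be tp by simp_all
    thus ?thesis using that x(1) unfolding C_def mem_Collect_eq As PAB by (auto simp: algebra_simps)
   qed
   have dCt: "d \<in> C ta" unfolding C_def using dC tp be by simp
   have qd: "P + d \<in> C ta" using PCw dCt by blast
   have Pcl: "P \<in> closure (C ta)" by (rule ray_closure[of P "P + d"]) (use PCw[OF oconeD(5)[OF Cocone[OF tp] dCt]] in simp)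
   have PK: "P \<in> K" proof -
    have "cr x * (cr (1 - ta) * d + cr ta * w1) \<in> K" by (rule oconeD(5)[OF K ocone_add[OF K oconeD(5)[OF K dK] oconeD(5)[OF K w1K]]]) (use x t tp in auto)
    thus ?thesis unfolding x(3) v_def by (simp add: algebra_simps)
   qed
   have cC: "convex (C ta)" using Copen by blast
   have CtK: "C ta \<subseteq> K" using CK t by simp
   show ?thesis proof (cases "ends_radially F P (P + d)")
    case True
    then obtain g where g: "g \<in> G" "matches K g (C ta) F P" using germ_familyD[OF decidedD(2)[OF dec] cC F(1) Pcl qd] dK by auto
    have "complete g (C ta)" by (rule matches_complete[OF g(2) Cocone[OF tp] CtK F(1) PCw])
    hence "complete g K" using decidedD(3)[OF dec g(1) Cocone[OF tp] CtK] by blast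
    then obtain H where H: "dimm {z. z - P \<in> K} H" "!!z. z \<in> C ta ==> z - P \<in> K ==> H z = F z" using matches_extends[OF K cC F(1) Pcl qd _ g(2)] dK by auto
    have HF: "H z = F z" if "z \<in> C ta" "z - P \<in> K" for z using H(2) that .
    \<comment> \<open>Near \<open>P\<close> the value \<open>F z = F (l * z)\<close> is read off
      from \<open>H\<close>, since \<open>l * P\<close> is an interior point of
      \<open>P + K\<close>.\<close>
    have "extendable (C ta) F P" proof (rule extendableI[of "{z. cr l * z + 0 \<in> {z. z - P \<in> K}}" "%z. H (cr l * z + 0)"])
     show "dimm {z. cr l * z + 0 \<in> {z. z - P \<in> K}} (%z. H (cr l * z + 0))" by (rule dimm_affine[OF H(1)]) (use l in simp)
     show "P \<in> {z. cr l * z + 0 \<in> {z. z - P \<in> K}}" using oconeD(5)[OF K PK, of "l - 1"] l by (simp add: algebra_simps)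
     fix z assume z: "z \<in> C ta" "z \<in> {z. cr l * z + 0 \<in> {z. z - P \<in> K}}"
     have "cr l * z \<in> C ta" using oconeD(5)[OF Cocone[OF tp] z(1), of l] l by simp
     hence "H (cr l * z) = F (cr l * z)" using z by (intro HF) auto
     thus "H (cr l * z + 0) = F z" using F(3)[OF z(1)] by simp
    qed
    thus ?thesis using nF by blast
   next case nr: False
    have P0: "norm P > 0" using PK oconeD(4)[OF K] by auto
    have ne: "\<not> ends_at {-1<..<0} (%t. F (P + cr (-t) * (P + d - P))) s" if "s \<in> Sing" for s using nr that unfolding ends_radially_def by blast
    obtain m c where m: "0 < m" "m < 1" "!!w. w \<in> C ta ==> cr m * w + c \<in> C ta ==> F (cr m * w + c) = F w"
     "norm (c / cr (1 - m) - P) < norm P" using end_trichotomy[OF cC F(1) Pcl qd ne nF P0] by metis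
    have "cr m * 0 + c = 0" by (rule common_fixed_point[OF Cocone[OF tp], of 0 F l]) (use F l m in auto)
    thus ?thesis using m(4) by simp
   qed
  qed
 qed
 obtain F where F: "dimm K F" "!!S F' w. convex S ==> dimm S F' ==> d \<in> S ==> \<exists>e>0. \<forall>z\<in>ball d e. F' z = E z ==> w \<in> S ==> w \<in> K ==> F w = F' w" by (rule glue_convex[OF oconeD(1)[OF K] loc], assumption, rule that)
 have FE: "F z = E z" if "z \<in> K'" for z by (rule F(2)[of K' E z]) (use that d K' E oconeD(2)[OF K'(1)] in \<open>auto intro: exI[of _ 1]\<close>)
 have l0: "l > 0" using l by simp
 have "F (cr l * z + 0) = F z" if z: "z \<in> K" for z proof (rule dimm_affine_unique[OF oconeD(2)[OF K] F(1) oconeD(2)[OF K] F(1) l0, of K'])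
  fix w assume w: "w \<in> K'"
  have "cr l * w \<in> K'" using oconeD(5)[OF K'(1) w l0] .
  thus "w \<in> K & cr l * w + 0 \<in> K & F (cr l * w + 0) = F w" using w K'(2) FE inv by auto
 qed (use z oconeD(5)[OF K z l0] oconeD(1,3)[OF K'(1)] in auto)
 thus ?thesis using that[OF F(1) FE] by simp
qed

text \<open>If the apex is singular, its germ is complete on \<open>K'\<close>, hence on
  \<open>K\<close>. Otherwise the complete cone has a homothety with some fixed point
  \<open>z0\<close>, about which \<open>cone_extension\<close> reaches all of \<open>K\<close>. Were
  \<open>z0\<close> not 0, \<open>end_trichotomy\<close> would give a homothety whose fixed point is
  closer to 0 than \<open>z0\<close>, while \<open>common_fixed_point\<close> makes the two
  equal.\<close>

lemma pivot0:
 assumes dec: "decided K G" and K': "ocone K'" "K' \<subseteq> K" and E: "dimm K' E" and nE: "\<not> extendable K' E 0"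
 obtains F where "dimm K F" "!!z. z \<in> K' ==> F z = E z"
proof -
 have K: "ocone K" using decidedD(1)[OF dec] .
 obtain q where q: "q \<in> K'" using oconeD(3)[OF K'(1)] by blast
 have cl: "0 \<in> closure K'" using ocone_closure[OF K'(1), of 0] by simp
 have cK': "convex K'" using oconeD(2)[OF K'(1)] .
 have qK: "q - 0 \<in> K" using q K'(2) by auto
 show ?thesis proof (cases "ends_radially E 0 q")
  case True
  then obtain g where g: "g \<in> G" "matches K g K' E 0" using germ_familyD[OF decidedD(2)[OF dec] cK' E cl q qK] by auto
  have "complete g K'" by (rule matches_complete[OF g(2) K' E]) simp
  hence "complete g K" using decidedD(3)[OF dec g(1) K'] by blast
  then obtain F where F: "dimm {z. z - 0 \<in> K} F" "!!z. z \<in> K' ==> z - 0 \<in> K ==> F z = E z" using matches_extends[OF K cK' E cl q qK g(2)] by metis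
  show ?thesis by (rule that[of F]) (use F K'(2) in auto)
 next case False
  obtain l z0 FC where C: "l > 1" "dimm {z. z - z0 \<in> K'} FC" "!!z. z - z0 \<in> K' ==> FC (z0 + cr l * (z - z0)) = FC z"
   "!!z. z \<in> K' ==> z - z0 \<in> K' ==> FC z = E z" using ocone_homothety[OF K'(1) E] by metis
  have d1: "dimm K' (%w. FC (w + z0))" using dimm_shift[OF C(2), of z0] by simp
  have i1: "FC (cr l * w + z0) = FC (w + z0)" if "w \<in> K'" for w using C(3)[of "w + z0"] that by (simp add: add.commute)
  obtain F' where F': "dimm K F'" "!!z. z \<in> K' ==> F' z = FC (z + z0)" "!!z. z \<in> K ==> F' (cr l * z) = F' z" using cone_extension[OF dec K' d1 C(1) i1] by blast
  let ?FK = "%z. F' (z - z0)"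
  have dFK: "dimm {z. z - z0 \<in> K} ?FK" using dimm_shift[OF F'(1), of "- z0"] by simp
  have FKE: "?FK z = E z" if "z \<in> K'" "z - z0 \<in> K'" for z using F'(2)[of "z - z0"] C(4)[of z] that by simp
  have "z0 = 0" proof (rule ccontr)
   assume z0: "z0 ~= 0"
   have ne: "\<not> ends_at {-1<..<0} (%t. E (0 + cr (-t) * (q - 0))) s" if "s \<in> Sing" for s using False that unfolding ends_radially_def by blast
   have nz: "norm z0 > 0" using z0 by simp
   obtain m c where m: "0 < m" "m < 1" "!!w. w \<in> K' ==> cr m * w + c \<in> K' ==> E (cr m * w + c) = E w"
    "norm (c / cr (1 - m) - 0) < norm z0" using end_trichotomy[OF cK' E cl q ne nE nz] by metis
   have cK: "convex {z. z - z0 \<in> K}" using convex_translate_preimage[OF oconeD(2)[OF K]] .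
   have B: "?FK (cr m * w + c) = ?FK w" if w: "w - z0 \<in> K" "cr m * w + c - z0 \<in> K" for w proof (rule dimm_affine_unique[OF cK dFK cK dFK m(1), of "K' Int {w. w - z0 \<in> K'} Int {w. cr m * w + c \<in> K'} Int {w. cr m * w + (c - z0) \<in> K'}"])
    let ?V = "K' Int {w. w - z0 \<in> K'} Int {w. cr m * w + c \<in> K'} Int {w. cr m * w + (c - z0) \<in> K'}"
    show "open ?V" using oconeD(1)[OF K'(1)] open_translate_preimage open_affine_preimage by blast
    obtain T1 where T1: "!!t. t >= T1 ==> - z0 + cr t * q \<in> K'" using ocone_far[OF K'(1) q] by metis
    obtain T2 where T2: "!!t. t >= T2 ==> c + cr t * q \<in> K'" using ocone_far[OF K'(1) q] by metis
    obtain T3 where T3: "!!t. t >= T3 ==> (c - z0) + cr t * q \<in> K'" using ocone_far[OF K'(1) q] by metis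
    \<comment> \<open>A multiple of \<open>q\<close> far enough out for all four memberships;
      translates of an open cone always meet.\<close>
    define t where "t = max (max 1 T1) (max (T2/m) (T3/m))"
    have "t >= 1" "t >= T1" "T2 / m <= t" "T3 / m <= t" by (auto simp: t_def)
    hence "t >= 1" "t >= T1" "m * t >= T2" "m * t >= T3" using m(1) by (auto simp: pos_divide_le_eq mult.commute)
    hence "cr t * q \<in> ?V" using T1[of t] T2[of "m*t"] T3[of "m*t"] oconeD(5)[OF K'(1) q, of t] by (auto simp: algebra_simps)
    thus "?V ~= {}" by blast
    fix v assume v: "v \<in> ?V"
    have v': "v \<in> K'" "v - z0 \<in> K'" "cr m * v + c \<in> K'" "cr m * v + c - z0 \<in> K'" using v by (auto simp: algebra_simps)
    show "v \<in> {z. z - z0 \<in> K} & cr m * v + c \<in> {z. z - z0 \<in> K} & ?FK (cr m * v + c) = ?FK v" using FKE[OF v'(1,2)] FKE[OF v'(3,4)] m(3)[OF v'(1,3)] v' K'(2) by auto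
   qed (use w in auto)
   have A: "?FK (z0 + cr l * (z - z0)) = ?FK z" if "z - z0 \<in> K" for z using F'(3)[OF that] by simp
   have "cr m * z0 + c = z0" by (rule common_fixed_point[OF K dFK, of l]) (use C(1) A m B in auto)
   hence "c = cr (1 - m) * z0" by (simp add: algebra_simps)
   hence "c / cr (1 - m) = z0" using m(2) by (simp del: of_real_diff)
   thus False using m(4) by simp
  qed
  hence "F' z = E z" if "z \<in> K'" for z using FKE[of z] that by simp
  thus ?thesis using that F'(1) by blast
 qed
qed

lemma pivot:
 assumes dec: "decided K G" and K': "ocone K'" "K' \<subseteq> K" and E: "dimm {z. z - P \<in> K'} E" and nE: "\<not> extendable {z. z - P \<in> K'} E P"
 obtains F where "dimm {z. z - P \<in> K} F" "!!z. z - P \<in> K' ==> F z = E z"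
proof -
 have "\<not> extendable K' (%w. E (w + P)) 0" proof
  assume "extendable K' (%w. E (w + P)) 0"
  then obtain e H where H: "e > 0" "dimm (ball 0 e) H" "!!w. w \<in> K' ==> w \<in> ball 0 e ==> H w = E (w + P)" unfolding extendable_def by blast
  have "extendable {z. z - P \<in> K'} E P" by (rule extendableI[OF dimm_shift[OF H(2), of "-P"]]) (use H in auto)
  thus False using nE by blast
 qed
 then obtain F where F: "dimm K F" "!!z. z \<in> K' ==> F z = E (z + P)" using dimm_shift[OF E, of P] pivot0[OF dec K' ] by auto
 show ?thesis by (rule that[of "%z. F (z - P)"]) (use dimm_shift[OF F(1), of "-P"] F(2) in auto)
qed

end

text \<open>The open triangle with vertices \<open>w\<close>, \<open>v\<close> and
  \<open>u * v\<close>; at \<open>u = 0\<close> it reaches the origin.\<close>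

definition tri :: "complex => complex => real => complex set" where
 "tri v w u = {z. 0 < crd w v z & u * (1 - crd w v z) < crd v w z & crd v w z < 1 - crd w v z}"

lemma crd_pair:
 assumes "Im (cnj w * v) ~= 0"
 shows "crd v w (cr a * v + cr b * w) = a" "crd w v (cr a * v + cr b * w) = b"
  "cr (crd v w z) * v + cr (crd w v z) * w = z" using crd_of[OF assms] crd_eq[OF assms] by blast+

lemma tri_mem: assumes "Im (cnj w * v) ~= 0"
 shows "cr a * v + cr b * w \<in> tri v w u \<longleftrightarrow> 0 < b & u * (1 - b) < a & a < 1 - b" unfolding tri_def mem_Collect_eq crd_pair[OF assms] ..

lemma tri_open: "open (tri v w u)" and tri_convex: "convex (tri v w u)"
proof -
 note lin = crd_linear[of v w] crd_linear[of w v]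
 have l1: "linear (%z. - crd w v z)" "linear (%z. - u * crd w v z - crd v w z)" "linear (%z. crd v w z + crd w v z)" by (rule linearI; simp add: linear_add[OF lin(1)] linear_add[OF lin(2)] linear_scale[OF lin(1)] linear_scale[OF lin(2)] algebra_simps)+
 have C: "tri v w u = {z. - crd w v z < 0} Int {z. - u * crd w v z - crd v w z < - u} Int {z. crd v w z + crd w v z < 1}" unfolding tri_def by (auto simp: algebra_simps)
 show "open (tri v w u)" "convex (tri v w u)" unfolding C using halfplane[OF l1(1)] halfplane[OF l1(2)] halfplane[OF l1(3)] by (intro open_Int convex_Int; blast)+
qed

lemma tri_B: assumes "z \<in> tri v w u" "u < 1" shows "crd w v z < 1"
proof (rule ccontr)
 assume "\<not> ?thesis"
 thus False using assms(2) mult_right_mono_neg[of u 1 "1 - crd w v z"] using assms(1) unfolding tri_def by simp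
qed

lemma tri_mono: assumes "u' <= u" "u < 1" shows "tri v w u \<subseteq> tri v w u'"
proof
 fix z assume z: "z \<in> tri v w u"
 have "u' * (1 - crd w v z) <= u * (1 - crd w v z)" using tri_B[OF z assms(2)] assms(1) by (intro mult_right_mono) auto
 thus "z \<in> tri v w u'" using z unfolding tri_def by auto
qed

lemma tri_closure:
 assumes ind: "Im (cnj w * v) ~= 0" and u: "u < 1" and "0 <= b" "u * (1 - b) <= a" "a <= 1 - b"
 shows "cr a * v + cr b * w \<in> closure (tri v w u)"
proof (rule ray_closure[of _ "cr ((1 + u) / 3) * v + cr (1/3) * w"])
 fix t :: real assume t: "0 < t" "t <= 1"
 let ?P = "cr a * v + cr b * w"
 have e: "?P + cr t * (cr ((1 + u) / 3) * v + cr (1/3) * w - ?P) =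
  cr ((1 - t) * a + t * ((1 + u) / 3)) * v + cr ((1 - t) * b + t * (1/3)) * w" by (simp add: algebra_simps)
 have 1: "(1 - t) * b + t * (1/3) > 0" using t assms by (intro add_nonneg_pos) auto
 have "(1 - t) * (u * (1 - b)) <= (1 - t) * a" "(1 - t) * a <= (1 - t) * (1 - b)" using t assms by (intro mult_left_mono; simp)+
 moreover have "t * u < t" using t u by simp
 ultimately have "u * (1 - ((1 - t) * b + t * (1/3))) < (1 - t) * a + t * ((1 + u) / 3) & (1 - t) * a + t * ((1 + u) / 3) < 1 - ((1 - t) * b + t * (1/3))" by (simp add: algebra_simps add_divide_distrib)
 thus "?P + cr t * (cr ((1 + u) / 3) * v + cr (1/3) * w - ?P) \<in> tri v w u" unfolding e tri_mem[OF ind] using 1 by blast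
qed

lemma tri_side: assumes "Im (cnj w * v) ~= 0" "u < 1" "0 <= b" "b <= 1" shows "cr (u * (1 - b)) * v + cr b * w \<in> closure (tri v w u)" by (rule tri_closure[OF assms(1,2,3) order_refl]) (use assms mult_right_mono[of u 1 "1 - b"] in simp)

lemma tri_apex: assumes "Im (cnj w * v) ~= 0" "u < 1" shows "w \<in> closure (tri v w u)" using tri_side[OF assms, of 1] by simp

lemma meets_closure: assumes "P \<in> closure D" "open U" "P \<in> U" shows "D Int U ~= {}" using open_Int_closure_eq_empty[OF assms(2), of D] assms by blast

section \<open>Sweeping triangles: completeness moves back to the apex\<close>

context dilation_surface begin

text \<open>The moving side joins \<open>s * v\<close> to \<open>w\<close>, with \<open>s\<close>
  decreasing from \<open>u0\<close> to 0; the parameter of \<open>sweep\<close> is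
  \<open>- s\<close>. The end points of the side are covered by \<open>Ve\<close> and
  \<open>W\<close>, so an obstacle lies strictly between them.\<close>

lemma tri_sweep:
 assumes ind: "Im (cnj w * v) ~= 0" and u0: "0 < u0" "u0 < 1" and E0: "dimm (tri v w u0) E0"
  and V: "convex Ve" "dimm Ve e" "!!s. 0 < s ==> s <= u0 ==> cr s * v \<in> Ve" "!!z. z \<in> tri v w u0 ==> z \<in> Ve ==> e z = E0 z"
  and W: "convex W" "dimm W F" "w \<in> W" "!!z. z \<in> tri v w u0 ==> z \<in> W ==> F z = E0 z"
 obtains (complete) E where "dimm (tri v w 0) E" "!!z. z \<in> tri v w u0 ==> E z = E0 z"
 | (obstacle) s b E where "0 < s" "s <= u0" "0 < b" "b < 1" "dimm (tri v w s) E" "!!z. z \<in> tri v w u0 ==> E z = E0 z"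
   "\<not> extendable (tri v w s) E (cr (s * (1 - b)) * v + cr b * w)"
proof -
 let ?S = "%ta. tri v w (- ta)"
 let ?p = "%ta b. cr (- ta * (1 - b)) * v + cr b * w"
 let ?C = "%ta. ?p ta ` {0..1}"
 have oV: "open Ve" "open W" using dimm_open V(2) W(2) by blast+
 have V1: "tri v w u0 Int Ve ~= {}" using meets_closure[OF tri_side[OF ind u0(2), of 0] oV(1)] V(3)[of u0] u0 by simp
 have W1: "tri v w u0 Int W ~= {}" using meets_closure[OF tri_apex[OF ind u0(2)] oV(2) W(3)] .
 show ?thesis proof (rule sweep[of "- u0" 0 ?S ?C E0])
  show "- u0 < 0" using u0 by simp
  show "open (?S ta) & convex (?S ta)" for ta using tri_open tri_convex by blast
  show "?S (- u0) ~= {}" using V1 by auto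
  show "?S si \<subseteq> ?S ta" if "- u0 <= si" "si <= ta" for si ta by (rule tri_mono) (use that u0 in auto)
  show "\<exists>si. - u0 <= si & si < ta & z \<in> ?S si" if h: "- u0 < ta" "z \<in> ?S ta" for ta z proof -
   have B: "crd w v z < 1" by (rule tri_B[OF h(2)]) (use h(1) u0 in simp)
   have z: "0 < crd w v z" "- ta * (1 - crd w v z) < crd v w z" "crd v w z < 1 - crd w v z" using h(2) unfolding tri_def by auto
   define d where "d = crd v w z + ta * (1 - crd w v z)"
   have d: "d > 0" using z(2) by (simp add: d_def)
   define si where "si = max (- u0) (ta - d / (2 * (1 - crd w v z)))"
   have s: "- u0 <= si" "si < ta" "si >= ta - d / (2 * (1 - crd w v z))" using d B h(1) by (auto simp: si_def)
   have "(ta - si) * (1 - crd w v z) <= d / (2 * (1 - crd w v z)) * (1 - crd w v z)" using s B by (intro mult_right_mono) auto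
   also have "... = d / 2" proof -
    have "d / (2 * x) * x = d / 2" if "x > 0" for x using that by simp
    from this[of "1 - crd w v z"] show ?thesis using B by simp
   qed
   finally show ?thesis using d unfolding d_def using s z unfolding tri_def by (auto simp: algebra_simps)
  qed
  show "compact (?C ta) & ?C ta \<subseteq> closure (?S ta)" if "- u0 <= ta" for ta proof
   show "compact (?C ta)" by (intro compact_continuous_image continuous_intros) simp
   show "?C ta \<subseteq> closure (?S ta)" using tri_side[OF ind, of "- ta"] that u0 by auto
  qed
  show "\<exists>ta'>ta. ta' <= 0 & ?S ta' \<subseteq> ?S ta Un (\<Union>x\<in>?C ta. ball x r)" if h: "- u0 <= ta" "ta < 0" "0 < r" for ta r proof -
   have nv: "norm v + 1 > 0" by (simp add: add_nonneg_pos)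
   define ta' where "ta' = min 0 (ta + r / (2 * (norm v + 1)))"
   have t': "ta < ta'" "ta' <= 0" "ta' - ta <= r / (2 * (norm v + 1))" using h nv by (auto simp: ta'_def)
   have "?S ta' \<subseteq> ?S ta Un (\<Union>x\<in>?C ta. ball x r)" proof
    fix z assume z: "z \<in> ?S ta'"
    let ?a = "crd v w z" and ?b = "crd w v z"
    have b: "?b < 1" by (rule tri_B[OF z]) (use t' h u0 in simp)
    have a: "0 < ?b" "- ta' * (1 - ?b) < ?a" "?a < 1 - ?b" using z unfolding tri_def by auto
    show "z \<in> ?S ta Un (\<Union>x\<in>?C ta. ball x r)" proof (cases "- ta * (1 - ?b) < ?a")
     case True
     thus ?thesis using a unfolding tri_def by auto
    next case False
     have "?p ta ?b - z = cr (- ta * (1 - ?b) - ?a) * v" using crd_pair(3)[OF ind, of z] by (simp add: algebra_simps)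
     hence "dist (?p ta ?b) z = (- ta * (1 - ?b) - ?a) * norm v" using False unfolding dist_norm by (simp only: norm_mult norm_of_real)
     also have "... <= (ta' - ta) * (norm v + 1)" proof (rule mult_mono)
      have "- ta * (1 - ?b) - ?a <= (ta' - ta) * (1 - ?b)" using a by (simp add: algebra_simps)
      also have "... <= ta' - ta" using t' a(1) b mult_left_mono[of "1 - ?b" 1 "ta' - ta"] by simp
      finally show "- ta * (1 - ?b) - ?a <= ta' - ta" .
     qed (use t' in auto)
     also have "... <= r / (2 * (norm v + 1)) * (norm v + 1)" using t' nv by (intro mult_right_mono) auto
     also have "... = r / 2" using nv by (simp add: field_simps)
     finally have "dist (?p ta ?b) z < r" using h by simp
     moreover have "?p ta ?b \<in> ?C ta" by (rule imageI) (use a b in simp)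
     ultimately show ?thesis by (intro UnI2 UN_I) auto
    qed
   qed
   thus ?thesis using t' by blast
  qed
  show "dimm (?S (- u0)) E0" using E0 by simp
 next
  fix E assume "dimm (?S 0) E" "!!z. z \<in> ?S (- u0) ==> E z = E0 z"
  thus ?thesis by (intro complete[of E]) auto
 next
  fix ta E P assume h: "- u0 <= ta" "ta < 0" "dimm (?S ta) E" "!!z. z \<in> ?S (- u0) ==> E z = E0 z" "P \<in> ?C ta" "\<not> extendable (?S ta) E P"
  obtain b where b: "0 <= b" "b <= 1" "P = ?p ta b" using h(5) by auto
  have sub: "tri v w u0 \<subseteq> ?S ta" by (rule tri_mono) (use h u0 in auto)
  have EE: "E z = E0 z" if "z \<in> tri v w u0" for z using h(4) that by simp
  have "b ~= 0" proof
   assume b0: "b = 0"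
   have "P \<in> Ve" using V(3)[of "- ta"] h b0 b by simp
   hence "extendable (?S ta) E P" proof (rule extendableI[OF V(2)])
    fix z assume z: "z \<in> ?S ta" "z \<in> Ve"
    show "e z = E z" by (rule convex_agree[OF V(1,2) tri_convex h(3), of "tri v w u0 Int Ve"]) (use V(4) EE V1 oV tri_open sub z in auto)
   qed
   thus False using h(6) by blast
  qed
  moreover have "b ~= 1" proof
   assume b0: "b = 1"
   have "P \<in> W" using W(3) b0 b by simp
   hence "extendable (?S ta) E P" proof (rule extendableI[OF W(2)])
    fix z assume z: "z \<in> ?S ta" "z \<in> W"
    show "F z = E z" by (rule convex_agree[OF W(1,2) tri_convex h(3), of "tri v w u0 Int W"]) (use W(4) EE W1 oV tri_open sub z in auto)
   qed
   thus False using h(6) by blast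
  qed
  ultimately show ?thesis using h b EE by (intro obstacle[of "- ta" b E]) auto
 qed
qed

text \<open>By \<open>cond\<close>, \<open>W\<close> contains what lies beyond the side from
  \<open>v\<close> to \<open>w\<close>, so the triangle and \<open>W\<close> together contain a
  cone: at 0 if the sweep is complete, at the obstacle otherwise. In the second case the immersion
  does not extend over the apex, and \<open>pivot\<close> enlarges the cone to all of
  \<open>K\<close>.\<close>

lemma tri_main:
 assumes dec: "decided K G" and vw: "v \<in> K" "w \<in> K" and ind: "Im (cnj w * v) ~= 0" and u0: "0 < u0" "u0 < 1"
  and e: "dimm (K Int ball 0 ep) e" "norm v < ep" and E0: "dimm (tri v w u0) E0"
  and eE0: "!!z. z \<in> tri v w u0 ==> z \<in> K Int ball 0 ep ==> e z = E0 z"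
  and W: "convex W" "dimm W F" "w \<in> W" "!!z. z \<in> tri v w u0 ==> z \<in> W ==> F z = E0 z"
  and keep: "!!s. 0 <= s ==> s <= u0 ==> w - cr s * v \<in> K"
  and cond: "0 < de" "!!s xi y. 0 <= s ==> s <= u0 ==> -1 < xi ==> 0 < y ==> y < de * (1 + xi) ==> - (1 - s) * xi <= y ==>
    w + cr xi * (w - cr s * v) + cr y * v \<in> W"
 obtains (complete) K1 where "ocone K1" "K1 \<subseteq> K" "complete e K1"
 | (obstacle) s b E F2 where "0 < s" "s <= u0" "0 < b" "b < 1" "dimm (tri v w s) E" "!!z. z \<in> tri v w u0 ==> E z = E0 z"
   "!!z. z \<in> tri v w s ==> z \<in> K Int ball 0 ep ==> e z = E z"
   "\<not> extendable (tri v w s) E (cr (s * (1 - b)) * v + cr b * w)"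
   "dimm {z. z - (cr (s * (1 - b)) * v + cr b * w) \<in> K} F2"
   "!!z. z \<in> tri v w s ==> z - (cr (s * (1 - b)) * v + cr b * w) \<in> K ==> F2 z = E z"
proof -
 have K: "ocone K" using decidedD(1)[OF dec] .
 let ?A = "crd v w" and ?B = "crd w v"
 note AB = crd_pair[OF ind]
 have lin: "?A (x + y) = ?A x + ?A y" "?B (x + y) = ?B x + ?B y" "?A (cr t * x) = t * ?A x" "?B (cr t * x) = t * ?B x" for x y t using linear_add[OF crd_linear, of v w x y] linear_add[OF crd_linear, of w v x y] linear_scale[OF crd_linear, of v w t x] linear_scale[OF crd_linear, of w v t x] by (simp_all add: scaleR_conv_of_real)
 have lz: "?A 0 = 0" "?B 0 = 0" using lin(3)[of 0 0] lin(4)[of 0 0] by simp_all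
 have cVe: "convex (K Int ball 0 ep)" using oconeD(2)[OF K] by (intro convex_Int convex_ball)
 have sV: "cr s * v \<in> K Int ball 0 ep" if "0 < s" "s <= u0" for s proof -
  have "s * norm v <= 1 * norm v" using that u0 by (intro mult_right_mono) auto
  thus ?thesis using oconeD(5)[OF K vw(1) that(1)] that e(2) by (simp add: norm_mult)
 qed
 have oV: "open (K Int ball 0 ep)" "open W" using dimm_open e(1) W(2) by blast+
 have V1: "tri v w u0 Int (K Int ball 0 ep) ~= {}" using meets_closure[OF tri_side[OF ind u0(2), of 0] oV(1)] sV[of u0] u0 by simp
 have W1: "tri v w u0 Int W ~= {}" using meets_closure[OF tri_apex[OF ind u0(2)] oV(2) W(3)] .
 have ext: "\<exists>H. dimm (tri v w s Un W) H & (\<forall>z\<in>tri v w s. H z = E z) & (\<forall>z\<in>W. H z = F z) & (\<forall>z\<in>tri v w s. z \<in> K Int ball 0 ep --> e z = E z)"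
  if h: "s <= u0" "dimm (tri v w s) E" "!!z. z \<in> tri v w u0 ==> E z = E0 z" for s E proof -
  have sub: "tri v w u0 \<subseteq> tri v w s" by (rule tri_mono) (use h u0 in auto)
  have 1: "E z = F z" if "z \<in> tri v w s" "z \<in> W" for z by (rule convex_agree[OF tri_convex h(2) W(1,2), of "tri v w u0 Int W"]) (use W(4) h(3) W1 oV tri_open sub that in auto)
  have 2: "e z = E z" if "z \<in> tri v w s" "z \<in> K Int ball 0 ep" for z by (rule convex_agree[OF cVe e(1) tri_convex h(2), of "tri v w u0 Int (K Int ball 0 ep)"]) (use eE0 h(3) V1 oV tri_open sub that in auto)
  obtain H where "dimm (tri v w s Un W) H" "!!z. z \<in> tri v w s ==> H z = E z" "!!z. z \<in> W ==> H z = F z" using dimm_glue2[OF h(2) W(2) 1] by blast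
  thus ?thesis using 2 by blast
 qed
 show ?thesis proof (rule tri_sweep[OF ind u0 E0 cVe e(1) sV eE0 W])
  fix E assume E: "dimm (tri v w 0) E" "!!z. z \<in> tri v w u0 ==> E z = E0 z"
  have u00: "0 <= u0" using u0 by simp
  obtain H where H: "dimm (tri v w 0 Un W) H" "\<forall>z\<in>tri v w 0. H z = E z" "\<forall>z\<in>tri v w 0. z \<in> K Int ball 0 ep --> e z = E z" using ext[OF u00 E] by blast
  \<comment> \<open>A thin cone along \<open>w\<close>: on the near side of the line through
    \<open>v\<close> and \<open>w\<close> it is in the triangle, from that line on it is in
    \<open>W\<close>.\<close>
  define K1 where "K1 = {z. 0 < ?A z & ?A z < de * ?B z}"
  have Bp: "?B z > 0" if "z \<in> K1" for z proof -
   have "0 < de * ?B z" using that unfolding K1_def by auto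
   thus ?thesis using cond(1) by (simp add: zero_less_mult_iff)
  qed
  have K1K: "K1 \<subseteq> K" proof
   fix z assume z: "z \<in> K1"
   have "cr (?A z) * v + cr (?B z) * w \<in> K" by (rule ocone_add[OF K oconeD(5)[OF K vw(1)] oconeD(5)[OF K vw(2)]]) (use z Bp[OF z] in \<open>auto simp: K1_def\<close>)
   thus "z \<in> K" unfolding AB(3) .
  qed
  have K1sub: "K1 \<subseteq> tri v w 0 Un W" proof
   fix z assume z: "z \<in> K1"
   show "z \<in> tri v w 0 Un W" proof (cases "?A z < 1 - ?B z")
    case True
    thus ?thesis using z Bp[OF z] unfolding tri_def K1_def by auto
   next case False
    have "w + cr (?B z - 1) * (w - cr 0 * v) + cr (?A z) * v \<in> W" by (rule cond(2)) (use z Bp[OF z] False u0 in \<open>auto simp: K1_def\<close>)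
    moreover have "w + cr (?B z - 1) * (w - cr 0 * v) + cr (?A z) * v = z" using AB(3)[of z] by (simp add: algebra_simps)
    ultimately show ?thesis by simp
   qed
  qed
  have oK1: "ocone K1" proof -
   have l1: "linear (%z. - ?A z)" "linear (%z. ?A z - de * ?B z)" by (rule linearI; simp add: linear_add[OF crd_linear] linear_scale[OF crd_linear] algebra_simps)+
   have C: "K1 = {z. - ?A z < 0} Int {z. ?A z - de * ?B z < 0}" unfolding K1_def by auto
   have "open K1 & convex K1" unfolding C using halfplane[OF l1(1)] halfplane[OF l1(2)] by (intro conjI open_Int convex_Int; blast)
   moreover have "cr (de/2) * v + cr 1 * w \<in> K1" unfolding K1_def mem_Collect_eq AB using cond(1) by simp
   moreover have "cr t * z \<in> K1" if "z \<in> K1" "t > 0" for z t proof -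
    have "0 < t * ?A z" "t * ?A z < t * (de * ?B z)" by (intro mult_pos_pos mult_strict_left_mono; use that in \<open>simp add: K1_def\<close>)+
    thus ?thesis unfolding K1_def mem_Collect_eq lin by (simp add: mult_ac)
   qed
   ultimately show ?thesis unfolding ocone_def using lz by (auto simp: K1_def)
  qed
   have l: "linear (%z. ?A z + ?B z)" by (rule linearI; simp add: linear_add[OF crd_linear] linear_scale[OF crd_linear] algebra_simps)
   have "open {z. ?A z + ?B z < 1}" "0 \<in> {z. ?A z + ?B z < 1}" using halfplane(1)[OF l] lz by auto
   then obtain d where d: "d > 0" "ball 0 d \<subseteq> {z. ?A z + ?B z < 1}" using open_contains_ball by blast
  have "complete e K1" unfolding complete_def proof (intro exI conjI)
   show "dimm K1 H" by (rule dimm_subset[OF H(1) oconeD(1)[OF oK1] K1sub])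
   have ep: "ep > 0" using e(2) by (rule le_less_trans[OF norm_ge_zero])
   show "0 < min d ep" using d ep by simp
   show "\<forall>z\<in>K1. norm z < min d ep --> H z = e z" proof (intro ballI impI)
    fix z assume z: "z \<in> K1" "norm z < min d ep"
    have "z \<in> tri v w 0" using d z(2) using z(1) Bp[OF z(1)] unfolding tri_def K1_def by auto
    thus "H z = e z" using H z K1K by auto
   qed
  qed
  thus ?thesis using complete[OF oK1 K1K] by blast
 next
  fix s b E assume s: "0 < s" "s <= u0" "0 < b" "b < 1" and E: "dimm (tri v w s) E" "!!z. z \<in> tri v w u0 ==> E z = E0 z"
   and nE: "\<not> extendable (tri v w s) E (cr (s * (1 - b)) * v + cr b * w)"
  let ?Q = "cr (s * (1 - b)) * v + cr b * w"
  obtain H where H: "dimm (tri v w s Un W) H" "\<forall>z\<in>tri v w s. H z = E z" "\<forall>z\<in>tri v w s. z \<in> K Int ball 0 ep --> e z = E z" using ext[OF s(2) E] by blast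
  \<comment> \<open>The directions of a thin cone at the obstacle, along the moving side, which has
    direction \<open>w - s * v\<close>.\<close>
  define K2 where "K2 = {z. 0 < ?B z & 0 < ?A z + s * ?B z & ?A z + s * ?B z < de * ?B z}"
  have dec2: "z = cr (?B z) * (w - cr s * v) + cr (?A z + s * ?B z) * v" for z using AB(3)[of z] by (simp add: algebra_simps)
  have gK: "w - cr s * v \<in> K" using keep s by simp
  have K2K: "K2 \<subseteq> K" proof
   fix z assume z: "z \<in> K2"
   have "cr (?B z) * (w - cr s * v) + cr (?A z + s * ?B z) * v \<in> K" by (rule ocone_add[OF K oconeD(5)[OF K gK] oconeD(5)[OF K vw(1)]]) (use z in \<open>auto simp: K2_def\<close>)
   thus "z \<in> K" using dec2[of z] by simp
  qed
  have oK2: "ocone K2" proof -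
   have l1: "linear (%z. - ?B z)" "linear (%z. - ?A z - s * ?B z)" "linear (%z. ?A z + s * ?B z - de * ?B z)" by (rule linearI; simp add: linear_add[OF crd_linear] linear_scale[OF crd_linear] algebra_simps)+
   have C: "K2 = {z. - ?B z < 0} Int {z. - ?A z - s * ?B z < 0} Int {z. ?A z + s * ?B z - de * ?B z < 0}" unfolding K2_def by auto
   have "open K2 & convex K2" unfolding C using halfplane[OF l1(1)] halfplane[OF l1(2)] halfplane[OF l1(3)] by (intro conjI open_Int convex_Int; blast)
   moreover have "cr (de/2 - s) * v + cr 1 * w \<in> K2" unfolding K2_def mem_Collect_eq AB using cond(1) by simp
   moreover have "cr t * z \<in> K2" if "z \<in> K2" "t > 0" for z t proof -
    have "0 < t * ?B z" "0 < t * (?A z + s * ?B z)" "t * (?A z + s * ?B z) < t * (de * ?B z)" by (intro mult_pos_pos mult_strict_left_mono; use that in \<open>simp add: K2_def\<close>)+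
    thus ?thesis unfolding K2_def mem_Collect_eq lin by (simp add: algebra_simps)
   qed
   ultimately show ?thesis unfolding ocone_def using lz by (auto simp: K2_def)
  qed
  have zc: "?A z = s * (1 - b) + ?A (z - ?Q)" "?B z = b + ?B (z - ?Q)" for z proof -
   have "?A (?Q + (z - ?Q)) = ?A ?Q + ?A (z - ?Q)" "?B (?Q + (z - ?Q)) = ?B ?Q + ?B (z - ?Q)" by (rule lin)+
   thus "?A z = s * (1 - b) + ?A (z - ?Q)" "?B z = b + ?B (z - ?Q)" unfolding AB by simp_all
  qed
  have intri: "z \<in> tri v w s" if z: "z - ?Q \<in> K2" "?A z < 1 - ?B z" for z proof -
   have "s * (1 - ?B z) = s * (1 - b) - s * ?B (z - ?Q)" unfolding zc(2)[of z] by (simp add: algebra_simps)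
   also have "... < ?A z" using z(1) unfolding zc(1)[of z] K2_def by simp
   finally have "s * (1 - ?B z) < ?A z" .
   moreover have "0 < ?B z" using z(1) s(3) unfolding zc(2)[of z] K2_def by simp
   ultimately show ?thesis using z(2) unfolding tri_def by simp
  qed
  have Qsub: "{z. z - ?Q \<in> K2} \<subseteq> tri v w s Un W" proof
   fix z assume "z \<in> {z. z - ?Q \<in> K2}"
   hence z: "z - ?Q \<in> K2" by simp
   define x y where "x = ?B (z - ?Q)" and "y = ?A (z - ?Q) + s * ?B (z - ?Q)"
   have xy: "0 < x" "0 < y" "y < de * x" using z unfolding K2_def x_def y_def by auto
   show "z \<in> tri v w s Un W" proof (cases "?A z < 1 - ?B z")
    case True
    thus ?thesis using intri[OF z] by blast
   next case False
    have Bz: "?B z = b + x" and Az: "?A z = s * (1 - b) + y - s * x" using zc[of z] by (auto simp: x_def y_def)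
    have "y < de * (1 + (b + x - 1))" proof -
     have "de * x <= de * (b + x)" using cond(1) s by (intro mult_left_mono) auto
     thus ?thesis using xy by simp
    qed
    moreover have "- (1 - s) * (b + x - 1) <= y" using False unfolding Bz Az by (simp add: algebra_simps)
    ultimately have "w + cr (b + x - 1) * (w - cr s * v) + cr y * v \<in> W" by (intro cond(2)) (use s xy u0 in auto)
    moreover have "w + cr (b + x - 1) * (w - cr s * v) + cr y * v = cr (?A z) * v + cr (?B z) * w" unfolding Az Bz by (simp add: algebra_simps)
    ultimately show ?thesis unfolding AB(3) by simp
   qed
  qed
  have oQ: "open {z. z - ?Q \<in> K2}" "convex {z. z - ?Q \<in> K2}" using open_translate_preimage[OF oconeD(1)[OF oK2]] convex_translate_preimage[OF oconeD(2)[OF oK2]] by auto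
  have dH: "dimm {z. z - ?Q \<in> K2} H" by (rule dimm_subset[OF H(1) oQ(1) Qsub])
  have near: "\<exists>z\<in>ball ?Q r. z \<in> {z. z - ?Q \<in> K2} & z \<in> tri v w s" if r: "r > 0" for r proof -
   have l: "linear (%z. ?A z + ?B z)" by (rule linearI; simp add: linear_add[OF crd_linear] linear_scale[OF crd_linear] algebra_simps)
   have "s * (1 - b) < 1 * (1 - b)" using s u0 by (intro mult_strict_right_mono) auto
   hence "?Q \<in> {z. ?A z + ?B z < 1}" unfolding mem_Collect_eq AB by simp
   hence "?Q \<in> ball ?Q r Int {z. ?A z + ?B z < 1}" using r by simp
   moreover have "open (ball ?Q r Int {z. ?A z + ?B z < 1})" using halfplane(1)[OF l] by blast
   ultimately obtain z where "z \<in> {z. z - ?Q \<in> K2}" "z \<in> ball ?Q r Int {z. ?A z + ?B z < 1}" using meets_closure[OF ocone_closure[OF oK2, of ?Q]] by blast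
   thus ?thesis using intri[of z] by (intro bexI[of _ z]) auto
  qed
  have "\<not> extendable {z. z - ?Q \<in> K2} H ?Q" proof
   assume x: "extendable {z. z - ?Q \<in> K2} H ?Q"
   have "extendable (tri v w s) E ?Q" by (rule extendable_transfer[OF x dH tri_convex E(1) near]) (use H(2) in auto)
   thus False using nE by blast
  qed
  then obtain F2 where F2: "dimm {z. z - ?Q \<in> K} F2" "!!z. z - ?Q \<in> K2 ==> F2 z = H z" using pivot[OF dec oK2 K2K dH] by blast
  have cQK: "convex {z. z - ?Q \<in> K}" using convex_translate_preimage[OF oconeD(2)[OF K]] .
  have "F2 z = E z" if z: "z \<in> tri v w s" "z - ?Q \<in> K" for z proof (rule convex_agree[OF cQK F2(1) tri_convex E(1), of "{z. z - ?Q \<in> K2} Int tri v w s"])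
   show "{z. z - ?Q \<in> K2} Int tri v w s ~= {}" using near[of 1] by auto
  qed (use oQ tri_open K2K F2(2) H(2) z in auto)
  thus ?thesis using obstacle[OF s E _ nE F2(1)] H(3) by blast
 qed
qed

text \<open>Only some subcone of \<open>K\<close> is asked for, which makes the condition open
  (\<open>good_open\<close>). The disc ties the cone to its apex, so that the germ at
  \<open>x\<close> determines the immersion.\<close>

definition good :: "complex set => 'a => bool" where
 "good K x \<longleftrightarrow> (\<exists>K' ep F. ocone K' & K' \<subseteq> K & 0 < ep & dimm (K' Un ball 0 ep) F & F 0 = x)"

text \<open>The complete cone at \<open>v\<close> covers the far side of a triangle with vertices
  \<open>v\<close> and \<open>w\<close>, whose third vertex is swept to 0. An obstacle
  \<open>Q\<close> comes with an immersion of \<open>Q + K\<close>, which takes over the role of the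
  cone at \<open>v\<close> in a second sweep with \<open>Q'\<close> instead of \<open>w\<close>. A
  second obstacle either lies in the triangle that was immersed before, or its own cone contains
  \<open>Q\<close> and extends the first immersion over \<open>Q\<close>; both are absurd.\<close>

lemma forward_complete:
 assumes dec: "decided K G" and e: "dimm (K Int ball 0 ep) e" and v: "v \<in> K" "norm v < ep" and gv: "good K (e v)"
 obtains K1 where "ocone K1" "K1 \<subseteq> K" "complete e K1"
proof -
 have K: "ocone K" using decidedD(1)[OF dec] .
 obtain K' ep' F where F: "ocone K'" "K' \<subseteq> K" "0 < ep'" "dimm (K' Un ball 0 ep') F" "F 0 = e v" using gv unfolding good_def by blast
 have v0: "v ~= 0" using v(1) oconeD(4)[OF K] by auto
 have vV: "v \<in> K Int ball 0 ep" using v by simp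
 obtain mu e0 where g: "mu > 0" "e0 > 0" "!!h. norm h < e0 ==> e (v + h) = F (0 + cr mu * h)" using dimm_germ[OF dimm_atD[OF e vV] dimm_atD[OF F(4), of 0]] F(3,5) by auto
 let ?F1 = "%z. F (cr mu * z + - (cr mu * v))"
 let ?O = "{z. cr mu * z + - (cr mu * v) \<in> K' Un ball 0 ep'}"
 have dO: "dimm ?O ?F1" by (rule dimm_affine[OF F(4) g(1)])
 have aff: "cr mu * z + - (cr mu * v) = cr mu * (z - v)" for z by (simp add: algebra_simps)
 let ?W = "{z. z - v \<in> K'}"
 have WO: "?W \<subseteq> ?O" unfolding aff using oconeD(5)[OF F(1) _ g(1)] by blast
 have dW: "dimm ?W ?F1" by (rule dimm_subset[OF dO open_translate_preimage[OF oconeD(1)[OF F(1)]] WO])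
 have F1e: "?F1 z = e z" if "z \<in> ball v e0" for z proof -
  have "norm (z - v) < e0" using that by (simp add: dist_norm norm_minus_commute)
  from g(3)[OF this] show ?thesis unfolding aff by simp
 qed
 obtain d where d: "d \<in> K'" "Im (cnj v * d) ~= 0" proof -
  obtain d0 where d0: "d0 \<in> K'" using oconeD(3)[OF F(1)] by blast
  show ?thesis proof (cases "Im (cnj v * d0) = 0")
   case False
   thus ?thesis using that d0 by blast
  next case True
   obtain r where r: "r > 0" "ball d0 r \<subseteq> K'" using d0 oconeD(1)[OF F(1)] open_contains_ball by blast
   define t where "t = r / (2 * norm v)"
   have t: "t > 0" "norm (cr t * (\<i> * v)) < r" using r v0 by (auto simp: t_def norm_mult norm_divide)
   have "d0 + cr t * (\<i> * v) \<in> K'" using r t by (auto simp: dist_norm)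
   moreover have "Im (cnj v * (d0 + cr t * (\<i> * v))) = t * (norm v)\<^sup>2" unfolding cmod_power2 using True by (simp add: algebra_simps power2_eq_square)
   ultimately show ?thesis using that[of "d0 + cr t * (\<i> * v)"] t(1) v0 by simp
  qed
 qed
 have dK: "d \<in> K" using d F(2) by blast
 obtain r where r: "r > 0" "ball d r \<subseteq> K'" using d oconeD(1)[OF F(1)] open_contains_ball by blast
 define de0 where "de0 = r / (norm v + 1)"
 have nv: "norm v + 1 > 0" by (simp add: add_nonneg_pos)
 have del0: "de0 > 0" using r nv by (simp add: de0_def)
 have dsv: "d + cr si * v \<in> K'" if "0 <= si" "si <= de0" for si proof -
  have "si * (norm v + 1) <= r" using that nv by (simp add: de0_def field_simps)
  hence "norm (cr si * v) < r" using that r by (cases "si = 0") (auto simp: norm_mult algebra_simps)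
  thus ?thesis using r(2) by (auto simp: dist_norm)
 qed
 \<comment> \<open>\<open>w\<close> is taken so far out along \<open>d\<close> that
   \<open>cond\<close> holds: there \<open>xi * (1 - s) + y\<close> is at most
   \<open>2 * (1 + xi)\<close>, and \<open>2 < de0 * L\<close> keeps this within the tolerance
   \<open>de0\<close> of the direction \<open>d\<close>.\<close>
 define L where "L = 2 / de0 + 1"
 have L: "L > 0" "2 < de0 * L" using del0 by (auto simp: L_def field_simps)
 define w where "w = v + cr L * d"
 have ind: "Im (cnj w * v) ~= 0" unfolding w_def using d L by (simp add: algebra_simps)
 have LdK: "cr L * d \<in> K" using oconeD(5)[OF K dK L(1)] .
 have wK: "w \<in> K" unfolding w_def by (rule ocone_add[OF K v(1) LdK])
 have wW: "w \<in> ?W" using oconeD(5)[OF F(1) d(1) L(1)] by (simp add: w_def)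
 have seg: "v + cr t * (w - v) \<in> ?O" if "0 <= t" for t proof (cases "t = 0")
  case True
  thus ?thesis using F(3) by simp
 next case False
  have "cr (t * L) * d \<in> K'" by (rule oconeD(5)[OF F(1) d(1)]) (use that False L in simp)
  hence "v + cr t * (w - v) \<in> ?W" by (simp add: w_def mult.assoc)
  thus ?thesis using WO by blast
 qed
 obtain ep2 where e2: "ep2 > 0" "!!t z. 0 <= t ==> t <= 1 ==> dist (v + cr t * (w - v)) z < ep2 ==> z \<in> ?O" proof -
  have c: "compact ((%t. v + cr t * (w - v)) ` {0..1})" by (intro compact_continuous_image continuous_intros) simp
  have s: "(%t. v + cr t * (w - v)) ` {0..1} \<subseteq> ?O" using seg by (intro image_subsetI) simp
  obtain ep2 where x: "ep2 > 0" "(\<Union>x\<in>(%t. v + cr t * (w - v)) ` {0..1}. ball x ep2) \<subseteq> ?O" using compact_subset_open_imp_ball_epsilon_subset[OF c dimm_open[OF dO] s] by blast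
  show ?thesis proof (rule that[OF x(1)])
   fix t :: real and z assume "0 <= t" "t <= 1" "dist (v + cr t * (w - v)) z < ep2"
   hence "z \<in> (\<Union>x\<in>(%t. v + cr t * (w - v)) ` {0..1}. ball x ep2)" by (intro UN_I[of "v + cr t * (w - v)"] imageI) auto
   thus "z \<in> ?O" using x(2) by blast
  qed
 qed
 \<comment> \<open>So close to 1 that the initial triangle lies in the neighbourhood of the segment
   from \<open>v\<close> to \<open>w\<close> on which the immersion at \<open>v\<close> is
   given.\<close>
 define u0 where "u0 = max (1/2) (1 - ep2 / (2 * (norm v + 1)))"
 have u0: "0 < u0" "u0 < 1" "1 - u0 <= ep2 / (2 * (norm v + 1))" using e2 nv by (auto simp: u0_def less_max_iff_disj)
 have triO: "tri v w u0 \<subseteq> ?O" proof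
  fix z assume z: "z \<in> tri v w u0"
  let ?a = "crd v w z" and ?b = "crd w v z"
  have b: "0 < ?b" "?b < 1" "u0 * (1 - ?b) < ?a" "?a < 1 - ?b" using z tri_B[OF z u0(2)] unfolding tri_def by auto
  have "v + cr ?b * (w - v) - z = cr (1 - ?b - ?a) * v" using crd_pair(3)[OF ind, of z] by (simp add: algebra_simps)
  hence "dist (v + cr ?b * (w - v)) z = (1 - ?b - ?a) * norm v" using b unfolding dist_norm by (simp only: norm_mult norm_of_real)
  also have "... <= (1 - u0) * (norm v + 1)" proof (rule mult_mono)
   have "u0 * ?b <= 1 * ?b" using b u0 by (intro mult_right_mono) auto
   moreover have "u0 - u0 * ?b < ?a" using b(3) by (simp add: right_diff_distrib)
   ultimately show "1 - ?b - ?a <= 1 - u0" by linarith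
  qed (use u0 in auto)
  also have "... <= ep2 / (2 * (norm v + 1)) * (norm v + 1)" using u0 nv by (intro mult_right_mono) auto
  also have "... = ep2 / 2" using nv by (simp add: field_simps)
  finally show "z \<in> ?O" using e2 b by (intro e2(2)[of ?b]) auto
 qed
 have dE0: "dimm (tri v w u0) ?F1" by (rule dimm_subset[OF dO tri_open triO])
 have cV: "convex (K Int ball 0 ep)" using oconeD(2)[OF K] by (intro convex_Int convex_ball)
 have eE0: "e z = ?F1 z" if "z \<in> tri v w u0" "z \<in> K Int ball 0 ep" for z proof (rule convex_agree[OF cV e tri_convex dE0, of "tri v w u0 Int ((K Int ball 0 ep) Int ball v e0)"])
  have "cr 1 * v + cr 0 * w \<in> closure (tri v w u0)" by (rule tri_closure[OF ind u0(2)]) (use u0 in auto)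
  hence vc: "v \<in> closure (tri v w u0)" by simp
  have "open ((K Int ball 0 ep) Int ball v e0)" using dimm_open[OF e] by blast
  thus "tri v w u0 Int ((K Int ball 0 ep) Int ball v e0) ~= {}" by (rule meets_closure[OF vc]) (use vV g in auto)
  show "open (tri v w u0 Int ((K Int ball 0 ep) Int ball v e0))" using tri_open dimm_open[OF e] by blast
 qed (use that F1e in auto)
 have keep: "w - cr s * v \<in> K" if "0 <= s" "s <= u0" for s proof -
  have "cr (1 - s) * v + cr L * d \<in> K" by (rule ocone_add[OF K oconeD(5)[OF K v(1)] LdK]) (use that u0 in simp)
  thus ?thesis by (simp add: w_def algebra_simps)
 qed
 have cond: "w + cr xi * (w - cr s * v) + cr y * v \<in> ?W"
  if h: "0 <= s" "s <= u0" "-1 < xi" "0 < y" "y < 1 * (1 + xi)" "- (1 - s) * xi <= y" for s xi y proof -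
  define p where "p = (1 + xi) * L"
  have p: "p > 0" using h L by (simp add: p_def)
  define si where "si = (xi * (1 - s) + y) / p"
  have "0 <= xi * (1 - s) + y" using h by (simp add: algebra_simps)
  moreover have "xi * (1 - s) + y <= 2 * (1 + xi)" proof (cases "xi >= 0")
   case True
   have "xi * (1 - s) <= xi * 1" using True h by (intro mult_left_mono) auto
   thus ?thesis using h by simp
  next case False
   have "xi * (1 - s) <= 0" using False h u0 by (intro mult_nonpos_nonneg) auto
   thus ?thesis using h by simp
  qed
  moreover have "2 * (1 + xi) <= de0 * p" using L(2) h mult_right_mono[of 2 "de0 * L" "1 + xi"] by (simp add: p_def mult_ac)
  ultimately have "0 <= si" "si <= de0" using p by (auto simp: si_def field_simps)
  hence "cr p * (d + cr si * v) \<in> K'" using oconeD(5)[OF F(1) dsv p] by blast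
  moreover have "cr p * (d + cr si * v) = cr p * d + cr (p * si) * v" by (simp add: algebra_simps)
  moreover have "p * si = xi * (1 - s) + y" using p by (simp add: si_def)
  ultimately have 1: "cr p * d + cr (xi * (1 - s) + y) * v \<in> K'" by (simp only:)
  have "w + cr xi * (w - cr s * v) + cr y * v - v = cr p * d + cr (xi * (1 - s) + y) * v" unfolding w_def p_def by (simp add: algebra_simps)
  thus ?thesis using 1 by simp
 qed
 have cW: "convex ?W" using convex_translate_preimage[OF oconeD(2)[OF F(1)]] .
 show ?thesis proof (rule tri_main[OF dec v(1) wK ind u0(1,2) e v(2) dE0 eE0 cW dW wW _ keep zero_less_one cond])
  show "?thesis" if "ocone K1" "K1 \<subseteq> K" "complete e K1" for K1 by (rule \<open>!!K1. ocone K1 ==> K1 \<subseteq> K ==> complete e K1 ==> thesis\<close>[OF that])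
 next
  fix s b E F2
  let ?Q = "cr (s * (1 - b)) * v + cr b * w"
  let ?T = "tri v w s"
  assume s: "0 < s" "s <= u0" "0 < b" "b < 1" and E: "dimm ?T E" "!!z. z \<in> tri v w u0 ==> E z = ?F1 z"
   and eE: "!!z. z \<in> ?T ==> z \<in> K Int ball 0 ep ==> e z = E z" and nE: "\<not> extendable ?T E ?Q"
   and F2: "dimm {z. z - ?Q \<in> K} F2" "!!z. z \<in> ?T ==> z - ?Q \<in> K ==> F2 z = E z"
  have s1: "s < 1" using s u0 by simp
  \<comment> \<open>Half of the way, in direction \<open>v\<close>, from \<open>Q\<close> to the
    side from \<open>v\<close> to \<open>w\<close>. So \<open>Q'\<close> is inside the old triangle,
    which then contains \<open>tri v Q' s\<close>.\<close>
  define \<iota> where "\<iota> = (1 - s) * (1 - b) / 2"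
  have io: "\<iota> > 0" "\<iota> < (1 - s) * (1 - b)" using s s1 by (auto simp: \<iota>_def)
  define Q where "Q = ?Q"
  define Q' where "Q' = Q + cr \<iota> * v"
  have Q'e: "Q' = cr (s * (1 - b) + \<iota>) * v + cr b * w" by (simp add: Q'_def Q_def algebra_simps)
  have ind': "Im (cnj Q' * v) ~= 0" proof -
   show ?thesis unfolding Q'e using ind s by (simp add: algebra_simps)
  qed
  have Q'K: "Q' \<in> K" unfolding Q'e by (rule ocone_add[OF K oconeD(5)[OF K v(1)] oconeD(5)[OF K wK]]) (use s io in \<open>auto intro: add_nonneg_pos\<close>)
  have sub: "tri v Q' s \<subseteq> ?T" proof
   fix z assume z: "z \<in> tri v Q' s"
   let ?a = "crd v Q' z" and ?b = "crd Q' v z"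
   have zb: "0 < ?b" "?b < 1" "s * (1 - ?b) < ?a" "?a < 1 - ?b" using z tri_B[OF z s1] unfolding tri_def by auto
   have ze: "z = cr (?a + ?b * (s * (1 - b) + \<iota>)) * v + cr (?b * b) * w" using crd_pair(3)[OF ind', of z] unfolding Q'e by (simp add: algebra_simps)
   have "?b * (s * (1 - b) + \<iota>) < ?b * (1 - b)" using zb io by (intro mult_strict_left_mono) (auto simp: algebra_simps)
   moreover have "?b * \<iota> > 0" using zb io by simp
   moreover have "?b * b > 0" using zb s by simp
   ultimately have "0 < ?b * b & s * (1 - ?b * b) < ?a + ?b * (s * (1 - b) + \<iota>) & ?a + ?b * (s * (1 - b) + \<iota>) < 1 - ?b * b" using zb by (simp add: algebra_simps)
   hence "cr (?a + ?b * (s * (1 - b) + \<iota>)) * v + cr (?b * b) * w \<in> ?T" using tri_mem[OF ind] by blast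
   thus "z \<in> ?T" using ze by simp
  qed
  have dE': "dimm (tri v Q' s) E" by (rule dimm_subset[OF E(1) tri_open sub])
  have eE': "e z = E z" if "z \<in> tri v Q' s" "z \<in> K Int ball 0 ep" for z using eE sub that by blast
  have Qf: "?Q = Q" by (simp add: Q_def)
  note F2' = F2[unfolded Qf] and nE' = nE[unfolded Qf]
  have cW2: "convex {z. z - Q \<in> K}" using convex_translate_preimage[OF oconeD(2)[OF K]] .
  have ivK: "cr \<iota> * v \<in> K" using oconeD(5)[OF K v(1) io(1)] .
  have Q'W: "Q' \<in> {z. z - Q \<in> K}" using ivK by (simp add: Q'_def)
  have FE': "F2 z = E z" if "z \<in> tri v Q' s" "z \<in> {z. z - Q \<in> K}" for z using F2'(2) sub that by blast
  have keep': "Q' - cr s' * v \<in> K" if "0 <= s'" "s' <= s" for s' proof -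
   have "b * s <= b * 1" using s s1 by (intro mult_left_mono) auto
   hence "s * (1 - b) + \<iota> - s' + b > 0" using that io by (simp add: algebra_simps)
   hence "cr (s * (1 - b) + \<iota> - s' + b) * v + cr b * (cr L * d) \<in> K" by (intro ocone_add[OF K oconeD(5)[OF K v(1)] oconeD(5)[OF K LdK]]) (use s in auto)
   moreover have "cr (s * (1 - b) + \<iota> - s' + b) * v + cr b * (cr L * d) = Q' - cr s' * v" unfolding Q'e w_def by (simp add: algebra_simps)
   ultimately show ?thesis by simp
  qed
  obtain r1 where r1: "r1 > 0" "ball (cr \<iota> * v) r1 \<subseteq> K" using ivK oconeD(1)[OF K] open_contains_ball by blast
  define N where "N = norm Q' + norm v + 1"
  have N: "N > 0" "!!s'. 0 <= s' ==> s' <= s ==> norm (Q' - cr s' * v) <= N" proof -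
   show "N > 0" by (simp add: N_def add_nonneg_pos)
   fix s' assume h: "0 <= s'" "s' <= s"
   have "norm (cr s' * v) <= 1 * norm v" unfolding norm_mult norm_of_real using h s1 by (intro mult_right_mono) auto
   thus "norm (Q' - cr s' * v) <= N" using norm_triangle_ineq4[of Q' "cr s' * v"] by (simp add: N_def)
  qed
  \<comment> \<open>For negative \<open>xi\<close> the bounds on \<open>y\<close> in
    \<open>cond'\<close> force \<open>- xi <= ka0\<close>, so that the displaced point stays in a
    neighbourhood of \<open>Q'\<close> inside \<open>Q + K\<close>.\<close>
  define ka0 where "ka0 = r1 / (2 * N)"
  have k0: "ka0 > 0" using r1 N by (simp add: ka0_def)
  have kK: "cr \<iota> * v - cr ka * (Q' - cr s' * v) \<in> K" if h: "0 <= ka" "ka <= ka0" "0 <= s'" "s' <= s" for ka s' proof -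
   have "norm (cr ka * (Q' - cr s' * v)) <= ka0 * N" unfolding norm_mult norm_of_real using h N by (intro mult_mono) auto
   also have "... < r1" using r1 N by (simp add: ka0_def)
   finally show ?thesis using r1(2) by (auto simp: dist_norm)
  qed
  have cond': "Q' + cr xi * (Q' - cr s' * v) + cr y * v \<in> {z. z - Q \<in> K}"
   if h: "0 <= s'" "s' <= s" "-1 < xi" "0 < y" "y < (1 - s) * ka0 * (1 + xi)" "- (1 - s') * xi <= y" for s' xi y proof -
   have yv: "cr y * v \<in> K" using oconeD(5)[OF K v(1) h(4)] .
   have 1: "cr \<iota> * v + cr xi * (Q' - cr s' * v) \<in> K" proof (cases "xi >= 0")
    case True
    show ?thesis proof (cases "xi = 0")
     case False
     thus ?thesis using True by (intro ocone_add[OF K ivK oconeD(5)[OF K keep'[OF h(1,2)]]]) simp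
    qed (use ivK in simp)
   next case False
    have "(1 - s) * (- xi) <= (1 - s') * (- xi)" using False h by (intro mult_right_mono) auto
    also have "... = - (1 - s') * xi" by (simp only: mult_minus_left mult_minus_right)
    also have "... <= y" by (rule h(6))
    also have "(1 - s) * ka0 * (1 + xi) <= (1 - s) * ka0 * 1" by (intro mult_left_mono) (use False s1 k0 in auto)
    hence "y <= (1 - s) * ka0" using h(5) by linarith
    finally have "(1 - s) * (- xi) <= (1 - s) * ka0" .
    hence "- xi <= ka0" by (rule mult_left_le_imp_le) (use s1 in simp)
    hence "cr \<iota> * v - cr (- xi) * (Q' - cr s' * v) \<in> K" using False h by (intro kK) auto
    thus ?thesis by simp
   qed
   have "cr \<iota> * v + cr xi * (Q' - cr s' * v) + cr y * v \<in> K" by (rule ocone_add[OF K 1 yv])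
   thus ?thesis by (simp add: Q'_def algebra_simps)
  qed
  have dpos: "0 < (1 - s) * ka0" using s1 k0 by simp
  show ?thesis proof (rule tri_main[OF dec v(1) Q'K ind' s(1) s1 e v(2) dE' eE' cW2 F2'(1) Q'W FE' keep' dpos cond'])
   show "?thesis" if "ocone K1" "K1 \<subseteq> K" "complete e K1" for K1 by (rule \<open>!!K1. ocone K1 ==> K1 \<subseteq> K ==> complete e K1 ==> thesis\<close>[OF that])
  next
   fix s2 b2 E2 F3
   let ?Q2 = "cr (s2 * (1 - b2)) * v + cr b2 * Q'"
   let ?T2 = "tri v Q' s2"
   assume s2: "0 < s2" "s2 <= s" "0 < b2" "b2 < 1" and E2: "dimm ?T2 E2" "!!z. z \<in> tri v Q' s ==> E2 z = E z"
    and nE2: "\<not> extendable ?T2 E2 ?Q2"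
    and F3: "dimm {z. z - ?Q2 \<in> K} F3" "!!z. z \<in> ?T2 ==> z - ?Q2 \<in> K ==> F3 z = E2 z"
   have sub2: "tri v Q' s \<subseteq> ?T2" by (rule tri_mono[OF s2(2) s1])
   have ap: "Q' \<in> closure (tri v Q' s)" by (rule tri_apex[OF ind' s1])
   have ne: "tri v Q' s ~= {}" using ap by auto
   have E2E: "E2 z = E z" if "z \<in> ?T2" "z \<in> ?T" for z by (rule convex_agree[OF tri_convex E2(1) tri_convex E(1) tri_open ne sub2 sub]) (use E2(2) that in auto)
   \<comment> \<open>The coefficient of \<open>v\<close> in the difference of \<open>Q\<close> and
     the second obstacle, with \<open>L * d\<close> as the other basis vector. Its sign decides
     which of the two contradictions applies.\<close>
   define ka where "ka = (1 - b2) * (s * (1 - b) + b + \<iota> - s2) - \<iota>"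
   have Q2e: "?Q2 = cr (s2 * (1 - b2) + b2 * (s * (1 - b) + \<iota>)) * v + cr (b2 * b) * w" unfolding Q'e by (simp add: algebra_simps)
   show ?thesis proof (cases "ka < 0")
    case True
    have "?Q2 \<in> ?T" unfolding Q2e tri_mem[OF ind] proof (intro conjI)
     show "0 < b2 * b" using s s2 by simp
     have "b * (1 - s) * (1 - b2) > 0" using s s1 s2 by simp
     thus "s * (1 - b2 * b) < s2 * (1 - b2) + b2 * (s * (1 - b) + \<iota>)" using True unfolding ka_def by (simp add: algebra_simps)
     have "b2 * (s * (1 - b) + \<iota>) < b2 * (1 - b)" using s2 io by (intro mult_strict_left_mono) (auto simp: algebra_simps)
     moreover have "s2 * (1 - b2) < 1 * (1 - b2)" using s2 s1 by (intro mult_strict_right_mono) auto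
     ultimately show "s2 * (1 - b2) + b2 * (s * (1 - b) + \<iota>) < 1 - b2 * b" by (simp add: algebra_simps)
    qed
    hence "extendable ?T2 E2 ?Q2" by (rule extendableI[OF E(1)]) (use E2E in auto)
    thus ?thesis using nE2 by blast
   next case False
    have lK: "cr ((1 - b2) * b) * (cr L * d) \<in> K" by (rule oconeD(5)[OF K LdK]) (use s s2 in simp)
    have "cr ka * v + cr ((1 - b2) * b) * (cr L * d) \<in> K" proof (cases "ka = 0")
     case False
     thus ?thesis using \<open>\<not> ka < 0\<close> by (intro ocone_add[OF K oconeD(5)[OF K v(1)] lK]) simp
    qed (use lK in simp)
    moreover have "cr ka * v + cr ((1 - b2) * b) * (cr L * d) = Q - ?Q2" unfolding Q2e ka_def Q_def w_def by (simp add: algebra_simps)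
    ultimately have QK: "Q \<in> {z. z - ?Q2 \<in> K}" by simp
    have "cr (1 - b2) * (Q' - cr s2 * v) \<in> K" by (rule oconeD(5)[OF K keep']) (use s2 in auto)
    moreover have "cr (1 - b2) * (Q' - cr s2 * v) = Q' - ?Q2" by (simp add: algebra_simps)
    ultimately have "Q' \<in> {z. z - ?Q2 \<in> K}" by simp
    hence ne3: "tri v Q' s Int {z. z - ?Q2 \<in> K} ~= {}" by (rule meets_closure[OF ap dimm_open[OF F3(1)]])
    have c3: "convex {z. z - ?Q2 \<in> K}" using convex_translate_preimage[OF oconeD(2)[OF K]] .
    have "extendable ?T E Q" using QK proof (rule extendableI[OF F3(1)])
     fix z assume z: "z \<in> ?T" "z \<in> {z. z - ?Q2 \<in> K}"
     show "F3 z = E z" by (rule convex_agree[OF c3 F3(1) tri_convex E(1), of "tri v Q' s Int {z. z - ?Q2 \<in> K}"])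
       (use ne3 open_Int[OF tri_open dimm_open[OF F3(1)]] sub sub2 F3(2) E2(2) z in auto)
    qed
    thus ?thesis using nE' by blast
   qed
  qed
 qed auto
qed

end

lemma ocone_around:
 assumes K: "ocone K" "d \<in> K" and ep: "ep > 0"
 obtains K0 where "ocone K0" "K0 \<subseteq> K" "d \<in> K0" "!!k. k \<in> K0 ==> \<exists>t>0. \<exists>x\<in>K. norm (x - d) < ep & k = cr t * x"
proof -
 obtain r where r: "r > 0" "ball d r \<subseteq> K" using K oconeD(1) open_contains_ball by blast
 define rh where "rh = min r ep"
 have rho: "rh > 0" "ball d rh \<subseteq> K" using r ep by (auto simp: rh_def)
 define K0 where "K0 = (\<Union>t\<in>{0<..}. (%x. cr t * x) ` ball d rh)"
 have sub: "K0 \<subseteq> K" using rho(2) oconeD(5)[OF K(1)] unfolding K0_def by fastforce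
 have "open ((%x. cr t * x) ` ball d rh)" if "t > 0" for t using open_scaling[of t "ball d rh"] that by (simp add: scaleR_conv_of_real)
 hence "open K0" unfolding K0_def by (intro open_UN) auto
 moreover have "convex K0" proof (rule convexI)
  fix x y and a b :: real assume h: "x \<in> K0" "y \<in> K0" "0 <= a" "0 <= b" "a + b = 1"
  obtain t1 x1 where x: "t1 > 0" "x1 \<in> ball d rh" "x = cr t1 * x1" using h(1) unfolding K0_def by auto
  obtain t2 x2 where y: "t2 > 0" "x2 \<in> ball d rh" "y = cr t2 * x2" using h(2) unfolding K0_def by auto
  define T where "T = a * t1 + b * t2"
  have T: "T > 0" proof (cases "a = 0")
   case True
   thus ?thesis using h y by (simp add: T_def)
  next case False
   hence "a * t1 > 0" using h x by simp
   moreover have "b * t2 >= 0" using h y by simp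
   ultimately show ?thesis by (simp add: T_def)
  qed
  let ?w = "(a * t1 / T) *\<^sub>R x1 + (b * t2 / T) *\<^sub>R x2"
  have "?w \<in> ball d rh" proof (rule convexD[OF convex_ball x(2) y(2)])
   show "a * t1 / T + b * t2 / T = 1" using T by (simp add: T_def add_divide_distrib[symmetric])
  qed (use h x y T in auto)
  moreover have "a *\<^sub>R x + b *\<^sub>R y = cr T * ?w" using T unfolding x(3) y(3) by (simp add: scaleR_conv_of_real distrib_left)
  ultimately show "a *\<^sub>R x + b *\<^sub>R y \<in> K0" unfolding K0_def using T by blast
 qed
 moreover have dK0: "d \<in> K0" unfolding K0_def using rho(1) by (intro UN_I[of 1]) (auto intro!: image_eqI[of _ _ d])
 moreover have "cr t * z \<in> K0" if zz: "z \<in> K0" "t > 0" for z t proof -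
  obtain t1 x1 where x: "t1 > 0" "x1 \<in> ball d rh" "z = cr t1 * x1" using zz(1) unfolding K0_def by auto
  show ?thesis unfolding x(3) unfolding K0_def using x zz(2) by (intro UN_I[of "t * t1"]) auto
 qed
 moreover have "0 ~: K0" using sub oconeD(4)[OF K(1)] by blast
 ultimately have oc: "ocone K0" unfolding ocone_def by blast
 have scaled: "\<exists>t>0. \<exists>x\<in>K. norm (x - d) < ep & k = cr t * x" if kk: "k \<in> K0" for k proof -
  obtain t x where x: "t > 0" "x \<in> ball d rh" "k = cr t * x" using kk unfolding K0_def by auto
  show ?thesis using x(2) x(2) rho(2) x by (fastforce simp: rh_def dist_norm norm_minus_commute)
 qed
 show ?thesis by (rule that[OF oc sub dK0 scaled])
qed

lemma ocone_uminus: "ocone K ==> ocone {z. - z \<in> K}"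
proof -
 assume K: "ocone K"
 have "open {z. - z \<in> K}" "convex {z. - z \<in> K}" proof -
  have e: "{z. - z \<in> K} = uminus ` K" by (auto simp: image_iff) (metis add.inverse_inverse)
  show "open {z. - z \<in> K}" unfolding e using open_negations oconeD(1)[OF K] by blast
  show "convex {z. - z \<in> K}" unfolding e using convex_negations oconeD(2)[OF K] by blast
 qed
 moreover obtain k where "k \<in> K" using oconeD(3)[OF K] by blast
 hence "- k \<in> {z. - z \<in> K}" by simp
 moreover have "cr t * z \<in> {z. - z \<in> K}" if "z \<in> {z. - z \<in> K}" "t > 0" for z t using oconeD(5)[OF K, of "- z" t] that by simp
 moreover have "{z. - z \<in> K} ~= {}" using calculation(3) by blast
 ultimately show ?thesis unfolding ocone_def using oconeD(4)[OF K] by auto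
qed

section \<open>Cones over a disc, and transversals without return\<close>

context dilation_surface begin

text \<open>The disc grows a spike in direction \<open>v\<close>: a narrow strip with a triangular
  roof whose tip moves to \<open>2 * v\<close>. Front points in the disc are harmless, and the strip
  is so narrow that all other front points lie in \<open>K\<close>, where \<open>no\<close> excludes
  obstacles.\<close>

lemma cap_direction:
 assumes K: "ocone K" and v: "v \<in> K" and e: "0 < r" "dimm (ball 0 r) e"
  and no: "!!D E P. convex D ==> 0 \<in> D ==> dimm D E ==> \<exists>d>0. \<forall>z\<in>ball 0 d. E z = e z ==> P \<in> closure D ==> P \<in> K ==> extendable D E P"
 shows "\<exists>S F. v \<in> S & convex S & dimm S F & 0 \<in> S & (\<exists>d>0. \<forall>z\<in>ball 0 d. F z = e z)"
proof -
 have v0: "v ~= 0" using v oconeD(4)[OF K] by auto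
 define n where "n = \<i> * v"
 have ind: "Im (cnj n * v) ~= 0" proof -
  have "Im (cnj n * v) = - (norm v)\<^sup>2" unfolding n_def cmod_power2 by (simp add: power2_eq_square algebra_simps)
  thus ?thesis using v0 by simp
 qed
 have nn: "norm n = norm v" by (simp add: n_def norm_mult)
 define A where "A = crd v n"
 define B where "B = crd n v"
 have AB: "cr (A z) * v + cr (B z) * n = z" "A (cr a * v + cr b * n) = a" "B (cr a * v + cr b * n) = b" for z a b unfolding A_def B_def by (rule crd_pair[OF ind])+
 obtain rh where rho: "rh > 0" "ball v rh \<subseteq> K" using v oconeD(1)[OF K] open_contains_ball by blast
 define N where "N = norm v + 1"
 have N: "N > 0" "norm v <= N" "norm v < N" by (simp_all add: N_def add_nonneg_pos)
 \<comment> \<open>The second bound makes the slope \<open>y / A P\<close> of a front point outside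
   the disc so small that its direction stays in the ball around \<open>v\<close> inside
   \<open>K\<close>.\<close>
 define et where "et = min (r / (4 * N)) (r * rh / (4 * N * N))"
 have eta: "et > 0" "et <= r / (4 * N)" "et <= r * rh / (4 * N * N)" using e(1) rho(1) N(1) by (auto simp: et_def)
 define a where "a = min 1 (r / (4 * N))"
 have a: "0 < a" "a <= 1" "a <= r / (4 * N)" using e(1) N(1) by (auto simp: a_def)
 define S where "S ta = {z. - et < A z & \<bar>B z\<bar> < et & A z < ta * (1 - \<bar>B z\<bar> / et)}" for ta
 have Sopen: "open (S ta) & convex (S ta)" if "ta >= 0" for ta proof -
  have l: "linear (%z. - A z)" "linear (%z. B z)" "linear (%z. - B z)" "linear (%z. A z + ta / et * B z)" "linear (%z. A z - ta / et * B z)" unfolding A_def B_def by (rule linearI; simp add: linear_add[OF crd_linear] linear_scale[OF crd_linear] algebra_simps)+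
  have iff: "x < ta * (1 - \<bar>y\<bar> / et) \<longleftrightarrow> x + ta / et * y < ta & x - ta / et * y < ta" for x y :: real proof (cases "y >= 0")
   case True
   have "0 <= ta / et * y" using True that eta by simp
   moreover have "ta * (1 - \<bar>y\<bar> / et) = ta - ta / et * y" using True by (simp add: right_diff_distrib)
   ultimately show ?thesis by linarith
  next case False
   have "ta / et * y <= 0" using False that eta by (intro mult_nonneg_nonpos) auto
   moreover have "ta * (1 - \<bar>y\<bar> / et) = ta + ta / et * y" using False by (simp add: algebra_simps)
   ultimately show ?thesis by linarith
  qed
  have S: "S ta = {z. - A z < et} Int {z. B z < et} Int {z. - B z < et} Int {z. A z + ta / et * B z < ta} Int {z. A z - ta / et * B z < ta}" unfolding S_def iff abs_less_iff by auto
  show ?thesis unfolding S using halfplane[OF l(1)] halfplane[OF l(2)] halfplane[OF l(3)] halfplane[OF l(4)] halfplane[OF l(5)] by (intro conjI open_Int convex_Int; blast)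
 qed
 have w1: "1 - \<bar>B z\<bar> / et > 0" if "z \<in> S ta" for z ta using that eta(1) unfolding S_def by simp
 have Smono: "S si \<subseteq> S ta" if "si <= ta" for si ta proof
  fix z assume z: "z \<in> S si"
  have "si * (1 - \<bar>B z\<bar> / et) <= ta * (1 - \<bar>B z\<bar> / et)" using w1[OF z] that by (intro mult_right_mono) auto
  thus "z \<in> S ta" using z unfolding S_def by auto
 qed
 have zS: "0 \<in> S ta" if "ta > 0" for ta using AB(2)[of 0 0] AB(3)[of 0 0] that eta(1) unfolding S_def by simp
 have nz: "norm z <= (\<bar>A z\<bar> + \<bar>B z\<bar>) * N" for z proof -
  have "norm z <= norm (cr (A z) * v) + norm (cr (B z) * n)" using norm_triangle_ineq[of "cr (A z) * v" "cr (B z) * n"] unfolding AB(1) .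
  also have "... = (\<bar>A z\<bar> + \<bar>B z\<bar>) * norm v" by (simp add: norm_mult nn distrib_right)
  also have "... <= (\<bar>A z\<bar> + \<bar>B z\<bar>) * N" using N by (intro mult_left_mono) auto
  finally show ?thesis .
 qed
 have Sa: "S a \<subseteq> ball 0 r" proof
  fix z assume z: "z \<in> S a"
  have "a * (1 - \<bar>B z\<bar> / et) <= a * 1" using a eta by (intro mult_left_mono) auto
  moreover have "A z < a * (1 - \<bar>B z\<bar> / et)" using z unfolding S_def by simp
  ultimately have "A z < r / (4 * N)" using a(3) by linarith
  hence "(\<bar>A z\<bar> + \<bar>B z\<bar>) * N <= (r / (4 * N) + r / (4 * N)) * N" using z eta unfolding S_def using N by (intro mult_right_mono) auto
  also have "... = r / 2" using N by (simp add: field_simps)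
  finally show "z \<in> ball 0 r" using nz[of z] e(1) by simp
 qed
 let ?p = "%ta y. cr (ta * (1 - \<bar>y\<bar> / et)) * v + cr y * n"
 let ?C = "%ta. ?p ta ` {-et..et}"
 have Ccl: "?p ta y \<in> closure (S ta)" if h: "ta > 0" "\<bar>y\<bar> <= et" for ta y proof (rule ray_closure[of _ 0])
  fix t :: real assume t: "0 < t" "t <= 1"
  define q where "q = \<bar>y\<bar> / et"
  have q: "0 <= q" "q <= 1" using h eta(1) by (auto simp: q_def)
  have eq: "?p ta y + cr t * (0 - ?p ta y) = cr ((1 - t) * (ta * (1 - q))) * v + cr ((1 - t) * y) * n" unfolding q_def[symmetric] by (simp add: algebra_simps)
  have ay: "\<bar>(1 - t) * y\<bar> = (1 - t) * \<bar>y\<bar>" using t by (simp add: abs_mult)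
  have "0 <= (1 - t) * (ta * (1 - q))" using t h q by simp
  hence 1: "- et < (1 - t) * (ta * (1 - q))" using eta by linarith
  have "(1 - t) * \<bar>y\<bar> <= (1 - t) * et" using t h by (intro mult_left_mono) auto
  moreover have "(1 - t) * et < 1 * et" using t eta by (intro mult_strict_right_mono) auto
  ultimately have 2: "\<bar>(1 - t) * y\<bar> < et" unfolding ay by linarith
  have 3: "(1 - t) * (ta * (1 - q)) < ta * (1 - \<bar>(1 - t) * y\<bar> / et)" using t h unfolding ay by (simp add: algebra_simps q_def)
  show "?p ta y + cr t * (0 - ?p ta y) \<in> S ta" unfolding eq S_def mem_Collect_eq AB using 1 2 3 by blast
 qed
 have oSa: "open (S a)" "convex (S a)" using Sopen a by auto
 obtain d0 where d0: "d0 > 0" "ball 0 d0 \<subseteq> S a" using zS[OF a(1)] oSa(1) open_contains_ball by blast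
 have near: "\<exists>d>0. \<forall>z\<in>ball 0 d. E z = e z" if "!!w. w \<in> S a ==> E w = e w" for E using that d0 by blast
 show ?thesis proof (rule sweep[of a 2 S ?C e])
  show "a < 2" using a by simp
  show "open (S ta) & convex (S ta)" if "a <= ta" for ta using Sopen that a by simp
  show "S a ~= {}" using zS[OF a(1)] by blast
  show "S si \<subseteq> S ta" if "si <= ta" for si ta by (rule Smono[OF that])
  show "\<exists>si. a <= si & si < ta & z \<in> S si" if h: "a < ta" "z \<in> S ta" for ta z proof -
   define x where "x = 1 - \<bar>B z\<bar> / et"
   have x: "x > 0" using w1[OF h(2)] by (simp add: x_def)
   define d where "d = ta * x - A z"
   have d: "d > 0" using h(2) unfolding d_def x_def S_def by simp
   define si where "si = max a (ta - d / (2 * x))"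
   have s: "a <= si" "si < ta" "si >= ta - d / (2 * x)" using d x h(1) by (auto simp: si_def)
   have "(ta - si) * x <= d / (2 * x) * x" using s x by (intro mult_right_mono) auto
   also have "... = d / 2" using x by simp
   finally have "A z < si * x" using d unfolding d_def by (simp add: algebra_simps)
   thus ?thesis using s h(2) unfolding S_def x_def by (intro exI[of _ si]) auto
  qed
  show "compact (?C ta) & ?C ta \<subseteq> closure (S ta)" if "a <= ta" for ta proof
   show "compact (?C ta)" using eta(1) by (intro compact_continuous_image continuous_intros) auto
   show "?C ta \<subseteq> closure (S ta)" using Ccl[of ta] that a by fastforce
  qed
  show "\<exists>ta'>ta. ta' <= 2 & S ta' \<subseteq> S ta Un (\<Union>x\<in>?C ta. ball x ep)" if h: "a <= ta" "ta < 2" "0 < ep" for ta ep proof -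
   define ta' where "ta' = min 2 (ta + ep / (2 * N))"
   have t': "ta < ta'" "ta' <= 2" "ta' - ta <= ep / (2 * N)" using h N by (auto simp: ta'_def)
   have "S ta' \<subseteq> S ta Un (\<Union>x\<in>?C ta. ball x ep)" proof
    fix z assume z: "z \<in> S ta'"
    show "z \<in> S ta Un (\<Union>x\<in>?C ta. ball x ep)" proof (cases "A z < ta * (1 - \<bar>B z\<bar> / et)")
     case True
     thus ?thesis using z unfolding S_def by auto
    next case False
     define x where "x = 1 - \<bar>B z\<bar> / et"
     have x: "0 < x" "x <= 1" using w1[OF z] eta by (simp_all add: x_def)
     have Az: "ta * x <= A z" "A z < ta' * x" using False z unfolding S_def x_def by auto
     have "?p ta (B z) - z = cr (ta * x - A z) * v" using AB(1)[of z] by (simp add: x_def algebra_simps)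
     hence "dist (?p ta (B z)) z = (A z - ta * x) * norm v" using Az unfolding dist_norm by (simp only: norm_mult norm_of_real) simp
     also have "... <= (ta' - ta) * N" proof (rule mult_mono)
      have "(ta' - ta) * x <= (ta' - ta) * 1" using x t' by (intro mult_left_mono) auto
      thus "A z - ta * x <= ta' - ta" using Az by (simp add: algebra_simps)
     qed (use t' N in auto)
     also have "... <= ep / (2 * N) * N" using t' N by (intro mult_right_mono) auto
     also have "... = ep / 2" using N by simp
     finally have "dist (?p ta (B z)) z < ep" using h by simp
     moreover have "?p ta (B z) \<in> ?C ta" by (rule imageI) (use z in \<open>auto simp: S_def\<close>)
     ultimately show ?thesis by (intro UnI2 UN_I) auto
    qed
   qed
   thus ?thesis using t' by blast
  qed
  show "dimm (S a) e" by (rule dimm_subset[OF e(2) oSa(1) Sa])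
 next
  fix E assume E: "dimm (S 2) E" "!!w. w \<in> S a ==> E w = e w"
  have "v \<in> S 2" using AB(2)[of 1 0] AB(3)[of 1 0] using eta(1) unfolding S_def by simp
  thus ?thesis using E(1) Sopen[of 2] zS[of 2] near[OF E(2)] by (intro exI[of _ "S 2"] exI[of _ E]) auto
 next
  fix ta E P assume h: "a <= ta" "ta < 2" and E: "dimm (S ta) E" "!!w. w \<in> S a ==> E w = e w" and P: "P \<in> ?C ta" "\<not> extendable (S ta) E P"
  obtain y where y0: "y \<in> {-et..et}" "P = ?p ta y" using P(1) by blast
  have y: "\<bar>y\<bar> <= et" "P = ?p ta y" using y0 by auto
  have tp: "ta > 0" using h a by simp
  have cS: "convex (S ta)" using Sopen tp by simp
  have BP: "B P = y" "A P >= 0" using y eta tp unfolding y(2) AB by auto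
  have "r <= norm P" proof (rule ccontr)
   assume "\<not> r <= norm P"
   hence "P \<in> ball 0 r" by simp
   hence "extendable (S ta) E P" proof (rule extendableI[OF e(2)])
    fix z assume z: "z \<in> S ta" "z \<in> ball 0 r"
    show "e z = E z" by (rule convex_agree[OF convex_ball e(2) cS E(1) oSa(1)]) (use zS[OF a(1)] Sa Smono[OF h(1)] E(2) z in auto)
   qed
   thus False using P(2) by blast
  qed
  hence "r <= (A P + \<bar>y\<bar>) * N" using nz[of P] BP by simp
  also have "... <= (A P + r / (4 * N)) * N" using y eta N by (intro mult_right_mono) auto
  also have "... = A P * N + r / 4" using N by (simp add: field_simps)
  finally have AP: "A P >= 3 * r / 4 / N" using N by (simp add: pos_divide_le_eq)
  have APp: "A P > 0" using AP e(1) N by (smt (verit) divide_pos_pos)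
  have "norm (cr (y / A P) * n) < rh" proof -
   have "\<bar>y / A P\<bar> = \<bar>y\<bar> / A P" using APp by simp
   also have "... <= (r * rh / (4 * N * N)) / (3 * r / 4 / N)" using y eta AP N e(1) rho(1) APp by (intro frac_le) auto
   also have "... = rh / (3 * N)" using e(1) N by (simp add: field_simps)
   finally have "\<bar>y / A P\<bar> * norm v <= rh / (3 * N) * N" using N rho by (intro mult_mono) auto
   also have "... < rh" using N rho by simp
   finally show ?thesis by (simp only: norm_mult norm_of_real nn)
  qed
  hence "v + cr (y / A P) * n \<in> K" using rho(2) by (auto simp: dist_norm)
  hence "cr (A P) * (v + cr (y / A P) * n) \<in> K" using oconeD(5)[OF K _ APp] by blast
  moreover have "cr (A P) * (v + cr (y / A P) * n) = P" using AB(1)[of P] BP APp by (simp add: distrib_left)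
  ultimately have PK: "P \<in> K" by simp
  have Pcl: "P \<in> closure (S ta)" unfolding y(2) by (rule Ccl[OF tp y(1)])
  have "extendable (S ta) E P" by (rule no[OF cS zS[OF tp] E(1) near[OF E(2)] Pcl PK])
  thus ?thesis using P(2) by blast
 qed
qed

lemma cap:
 assumes K: "ocone K" and e: "0 < r" "dimm (ball 0 r) e"
 obtains (complete) F where "dimm (K Un ball 0 r) F" "!!z. z \<in> ball 0 r ==> F z = e z"
 | (obstacle) D E P where "convex D" "0 \<in> D" "dimm D E" "\<exists>d>0. \<forall>z\<in>ball 0 d. E z = e z" "P \<in> closure D" "P \<in> K" "\<not> extendable D E P"
proof (cases "\<exists>D E P. convex D & 0 \<in> D & dimm D E & (\<exists>d>0. \<forall>z\<in>ball 0 d. E z = e z) & P \<in> closure D & P \<in> K & \<not> extendable D E P")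
 case True
 then obtain D E P where h: "convex D & 0 \<in> D & dimm D E & (\<exists>d>0. \<forall>z\<in>ball 0 d. E z = e z) & P \<in> closure D & P \<in> K & \<not> extendable D E P" by (elim exE)
 show ?thesis by (rule obstacle[of D E P]; use h in blast)
next case False
 have no: "extendable D E P" if "convex D" "0 \<in> D" "dimm D E" "\<exists>d>0. \<forall>z\<in>ball 0 d. E z = e z" "P \<in> closure D" "P \<in> K" for D E P using False that by blast
 have z0: "(0::complex) \<in> ball 0 r" using e(1) by simp
 have refl: "\<exists>d>0. \<forall>z\<in>ball 0 d. e z = e z" by (rule exI[of _ 1]) simp
 have loc: "\<exists>S F. w \<in> S & convex S & dimm S F & 0 \<in> S & (\<exists>d>0. \<forall>z\<in>ball 0 d. F z = e z)" if w: "w \<in> K Un ball 0 r" for w proof (cases "w \<in> K")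
  case True
  thus ?thesis by (rule cap_direction[OF K _ e no])
 next case False
  thus ?thesis using w z0 e(2) refl by blast
 qed
 have op: "open (K Un ball 0 r)" using oconeD(1)[OF K] by blast
 obtain F where F: "dimm (K Un ball 0 r) F" "!!S F' w. convex S ==> dimm S F' ==> 0 \<in> S ==> \<exists>d>0. \<forall>z\<in>ball 0 d. F' z = e z ==> w \<in> S ==> w \<in> K Un ball 0 r ==> F w = F' w" by (rule glue_convex[OF op loc], assumption, rule that)
 show ?thesis by (rule complete[OF F(1)]) (rule F(2)[OF convex_ball e(2) z0 refl], auto)
qed

text \<open>Stated for displacement vectors in immersed convex domains, so that it applies to every
  piece at hand without building a trajectory.\<close>

definition no_return :: "complex set => 'a set => bool" where
 "no_return K I \<longleftrightarrow> (\<forall>S F z d. convex S --> dimm S F --> z \<in> S --> z + d \<in> S --> d \<in> K --> F z \<in> I --> F (z + d) ~: I)"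

text \<open>The line is carried by a convex immersed domain rather than by a trajectory; the domain
  is shifted so that the starting point \<open>b\<close> is at 0.\<close>

definition hits :: "(complex => 'a) => complex => complex => bool" where
 "hits e b d \<longleftrightarrow> (\<exists>D E t. convex D & dimm D E & 0 \<in> D & (\<exists>rh>0. \<forall>z\<in>ball 0 rh. E z = e (b + z)) & 0 < t &
  cr t * d \<in> closure D & ends_radially E (cr t * d) 0)"

text \<open>The germ at the singularity is given on a whole cone of directions, so the same end
  point \<open>P\<close> is hit from nearby starting points in nearby directions. The new starting
  point and length are the coordinates of \<open>P\<close> in the basis \<open>u\<close>,
  \<open>d'\<close>.\<close>

lemma hits_persist:
 assumes K: "ocone K" "germ_family {z. - z \<in> K} G" and d: "d \<in> K" "Im (cnj d * u) ~= 0" and h: "hits e b d" and et: "et > 0"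
 obtains ep where "ep > 0" "!!d'. norm (d' - d) < ep ==> \<exists>x. \<bar>x\<bar> < et & hits e (b + cr x * u) d'"
proof -
 let ?N = "{z. - z \<in> K}"
 obtain D E t rh where D: "convex D" "dimm D E" "0 \<in> D" "rh > 0" "!!z. z \<in> ball 0 rh ==> E z = e (b + z)" "0 < t"
  "cr t * d \<in> closure D" "ends_radially E (cr t * d) 0" using h unfolding hits_def by blast
 define P where "P = cr t * d"
 have Pcl: "P \<in> closure D" and Pend: "ends_radially E P 0" using D by (auto simp: P_def)
 have "cr t * d \<in> K" by (rule oconeD(5)[OF K(1) d(1) D(6)])
 hence "0 - P \<in> ?N" by (simp add: P_def)
 then obtain g where g: "g \<in> G" "matches ?N g D E P" using germ_familyD[OF K(2) D(1,2) Pcl D(3) _ Pend] by blast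
 obtain mu de where m: "mu > 0" "de > 0" "!!w. w \<in> ?N ==> norm w < de ==> P + w \<in> D ==> E (P + w) = g (cr mu * w)" using g(2) unfolding matches_def by blast
 obtain s where s: "s \<in> Sing" "!!W. openin topX W ==> s \<in> W ==> \<exists>de>0. \<forall>w\<in>?N. norm w < de --> g w \<in> W" using K(2) g(1) unfolding germ_family_def unfolding tends_sing_def by auto
 have oD: "open D" using dimm_open[OF D(2)] .
 obtain r where r: "r > 0" "ball 0 r \<subseteq> D" using D(3) oD open_contains_ball by blast
 define c where "c = min et (min r rh / (2 * (norm u + 1)))"
 have nu: "norm u + 1 > 0" by (simp add: add_nonneg_pos)
 have c: "c > 0" using et r D(4) nu by (simp add: c_def)
 let ?x = "%d'. crd u d' P" and ?t = "%d'. crd d' u P"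
 have cx: "isCont ?x d" unfolding crd_def using d(2) by (intro continuous_intros) auto
 have ct: "isCont ?t d" using d(2) unfolding crd_def by (simp add: algebra_simps)
 have "(?x \<longlongrightarrow> 0) (nhds d)" "(?t \<longlongrightarrow> t) (nhds d)" using crd_of[OF d(2), of 0 t] cx ct by (auto simp: P_def continuous_at tendsto_nhds_iff isCont_def)
 hence "\<forall>\<^sub>F d' in nhds d. dist (?x d') 0 < c" "\<forall>\<^sub>F d' in nhds d. dist (?t d') t < t" using tendstoD c D(6) by blast+
 moreover have "\<forall>\<^sub>F d' in nhds d. d' \<in> K" using eventually_nhds_in_open[OF oconeD(1)[OF K(1)] d(1)] .
 moreover have "\<forall>\<^sub>F d' in nhds d. Im (cnj d' * u) ~= 0" proof -
  have "open {d'. Im (cnj d' * u) ~= 0}" by (intro open_Collect_neq continuous_intros)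
  thus ?thesis using eventually_nhds_in_open[of "{d'. Im (cnj d' * u) ~= 0}" d] d(2) by simp
 qed
 ultimately have "\<forall>\<^sub>F d' in nhds d. dist (?x d') 0 < c & dist (?t d') t < t & d' \<in> K & Im (cnj d' * u) ~= 0" by eventually_elim blast
 then obtain ep where eps: "ep > 0" "!!d'. dist d' d < ep ==> dist (?x d') 0 < c & dist (?t d') t < t & d' \<in> K & Im (cnj d' * u) ~= 0" unfolding eventually_nhds_metric by blast
 show ?thesis proof (rule that[OF eps(1)])
  fix d' assume "norm (d' - d) < ep"
  hence d': "\<bar>?x d'\<bar> < c" "dist (?t d') t < t" "d' \<in> K" "Im (cnj d' * u) ~= 0" using eps(2)[of d'] by (auto simp: dist_norm)
  define x where "x = ?x d'"
  define t' where "t' = ?t d'"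
  have t': "t' > 0" using d'(2) by (simp add: t'_def dist_real_def abs_if split: if_splits)
  have P: "P = cr x * u + cr t' * d'" unfolding x_def t'_def using crd_eq[OF d'(4), of P] by simp
  have xc: "\<bar>x\<bar> < c" using d'(1) by (simp add: x_def)
  have "\<bar>x\<bar> * norm u <= c * (norm u + 1)" using xc c by (intro mult_mono) auto
  also have "... <= min r rh / (2 * (norm u + 1)) * (norm u + 1)" using nu by (intro mult_right_mono) (auto simp: c_def)
  also have "... = min r rh / 2" using nu by (simp add: field_simps)
  finally have xu: "norm (cr x * u) <= min r rh / 2" by (simp add: norm_mult)
  have xuD: "cr x * u \<in> D" using xu r D(4) by (intro subsetD[OF r(2)]) auto
  have td: "cr t' * d' = P - cr x * u" using P by simp
  have tK: "cr t' * d' \<in> K" by (rule oconeD(5)[OF K(1) d'(3) t'])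
  have d'0: "d' ~= 0" using d'(3) oconeD(4)[OF K(1)] by auto
  have line: "P + cr y * (cr x * u - P) \<in> D" if "0 < y" "y <= 1" for y by (rule convex_shrink_mem0[OF D(1) oD Pcl xuD that])
  have "hits e (b + cr x * u) d'" unfolding hits_def proof (rule exI[of _ "{z. z + cr x * u \<in> D}"], rule exI[of _ "%z. E (z + cr x * u)"], rule exI[of _ t'], intro conjI)
   show "convex {z. z + cr x * u \<in> D}" using convex_affine_preimage[OF D(1), of 1 "cr x * u"] by simp
   show "dimm {z. z + cr x * u \<in> D} (%z. E (z + cr x * u))" by (rule dimm_shift[OF D(2)])
   show "0 \<in> {z. z + cr x * u \<in> D}" using xuD by simp
   show "\<exists>rh>0. \<forall>z\<in>ball 0 rh. E (z + cr x * u) = e (b + cr x * u + z)" proof (intro exI[of _ "rh / 2"] conjI ballI)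
    show "rh / 2 > 0" using D(4) by simp
    fix z :: complex assume "z \<in> ball 0 (rh / 2)"
    thus "E (z + cr x * u) = e (b + cr x * u + z)" using norm_triangle_ineq[of z "cr x * u"] xu D(5)[of "z + cr x * u"] by (simp add: algebra_simps)
   qed
   show "0 < t'" by (rule t')
   show "cr t' * d' \<in> closure {z. z + cr x * u \<in> D}" proof (rule ray_closure[of _ 0])
    fix y :: real assume y: "0 < y" "y <= 1"
    show "cr t' * d' + cr y * (0 - cr t' * d') \<in> {z. z + cr x * u \<in> D}" unfolding td using line[OF y] by simp
   qed
   show "ends_radially (%z. E (z + cr x * u)) (cr t' * d') 0" unfolding ends_radially_def ends_at_def proof (intro bexI[of _ s] allI impI s(1))
    fix W assume W: "openin topX W & s \<in> W"
    obtain de' where de': "de' > 0" "!!w. w \<in> ?N ==> norm w < de' ==> g w \<in> W" using s(2)[OF conjunct1[OF W] conjunct2[OF W]] by blast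
    have tp: "cr t' * d' \<in> K" by (rule tK)
    have dm: "min de (de' / mu) > 0" using m de' by simp
    obtain ta where ta: "0 < ta" "ta <= 1" "!!y. 0 < y ==> y <= ta ==> cr y * (cr t' * d') \<in> K & norm (cr y * (cr t' * d')) < min de (de' / mu)" using ocone_small[OF K(1) dm tp] by blast
    show "\<exists>t0\<in>{-1<..<0}. \<forall>y\<in>{-1<..<0}. t0 <= y --> E (cr t' * d' + cr (- y) * (0 - cr t' * d') + cr x * u) \<in> W" proof (intro bexI[of _ "- (ta / 2)"] ballI impI)
     show "- (ta / 2) \<in> {-1<..<0}" using ta by auto
     fix y :: real assume y: "y \<in> {-1<..<0}" "- (ta / 2) <= y"
     let ?w = "- (cr (- y) * (cr t' * d'))"
     have e1: "cr t' * d' + cr (- y) * (0 - cr t' * d') + cr x * u = P + ?w" unfolding P by (simp add: algebra_simps)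
     have e2: "P + ?w = P + cr (- y) * (cr x * u - P)" unfolding td by (simp add: algebra_simps)
     have yy: "cr (- y) * (cr t' * d') \<in> K & norm (cr (- y) * (cr t' * d')) < min de (de' / mu)" by (rule ta(3)) (use y ta in auto)
     have wN: "?w \<in> ?N" using yy by simp
     have wn: "norm ?w < de" "norm ?w < de' / mu" using yy by simp_all
     have "P + ?w \<in> D" unfolding e2 by (rule line) (use y in auto)
     hence "E (P + ?w) = g (cr mu * ?w)" by (rule m(3)[OF wN wn(1)])
     moreover have "g (cr mu * ?w) \<in> W" proof (rule de'(2))
      show "cr mu * ?w \<in> ?N" using oconeD(5)[OF ocone_uminus[OF K(1)] wN m(1)] .
      have "norm (cr mu * ?w) = mu * norm ?w" using m(1) by (simp only: norm_mult norm_of_real abs_of_pos)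
      thus "norm (cr mu * ?w) < de'" using wn(2) m(1) by (simp only: pos_less_divide_eq mult.commute)
     qed
     ultimately show "E (cr t' * d' + cr (- y) * (0 - cr t' * d') + cr x * u) \<in> W" unfolding e1 by simp
    qed
   qed
  qed
  thus "\<exists>x. \<bar>x\<bar> < et & hits e (b + cr x * u) d'" using xc by (intro exI[of _ x]) (simp add: c_def)
 qed
qed

text \<open>Two lines with the same germ at their ends coincide there up to scale, so the one that
  is longer in the scale of the germ passes the starting point of the other. By
  \<open>no_return\<close> this is possible only if the starting points have the same image.\<close>

lemma hits_merge:
 assumes K: "ocone K" and d: "d \<in> K" and nr: "no_return K I"
  and D1: "convex D1" "dimm D1 E1" "0 \<in> D1" "E1 0 \<in> I" "0 < t1" "cr t1 * d \<in> closure D1"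
  and D2: "convex D2" "dimm D2 E2" "0 \<in> D2" "E2 0 \<in> I" "0 < t2" "cr t2 * d \<in> closure D2"
  and m1: "0 < mu1" "0 < de1" "!!w. - w \<in> K ==> norm w < de1 ==> cr t1 * d + w \<in> D1 ==> E1 (cr t1 * d + w) = g (cr mu1 * w)"
  and m2: "0 < mu2" "0 < de2" "!!w. - w \<in> K ==> norm w < de2 ==> cr t2 * d + w \<in> D2 ==> E2 (cr t2 * d + w) = g (cr mu2 * w)"
  and le: "mu1 * t1 <= mu2 * t2"
 shows "E1 0 = E2 0"
proof -
 define l where "l = mu1 / mu2"
 have l: "l > 0" using m1 m2 by (simp add: l_def)
 let ?P1 = "cr t1 * d" and ?P2 = "cr t2 * d"
 define c where "c = ?P2 - cr l * ?P1"
 have ce: "c = cr (t2 - l * t1) * d" by (simp add: c_def algebra_simps)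
 have k: "0 <= t2 - l * t1" "t2 - l * t1 < t2" using le m1 m2 l D1(5) by (auto simp: l_def field_simps)
 have cD2: "c \<in> D2" proof -
  have "?P2 + cr (l * t1 / t2) * (0 - ?P2) \<in> D2" by (rule convex_shrink_mem0[OF D2(1) dimm_open[OF D2(2)] D2(6,3)]) (use k l D1(5) D2(5) in auto)
  moreover have "?P2 + cr (l * t1 / t2) * (0 - ?P2) = c" unfolding c_def using D2(5) by simp
  ultimately show ?thesis by simp
 qed
 let ?V = "D1 Int {z. cr l * z + c \<in> D2} Int {z. - (z - ?P1) \<in> K} Int ball ?P1 (min de1 (de2 / l))"
 have z0: "cr l * 0 + c \<in> D2" using cD2 by simp
 have cl1: "?P1 \<in> closure (D1 Int {z. cr l * z + c \<in> D2})" proof (rule ray_closure[of _ 0])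
  fix y :: real assume y: "0 < y" "y <= 1"
  have 1: "?P1 + cr y * (0 - ?P1) \<in> D1" by (rule convex_shrink_mem0[OF D1(1) dimm_open[OF D1(2)] D1(6,3) y])
  have "?P2 + cr y * (c - ?P2) \<in> D2" by (rule convex_shrink_mem0[OF D2(1) dimm_open[OF D2(2)] D2(6) cD2 y])
  moreover have "cr l * (?P1 + cr y * (0 - ?P1)) + c = ?P2 + cr y * (c - ?P2)" unfolding c_def by (simp add: algebra_simps)
  ultimately show "?P1 + cr y * (0 - ?P1) \<in> D1 Int {z. cr l * z + c \<in> D2}" using 1 by simp
 qed
 have "E2 (cr l * 0 + c) = E1 0" proof (rule dimm_affine_unique[OF D1(1,2) D2(1,2) l, of ?V])
  show "open ?V" using open_translate_preimage[OF oconeD(1)[OF ocone_uminus[OF K]], of ?P1] dimm_open[OF D1(2)] open_affine_preimage[OF dimm_open[OF D2(2)]] by fastforce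
  have dm: "min de1 (de2 / l) > 0" using m1 m2 l by simp
  have t1d: "?P1 \<in> K" using oconeD(5)[OF K d D1(5)] .
  obtain ta where ta: "0 < ta" "ta <= 1" "!!y. 0 < y ==> y <= ta ==> cr y * ?P1 \<in> K & norm (cr y * ?P1) < min de1 (de2 / l)" using ocone_small[OF K dm t1d] by blast
  have z1: "?P1 + cr ta * (0 - ?P1) \<in> D1" by (rule convex_shrink_mem0[OF D1(1) dimm_open[OF D1(2)] D1(6,3) ta(1,2)])
  have "?P2 + cr ta * (c - ?P2) \<in> D2" by (rule convex_shrink_mem0[OF D2(1) dimm_open[OF D2(2)] D2(6) cD2 ta(1,2)])
  moreover have "cr l * (?P1 + cr ta * (0 - ?P1)) + c = ?P2 + cr ta * (c - ?P2)" unfolding c_def by (simp add: algebra_simps)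
  ultimately have "?P1 + cr ta * (0 - ?P1) \<in> ?V" using z1 ta(3)[of ta] ta(1) by (simp add: dist_norm)
  thus "?V ~= {}" by blast
  fix z assume z: "z \<in> ?V"
  define w where "w = z - ?P1"
  have w: "- w \<in> K" "norm w < de1" "norm w < de2 / l" "?P1 + w \<in> D1" using z by (auto simp: w_def dist_norm norm_minus_commute)
  have e2: "cr l * z + c = ?P2 + cr l * w" by (simp add: w_def c_def algebra_simps)
  have "E2 (?P2 + cr l * w) = g (cr mu2 * (cr l * w))" proof (rule m2(3))
   show "- (cr l * w) \<in> K" using oconeD(5)[OF K w(1) l] by simp
   show "norm (cr l * w) < de2" using w(3) l by (simp add: norm_mult pos_less_divide_eq mult.commute)
   show "?P2 + cr l * w \<in> D2" using z unfolding e2[symmetric] by simp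
  qed
  also have "cr mu2 * (cr l * w) = cr mu1 * w" using m2(1) by (simp add: l_def)
  also have "g (cr mu1 * w) = E1 (?P1 + w)" by (rule m1(3)[OF w(1,2,4), symmetric])
  finally show "z \<in> D1 & cr l * z + c \<in> D2 & E2 (cr l * z + c) = E1 z" unfolding e2[symmetric] using z by (simp add: w_def)
 qed (use D1(3) z0 in auto)
 hence eq: "E2 c = E1 0" by simp
 have "c = 0" proof (rule ccontr)
  assume "c ~= 0"
  hence "t2 - l * t1 ~= 0" unfolding ce by auto
  hence "t2 - l * t1 > 0" using k by linarith
  hence "c \<in> K" unfolding ce by (rule oconeD(5)[OF K d])
  hence "E2 (0 + c) ~: I" using nr D2(1,2,3,4) cD2 unfolding no_return_def by (metis add_0)
  thus False using eq D1(4) by simp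
 qed
 thus ?thesis using eq by simp
qed

text \<open>By \<open>hits_merge\<close>, starting points that hit in one direction use different
  germs, so their number is bounded by \<open>card G\<close>. In a direction with the largest
  number, hits persist under small changes and no new ones can appear. A starting point
  \<open>s0\<close> away from the hits thus never hits in nearby directions, and its cap has no
  obstacle: a homothety would move it by a vector of \<open>K\<close> to a point with the same
  image, which is a return.\<close>

lemma no_return_good:
 assumes K: "ocone K" and e: "0 < r" "dimm (ball 0 r) e" "inj_on e (ball 0 r)" and u: "u ~= 0" "!!k. k \<in> K ==> Im (cnj k * u) ~= 0"
  and a: "0 < a" "a * norm u < r" and nr: "no_return K ((%s. e (cr s * u)) ` {-a<..<a})"
 obtains s where "\<bar>s\<bar> < a" "good K (e (cr s * u))"
proof -
 let ?I = "(%s. e (cr s * u)) ` {-a<..<a}"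
 let ?N = "{z. - z \<in> K}"
 obtain G where G: "germ_family ?N G" using germ_family_exists[OF ocone_uminus[OF K]] .
 have fG: "finite G" using G unfolding germ_family_def by simp
 define V where "V d = {s. \<bar>s\<bar> < a & hits e (cr s * u) d}" for d
 have sI: "e (cr s * u) \<in> ?I" if "\<bar>s\<bar> < a" for s using that by (intro imageI) auto
 have sr: "norm (cr s * u) < r" if "\<bar>s\<bar> < a" for s using a(2) that mult_right_mono[of "\<bar>s\<bar>" a "norm u"] by (simp add: norm_mult)
 have cardV: "finite (V d) & card (V d) <= card G" if d: "d \<in> K" for d proof -
  have ex: "\<exists>g\<in>G. \<exists>D E t. convex D & dimm D E & 0 \<in> D & E 0 = e (cr s * u) & 0 < t & cr t * d \<in> closure D & matches ?N g D E (cr t * d)"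
   if s: "s \<in> V d" for s proof -
   obtain D E t rh where D: "convex D" "dimm D E" "0 \<in> D" "rh > 0" "!!z. z \<in> ball 0 rh ==> E z = e (cr s * u + z)" "0 < t"
    "cr t * d \<in> closure D" "ends_radially E (cr t * d) 0" using s unfolding V_def unfolding hits_def by blast
   obtain g where "g \<in> G" "matches ?N g D E (cr t * d)" using oconeD(5)[OF K d D(6)] germ_familyD[OF G D(1,2,7,3) _ D(8)] by auto
   moreover have "E 0 = e (cr s * u)" using D(4) D(5)[of 0] by simp
   ultimately show ?thesis using D by blast
  qed
  then obtain ga where ga: "!!s. s \<in> V d ==> ga s \<in> G" "!!s. s \<in> V d ==> \<exists>D E t. convex D & dimm D E & 0 \<in> D & E 0 = e (cr s * u) & 0 < t & cr t * d \<in> closure D & matches ?N (ga s) D E (cr t * d)" by metis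
  have inj: "inj_on ga (V d)" proof (rule inj_onI)
   fix s1 s2 assume s: "s1 \<in> V d" "s2 \<in> V d" "ga s1 = ga s2"
   obtain D1 E1 t1 where D1: "convex D1" "dimm D1 E1" "0 \<in> D1" "E1 0 = e (cr s1 * u)" "0 < t1" "cr t1 * d \<in> closure D1" "matches ?N (ga s1) D1 E1 (cr t1 * d)" using ga(2)[OF s(1)] by (elim exE conjE)
   obtain D2 E2 t2 where D2: "convex D2" "dimm D2 E2" "0 \<in> D2" "E2 0 = e (cr s2 * u)" "0 < t2" "cr t2 * d \<in> closure D2" "matches ?N (ga s1) D2 E2 (cr t2 * d)" using ga(2)[OF s(2)] unfolding s(3) by (elim exE conjE)
   have s': "\<bar>s1\<bar> < a" "\<bar>s2\<bar> < a" using s unfolding V_def by auto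
   have I: "E1 0 \<in> ?I" "E2 0 \<in> ?I" unfolding D1(4) D2(4) using sI s' by auto
   obtain mu1 de1 where m1: "0 < mu1" "0 < de1" "!!w. - w \<in> K ==> norm w < de1 ==> cr t1 * d + w \<in> D1 ==> E1 (cr t1 * d + w) = ga s1 (cr mu1 * w)" using D1(7) unfolding matches_def mem_Collect_eq Ball_def by blast
   obtain mu2 de2 where m2: "0 < mu2" "0 < de2" "!!w. - w \<in> K ==> norm w < de2 ==> cr t2 * d + w \<in> D2 ==> E2 (cr t2 * d + w) = ga s1 (cr mu2 * w)" using D2(7) unfolding matches_def mem_Collect_eq Ball_def by blast
   have "E1 0 = E2 0" proof (cases "mu1 * t1 <= mu2 * t2")
    case True
    show ?thesis by (rule hits_merge[OF K d nr D1(1,2,3) I(1) D1(5,6) D2(1,2,3) I(2) D2(5,6) m1 m2 True])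
   next case False
    hence le: "mu2 * t2 <= mu1 * t1" by simp
    show ?thesis by (rule hits_merge[OF K d nr D2(1,2,3) I(2) D2(5,6) D1(1,2,3) I(1) D1(5,6) m2 m1 le, symmetric])
   qed
   hence "e (cr s1 * u) = e (cr s2 * u)" unfolding D1(4) D2(4) .
   hence "cr s1 * u = cr s2 * u" by (rule inj_onD[OF e(3)]) (use sr s' in auto)
   thus "s1 = s2" using u(1) by simp
  qed
  have sub: "ga ` V d \<subseteq> G" using ga(1) by blast
  show ?thesis using inj_on_finite[OF inj sub fG] card_inj_on_le[OF inj sub fG] by blast
 qed
 obtain k where kK: "k \<in> K" using oconeD(3)[OF K] by blast
 obtain d where d: "d \<in> K" "!!d'. d' \<in> K ==> card (V d') <= card (V d)" proof -
  have "\<exists>d. d \<in> K & (\<forall>d'. d' \<in> K --> card (V d') <= card (V d))" by (rule ex_has_greatest_nat[of "%d. d \<in> K" k "%d. card (V d)" "Suc (card G)"]) (use kK cardV in \<open>auto simp: less_Suc_eq_le\<close>)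
  thus ?thesis using that by blast
 qed
 have fV: "finite (V d)" using cardV[OF d(1)] by blast
 have "infinite {-a<..<a}" using a(1) by (simp add: infinite_Ioo)
 then obtain s0 where s0: "s0 \<in> {-a<..<a}" "s0 ~: V d" using fV by (meson finite_subset subsetI)
 \<comment> \<open>Distances that a moved hit must not bridge: from \<open>s0\<close> to the hits,
   from the hits to the ends of the interval, and half the gaps between hits.\<close>
 let ?X = "(%s. \<bar>s0 - s\<bar>) ` V d Un (%s. a - \<bar>s\<bar>) ` V d Un (%(s, s'). \<bar>s - s'\<bar> / 2) ` ((V d \<times> V d) Int {(s, s'). s ~= s'})"
 have fX: "finite (insert 1 ?X)" using fV by simp
 define et where "et = Min (insert 1 ?X)"
 have "et \<in> insert 1 ?X" unfolding et_def using fX by (intro Min_in) auto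
 hence eta: "et > 0" using s0(2) unfolding V_def by auto
 have le: "et <= x" if "x \<in> ?X" for x unfolding et_def using fX that by (intro Min_le) auto
 have eta1: "et <= \<bar>s0 - s\<bar>" "et <= a - \<bar>s\<bar>" if "s \<in> V d" for s using le that by blast+
 have eta2: "2 * et <= \<bar>s - s'\<bar>" if "s \<in> V d" "s' \<in> V d" "s ~= s'" for s s' proof -
  have "\<bar>s - s'\<bar> / 2 \<in> ?X" using that by (intro UnI2 image_eqI[of _ _ "(s, s')"]) auto
  hence "et <= \<bar>s - s'\<bar> / 2" by (rule le)
  thus ?thesis by simp
 qed
 have pers: "\<exists>ep>0. \<forall>d'. norm (d' - d) < ep --> (\<exists>x. \<bar>x\<bar> < et & hits e (cr s * u + cr x * u) d')" if "s \<in> V d" for s proof -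
  have h: "hits e (cr s * u) d" using that unfolding V_def by simp
  show ?thesis using hits_persist[OF K G d(1) u(2)[OF d(1)] h eta] by metis
 qed
 from bchoice[of "V d"] pers obtain epf where ef: "!!s. s \<in> V d ==> epf s > 0" "!!s d'. s \<in> V d ==> norm (d' - d) < epf s ==> \<exists>x. \<bar>x\<bar> < et & hits e (cr s * u + cr x * u) d'" by metis
 define ep where "ep = Min (insert 1 (epf ` V d))"
 have eps: "ep > 0" unfolding ep_def using fV using ef(1) by auto
 have eps2: "ep <= epf s" if "s \<in> V d" for s unfolding ep_def using fV that by (intro Min_le) auto
 have s0V: "s0 ~: V d'" if d': "d' \<in> K" "norm (d' - d) < ep" for d' proof
  assume in0: "s0 \<in> V d'"
  have "\<forall>s\<in>V d. \<exists>x. \<bar>x\<bar> < et & s + x \<in> V d'" proof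
   fix s assume s: "s \<in> V d"
   then obtain x where x: "\<bar>x\<bar> < et" "hits e (cr s * u + cr x * u) d'" using ef(2)[OF s, of d'] eps2[OF s] d' by force
   show "\<exists>x. \<bar>x\<bar> < et & s + x \<in> V d'" using eta1(2)[OF s] x(1) using x unfolding V_def by (intro exI[of _ x]) (simp add: distrib_right)
  qed
  from bchoice[OF this] obtain x where x: "!!s. s \<in> V d ==> \<bar>x s\<bar> < et & s + x s \<in> V d'" by blast
  have "inj_on (%s. s + x s) (V d)" proof (rule inj_onI, rule ccontr)
   fix s s' assume h: "s \<in> V d" "s' \<in> V d" "s + x s = s' + x s'" "s ~= s'"
   show False using x[OF h(1)] x[OF h(2)] h(3) eta2[OF h(1,2,4)] by linarith
  qed
  hence "card ((%s. s + x s) ` V d) = card (V d)" by (rule card_image)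
  moreover have "(%s. s + x s) ` V d \<subseteq> V d'" using x by blast
  ultimately obtain s where "s \<in> V d" "s0 = s + x s" using d(2)[OF d'(1)] cardV[OF d'(1)] card_subset_eq[of "V d'" "(%s. s + x s) ` V d"] card_mono[of "V d'" "(%s. s + x s) ` V d"] in0 by auto
  thus False using eta1(1)[of s] x[of s] by simp
 qed
 obtain K0 where K0: "ocone K0" "K0 \<subseteq> K" "d \<in> K0" "!!k. k \<in> K0 ==> \<exists>t>0. \<exists>x\<in>K. norm (x - d) < ep & k = cr t * x" using ocone_around[OF K d(1) eps] by blast
 have s0a: "\<bar>s0\<bar> < a" using s0(1) by auto
 define b where "b = cr s0 * u"
 define r' where "r' = r - norm b"
 have r': "r' > 0" using sr[OF s0a] by (simp add: r'_def b_def)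
 have db: "dimm (ball 0 r') (%z. e (z + b))" proof (rule dimm_subset[OF dimm_shift[OF e(2)]])
  show "ball 0 r' \<subseteq> {z. z + b \<in> ball 0 r}" proof
   fix z :: complex assume "z \<in> ball 0 r'"
   thus "z \<in> {z. z + b \<in> ball 0 r}" using norm_triangle_ineq[of z b] by (simp add: r'_def)
  qed
 qed simp
 show ?thesis proof (rule cap[OF K0(1) r' db])
  fix F assume F: "dimm (K0 Un ball 0 r') F" "!!z. z \<in> ball 0 r' ==> F z = e (z + b)"
  have "good K (e (cr s0 * u))" unfolding good_def using K0(1,2) r' F(1) F(2)[of 0] by (intro exI[of _ K0] exI[of _ r'] exI[of _ F]) (simp add: b_def)
  thus ?thesis using that s0a by blast
 next
  fix D E P assume D: "convex D" "0 \<in> D" "dimm D E" and near: "\<exists>d>0. \<forall>z\<in>ball 0 d. E z = e (z + b)" and P: "P \<in> closure D" "P \<in> K0" "\<not> extendable D E P"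
  have E0: "E 0 = e b" using near by force
  have "\<not> ends_radially E P 0" proof
   assume er: "ends_radially E P 0"
   obtain t x where x: "t > 0" "x \<in> K" "norm (x - d) < ep" "P = cr t * x" using K0(4)[OF P(2)] by blast
   have "hits e b x" unfolding hits_def using D near P(1) er x(1) unfolding x(4) by (intro exI[of _ D] exI[of _ E] exI[of _ t]) (simp add: add.commute)
   hence "s0 \<in> V x" using s0a unfolding V_def b_def by simp
   thus False using s0V[OF x(2,3)] by blast
  qed
  hence ne: "\<not> ends_at {-1<..<0} (%t. E (P + cr (-t) * (0 - P))) s" if "s \<in> Sing" for s using that unfolding ends_radially_def by blast
  obtain rh where rho: "rh > 0" "ball P rh \<subseteq> K0" using P(2) oconeD(1)[OF K0(1)] open_contains_ball by blast
  obtain l c where l: "0 < l" "l < 1" "!!w. w \<in> D ==> cr l * w + c \<in> D ==> E (cr l * w + c) = E w" "cr l * 0 + c \<in> D" "norm (c / cr (1 - l) - P) < rh" by (rule end_trichotomy[OF D(1,3) P(1) D(2) ne P(3) rho(1)], assumption, rule that)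
  have "c / cr (1 - l) \<in> K0" using rho(2) l(5) by (auto simp: dist_norm norm_minus_commute)
  hence "cr (1 - l) * (c / cr (1 - l)) \<in> K0" by (rule oconeD(5)[OF K0(1)]) (use l in simp)
  hence cK: "c \<in> K" using K0(2) l(2) by (auto simp del: of_real_diff)
  have eq: "E (0 + c) = E 0" using l(3)[OF D(2) l(4)] by simp
  have E0I: "E 0 \<in> ?I" unfolding E0 b_def using sI[OF s0a] .
  show ?thesis using l(4) nr[unfolded no_return_def, rule_format, of D E 0 c] D E0I cK using E0I unfolding eq by simp
 qed
qed

section \<open>Completeness spreads over all regular points\<close>

lemma dimm_nbhd:
 assumes "dimm_at E z" "rh > 0" obtains W where "openin topX W" "E z \<in> W" "W \<subseteq> E ` ball z rh"
proof -
 obtain U ph a b e where U: "(U,ph)\<in>atlas X" "a > 0" "e > 0" "!!w. w \<in> ball z e ==> E w \<in> U & ph (E w) = cr a * w + b" using assms(1) unfolding dimm_at_def by auto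
 define r where "r = min e rh"
 have r: "r > 0" "r <= e" "r <= rh" using U assms by (auto simp: r_def)
 let ?W = "{x\<in>U. ph x \<in> ball (cr a * z + b) (a * r)}"
 show ?thesis proof (rule that[of ?W])
  show "openin topX ?W" by (rule chart_open_vimage[OF U(1)]) auto
  show "E z \<in> ?W" using U(4)[of z] U(2,3) r by simp
  show "?W \<subseteq> E ` ball z rh" proof
   fix x assume x: "x \<in> ?W"
   define w where "w = (ph x - b) / cr a"
   have aw: "cr a * w + b = ph x" using U(2) by (simp add: w_def)
   have "a * dist z w = dist (cr a * z + b) (ph x)" unfolding aw[symmetric] using U(2) by (simp add: dist_norm norm_mult flip: right_diff_distrib)
   moreover have "dist (cr a * z + b) (ph x) < a * r" using x by simp
   ultimately have "a * dist z w < a * r" by linarith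
   hence w: "w \<in> ball z r" using U(2) by simp
   thus "x \<in> E ` ball z rh" using U(4)[of w] aw r chart_inj[OF U(1)] x w r by (auto dest: inj_onD)
  qed
 qed
qed

lemma Reg_open: "openin topX Reg" using Hausdorff_X finite_Sing Sing_subset unfolding regular_points_def by (simp add: closedin_Hausdorff_finite openin_diff)

text \<open>Each singularity has a connected punctured neighbourhood, so it can be added to the part
  that contains this neighbourhood; the connected surface itself would be split.\<close>

lemma Reg_not_split:
 assumes A: "openin topX A" "A ~= {}" and B: "openin topX B" "B ~= {}" and AB: "A Un B = Reg" "A Int B = {}"
 shows False
proof -
 have ex: "\<exists>N. openin topX N & s \<in> N & N - {s} \<subseteq> Reg & connectedin topX (N - {s})" if s: "s \<in> Sing" for s proof -
  obtain k rh ep N Q where "cone_point X s k rh ep N Q" using cone_pointE[OF s] by blast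
  then interpret cone_point X s k rh ep N Q .
  show ?thesis using N_open openin_subset N_Sing punctured_connected N_open N_Sing by (fastforce simp: regular_points_def)
 qed
 from bchoice[of Sing] ex obtain N where N: "!!s. s \<in> Sing ==> openin topX (N s) & s \<in> N s & N s - {s} \<subseteq> Reg & connectedin topX (N s - {s})" by metis
 have dich: "N s - {s} \<subseteq> B" if s: "s \<in> Sing" "\<not> N s - {s} \<subseteq> A" for s proof -
  have "connectedin topX (N s - {s})" "N s - {s} \<subseteq> A Un B" using N[OF s(1)] AB by auto
  thus ?thesis using A(1) B(1) AB(2) unfolding connectedin using s(2) \<open>N s - {s} \<subseteq> A Un B\<close> by blast
 qed
 define A' where "A' = A Un {s\<in>Sing. N s - {s} \<subseteq> A}"
 define B' where "B' = B Un {s\<in>Sing. \<not> N s - {s} \<subseteq> A}"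
 have disj: "A Int Sing = {}" "B Int Sing = {}" using AB(1) by (auto simp: regular_points_def)
 have oA: "openin topX A'" proof (subst openin_subopen, intro ballI)
  fix x assume "x \<in> A'"
  then consider "x \<in> A" | "x \<in> Sing" "N x - {x} \<subseteq> A" unfolding A'_def by blast
  thus "\<exists>T. openin topX T & x \<in> T & T \<subseteq> A'" proof cases
   case 1
   thus ?thesis using A(1) unfolding A'_def by blast
  next case 2
   thus ?thesis using N[OF 2(1)] unfolding A'_def by (intro exI[of _ "N x"]) blast
  qed
 qed
 have oB: "openin topX B'" proof (subst openin_subopen, intro ballI)
  fix x assume "x \<in> B'"
  then consider "x \<in> B" | "x \<in> Sing" "\<not> N x - {x} \<subseteq> A" unfolding B'_def by blast
  thus "\<exists>T. openin topX T & x \<in> T & T \<subseteq> B'" proof cases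
   case 1
   thus ?thesis using B(1) unfolding B'_def by blast
  next case 2
   thus ?thesis using N[OF 2(1)] dich[OF 2] unfolding B'_def by (intro exI[of _ "N x"]) blast
  qed
 qed
 have cov: "topspace topX \<subseteq> A' Un B'" using AB(1) unfolding A'_def B'_def regular_points_def by blast
 have "A' Int B' = {}" using AB(2) disj unfolding A'_def B'_def by blast
 thus False using connected_X oA oB cov A(2) B(2) unfolding connected_space_def A'_def B'_def by blast
qed

lemma good_reg: "good K x ==> x \<in> Reg" unfolding good_def using dimm_reg by fastforce

lemma complete_good:
 assumes e: "0 < ep" "dimm (ball 0 ep) e" and K: "ocone K1" "K1 \<subseteq> K" "complete e K1"
 shows "good K (e 0)"
proof -
 obtain F de where F: "dimm K1 F" "de > 0" "!!w. w \<in> K1 ==> norm w < de ==> F w = e w" using K(3) unfolding complete_def by blast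
 define r where "r = min de ep"
 have r: "r > 0" using e F by (simp add: r_def)
 have db: "dimm (ball 0 r) e" by (rule dimm_subset[OF e(2)]) (auto simp: r_def)
 have ag: "F z = e z" if "z \<in> K1" "z \<in> ball 0 r" for z using F(3) that by (simp add: r_def)
 obtain H where "dimm (K1 Un ball 0 r) H" "!!z. z \<in> K1 ==> H z = F z" "!!z. z \<in> ball 0 r ==> H z = e z" by (rule dimm_glue2[OF F(1) db ag], assumption+, rule that)
 thus ?thesis unfolding good_def using K r by (intro exI[of _ K1] exI[of _ r] exI[of _ H]) auto
qed

lemma good_cone_points:
 assumes "ocone K'" "K' \<subseteq> K" "dimm K' F" "x \<in> K'" shows "good K (F x)"
proof -
 obtain r where r: "r > 0" "ball x r \<subseteq> K'" using assms oconeD(1) open_contains_ball by blast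
 have "dimm (K' Un ball 0 r) (%z. F (z + x))" proof (rule dimm_subset[OF dimm_shift[OF assms(3)]])
  show "open (K' Un ball 0 r)" using oconeD(1)[OF assms(1)] by blast
  show "K' Un ball 0 r \<subseteq> {z. z + x \<in> K'}" proof
   fix z assume "z \<in> K' Un ball 0 r"
   then consider "z \<in> K'" | "z + x \<in> ball x r" by (auto simp: dist_norm)
   thus "z \<in> {z. z + x \<in> K'}" using ocone_add[OF assms(1) _ assms(4)] r(2) by cases auto
  qed
 qed
 thus ?thesis unfolding good_def using assms(1,2) r(1) by (intro exI[of _ K'] exI[of _ r] exI[of _ "%z. F (z + x)"]) simp
qed

text \<open>Near the apex a shift of the base point is absorbed by the disc. Far out it is absorbed
  by passing to the narrower cone \<open>K2\<close>, whose points \<open>cr t * y\<close> are at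
  distance at least \<open>t * r / 2\<close> from the boundary of \<open>K'\<close>.\<close>

lemma good_open: "openin topX {x. good K x}"
proof (subst openin_subopen, safe)
 fix x assume "good K x"
 then obtain K' ep F where F: "ocone K'" "K' \<subseteq> K" "0 < ep" "dimm (K' Un ball 0 ep) F" "F 0 = x" unfolding good_def by blast
 obtain k where k: "k \<in> K'" using oconeD(3)[OF F(1)] by blast
 obtain r where r: "r > 0" "ball k r \<subseteq> K'" using k oconeD(1)[OF F(1)] open_contains_ball by blast
 have r2: "r / 2 > 0" using r by simp
 obtain K2 where K2: "ocone K2" "K2 \<subseteq> K'" "!!z. z \<in> K2 ==> \<exists>t>0. \<exists>y\<in>K'. norm (y - k) < r / 2 & z = cr t * y" using ocone_around[OF F(1) k r2] by metis
 \<comment> \<open>For \<open>t <= 2 / r * rh\<close> the point \<open>cr t * y\<close>, shifted by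
   \<open>h\<close>, has norm below \<open>rh * M\<close>, hence is in the disc.\<close>
 define M where "M = 1 + 2 / r * (norm k + r)"
 have M: "M >= 1" using r by (simp add: M_def)
 define rh where "rh = ep / (2 * M)"
 have rho: "rh > 0" "rh * M < ep" "rh <= ep / 2" using F(3) M by (auto simp: rh_def field_simps)
 have gd: "good K (F h)" if h: "norm h < rh" for h proof -
  have "dimm (K2 Un ball 0 (ep / 2)) (%z. F (z + h))" proof (rule dimm_subset[OF dimm_shift[OF F(4)]])
   show "open (K2 Un ball 0 (ep / 2))" using oconeD(1)[OF K2(1)] by blast
   show "K2 Un ball 0 (ep / 2) \<subseteq> {z. z + h \<in> K' Un ball 0 ep}" proof
    fix z assume z: "z \<in> K2 Un ball 0 (ep / 2)"
    show "z \<in> {z. z + h \<in> K' Un ball 0 ep}" proof (cases "z \<in> K2")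
     case False
     hence "norm (z + h) < ep" using z norm_triangle_ineq[of z h] h rho(3) by simp
     thus ?thesis by simp
    next case True
     obtain t y where y: "t > 0" "y \<in> K'" "norm (y - k) < r / 2" "z = cr t * y" using K2(3)[OF True] by blast
     show ?thesis proof (cases "norm h < t * (r / 2)")
      case True
      have "norm (h / cr t) < r / 2" using True y(1) by (simp add: norm_divide field_simps)
      hence "norm ((y - k) + h / cr t) < r" using norm_triangle_ineq[of "y - k" "h / cr t"] y(3) by linarith
      hence "cr t * (y + h / cr t) \<in> K'" using r(2) oconeD(5)[OF F(1) _ y(1)] by (fastforce simp: dist_norm norm_minus_commute algebra_simps)
      thus ?thesis using y(1,4) by (simp add: distrib_left)
     next case False
      hence t: "t <= 2 / r * rh" using h r(1) by (simp add: field_simps)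
      have "t * norm y <= (2 / r * rh) * (norm k + r)" using norm_triangle_ineq[of k "y - k"] y(3) r(1) t y(1) by (intro mult_mono) auto
      hence "norm (z + h) < rh + (2 / r * rh) * (norm k + r)" using y(1,4) norm_triangle_ineq[of z h] h by (simp add: norm_mult)
      also have "... = rh * M" by (simp add: M_def algebra_simps)
      finally show ?thesis using rho(2) by simp
     qed
    qed
   qed
  qed
  thus ?thesis unfolding good_def using K2(1,2) F(2,3) by (intro exI[of _ K2] exI[of _ "ep / 2"] exI[of _ "%z. F (z + h)"]) auto
 qed
 have "dimm_at F 0" using F(3,4) by (intro dimm_atD[OF F(4)]) simp
 then obtain W where W: "openin topX W" "F 0 \<in> W" "W \<subseteq> F ` ball 0 rh" using dimm_nbhd rho(1) by blast
 have "W \<subseteq> {x. good K x}" proof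
  fix y assume "y \<in> W"
  then obtain h where "norm h < rh" "y = F h" using W(3) by auto
  thus "y \<in> {x. good K x}" using gd by simp
 qed
 thus "\<exists>T. openin topX T & x \<in> T & T \<subseteq> {x. good K x}" using W F(5) by blast
qed

text \<open>\<open>forward_complete\<close> moves goodness back over distances for which a disc is
  immersed, and along a compact segment finitely many such steps suffice.\<close>

lemma good_backward:
 assumes dec: "decided K G" and D: "convex D" "dimm D E" "z \<in> D" "z + v \<in> D" "v \<in> K" and g: "good K (E (z + v))"
 shows "good K (E z)"
proof -
 have K: "ocone K" using decidedD(1)[OF dec] .
 have v0: "norm v > 0" using D(5) oconeD(4)[OF K] by auto
 let ?p = "%t. z + cr t * v"
 have seg: "?p t \<in> D" if "0 <= t" "t <= 1" for t by (rule convex_line_mem[OF D(1), of z 0 v 1 t]) (use D that in auto)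
 have c: "compact (?p ` {0..1})" by (intro compact_continuous_image continuous_intros) simp
 have s: "?p ` {0..1} \<subseteq> D" using seg by auto
 obtain ep where eps: "ep > 0" "(\<Union>x\<in>?p ` {0..1}. ball x ep) \<subseteq> D" using compact_subset_open_imp_ball_epsilon_subset[OF c dimm_open[OF D(2)] s] by blast
 have bl: "ball (?p t) ep \<subseteq> D" if "0 <= t" "t <= 1" for t using eps(2) that by (meson UN_I UN_upper atLeastAtMost_iff image_eqI order_trans)
 have step: "good K (E (?p t'))" if h: "0 <= t'" "t' < t" "t <= 1" "(t - t') * norm v < ep" "good K (E (?p t))" for t t' proof -
  let ?e = "%w. E (w + ?p t')"
  have de: "dimm (ball 0 ep) ?e" proof (rule dimm_subset[OF dimm_shift[OF D(2)] open_ball])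
   show "ball 0 ep \<subseteq> {w. w + ?p t' \<in> D}" proof
    fix w :: complex assume "w \<in> ball 0 ep"
    hence "w + ?p t' \<in> ball (?p t') ep" by (simp add: dist_norm)
    moreover have "ball (?p t') ep \<subseteq> D" by (rule bl) (use h in auto)
    ultimately show "w \<in> {w. w + ?p t' \<in> D}" by blast
   qed
  qed
  have dK: "dimm (K Int ball 0 ep) ?e" by (rule dimm_subset[OF de open_Int[OF oconeD(1)[OF K] open_ball]]) blast
  have vK: "cr (t - t') * v \<in> K" by (rule oconeD(5)[OF K D(5)]) (use h in simp)
  have vn: "norm (cr (t - t') * v) < ep" using h by (simp add: norm_mult del: of_real_diff)
  have "cr (t - t') * v + ?p t' = ?p t" by (simp add: algebra_simps)
  hence gg: "good K (?e (cr (t - t') * v))" using h(5) by (simp only:)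
  obtain K1 where "ocone K1" "K1 \<subseteq> K" "complete ?e K1" using forward_complete[OF dec dK vK vn gg] by blast
  hence "good K (?e 0)" using complete_good[OF eps(1) de] by blast
  thus ?thesis by simp
 qed
 define et where "et = ep / (2 * norm v)"
 have eta: "et > 0" "et * norm v < ep" using eps v0 by (auto simp: et_def)
 have all: "good K (E (?p (max 0 (1 - real n * et))))" for n proof (induction n)
  case 0
  thus ?case using g by simp
 next case (Suc n)
  let ?t = "max 0 (1 - real n * et)" and ?t' = "max 0 (1 - real (Suc n) * et)"
  have le: "?t' <= ?t" "?t - ?t' <= et" "0 <= ?t'" "?t <= 1" using eta(1) by (auto simp: algebra_simps max_def)
  show ?case proof (cases "?t' = ?t")
   case False
   have "(?t - ?t') * norm v <= et * norm v" using le v0 by (intro mult_right_mono) auto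
   thus ?thesis using step[of ?t' ?t] le False Suc eta(2) by simp
  next case True
   show ?thesis unfolding True by (rule Suc)
  qed
 qed
 obtain n :: nat where "real n * et > 1" using reals_Archimedean3[OF eta(1)] by blast
 hence "max 0 (1 - real n * et) = 0" by simp
 thus ?thesis using all[of n] by simp
qed

text \<open>Take a point \<open>y\<close> that is not good but a limit of good ones. In a chart the
  points of \<open>y + K\<close> are not good, or \<open>good_backward\<close> would reach
  \<open>y\<close>. A small transversal of good points next to \<open>y\<close> sends its lines into
  \<open>y + K\<close>, from where no good point is reached again; so it has no return, and
  \<open>no_return_good\<close> gives a complete cone at one of its points. This cone consists of
  good points but enters \<open>y + K\<close>.\<close>

lemma good_everywhere:
 assumes dec: "decided K G" and ex: "good K x0" and x: "x \<in> Reg"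
 shows "good K x"
proof (rule ccontr)
 assume nx: "\<not> good K x"
 have K: "ocone K" using decidedD(1)[OF dec] .
 define R where "R = {y\<in>Reg. \<not> good K y}"
 \<comment> \<open>The good points form a nonempty open set; were the remaining regular points open
   too, \<open>Reg\<close> would be split.\<close>
 have "\<not> openin topX R" proof
  assume o: "openin topX R"
  show False by (rule Reg_not_split[OF good_open[of K] _ o]) (use ex x nx good_reg in \<open>auto simp: R_def\<close>)
 qed
 hence nall: "\<not> (\<forall>x\<in>R. \<exists>T. openin topX T & x \<in> T & T \<subseteq> R)" by (subst (asm) openin_subopen)
 have gen: "\<exists>y\<in>A. \<not> Q y" if "\<not> (\<forall>y\<in>A. Q y)" for A :: "'a set" and Q using that by blast
 obtain y where y0: "y \<in> R" "\<not> (\<exists>T. openin topX T & y \<in> T & T \<subseteq> R)" by (rule bexE[OF gen[OF nall]], rule that)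
 have y2: "\<not> W \<subseteq> R" if "openin topX W" "y \<in> W" for W proof
  assume "W \<subseteq> R"
  hence "\<exists>T. openin topX T & y \<in> T & T \<subseteq> R" using that by (intro exI[of _ W] conjI)
  thus False by (rule notE[OF y0(2)])
 qed
 note y = y0(1) y2
 have yR: "y \<in> Reg" "\<not> good K y" using y(1) by (auto simp: R_def)
 obtain U ph ps r0 where U: "(U,ph) \<in> atlas X" "y \<in> U" "r0 > 0" "dimm (ball (ph y) (4*r0)) ps"
  "!!v. v \<in> ball (ph y) (4*r0) ==> ps v \<in> U & ph (ps v) = v" "!!x. x \<in> U ==> ps (ph x) = x" by (rule chart_inverse[OF yR(1)], rule that)
 let ?F = "%z. ps (z + ph y)"
 define rh where "rh = 4 * r0"
 have rho: "rh > 0" using U by (simp add: rh_def)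
 have dF: "dimm (ball 0 rh) ?F" proof (rule dimm_subset[OF dimm_shift[OF U(4)] open_ball])
  show "ball 0 rh \<subseteq> {z. z + ph y \<in> ball (ph y) (4 * r0)}" by (auto simp: rh_def dist_norm)
 qed
 have injF: "inj_on ?F (ball 0 rh)" proof (rule inj_onI)
  fix z w :: complex assume h: "z \<in> ball 0 rh" "w \<in> ball 0 rh" "?F z = ?F w"
  have "ph (?F z) = z + ph y" "ph (?F w) = w + ph y" using h(1,2) U(5) by (simp_all add: rh_def dist_norm)
  thus "z = w" unfolding h(3) by simp
 qed
 have F0: "?F 0 = y" using U(2,6) by simp
 have bF: "good K (?F z)" if "z \<in> ball 0 rh" "z + v \<in> ball 0 rh" "v \<in> K" "good K (?F (z + v))" for z v by (rule good_backward[OF dec convex_ball dF that])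
 have RK: "\<not> good K (?F w)" if "w \<in> K" "w \<in> ball 0 rh" for w using bF[of 0 w] that F0 yR(2) rho by auto
 obtain k0 where k0: "k0 \<in> K" using oconeD(3)[OF K] by blast
 have rho2: "rh / 2 > 0" using rho by simp
 obtain t0 where t0: "0 < t0" "cr t0 * k0 \<in> K" "norm (cr t0 * k0) < rh / 2" using ocone_small[OF K rho2 k0] by blast
 define k where "k = cr t0 * k0"
 have k: "k \<in> K" "norm k < rh / 2" using t0 by (auto simp: k_def)
 have k00: "norm k > 0" using k(1) oconeD(4)[OF K] by auto
 obtain r where r: "r > 0" "ball k r \<subseteq> K" using k(1) oconeD(1)[OF K] open_contains_ball by blast
 \<comment> \<open>Small against \<open>k\<close>: from a point within \<open>2 * de\<close> of 0, a
   step within \<open>de\<close> of \<open>k\<close> ends in \<open>K\<close> and in the chart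
   disc.\<close>
 define de where "de = min (min r (rh / 2)) (norm k) / 4"
 have del: "de > 0" "4 * de <= r" "4 * de <= rh / 2" "4 * de <= norm k" using r rho k00 by (auto simp: de_def)
 have dF0: "dimm_at ?F 0" by (rule dimm_atD[OF dF]) (use rho in simp)
 obtain W where W: "openin topX W" "?F 0 \<in> W" "W \<subseteq> ?F ` ball 0 de" using dimm_nbhd[OF dF0 del(1)] by blast
 have oW: "openin topX (W Int Reg)" using W(1) Reg_open by (rule openin_Int)
 have "\<not> W Int Reg \<subseteq> R" by (rule y(2)[OF oW]) (use W(2) F0 yR in auto)
 then obtain x where x: "x \<in> W" "good K x" unfolding R_def by blast
 then obtain p where "p \<in> ball 0 de" "x = ?F p" using W(3) by blast
 hence p: "norm p < de" "good K (?F p)" using x(2) by simp_all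
 define u where "u = \<i> * k"
 have u0: "u ~= 0" using k00 by (auto simp: u_def)
 have op: "open {z\<in>ball 0 rh. ?F z \<in> {x. good K x}}" by (rule dimm_open_vimage[OF dF good_open])
 have pm: "p \<in> {z\<in>ball 0 rh. ?F z \<in> {x. good K x}}" using p del rho by auto
 obtain r1 where r1: "r1 > 0" "ball p r1 \<subseteq> {z\<in>ball 0 rh. ?F z \<in> {x. good K x}}" using op pm open_contains_ball by blast
 define r2 where "r2 = min r1 de"
 have r2: "r2 > 0" "r2 <= r1" "r2 <= de" using r1 del by (auto simp: r2_def)
 define a where "a = r2 / (2 * norm u)"
 have a: "a > 0" "a * norm u < r2" using r2 u0 by (auto simp: a_def)
 have us: "norm (cr s * u) < r2" if "\<bar>s\<bar> < a" for s using a(2) that mult_right_mono[of "\<bar>s\<bar>" a "norm u"] by (simp add: norm_mult)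
 obtain K' where K': "ocone K'" "K' \<subseteq> K" "k \<in> K'" "!!z. z \<in> K' ==> \<exists>t>0. \<exists>x\<in>K. norm (x - k) < de & z = cr t * x" using ocone_around[OF K k(1) del(1)] by blast
 have xu: "Im (cnj x * u) > 0" if "norm (x - k) < de" for x proof -
  have "Im (cnj x * u) = inner x k" by (simp add: u_def inner_complex_def)
  also have "... = (norm k)\<^sup>2 + inner (x - k) k" by (simp add: inner_diff_left power2_norm_eq_inner)
  also have "... >= (norm k)\<^sup>2 - norm (x - k) * norm k" using Cauchy_Schwarz_ineq2[of "x - k" k] by linarith
  finally have 1: "Im (cnj x * u) >= (norm k)\<^sup>2 - norm (x - k) * norm k" .
  have "norm (x - k) * norm k < norm k * norm k" using that del(4) k00 del(1) by (intro mult_strict_right_mono) auto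
  thus ?thesis using 1 by (simp add: power2_eq_square)
 qed
 have K'u: "Im (cnj z * u) ~= 0" if "z \<in> K'" for z proof -
  obtain t x where "t > 0" "norm (x - k) < de" "z = cr t * x" using K'(4)[OF \<open>z \<in> K'\<close>] by blast
  moreover have "Im (cnj (cr t * x) * u) = t * Im (cnj x * u)" by (simp add: algebra_simps)
  ultimately show ?thesis using xu[of x] by simp
 qed
 have hitR: "p + cr s * u + x \<in> ball 0 rh & p + cr s * u + x \<in> K" if h: "\<bar>s\<bar> < a" "norm (x - k) < de" for s x proof -
  have "norm (p + cr s * u + (x - k)) < 3 * de" using norm_triangle_ineq[of "p + cr s * u" "x - k"] norm_triangle_ineq[of p "cr s * u"] p(1) us[OF h(1)] r2 h(2) by linarith
  hence n: "norm (p + cr s * u + x - k) < 3 * de" by (simp add: algebra_simps)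
  hence "p + cr s * u + x \<in> ball k r" using del by (simp add: dist_norm norm_minus_commute)
  moreover have "norm (p + cr s * u + x) < rh" using norm_triangle_ineq[of "p + cr s * u + x - k" k] n k(2) del by simp
  ultimately show ?thesis using r(2) by auto
 qed
 let ?e = "%z. ?F (z + p)"
 have b2: "z + p \<in> ball p r1" "z + p \<in> ball 0 rh" if "z \<in> ball 0 r2" for z proof -
  show "z + p \<in> ball p r1" using that r2 by (simp add: dist_norm)
  thus "z + p \<in> ball 0 rh" using r1(2) by blast
 qed
 have de: "dimm (ball 0 r2) ?e" by (rule dimm_subset[OF dimm_shift[OF dF] open_ball]) (use b2 in blast)
 have ie: "inj_on ?e (ball 0 r2)" proof (rule inj_onI)
  fix z w assume h: "z \<in> ball 0 r2" "w \<in> ball 0 r2" "?e z = ?e w"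
  have "z + p = w + p" by (rule inj_onD[OF injF h(3) b2(2)[OF h(1)] b2(2)[OF h(2)]])
  thus "z = w" by simp
 qed
 let ?I = "(%s. ?e (cr s * u)) ` {-a<..<a}"
 have gI: "good K (?e (cr s * u))" if "\<bar>s\<bar> < a" for s using b2(1)[of "cr s * u"] us[OF that] r1(2) by auto
 have nr: "no_return K' ?I" unfolding no_return_def proof (intro allI impI notI)
  fix S F' z d assume S: "convex S" "dimm S F'" "z \<in> S" "z + d \<in> S" "d \<in> K'" and I: "F' z \<in> ?I" "F' (z + d) \<in> ?I"
  obtain s where s0: "s \<in> {-a<..<a}" and sF: "F' z = ?e (cr s * u)" using I(1) by blast
  have s: "\<bar>s\<bar> < a" "F' z = ?e (cr s * u)" using s0 sF by auto
  obtain s' where s0': "s' \<in> {-a<..<a}" and sF': "F' (z + d) = ?e (cr s' * u)" using I(2) by blast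
  have s': "\<bar>s'\<bar> < a" "F' (z + d) = ?e (cr s' * u)" using s0' sF' by auto
  obtain ta x where x: "ta > 0" "x \<in> K" "norm (x - k) < de" "d = cr ta * x" using K'(4)[OF S(5)] by blast
  define q where "q = p + cr s * u"
  have qe: "?e (cr s * u) = ?F q" by (simp add: q_def add.commute)
  have qb: "q \<in> ball 0 rh" using b2(2)[of "cr s * u"] us[OF s(1)] by (simp add: q_def add.commute)
  obtain mu e0 where g: "mu > 0" "e0 > 0" "!!h. norm h < e0 ==> F' (z + h) = ?F (q + cr mu * h)" using dimm_germ[OF dimm_atD[OF S(2,3)] dimm_atD[OF dF qb]] s(2) qe by metis
  have agree: "?F (q + cr mu * h) = F' (z + h)" if h: "z + h \<in> S" "q + cr mu * h \<in> ball 0 rh" for h proof -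
   have e: "cr mu * w + (q - cr mu * z) = q + cr mu * (w - z)" for w by (simp add: algebra_simps)
   have "?F (cr mu * (z + h) + (q - cr mu * z)) = F' (z + h)" proof (rule dimm_affine_unique[OF S(1,2) convex_ball dF g(1), of "S Int {w. cr mu * w + (q - cr mu * z) \<in> ball 0 rh} Int ball z e0"])
    show "open (S Int {w. cr mu * w + (q - cr mu * z) \<in> ball 0 rh} Int ball z e0)" using dimm_open[OF S(2)] open_affine_preimage[of "ball 0 rh"] by blast
    have "z \<in> S Int {w. cr mu * w + (q - cr mu * z) \<in> ball 0 rh} Int ball z e0" using S(3) qb g by simp
    thus "S Int {w. cr mu * w + (q - cr mu * z) \<in> ball 0 rh} Int ball z e0 ~= {}" by blast
    fix w assume w: "w \<in> S Int {w. cr mu * w + (q - cr mu * z) \<in> ball 0 rh} Int ball z e0"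
    hence "norm (w - z) < e0" by (auto simp: dist_norm norm_minus_commute)
    from g(3)[OF this] show "w \<in> S & cr mu * w + (q - cr mu * z) \<in> ball 0 rh & ?F (cr mu * w + (q - cr mu * z)) = F' w" using w unfolding e by simp
   next
    show "cr mu * (z + h) + (q - cr mu * z) \<in> ball 0 rh" using h(2) unfolding e by simp
   qed (rule h(1))
   thus ?thesis unfolding e by simp
  qed
  have qx: "q + x \<in> ball 0 rh" "q + x \<in> K" using hitR[OF s(1) x(3)] by (auto simp: q_def)
  have qt: "q + cr t * x \<in> ball 0 rh" if "0 <= t" "t <= 1" for t by (rule convex_line_mem[OF convex_ball, of q 0 x 0 rh 1]) (use qb qx that in auto)
  have md: "cr mu * d = cr (mu * ta) * x" by (simp add: x(4))
  \<comment> \<open>If the line returns no later than at \<open>q + x\<close>, the return happens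
    inside the chart, where its direction is transversal to \<open>u\<close>. Otherwise it passes
    \<open>q + x\<close>, which is not good.\<close>
  show False proof (cases "mu * ta <= 1")
   case True
   have in1: "q + cr mu * d \<in> ball 0 rh" unfolding md by (rule qt) (use True g x in auto)
   have "?F (q + cr mu * d) = ?F (p + cr s' * u)" using agree[OF S(4) in1] s'(2) by (simp add: add.commute)
   hence "q + cr mu * d = p + cr s' * u" by (rule inj_onD[OF injF]) (use in1 b2(2)[of "cr s' * u"] us[OF s'(1)] in \<open>auto simp: add.commute\<close>)
   hence e1: "cr (mu * ta) * x = cr (s' - s) * u" unfolding md q_def by (simp add: algebra_simps)
   have "Im (cnj (cr (mu * ta) * x) * u) = (mu * ta) * Im (cnj x * u)" by (simp add: algebra_simps)
   moreover have "Im (cnj (cr (s' - s) * u) * u) = 0" by (simp add: algebra_simps)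
   ultimately have "(mu * ta) * Im (cnj x * u) = 0" unfolding e1 by simp
   thus False using xu[OF x(3)] g(1) x(1) by simp
  next case False
   define t where "t = 1 / (mu * ta)"
   have t: "0 < t" "t < 1" "t * (mu * ta) = 1" using False g x by (auto simp: t_def)
   have zt: "z + cr t * d \<in> S" by (rule convex_line_mem[OF S(1), of z 0 d 1]) (use S t in auto)
   have me: "cr mu * (cr t * d) = x" proof -
    have "cr mu * (cr t * d) = cr (t * (mu * ta)) * x" by (simp add: x(4))
    thus ?thesis unfolding t(3) by simp
   qed
   have "F' (z + cr t * d) = ?F (q + x)" using agree[OF zt] qx(1) unfolding me by simp
   hence nb: "\<not> good K (F' (z + cr t * d))" using RK[OF qx(2,1)] by simp
   have dK: "cr (1 - t) * d \<in> K" by (rule oconeD(5)[OF K]) (use S(5) K'(2) t in auto)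
   have sum: "(z + cr t * d) + cr (1 - t) * d = z + d" by (simp add: algebra_simps)
   have "good K (F' (z + cr t * d))" by (rule good_backward[OF dec S(1,2) zt _ dK]; unfold sum) (use S(4) s'(2) gI[OF s'(1)] in simp_all)
   thus False using nb by blast
  qed
 qed
 obtain s where s: "\<bar>s\<bar> < a" "good K' (?e (cr s * u))" using no_return_good[OF K'(1) r2(1) de ie u0 K'u a nr] by blast
 define q where "q = p + cr s * u"
 have qe: "?e (cr s * u) = ?F q" by (simp add: q_def add.commute)
 have qb: "q \<in> ball 0 rh" using b2(2)[of "cr s * u"] us[OF s(1)] by (simp add: q_def add.commute)
 obtain K2 ep F' where F': "ocone K2" "K2 \<subseteq> K'" "0 < ep" "dimm (K2 Un ball 0 ep) F'" "F' 0 = ?F q" using s(2) unfolding good_def qe by blast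
 have d0: "dimm_at F' 0" by (rule dimm_atD[OF F'(4)]) (use F'(3) in simp)
 obtain mu e0 where g: "mu > 0" "e0 > 0" "!!h. norm h < e0 ==> F' (0 + h) = ?F (q + cr mu * h)" using dimm_germ[OF d0 dimm_atD[OF dF qb] F'(5)] by blast
 obtain k2 where k2: "k2 \<in> K2" using oconeD(3)[OF F'(1)] by blast
 obtain ta x where x: "ta > 0" "x \<in> K" "norm (x - k) < de" "k2 = cr ta * x" using K'(4) F'(2) k2 by blast
 have dK2: "dimm K2 F'" by (rule dimm_subset[OF F'(4) oconeD(1)[OF F'(1)]]) blast
 have xK2: "cr (1 / mu) * x \<in> K2" proof -
  have "cr (1 / (mu * ta)) * k2 \<in> K2" by (rule oconeD(5)[OF F'(1) k2]) (use g x in simp)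
  thus ?thesis using x(1,4) by simp
 qed
 have qx: "q + x \<in> ball 0 rh" "q + x \<in> K" using hitR[OF s(1) x(3)] by (auto simp: q_def)
 have me: "cr mu * (cr (1 / mu) * x) + q = q + x" using g(1) by simp
 have "?F (cr mu * (cr (1 / mu) * x) + q) = F' (cr (1 / mu) * x)" proof (rule dimm_affine_unique[OF oconeD(2)[OF F'(1)] dK2 convex_ball dF g(1), of "K2 Int {w. cr mu * w + q \<in> ball 0 rh} Int ball 0 e0"])
  have o2: "open ({w. cr mu * w + q \<in> ball 0 rh} Int ball 0 e0)" using open_affine_preimage[of "ball 0 rh" mu q] by blast
  thus "open (K2 Int {w. cr mu * w + q \<in> ball 0 rh} Int ball 0 e0)" using oconeD(1)[OF F'(1)] by (simp add: open_Int Int_assoc)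
  have cl0: "0 \<in> closure K2" using ocone_closure[OF F'(1), of 0] by simp
  show "K2 Int {w. cr mu * w + q \<in> ball 0 rh} Int ball 0 e0 ~= {}" using meets_closure[OF cl0 o2] qb g(2) by (simp add: Int_assoc)
  fix w assume w: "w \<in> K2 Int {w. cr mu * w + q \<in> ball 0 rh} Int ball 0 e0"
  hence "norm w < e0" by simp
  from g(3)[OF this] show "w \<in> K2 & cr mu * w + q \<in> ball 0 rh & ?F (cr mu * w + q) = F' w" using w by (simp add: add.commute)
 next
  show "cr mu * (cr (1 / mu) * x) + q \<in> ball 0 rh" unfolding me by (rule qx(1))
 qed (rule xK2)
 hence "F' (cr (1 / mu) * x) = ?F (q + x)" unfolding me by simp
 moreover have "good K (F' (cr (1 / mu) * x))" using good_cone_points[OF F'(1) _ dK2 xK2] F'(2) K'(2) by blast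
 ultimately show False using RK[OF qx(2,1)] by simp
qed

section \<open>Trajectories as lines in immersed domains\<close>

lemma straight_iff:
 "straight_path X d I ga \<longleftrightarrow> (\<forall>t\<in>I. \<exists>E. dimm_at E (cr t * d) & (\<exists>e>0. \<forall>u\<in>I. \<bar>u - t\<bar> < e --> ga u = E (cr u * d)))"
 (is "?L \<longleftrightarrow> ?R")
proof
 assume L: ?L
 show ?R proof
  fix t assume t: "t \<in> I"
  have yR: "ga t \<in> Reg" using L t unfolding straight_path_def by blast
  obtain U ph ps r where U: "(U,ph) \<in> atlas X" "ga t \<in> U" "r > 0" "dimm (ball (ph (ga t)) (4*r)) ps"
   "!!v. v \<in> ball (ph (ga t)) (4*r) ==> ps v \<in> U & ph (ps v) = v" "!!x. x \<in> U ==> ps (ph x) = x" by (rule chart_inverse[OF yR], rule that)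
  have "\<forall>(U, ph) \<in> atlas X. ga t \<in> U -->
     (\<exists>a>0. \<exists>e>0. \<forall>u\<in>I. \<bar>u - t\<bar> < e --> ga u \<in> U & ph (ga u) = ph (ga t) + cr (a * (u - t)) * d)" using L t unfolding straight_path_def by blast
  from bspec[OF this U(1)] obtain a e where a: "a > 0" "e > 0" "!!u. u \<in> I ==> \<bar>u - t\<bar> < e ==> ga u \<in> U & ph (ga u) = ph (ga t) + cr (a * (u - t)) * d" using U(2) by auto
  let ?c = "ph (ga t) - cr a * (cr t * d)"
  let ?E = "%w. ps (cr a * w + ?c)"
  have "dimm_at ps (cr a * (cr t * d) + ?c)" using dimm_atD[OF U(4)] U(3) by simp
  hence "dimm_at ?E (cr t * d)" using a(1) by (rule dimm_at_affine)
  moreover have "ga u = ?E (cr u * d)" if u: "u \<in> I" "\<bar>u - t\<bar> < e" for u proof -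
   have "cr a * (cr u * d) + ?c = ph (ga u)" using a(3)[OF u] by (simp add: algebra_simps)
   hence "ps (cr a * (cr u * d) + ?c) = ps (ph (ga u))" by (simp only:)
   moreover have "ps (ph (ga u)) = ga u" by (rule U(6)) (use a(3)[OF u] in blast)
   ultimately show ?thesis by (simp only:)
  qed
  ultimately show "\<exists>E. dimm_at E (cr t * d) & (\<exists>e>0. \<forall>u\<in>I. \<bar>u - t\<bar> < e --> ga u = E (cr u * d))" using a(2) by blast
 qed
next
 assume R: ?R
 show ?L unfolding straight_path_def proof (intro ballI conjI)
  fix t assume t: "t \<in> I"
  obtain E e where E: "dimm_at E (cr t * d)" "e > 0" "!!u. u \<in> I ==> \<bar>u - t\<bar> < e ==> ga u = E (cr u * d)" using R t by blast
  have gt: "ga t = E (cr t * d)" using E(2,3) t by simp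
  show "ga t \<in> Reg" unfolding gt by (rule dimm_at_reg[OF E(1)])
  fix C assume C: "C \<in> atlas X"
  obtain U ph where Ce: "C = (U, ph)" by (cases C)
  have "\<exists>a>0. \<exists>e>0. \<forall>u\<in>I. \<bar>u - t\<bar> < e --> ga u \<in> U & ph (ga u) = ph (ga t) + cr (a * (u - t)) * d" if "ga t \<in> U" proof -
   have UA: "(U, ph) \<in> atlas X" using C Ce by simp
   have "E (cr t * d) \<in> U" using that gt by simp
   then obtain a b e2 where a: "a > 0" "e2 > 0" "!!w. w \<in> ball (cr t * d) e2 ==> E w \<in> U & ph (E w) = cr a * w + b" using dimm_at_chart[OF E(1) UA] by metis
   have nd: "norm d + 1 > 0" by (simp add: add_nonneg_pos)
   define e' where "e' = min e (e2 / (norm d + 1))"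
   have e': "e' > 0" using E(2) a(2) nd by (simp add: e'_def)
   have "ga u \<in> U & ph (ga u) = ph (ga t) + cr (a * (u - t)) * d" if u: "u \<in> I" "\<bar>u - t\<bar> < e'" for u proof -
    have "\<bar>u - t\<bar> * norm d < e2" using u(2) nd by (auto simp: e'_def field_simps algebra_simps)
    moreover have "norm (cr t * d - cr u * d) = \<bar>u - t\<bar> * norm d" unfolding left_diff_distrib[symmetric] of_real_diff[symmetric] norm_mult norm_of_real by (simp add: abs_minus_commute)
    ultimately have 1: "E (cr u * d) \<in> U" "ph (E (cr u * d)) = cr a * (cr u * d) + b" using a(3) by (auto simp: dist_norm)
    have 2: "ph (ga t) = cr a * (cr t * d) + b" unfolding gt using a(2,3) by simp
    show ?thesis using E(3) u using 1 unfolding 2 by (simp add: e'_def algebra_simps)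
   qed
   thus ?thesis using a(1) e' by blast
  qed
  thus "case C of (U, ph) => ga t \<in> U --> (\<exists>a>0. \<exists>e>0. \<forall>u\<in>I. \<bar>u - t\<bar> < e --> ga u \<in> U & ph (ga u) = ph (ga t) + cr (a * (u - t)) * d)" unfolding Ce by simp
 qed
qed

lemma straight_line:
 assumes "dimm D E" "mu > 0" "!!t. t \<in> I ==> p + cr (mu * (t - t0)) * d \<in> D"
 shows "straight_path X d I (%t. E (p + cr (mu * (t - t0)) * d))" unfolding straight_iff
proof
 fix t assume t: "t \<in> I"
 have e: "cr mu * (cr u * d) + (p - cr (mu * t0) * d) = p + cr (mu * (u - t0)) * d" for u by (simp add: algebra_simps)
 have "dimm_at E (cr mu * (cr t * d) + (p - cr (mu * t0) * d))" unfolding e using dimm_atD[OF assms(1) assms(3)[OF t]] .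
 hence "dimm_at (%w. E (cr mu * w + (p - cr (mu * t0) * d))) (cr t * d)" using assms(2) by (rule dimm_at_affine)
 thus "\<exists>E'. dimm_at E' (cr t * d) & (\<exists>e>0. \<forall>u\<in>I. \<bar>u - t\<bar> < e --> E (p + cr (mu * (u - t0)) * d) = E' (cr u * d))" using e by (intro exI[of _ "%w. E (cr mu * w + (p - cr (mu * t0) * d))"] conjI exI[of _ 1]) (simp_all only: zero_less_one, simp)
qed

lemma straight_localI:
 assumes "!!t. t \<in> I ==> \<exists>J et. open J & t \<in> J & straight_path X d J et & (\<forall>u\<in>J. ka u = et u)"
 shows "straight_path X d I ka" unfolding straight_iff
proof
 fix t assume t: "t \<in> I"
 obtain J et where J: "open J" "t \<in> J" "straight_path X d J et" "\<forall>u\<in>J. ka u = et u" using assms[OF t] by blast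
 obtain E e where E: "dimm_at E (cr t * d)" "e > 0" "!!u. u \<in> J ==> \<bar>u - t\<bar> < e ==> et u = E (cr u * d)" using J(2,3) unfolding straight_iff by blast
 obtain e2 where e2: "e2 > 0" "ball t e2 \<subseteq> J" using J(1,2) open_contains_ball by blast
 have "ka u = E (cr u * d)" if "\<bar>u - t\<bar> < min e e2" for u using e2(2) that J(4) E(3) that by (auto simp: dist_real_def abs_minus_commute)
 thus "\<exists>E. dimm_at E (cr t * d) & (\<exists>e>0. \<forall>u\<in>I. \<bar>u - t\<bar> < e --> ka u = E (cr u * d))" using E(1,2) e2(1) by (intro exI[of _ E] conjI exI[of _ "min e e2"]) auto
qed

lemma straight_subset: "straight_path X d I ga ==> J \<subseteq> I ==> straight_path X d J ga" unfolding straight_iff by blast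

text \<open>Points of a line accumulate at one another, and this is all that
  \<open>dimm_unique_local\<close> needs; no open set of agreement is assumed.\<close>

lemma dimm_line_agree:
 assumes "dimm (ball c1 r1) E1" "dimm (ball c2 r2) E2" "d ~= 0" "open T" "x \<in> T"
  and T: "!!u. u \<in> T ==> cr u * d \<in> ball c1 r1 & cr u * d \<in> ball c2 r2 & E1 (cr u * d) = E2 (cr u * d)"
  and z: "z \<in> ball c1 r1" "z \<in> ball c2 r2"
 shows "E1 z = E2 z"
proof -
 let ?w = "cr x * d"
 have w: "?w \<in> ball c1 r1" "?w \<in> ball c2 r2" "E1 ?w = E2 ?w" using T[OF assms(5)] by auto
 obtain de where del: "de > 0" "ball x de \<subseteq> T" using assms(4,5) open_contains_ball by blast
 have ex: "\<exists>w. w \<in> ball ?w e & w ~= ?w & E1 w = E2 w" if e: "e > 0" for e proof -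
  define s where "s = min (de / 2) (e / (2 * norm d))"
  have s: "s > 0" "s < de" "s * norm d < e" using e del assms(3) by (auto simp: s_def min_def field_simps)
  have "x + s \<in> T" using del s by (intro subsetD[OF del(2)]) (simp add: dist_real_def)
  hence "E1 (cr (x + s) * d) = E2 (cr (x + s) * d)" using T by blast
  moreover have "cr (x + s) * d = ?w + cr s * d" by (simp add: algebra_simps)
  moreover have "norm (cr s * d) < e" "cr s * d ~= 0" using s assms(3) by (auto simp: norm_mult)
  ultimately show ?thesis by (intro exI[of _ "?w + cr s * d"]) (simp add: dist_norm)
 qed
 obtain e where e: "e > 0" "!!w. w \<in> ball ?w e ==> E1 w = E2 w" using dimm_unique_local[OF dimm_atD[OF assms(1) w(1)] dimm_atD[OF assms(2) w(2)] w(3) ex] by blast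
 show ?thesis proof (rule convex_agree[OF convex_ball assms(1) convex_ball assms(2), of "ball ?w e Int ball c1 r1 Int ball c2 r2"])
  have "?w \<in> ball ?w e Int ball c1 r1 Int ball c2 r2" using e w by simp
  thus "ball ?w e Int ball c1 r1 Int ball c2 r2 ~= {}" by blast
 qed (use e z in auto)
qed

text \<open>Around each parameter both paths are lines in immersed discs. If they agree on a piece
  of the line, the immersions agree by \<open>dimm_line_agree\<close>, so the paths agree on the
  whole neighbourhood; connectedness of \<open>I\<close> does the rest.\<close>

lemma straight_unique:
 assumes d: "d ~= 0" and g: "straight_path X d I ga" "straight_path X d I et" and I: "open I" "is_interval I"
  and t0: "t0 \<in> I" "e0 > 0" "!!u. \<bar>u - t0\<bar> < e0 ==> ga u = et u" and t: "t \<in> I"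
 shows "ga t = et t"
proof -
 let ?P = "%t. \<exists>e>0. \<forall>u. \<bar>u - t\<bar> < e --> ga u = et u"
 have "?P t" proof (rule connected_induction_simple[of I t0 t ?P])
  show "connected I" using I(2) is_interval_connected_1 by blast
  show "?P t0" using t0 by blast
  fix a assume a: "a \<in> I"
  obtain E1 e1 where E1: "dimm_at E1 (cr a * d)" "e1 > 0" "!!u. u \<in> I ==> \<bar>u - a\<bar> < e1 ==> ga u = E1 (cr u * d)" using g(1) a unfolding straight_iff by blast
  obtain E2 e2 where E2: "dimm_at E2 (cr a * d)" "e2 > 0" "!!u. u \<in> I ==> \<bar>u - a\<bar> < e2 ==> et u = E2 (cr u * d)" using g(2) a unfolding straight_iff by blast
  obtain r1 where r1: "r1 > 0" "dimm (ball (cr a * d) r1) E1" using dimm_at_ball[OF E1(1)] by blast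
  obtain r2 where r2: "r2 > 0" "dimm (ball (cr a * d) r2) E2" using dimm_at_ball[OF E2(1)] by blast
  obtain e3 where e3: "e3 > 0" "ball a e3 \<subseteq> I" using I(1) a open_contains_ball by blast
  define e where "e = min (min e1 e2) (min e3 (min r1 r2 / norm d))"
  have e: "e > 0" "e <= e1" "e <= e2" "e <= e3" using E1 E2 r1 r2 e3 d by (auto simp: e_def)
  have inb: "cr u * d \<in> ball (cr a * d) r1 & cr u * d \<in> ball (cr a * d) r2" if "\<bar>u - a\<bar> < e" for u proof -
   have "\<bar>u - a\<bar> * norm d < min r1 r2" using that d by (simp add: e_def pos_less_divide_eq)
   moreover have "norm (cr a * d - cr u * d) = \<bar>u - a\<bar> * norm d" unfolding left_diff_distrib[symmetric] of_real_diff[symmetric] norm_mult norm_of_real by (simp add: abs_minus_commute)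
   ultimately show ?thesis by (simp add: dist_norm)
  qed
  have inI: "u \<in> I" if "\<bar>u - a\<bar> < e" for u using e3(2) e(4) that by (auto simp: dist_real_def abs_minus_commute)
  show "\<exists>T. openin (top_of_set I) T & a \<in> T & (\<forall>x\<in>T. \<forall>y\<in>T. ?P x --> ?P y)" proof (intro exI[of _ "ball a e"] conjI ballI impI)
   show "openin (top_of_set I) (ball a e)" using e3 e(4) by (intro open_openin_trans I(1)) (auto simp: subset_iff)
   show "a \<in> ball a e" using e(1) by simp
   fix x y assume x: "x \<in> ball a e" and y: "y \<in> ball a e" and P: "?P x"
   obtain e4 where e4: "e4 > 0" "!!u. \<bar>u - x\<bar> < e4 ==> ga u = et u" using P by blast
   have eq: "E1 z = E2 z" if "z \<in> ball (cr a * d) r1" "z \<in> ball (cr a * d) r2" for z proof (rule dimm_line_agree[OF r1(2) r2(2) d, of "ball a e Int ball x e4" x z])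
    fix u assume u: "u \<in> ball a e Int ball x e4"
    hence ua: "\<bar>u - a\<bar> < e" and ux: "\<bar>u - x\<bar> < e4" by (auto simp: dist_real_def abs_minus_commute)
    show "cr u * d \<in> ball (cr a * d) r1 & cr u * d \<in> ball (cr a * d) r2 & E1 (cr u * d) = E2 (cr u * d)" using E1(3)[of u] E2(3)[of u] e4(2)[OF ux] inI[OF ua] ua e inb[OF ua] by simp
   qed (use x e4 that in auto)
   have ge: "ga u = et u" if "\<bar>u - a\<bar> < e" for u using E1(3)[of u] E2(3)[of u] inI[OF that] inb[OF that] eq that e by auto
   have "\<bar>y - a\<bar> < e" using y by (simp add: dist_real_def abs_minus_commute)
   thus "?P y" using ge by (intro exI[of _ "e - \<bar>y - a\<bar>"]) auto
  qed
 qed (use t0 t in auto)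
 thus ?thesis by force
qed

text \<open>The line in \<open>D\<close> is a straight path and continues the trajectory, so
  maximality puts its parameters into \<open>I\<close>. The factor \<open>mu\<close> compares the
  two affine parametrizations.\<close>

lemma follow:
 assumes tr: "trajectory X d I ga" and d: "d ~= 0" and t0: "t0 \<in> I" and E: "dimm D E" and J: "is_interval J" "0 \<in> J"
  and JD: "!!s. s \<in> J ==> p + cr s * d \<in> D" and eq: "ga t0 = E p"
 obtains mu where "mu > 0" "!!s. s \<in> J ==> t0 + s / mu \<in> I & ga (t0 + s / mu) = E (p + cr s * d)"
proof -
 have I: "open I" "is_interval I" "straight_path X d I ga"
  and mx: "!!J ga'. open J ==> is_interval J ==> I \<subseteq> J ==> (\<forall>t\<in>I. ga' t = ga t) ==> straight_path X d J ga' ==> J = I" using tr unfolding trajectory_def by blast+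
 define Os where "Os = {s. p + cr s * d \<in> D}"
 have "continuous_on UNIV (%s::real. p + cr s * d)" by (intro continuous_intros)
 hence oO: "open Os" unfolding Os_def using open_vimage[OF dimm_open[OF E]] by (simp add: vimage_def)
 define J' where "J' = connected_component_set Os 0"
 have oJ': "open J'" unfolding J'_def using oO by (rule open_connected_component)
 have cJ': "connected J'" unfolding J'_def by (rule connected_connected_component)
 have JJ': "J \<subseteq> J'" unfolding J'_def using J JD is_interval_connected_1 by (intro connected_component_maximal) (auto simp: Os_def)
 have J'O: "J' \<subseteq> Os" unfolding J'_def by (rule connected_component_subset)
 obtain F e1 where F: "dimm_at F (cr t0 * d)" "e1 > 0" "!!u. u \<in> I ==> \<bar>u - t0\<bar> < e1 ==> ga u = F (cr u * d)" using I(3) t0 unfolding straight_iff by blast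
 have pD: "p \<in> D" using JD[OF J(2)] by simp
 obtain mu e2 where m: "mu > 0" "e2 > 0" "!!h. norm h < e2 ==> F (cr t0 * d + h) = E (p + cr mu * h)" using F(3)[OF t0] F(2) eq dimm_germ[OF F(1) dimm_atD[OF E pD] ] by auto
 define J2 where "J2 = {t. mu * (t - t0) \<in> J'}"
 have "continuous_on UNIV (%t::real. mu * (t - t0))" by (intro continuous_intros)
 hence oJ2: "open J2" unfolding J2_def using open_vimage[OF oJ'] by (simp add: vimage_def)
 have iJ2: "is_interval J2" unfolding is_interval_1 proof (intro ballI allI impI)
  fix a b x assume h: "a \<in> J2" "b \<in> J2" "a <= x & x <= b"
  show "x \<in> J2" using h m(1) using cJ' is_interval_connected_1 using h(1,2) unfolding J2_def mem_Collect_eq is_interval_1 by fastforce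
 qed
 have t0J2: "t0 \<in> J2" using J(2) JJ' unfolding J2_def by auto
 let ?et = "%t. E (p + cr (mu * (t - t0)) * d)"
 have sJ2: "straight_path X d J2 ?et" by (rule straight_line[OF E m(1)]) (use J'O in \<open>auto simp: J2_def Os_def\<close>)
 obtain e3 where e3: "e3 > 0" "ball t0 e3 \<subseteq> I Int J2" using I(1) oJ2 t0 t0J2 open_contains_ball[of "I Int J2"] by blast
 define e where "e = min (min e1 e3) (e2 / norm d)"
 have e: "e > 0" using F m e3 d by (simp add: e_def)
 have near: "ga u = ?et u" if u: "\<bar>u - t0\<bar> < e" for u proof -
  have uI: "u \<in> I" using u e3(2) by (auto simp: e_def dist_real_def abs_minus_commute)
  have "norm (cr (u - t0) * d) < e2" using u using d unfolding norm_mult norm_of_real by (simp add: e_def pos_less_divide_eq)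
  hence "F (cr t0 * d + cr (u - t0) * d) = E (p + cr mu * (cr (u - t0) * d))" by (rule m(3))
  moreover have "cr t0 * d + cr (u - t0) * d = cr u * d" by (simp add: algebra_simps)
  moreover have "cr mu * (cr (u - t0) * d) = cr (mu * (u - t0)) * d" by (simp add: mult_ac)
  ultimately have "F (cr u * d) = ?et u" by (simp only:)
  thus ?thesis using F(3)[OF uI] u by (simp add: e_def)
 qed
 have ag: "ga t = ?et t" if "t \<in> I" "t \<in> J2" for t by (rule straight_unique[OF d straight_subset[OF I(3), of "I Int J2"] straight_subset[OF sJ2, of "I Int J2"] open_Int[OF I(1) oJ2] is_interval_Int[OF I(2) iJ2] _ e near])
   (use t0 t0J2 that in auto)
 let ?ga' = "%t. if t \<in> I then ga t else ?et t"
 have "I Un J2 = I" proof (rule mx[of _ ?ga'])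
  show "open (I Un J2)" using I(1) oJ2 by blast
  have "connected (I Un J2)" using I(2) iJ2 t0 t0J2 by (intro connected_Un) (auto simp: is_interval_connected_1)
  thus "is_interval (I Un J2)" using is_interval_connected_1 by blast
  show "straight_path X d (I Un J2) ?ga'" proof (rule straight_localI)
   fix t assume "t \<in> I Un J2"
   then consider "t \<in> I" | "t \<in> J2" by blast
   thus "\<exists>J et. open J & t \<in> J & straight_path X d J et & (\<forall>u\<in>J. ?ga' u = et u)" proof cases
    case 1
    thus ?thesis using I by (intro exI[of _ I] exI[of _ ga]) simp
   next case 2
    thus ?thesis using oJ2 sJ2 ag by (intro exI[of _ J2] exI[of _ ?et]) simp
   qed
  qed
 qed auto
 hence J2I: "J2 \<subseteq> I" by blast
 show ?thesis proof (rule that[OF m(1)])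
  fix s assume s: "s \<in> J"
  have e: "mu * (t0 + s / mu - t0) = s" using m(1) by simp
  hence "t0 + s / mu \<in> J2" using s JJ' unfolding J2_def by auto
  thus "t0 + s / mu \<in> I & ga (t0 + s / mu) = E (p + cr s * d)" using J2I ag[of "t0 + s / mu"] unfolding e by blast
 qed
qed

text \<open>By \<open>straight_unique\<close> all extensions of the path are compatible, so their
  union is the maximal one.\<close>

lemma trajectory_exists:
 assumes d: "d ~= 0" and I: "straight_path X d I ga" "open I" "is_interval I" "I ~= {}"
 obtains J ga' where "I \<subseteq> J" "!!t. t \<in> I ==> ga' t = ga t" "trajectory X d J ga'"
proof -
 define ok where "ok J et \<longleftrightarrow> open J & is_interval J & I \<subseteq> J & straight_path X d J et & (\<forall>t\<in>I. et t = ga t)" for J et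
 have okI: "ok I ga" using I unfolding ok_def by blast
 obtain t0 where t0: "t0 \<in> I" using I(4) by blast
 obtain e0 where e0: "e0 > 0" "ball t0 e0 \<subseteq> I" using I(2) t0 open_contains_ball by blast
 have agree: "et1 t = et2 t" if h: "ok J1 et1" "ok J2 et2" "t \<in> J1" "t \<in> J2" for J1 et1 J2 et2 t proof (rule straight_unique[OF d, of "J1 Int J2" et1 et2 t0 e0])
  show "et1 u = et2 u" if "\<bar>u - t0\<bar> < e0" for u using e0(2) that using h(1,2) unfolding ok_def by (auto simp: dist_real_def abs_minus_commute)
  show "straight_path X d (J1 Int J2) et1" "straight_path X d (J1 Int J2) et2" using h straight_subset unfolding ok_def by blast+
  show "open (J1 Int J2)" "is_interval (J1 Int J2)" using h is_interval_Int unfolding ok_def by blast+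
  show "t0 \<in> J1 Int J2" "t \<in> J1 Int J2" using h t0 unfolding ok_def by blast+
 qed (rule e0)
 define M where "M = {J. \<exists>et. ok J et}"
 define Js where "Js = \<Union>M"
 define gas where "gas t = (SOME x. \<exists>J et. ok J et & t \<in> J & x = et t)" for t
 have gs: "gas t = et t" if "ok J et" "t \<in> J" for J et t proof -
  have "\<exists>x. \<exists>J et. ok J et & t \<in> J & x = et t" using that by blast
  hence "\<exists>J et. ok J et & t \<in> J & gas t = et t" unfolding gas_def by (rule someI_ex)
  thus ?thesis using agree that by metis
 qed
 have IJs: "I \<subseteq> Js" using okI unfolding Js_def M_def by blast
 show ?thesis proof (rule that[OF IJs])
  show "gas t = ga t" if "t \<in> I" for t using gs[OF okI that] .
  show "trajectory X d Js gas" unfolding trajectory_def proof (intro conjI allI impI)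
   show "Js ~= {}" using IJs I(4) by blast
   show "open Js" unfolding Js_def M_def ok_def by blast
   have "connected Js" unfolding Js_def proof (rule connected_Union)
    show "connected s" if "s \<in> M" for s using that is_interval_connected_1 unfolding M_def ok_def by blast
    show "\<Inter>M ~= {}" using t0 unfolding M_def ok_def by blast
   qed
   thus "is_interval Js" using is_interval_connected_1 by blast
   show sJs: "straight_path X d Js gas" proof (rule straight_localI)
    fix t assume "t \<in> Js"
    then obtain J et where "ok J et" "t \<in> J" unfolding Js_def M_def by blast
    thus "\<exists>J et. open J & t \<in> J & straight_path X d J et & (\<forall>u\<in>J. gas u = et u)" using gs by (intro exI[of _ J] exI[of _ et]) (simp add: ok_def)
   qed
   fix J ga' assume h: "open J & is_interval J & Js \<subseteq> J & (\<forall>t\<in>Js. ga' t = gas t) & straight_path X d J ga'"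
   have "ok J ga'" unfolding ok_def using h IJs gs[OF okI] by (metis subsetD subset_trans)
   hence "J \<subseteq> Js" unfolding Js_def M_def by blast
   thus "J = Js" using h by blast
  qed
 qed
qed

text \<open>Discs around the points of the path agree where they overlap, because overlapping discs
  share a piece of the line. A neighbourhood of uniform width of the compact segment is
  convex.\<close>

lemma straight_strip:
 assumes d: "d ~= 0" and I: "straight_path X d I ga" "open I" and ab: "{a..b} \<subseteq> I"
 obtains D E where "convex D" "dimm D E" "!!t. t \<in> {a..b} ==> cr t * d \<in> D & E (cr t * d) = ga t"
proof -
 have ex: "\<forall>t\<in>{a..b}. \<exists>rF. fst rF > 0 & dimm (ball (cr t * d) (fst rF)) (snd rF) & (\<forall>u\<in>I. \<bar>u - t\<bar> * norm d < fst rF --> ga u = snd rF (cr u * d))" proof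
  fix t assume "t \<in> {a..b}"
  hence tI: "t \<in> I" using ab by blast
  obtain E e where E: "dimm_at E (cr t * d)" "e > 0" "!!u. u \<in> I ==> \<bar>u - t\<bar> < e ==> ga u = E (cr u * d)" using I(1) tI unfolding straight_iff by blast
  obtain r where r: "r > 0" "dimm (ball (cr t * d) r) E" using dimm_at_ball[OF E(1)] by blast
  let ?r = "min r (e * norm d)"
  have "dimm (ball (cr t * d) ?r) E" by (rule dimm_subset[OF r(2)]) auto
  moreover have "?r > 0" using r E d by simp
  moreover have "ga u = E (cr u * d)" if "u \<in> I" "\<bar>u - t\<bar> * norm d < ?r" for u using E(3)[OF that(1)] that(2) d by simp
  ultimately show "\<exists>rF. fst rF > 0 & dimm (ball (cr t * d) (fst rF)) (snd rF) & (\<forall>u\<in>I. \<bar>u - t\<bar> * norm d < fst rF --> ga u = snd rF (cr u * d))" by (intro exI[of _ "(?r, E)"]) (simp only: fst_conv snd_conv, blast)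
 qed
 from bchoice[OF ex] obtain rF where rF: "\<forall>t\<in>{a..b}. fst (rF t) > 0 & dimm (ball (cr t * d) (fst (rF t))) (snd (rF t)) & (\<forall>u\<in>I. \<bar>u - t\<bar> * norm d < fst (rF t) --> ga u = snd (rF t) (cr u * d))" ..
 define r where "r t = fst (rF t)" for t
 define F where "F t = snd (rF t)" for t
 have rp: "r t > 0" and dF: "dimm (ball (cr t * d) (r t)) (F t)" and gF: "!!u. u \<in> I ==> \<bar>u - t\<bar> * norm d < r t ==> ga u = F t (cr u * d)"
  if "t \<in> {a..b}" for t using rF that unfolding r_def F_def by blast+
 have dist_line: "norm (cr t * d - cr u * d) = \<bar>u - t\<bar> * norm d" for t u :: real unfolding left_diff_distrib[symmetric] of_real_diff[symmetric] norm_mult norm_of_real by (simp add: abs_minus_commute)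
 have agree: "F t z = F t' z" if h: "t \<in> {a..b}" "t' \<in> {a..b}" "z \<in> ball (cr t * d) (r t)" "z \<in> ball (cr t' * d) (r t')" for t t' z proof -
  define T where "T = I Int {u. \<bar>u - t\<bar> * norm d < r t} Int {u. \<bar>u - t'\<bar> * norm d < r t'}"
  have oT: "open T" unfolding T_def using I(2) by (intro open_Int open_Collect_less continuous_intros)
  obtain k where kd: "k = r t / (r t + r t')" by simp
  have rr: "r t > 0" "r t' > 0" using rp h by auto
  have k: "0 <= k" "k <= 1" using rr by (auto simp: kd)
  define u where "u = (1 - k) * t + k * t'"
  have dd: "\<bar>t - t'\<bar> * norm d < r t + r t'" using dist_triangle[of "cr t' * d" "cr t * d" z] h(3,4) dist_line[of t' t] by (simp add: dist_norm norm_minus_commute)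
  have "u - t = k * (t' - t)" "u - t' = (1 - k) * (t - t')" unfolding u_def by (simp_all add: algebra_simps)
  hence ab1: "\<bar>u - t\<bar> = k * \<bar>t - t'\<bar>" "\<bar>u - t'\<bar> = (1 - k) * \<bar>t - t'\<bar>" using k by (simp_all add: abs_mult abs_minus_commute)
  have k2: "1 - k = r t' / (r t + r t')" using rr by (simp add: kd field_simps)
  have "k * (\<bar>t - t'\<bar> * norm d) < k * (r t + r t')" using dd rr by (intro mult_strict_left_mono) (auto simp: kd)
  moreover have "k * (r t + r t') = r t" using rr by (simp add: kd)
  ultimately have 1: "\<bar>u - t\<bar> * norm d < r t" unfolding ab1 by (simp only: mult.assoc)
  have "(1 - k) * (\<bar>t - t'\<bar> * norm d) < (1 - k) * (r t + r t')" using dd rr unfolding k2 by (intro mult_strict_left_mono) auto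
  moreover have "(1 - k) * (r t + r t') = r t'" unfolding k2 using rr by simp
  ultimately have 2: "\<bar>u - t'\<bar> * norm d < r t'" unfolding ab1(2) by (simp only: mult.assoc)
  have "u \<in> closed_segment t t'" unfolding in_segment u_def using k by (intro exI[of _ k]) simp
  moreover have "closed_segment t t' \<subseteq> {a..b}" by (rule closed_segment_subset) (use h in auto)
  ultimately have "u \<in> I" using ab by blast
  hence uT: "u \<in> T" using 1 2 unfolding T_def by simp
  show ?thesis proof (rule dimm_line_agree[OF dF[OF h(1)] dF[OF h(2)] d oT uT _ h(3,4)])
   fix v assume v: "v \<in> T"
   thus "cr v * d \<in> ball (cr t * d) (r t) & cr v * d \<in> ball (cr t' * d) (r t') & F t (cr v * d) = F t' (cr v * d)" using gF[OF h(1), of v] gF[OF h(2), of v] unfolding T_def mem_ball dist_norm dist_line by simp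
  qed
 qed
 obtain E where E: "dimm (\<Union>t\<in>{a..b}. ball (cr t * d) (r t)) E" "!!t z. t \<in> {a..b} ==> z \<in> ball (cr t * d) (r t) ==> E z = F t z" by (rule dimm_glue[of "{a..b}" "%t. ball (cr t * d) (r t)" F], rule dF, assumption, rule agree, assumption+, rule that)
 have c: "compact ((%t. cr t * d) ` {a..b})" by (intro compact_continuous_image continuous_intros) simp
 have sub: "(%t. cr t * d) ` {a..b} \<subseteq> (\<Union>t\<in>{a..b}. ball (cr t * d) (r t))" using rp by force
 obtain ep where eps: "ep > 0" "(\<Union>x\<in>(%t. cr t * d) ` {a..b}. ball x ep) \<subseteq> (\<Union>t\<in>{a..b}. ball (cr t * d) (r t))" using compact_subset_open_imp_ball_epsilon_subset[OF c dimm_open[OF E(1)] sub] by blast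
 let ?D = "\<Union>t\<in>{a..b}. ball (cr t * d) ep"
 have "convex ?D" proof (rule convexI)
  fix x y and al be :: real assume h: "x \<in> ?D" "y \<in> ?D" "0 <= al" "0 <= be" "al + be = 1"
  obtain t where t: "t \<in> {a..b}" "norm (x - cr t * d) < ep" using h(1) by (auto simp: dist_norm norm_minus_commute)
  obtain s where s: "s \<in> {a..b}" "norm (y - cr s * d) < ep" using h(2) by (auto simp: dist_norm norm_minus_commute)
  have "al *\<^sub>R (x - cr t * d) + be *\<^sub>R (y - cr s * d) \<in> ball 0 ep" by (rule convexD[OF convex_ball]) (use t s h in auto)
  moreover have "al *\<^sub>R (x - cr t * d) + be *\<^sub>R (y - cr s * d) = al *\<^sub>R x + be *\<^sub>R y - cr (al *\<^sub>R t + be *\<^sub>R s) * d" by (simp add: scaleR_conv_of_real algebra_simps)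
  moreover have "al *\<^sub>R t + be *\<^sub>R s \<in> {a..b}" by (rule convexD[OF convex_real_interval(5)]) (use t s h in auto)
  ultimately show "al *\<^sub>R x + be *\<^sub>R y \<in> ?D" by (intro UN_I[of "al *\<^sub>R t + be *\<^sub>R s"]) (simp_all add: dist_norm norm_minus_commute)
 qed
 moreover have "dimm ?D E" by (rule dimm_subset[OF E(1)]) (use eps(2) in auto)
 moreover have "cr t * d \<in> ?D & E (cr t * d) = ga t" if t: "t \<in> {a..b}" for t proof
  show "cr t * d \<in> ?D" using t eps(1) by (intro UN_I[of t]) auto
  have "E (cr t * d) = F t (cr t * d)" by (rule E(2)[OF t]) (use rp[OF t] in simp)
  thus "E (cr t * d) = ga t" using gF[OF t, of t] rp[OF t] t ab by auto
 qed
 ultimately show ?thesis using that by blast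
qed

section \<open>From a horizon saddle connection to a complete cone\<close>

lemma good_mono: "good K0 x ==> K0 \<subseteq> K ==> good K x" unfolding good_def by blast

text \<open>Take a trajectory with direction in \<open>K\<close> and the largest number of
  crossings. A line of nearby direction that starts on \<open>L\<close> next to its last crossing
  crosses \<open>L\<close> next to all earlier crossings in its past. If it also came back to the
  starting piece of \<open>L\<close>, it would have one crossing more than the maximum. So this
  piece is a transversal without return.\<close>

lemma horizon_good:
 assumes sc: "saddle_connection X dL L"
  and bound: "!!d I ga. d \<in> sphere 0 1 ==> d ~= dL ==> d ~= - dL ==> trajectory X d I ga ==>
     finite {t\<in>I. ga t \<in> L ` {0<..<1}} & card {t\<in>I. ga t \<in> L ` {0<..<1}} <= k"
  and K: "ocone K" and trans: "!!x. x \<in> K ==> Im (cnj x * dL) ~= 0"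
 obtains x where "good K x"
proof -
 have dL: "norm dL = 1" "straight_path X dL {0<..<1} L" using sc unfolding saddle_connection_def by auto
 hence dL0: "dL ~= 0" by auto
 define C where "C I ga = {t\<in>I. ga t \<in> L ` {0<..<1}}" for I and ga :: "real => 'a"
 have Cb: "finite (C I ga) & card (C I ga) <= k" if h: "d \<in> K" "norm d = 1" "trajectory X d I ga" for d I ga using trans[OF h(1)] unfolding C_def using bound[of d I ga] h by fastforce
 obtain k0 where k0: "k0 \<in> K" using oconeD(3)[OF K] by blast
 define d0 where "d0 = cr (1 / norm k0) * k0"
 have d0: "d0 \<in> K" "norm d0 = 1" using k0 oconeD(4)[OF K] unfolding d0_def using oconeD(5)[OF K k0, of "1 / norm k0"] by (auto simp: norm_mult norm_divide)
 \<comment> \<open>At least one crossing is needed, so that a trajectory with the most crossings has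
   a last one.\<close>
 have start: "\<exists>I ga. trajectory X d0 I ga & 0 \<in> C I ga" proof -
  have yR: "L (1/2) \<in> Reg" using dL(2) unfolding straight_path_def by auto
  obtain U ph ps r where U: "(U,ph) \<in> atlas X" "L (1/2) \<in> U" "r > 0" "dimm (ball (ph (L (1/2))) (4*r)) ps"
   "!!v. v \<in> ball (ph (L (1/2))) (4*r) ==> ps v \<in> U & ph (ps v) = v" "!!x. x \<in> U ==> ps (ph x) = x" by (rule chart_inverse[OF yR], rule that)
  have st: "straight_path X d0 {-r<..<r} (%t. ps (ph (L (1/2)) + cr (1 * (t - 0)) * d0))" by (rule straight_line[OF U(4)]) (use U(3) d0(2) in \<open>auto simp: dist_norm norm_mult\<close>)
  have d00: "d0 ~= 0" using d0(2) by auto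
  obtain J ga' where J: "{-r<..<r} \<subseteq> J" "!!t. t \<in> {-r<..<r} ==> ga' t = ps (ph (L (1/2)) + cr (1 * (t - 0)) * d0)" "trajectory X d0 J ga'" by (rule trajectory_exists[OF d00 st]) (use U(3) that in \<open>auto simp: is_interval_oo\<close>)
  show ?thesis using J(2)[of 0] U unfolding C_def using J(1) U(3) using J(3) by fastforce
 qed
 let ?Q = "%(d, I, ga). d \<in> K & norm d = 1 & trajectory X d I ga"
 obtain I0 ga0 where tr0: "trajectory X d0 I0 ga0" "0 \<in> C I0 ga0" using start by blast
 have "\<exists>q. ?Q q & (\<forall>q'. ?Q q' --> card (C (fst (snd q')) (snd (snd q'))) <= card (C (fst (snd q)) (snd (snd q))))" by (rule ex_has_greatest_nat[of ?Q "(d0, I0, ga0)" _ "Suc k"]) (use tr0 d0 Cb in \<open>auto simp: less_Suc_eq_le\<close>)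
 then obtain d I ga where d: "d \<in> K" "norm d = 1" and tr: "trajectory X d I ga"
  and mx: "!!d' I' ga'. d' \<in> K ==> norm d' = 1 ==> trajectory X d' I' ga' ==> card (C I' ga') <= card (C I ga)" by (auto 4 3)
 define T where "T = C I ga"
 have fT: "finite T" unfolding T_def using Cb[OF d tr] by blast
 have Tne: "T ~= {}" using Cb[OF d0 tr0(1)] tr0(2) using mx[OF d0 tr0(1)] unfolding T_def by auto
 define t1 where "t1 = Min T"
 define tM where "tM = Max T"
 have tT: "t1 \<in> T" "tM \<in> T" "!!t. t \<in> T ==> t1 <= t & t <= tM" using fT Tne unfolding t1_def tM_def by auto
 have TI: "T \<subseteq> I" unfolding T_def C_def by blast
 have I: "open I" "is_interval I" "straight_path X d I ga" using tr unfolding trajectory_def by blast+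
 have "{t1..tM} \<subseteq> I" using I(2) tT(1,2) TI unfolding is_interval_1 by (meson atLeastAtMost_iff subsetD subsetI)
 have d00: "d ~= 0" using d(2) by auto
 obtain D E where D: "convex D" "dimm D E" "!!t. t \<in> {t1..tM} ==> cr t * d \<in> D & E (cr t * d) = ga t" by (rule straight_strip[OF d00 I(3,1) \<open>{t1..tM} \<subseteq> I\<close>], rule that)
 have cross: "\<exists>y>0. \<forall>si. \<bar>si\<bar> < y --> cr t * d + cr si * dL \<in> D & E (cr t * d + cr si * dL) \<in> L ` {0<..<1}" if t: "t \<in> T" for t proof -
  have tD: "cr t * d \<in> D" "E (cr t * d) = ga t" using D(3)[of t] tT(3)[OF t] by auto
  obtain x where x: "x \<in> {0<..<1}" "ga t = L x" using t unfolding T_def C_def by blast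
  obtain F e1 where F: "dimm_at F (cr x * dL)" "e1 > 0" "!!u. u \<in> {0<..<1} ==> \<bar>u - x\<bar> < e1 ==> L u = F (cr u * dL)" using dL(2) x(1) unfolding straight_iff by blast
  obtain mu e2 where m: "mu > 0" "e2 > 0" "!!h. norm h < e2 ==> E (cr t * d + h) = F (cr x * dL + cr mu * h)" using tD(2) x F(3)[OF x(1)] F(2) dimm_germ[OF dimm_atD[OF D(2) tD(1)] F(1)] by auto
  obtain e3 where e3: "e3 > 0" "ball (cr t * d) e3 \<subseteq> D" using dimm_open[OF D(2)] tD(1) open_contains_ball by blast
  define y where "y = min (min e2 e3) (min e1 (min x (1 - x)) / mu)"
  have y: "y > 0" using m e3 F(2) x(1) by (auto simp: y_def)
  show ?thesis proof (intro exI[of _ y] conjI allI impI y)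
   fix si assume s: "\<bar>si\<bar> < y"
   have n: "norm (cr si * dL) < e2" "norm (cr si * dL) < e3" using s dL(1) by (auto simp: y_def norm_mult)
   show "cr t * d + cr si * dL \<in> D" using e3(2) n(2) by (auto simp: dist_norm)
   have "\<bar>mu * si\<bar> < min e1 (min x (1 - x))" using s m(1) by (simp add: y_def abs_mult pos_less_divide_eq mult.commute)
   hence ms: "\<bar>mu * si\<bar> < e1" "x + mu * si \<in> {0<..<1}" by auto
   have "E (cr t * d + cr si * dL) = F (cr (x + mu * si) * dL)" using m(3)[OF n(1)] by (simp add: algebra_simps)
   also have "... = L (x + mu * si)" using F(3)[OF ms(2)] ms(1) by simp
   finally show "E (cr t * d + cr si * dL) \<in> L ` {0<..<1}" using ms(2) by (intro image_eqI)
  qed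
 qed
 from bchoice[of T] cross obtain yf where yf: "!!t. t \<in> T ==> yf t > 0" "!!t si. t \<in> T ==> \<bar>si\<bar> < yf t ==> cr t * d + cr si * dL \<in> D & E (cr t * d + cr si * dL) \<in> L ` {0<..<1}" by metis
 define y0 where "y0 = Min (yf ` T)"
 have y0: "y0 > 0" unfolding y0_def using fT Tne using yf(1) by auto
 have y0le: "y0 <= yf t" if "t \<in> T" for t unfolding y0_def using fT that by (intro Min_le) auto
 have yc: "cr t * d + cr si * dL \<in> D & E (cr t * d + cr si * dL) \<in> L ` {0<..<1}" if "t \<in> T" "\<bar>si\<bar> < y0" for t si by (rule yf(2)[OF that(1)]) (use y0le[OF that(1)] that(2) in linarith)
 have tMD: "cr tM * d \<in> D" using D(3)[of tM] tT(3)[OF tT(2)] by auto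
 obtain r1 where r1: "r1 > 0" "inj_on E (ball (cr tM * d) r1)" using dimm_at_inj[OF dimm_atD[OF D(2) tMD]] by blast
 obtain r2 where r2: "r2 > 0" "ball (cr tM * d) r2 \<subseteq> D" using dimm_open[OF D(2)] tMD open_contains_ball by blast
 define r where "r = min r1 r2"
 have r: "r > 0" using r1 r2 by (simp add: r_def)
 let ?e = "%z. E (z + cr tM * d)"
 have de: "dimm (ball 0 r) ?e" proof (rule dimm_subset[OF dimm_shift[OF D(2)] open_ball])
  show "ball 0 r \<subseteq> {z. z + cr tM * d \<in> D}" proof
   fix z :: complex assume "z \<in> ball 0 r"
   thus "z \<in> {z. z + cr tM * d \<in> D}" using r2(2) by (auto simp: dist_norm r_def)
  qed
 qed
 have ie: "inj_on ?e (ball 0 r)" proof (rule inj_onI)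
  fix z w :: complex assume h: "z \<in> ball 0 r" "w \<in> ball 0 r" "?e z = ?e w"
  have "z + cr tM * d = w + cr tM * d" by (rule inj_onD[OF r1(2) h(3)]) (use h in \<open>auto simp: r_def dist_norm\<close>)
  thus "z = w" by simp
 qed
 define a where "a = min y0 r / 2"
 have a: "a > 0" "a <= y0 / 2" "a * norm dL < r" using y0 r dL(1) by (auto simp: a_def)
 let ?ka = "%x. crd x dL d" and ?om = "%x. crd dL x d"
 have ind: "Im (cnj dL * d) ~= 0" using trans[OF d(1)] by (simp add: algebra_simps)
 have "isCont ?ka d" unfolding crd_def using ind by (intro continuous_intros) auto
 moreover have "isCont ?om d" unfolding crd_def using trans[OF d(1)] by (intro continuous_intros) auto
 moreover have "?ka d = 1" "?om d = 0" using crd_of[OF ind, of 1 0] by simp_all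
 ultimately have "(?ka \<longlongrightarrow> 1) (nhds d)" "(?om \<longlongrightarrow> 0) (nhds d)" by (auto simp: continuous_at tendsto_nhds_iff isCont_def)
 \<comment> \<open>With this tolerance, the drift along \<open>dL\<close> over the parameters from
   \<open>tM\<close> back to \<open>t1\<close> stays below \<open>y0 / 2\<close>.\<close>
 moreover have wpos: "y0 / 2 / (tM - t1 + 1) > 0" using y0 tT by (simp add: add_nonneg_pos)
 ultimately have "\<forall>\<^sub>F x in nhds d. dist (?ka x) 1 < 1" "\<forall>\<^sub>F x in nhds d. dist (?om x) 0 < y0 / 2 / (tM - t1 + 1)" using tendstoD zero_less_one by blast+
 hence "\<forall>\<^sub>F x in nhds d. dist (?ka x) 1 < 1 & dist (?om x) 0 < y0 / 2 / (tM - t1 + 1)" by eventually_elim blast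
 then obtain ep where eps: "ep > 0" "!!x. dist x d < ep ==> dist (?ka x) 1 < 1 & dist (?om x) 0 < y0 / 2 / (tM - t1 + 1)" unfolding eventually_nhds_metric by blast
 obtain K0 where K0: "ocone K0" "K0 \<subseteq> K" "!!z. z \<in> K0 ==> \<exists>t>0. \<exists>x\<in>K. norm (x - d) < ep & z = cr t * x" using ocone_around[OF K d(1) eps(1)] by metis
 let ?I = "(%s. ?e (cr s * dL)) ` {-a<..<a}"
 have IL: "?I \<subseteq> L ` {0<..<1}" proof
  fix q assume "q \<in> ?I"
  then obtain s where s: "s \<in> {-a<..<a}" "q = ?e (cr s * dL)" by blast
  show "q \<in> L ` {0<..<1}" using s(1) a y0 unfolding s(2) using yc[OF tT(2), of s] by (auto simp: add.commute)
 qed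
 have nr: "no_return K0 ?I" unfolding no_return_def proof (intro allI impI notI)
  fix S F z d' assume S: "convex S" "dimm S F" "z \<in> S" "z + d' \<in> S" "d' \<in> K0" and Fz: "F z \<in> ?I" "F (z + d') \<in> ?I"
  obtain s where s0: "s \<in> {-a<..<a}" "F z = ?e (cr s * dL)" using Fz(1) by blast
  have s: "\<bar>s\<bar> < y0 / 2" using s0(1) a by auto
  obtain ta x where x: "ta > 0" "x \<in> K" "norm (x - d) < ep" "d' = cr ta * x" using K0(3)[OF S(5)] by blast
  have x0: "norm x > 0" using x(2) oconeD(4)[OF K] by auto
  define d2 where "d2 = cr (1 / norm x) * x"
  have d2: "d2 \<in> K" "norm d2 = 1" "x = cr (norm x) * d2" "d2 ~= 0" unfolding d2_def using oconeD(5)[OF K x(2), of "1 / norm x"] x0 by (auto simp: norm_mult norm_divide)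
  define de where "de = ta * norm x"
  have del: "de > 0" "d' = cr de * d2" using x x0 d2(3) by (auto simp: de_def mult.assoc)
  have kw: "?ka x > 0" "\<bar>?om x\<bar> < y0 / 2 / (tM - t1 + 1)" using eps(2)[of x] x(3) by (auto simp: dist_norm)
  have dx: "cr (?ka x) * x + cr (?om x) * dL = d" by (rule crd_eq) (use trans[OF x(2)] in \<open>simp add: algebra_simps\<close>)
  define O' where "O' = {t. z + cr (1 * (t - 0)) * d2 \<in> S}"
  have "continuous_on UNIV (%t::real. z + cr (1 * (t - 0)) * d2)" by (intro continuous_intros)
  hence oO: "open O'" unfolding O'_def using open_vimage[OF dimm_open[OF S(2)]] by (simp add: vimage_def)
  have iO: "is_interval O'" unfolding is_interval_1 proof (intro ballI allI impI)
   fix u v w assume h: "u \<in> O'" "v \<in> O'" "u <= w & w <= v"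
   thus "w \<in> O'" unfolding O'_def mem_Collect_eq using convex_line_mem[OF S(1), of z u d2 v w] by simp
  qed
  have O0: "0 \<in> O'" "de \<in> O'" unfolding O'_def using S(3,4) del by auto
  have st: "straight_path X d2 O' (%t. F (z + cr (1 * (t - 0)) * d2))" by (rule straight_line[OF S(2)]) (auto simp: O'_def)
  have One: "O' ~= {}" using O0 by blast
  obtain J ga' where J: "O' \<subseteq> J" "!!t. t \<in> O' ==> ga' t = F (z + cr (1 * (t - 0)) * d2)" "trajectory X d2 J ga'" by (rule trajectory_exists[OF d2(4) st oO iO One], rule that)
  define q where "q = cr s * dL + cr tM * d"
  have g0: "ga' 0 = E q" using J(2)[OF O0(1)] s0(2) by (simp add: q_def)
  have qt: "q - cr ((tM - t) * ?ka x) * x = cr t * d + cr (s + (tM - t) * ?om x) * dL" for t proof -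
   have "cr (tM - t) * (cr (?ka x) * x + cr (?om x) * dL) = cr (tM - t) * d" unfolding dx ..
   thus ?thesis unfolding q_def by (simp add: algebra_simps)
  qed
  have sm: "\<bar>s + (tM - t) * ?om x\<bar> < y0" if t: "t \<in> T" for t proof -
   have "(tM - t) * \<bar>?om x\<bar> <= (tM - t1 + 1) * \<bar>?om x\<bar>" using tT(3)[OF t] by (intro mult_right_mono) auto
   moreover have p: "tM - t1 + 1 > 0" using tT(3)[OF tT(2)] by simp
   hence "(tM - t1 + 1) * \<bar>?om x\<bar> < y0 / 2" using kw(2) by (simp only: pos_less_divide_eq mult.commute)
   moreover have "\<bar>(tM - t) * ?om x\<bar> = (tM - t) * \<bar>?om x\<bar>" using tT(3)[OF t] by (simp add: abs_mult)
   ultimately show ?thesis using s by linarith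
  qed
  have qc: "q - cr ((tM - t) * ?ka x) * x \<in> D & E (q - cr ((tM - t) * ?ka x) * x) \<in> L ` {0<..<1}" if "t \<in> T" for t unfolding qt by (rule yc[OF that sm[OF that]])
  define Y where "Y = (tM - t1) * ?ka x * norm x"
  have qe: "q - cr ((tM - t) * ?ka x) * x = q + cr (- ((tM - t) * ?ka x * norm x)) * d2" for t using d2(3) by (simp add: mult.assoc)
  have path: "q + cr v * d2 \<in> D" if v: "v \<in> {-Y..0}" for v proof (rule convex_line_mem[OF D(1)])
   show "q + cr (- Y) * d2 \<in> D" using qc[OF tT(1)] unfolding qe Y_def by blast
   show "q + cr 0 * d2 \<in> D" using qc[OF tT(2)] by simp
  qed (use v in auto)
  have Y0: "0 \<in> {-Y..0}" unfolding Y_def using kw x0 tT(3)[OF tT(2)] by simp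
  have J0: "0 \<in> J" using O0 J(1) by blast
  have iv: "is_interval {-Y..0}" by (rule is_interval_cc)
  obtain mu where mu: "mu > 0" "!!v. v \<in> {-Y..0} ==> 0 + v / mu \<in> J & ga' (0 + v / mu) = E (q + cr v * d2)" by (rule follow[OF J(3) d2(4) J0 D(2) iv Y0 path g0], assumption, rule that)
  \<comment> \<open>The crossings in the past, one for each element of \<open>T\<close>. Their
    parameters are nonpositive, whereas the return has parameter \<open>de > 0\<close>.\<close>
  define c where "c t = - ((tM - t) * ?ka x * norm x) / mu" for t
  have cC: "c t \<in> C J ga'" if t: "t \<in> T" for t proof -
   have "- ((tM - t) * ?ka x * norm x) \<in> {-Y..0}" using tT(3)[OF t] kw x0 using tT(3)[OF t] kw x0 unfolding Y_def by (simp add: mult.assoc)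
   from mu(2)[OF this] show ?thesis unfolding c_def using qc[OF t] unfolding qe C_def by simp
  qed
  have "inj_on c T" proof (rule inj_onI)
   fix t t' assume "c t = c t'"
   thus "t = t'" using mu(1) unfolding c_def using kw x0 by simp
  qed
  hence cc: "card (c ` T) = card T" by (rule card_image)
  have neg: "c t <= 0" if "t \<in> T" for t using tT(3)[OF that] kw x0 unfolding c_def using mu(1) by (simp add: divide_nonpos_pos)
  have dn: "de ~: c ` T" using neg del(1) by fastforce
  have dC: "de \<in> C J ga'" using J(2)[OF O0(2)] Fz(2) IL del unfolding C_def using O0 J(1) by auto
  have fC: "finite (C J ga')" using Cb[OF d2(1,2) J(3)] by blast
  have "card (insert de (c ` T)) <= card (C J ga')" by (rule card_mono[OF fC]) (use dC cC in blast)
  moreover have "card (insert de (c ` T)) = Suc (card T)" using dn cc fT by simp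
  moreover have "card (C J ga') <= card T" unfolding T_def by (rule mx[OF d2(1,2) J(3)])
  ultimately show False by linarith
 qed
 have tr0: "Im (cnj z * dL) ~= 0" if "z \<in> K0" for z using trans K0(2) that by blast
 obtain s where "good K0 (?e (cr s * dL))" using no_return_good[OF K0(1) r de ie dL0 tr0 a(1,3) nr] by blast
 thus ?thesis using that good_mono K0(2) by blast
qed

text \<open>A germ at a singularity takes regular values, which are good.
  \<open>forward_complete\<close> moves this back to the apex of the germ on some subcone, and
  decidedness enlarges the subcone to \<open>K\<close>.\<close>

lemma all_complete:
 assumes dec: "decided K G" and g: "!!x. x \<in> Reg ==> good K x" and h: "h \<in> G"
 shows "complete h K"
proof -
 have K: "ocone K" using decidedD(1)[OF dec] .
 obtain de where d: "de > 0" "dimm (K Int ball 0 de) h" using decidedD(2)[OF dec] h unfolding germ_family_def by blast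
 obtain k where k: "k \<in> K" using oconeD(3)[OF K] by blast
 obtain t where t: "0 < t" "cr t * k \<in> K" "norm (cr t * k) < de" using ocone_small[OF K d(1) k] by blast
 have "good K (h (cr t * k))" by (rule g[OF dimm_reg[OF d(2)]]) (use t in simp)
 then obtain K1 where "ocone K1" "K1 \<subseteq> K" "complete h K1" using forward_complete[OF dec d(2) t(2,3)] by blast
 thus ?thesis using decidedD(3)[OF dec h] by blast
qed

section \<open>Hyperbolic closed geodesics as limit sets\<close>

lemma transition_factorI:
 assumes "(U, ph) \<in> atlas X" "(V, xi) \<in> atlas X" "dimm_at E w" "e > 0" "al > 0"
  "!!z. z \<in> ball w e ==> E z \<in> U & ph (E z) = cr al * z + b"
  "!!z. z \<in> ball w e ==> E z \<in> V & xi (E z) = cr be * z + b'"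
 shows "transition_factor X (U, ph) (V, xi) (E w) (be / al)"
proof -
 obtain W where W: "openin topX W" "E w \<in> W" "W \<subseteq> E ` ball w e" using dimm_nbhd[OF assms(3,4)] by blast
 have "W \<subseteq> U Int V" using W(3) assms(6,7) by blast
 moreover have "xi y = cr (be / al) * ph y + (b' - cr (be / al) * b)" if yW: "y \<in> W" for y proof -
  obtain z where z: "z \<in> ball w e" "y = E z" using W(3) yW by blast
  show ?thesis using assms(5) assms(6,7)[OF z(1)] z(2) by (simp only: distrib_left) simp
 qed
 ultimately show ?thesis unfolding transition_factor_def fst_conv snd_conv using W(1,2) by blast
qed

text \<open>A transition factor is the quotient of the scales of \<open>E\<close> in two successive
  charts, so the product along the loop telescopes. At its end the loop is back in the initial
  chart, where the identification multiplies the scale by \<open>nu\<close>.\<close>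

lemma hyperbolic_geodesic:
 assumes D: "dimm D E" and s: "s > 0" and seg: "!!u. 0 <= u ==> u <= 1 ==> q + cr (s * (u - 0)) * d \<in> D"
  and hol: "e0 > 0" "nu > 0" "nu ~= 1" "!!h. norm h < e0 ==> E (q + cr s * d + h) = E (q + cr nu * h)"
 shows "hyperbolic_closed_geodesic X d (%u. E (q + cr (s * (u - 0)) * d))"
proof -
 let ?c = "%u. E (q + cr (s * (u - 0)) * d)"
 let ?z = "%u. q + cr (s * (u - 0)) * d"
 have "?c 0 = ?c 1" using hol(4)[of 0] hol(1) by simp
 moreover have "straight_path X d {0..1} ?c" by (rule straight_line[OF D s]) (use seg in auto)
 ultimately have cg: "closed_geodesic X d ?c" unfolding closed_geodesic_def by blast
 define S where "S = ?z ` {0..1}"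
 have cS: "compact S" unfolding S_def by (intro compact_continuous_image continuous_intros) simp
 have Sne: "S ~= {}" unfolding S_def by simp
 have SD: "S \<subseteq> D" unfolding S_def using seg by auto
 let ?ok = "%B U ph a b. (U, ph) \<in> atlas X & a > 0 & (\<forall>w\<in>B. E w \<in> U & ph (E w) = cr a * w + b)"
 define Cov where "Cov = {B. open B & (\<exists>U ph a b. ?ok B U ph a b)}"
 have cov: "S \<subseteq> \<Union>Cov" proof
  fix x assume "x \<in> S"
  hence "dimm_at E x" using SD dimm_atD[OF D] by blast
  then obtain U ph a b e where "(U, ph) \<in> atlas X" "a > 0" "e > 0" "\<forall>w\<in>ball x e. E w \<in> U & ph (E w) = cr a * w + b" unfolding dimm_at_def by auto
  hence "ball x e \<in> Cov" "x \<in> ball x e" unfolding Cov_def by auto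
  thus "x \<in> \<Union>Cov" by blast
 qed
 have opn: "open B" if "B \<in> Cov" for B using that unfolding Cov_def by blast
 obtain de where del: "de > 0" "!!x. x \<in> S ==> \<exists>B\<in>Cov. ball x de \<subseteq> B" by (rule Heine_Borel_lemma[OF cS cov opn], assumption, rule that)
 obtain n :: nat where n: "n > 0" "s * norm d / real n < de" proof -
  obtain n :: nat where n: "s * norm d < real n * de" using reals_Archimedean3[OF del(1)] by blast
  have "n > 0" using n s by (cases "n = 0") (auto simp: mult_less_0_iff not_less)
  thus ?thesis using that[of n] n by (simp add: pos_divide_less_eq mult.commute)
 qed
 define t where "t i = real i / real n" for i :: nat
 have t01: "0 <= t i" "t i <= 1" if "i <= n" for i using that n(1) by (auto simp: t_def)
 have tS: "?z (t i) \<in> S" if "i <= n" for i unfolding S_def using t01[OF that] by (intro imageI) auto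
 have piece: "?z u \<in> ball (?z (t i)) de" if "t i <= u" "u <= t (Suc i)" for i u proof -
  have "u - t i <= 1 / real n" using that by (simp add: t_def add_divide_distrib)
  hence "(u - t i) * (s * norm d) <= (1 / real n) * (s * norm d)" using s by (intro mult_right_mono) auto
  hence 1: "(u - t i) * (s * norm d) < de" using n(2) by simp
  have "?z (t i) - ?z u = cr (- (s * (u - t i))) * d" by (simp add: algebra_simps)
  hence "norm (?z (t i) - ?z u) = (u - t i) * (s * norm d)" using s that(1) by (simp only: norm_mult norm_of_real) (simp add: abs_mult)
  thus ?thesis using 1 by (simp add: dist_norm)
 qed
 have "\<forall>i. \<exists>q. i <= n --> (fst q, fst (snd q)) \<in> atlas X & fst (snd (snd q)) > (0::real) & (\<forall>w\<in>ball (?z (t i)) de. E w \<in> fst q & fst (snd q) (E w) = cr (fst (snd (snd q))) * w + snd (snd (snd q)))" proof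
  fix i
  show "\<exists>q. i <= n --> (fst q, fst (snd q)) \<in> atlas X & fst (snd (snd q)) > (0::real) & (\<forall>w\<in>ball (?z (t i)) de. E w \<in> fst q & fst (snd q) (E w) = cr (fst (snd (snd q))) * w + snd (snd (snd q)))" proof (cases "i <= n")
   case True
   then obtain B where B: "B \<in> Cov" "ball (?z (t i)) de \<subseteq> B" using del(2)[OF tS] by blast
   then obtain U ph a b where "?ok B U ph a b" unfolding Cov_def by blast
   thus ?thesis using B(2) by (intro exI[of _ "(U, ph, a, b)"]) auto
  qed blast
 qed
 from choice[OF this] obtain Q where Q: "!!i. i <= n ==> (fst (Q i), fst (snd (Q i))) \<in> atlas X & fst (snd (snd (Q i))) > (0::real) &
  (\<forall>w\<in>ball (?z (t i)) de. E w \<in> fst (Q i) & fst (snd (Q i)) (E w) = cr (fst (snd (snd (Q i)))) * w + snd (snd (snd (Q i))))" by blast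
 define U where "U i = fst (Q i)" for i
 define ph where "ph i = fst (snd (Q i))" for i
 define al where "al i = fst (snd (snd (Q i)))" for i
 define b where "b i = snd (snd (snd (Q i)))" for i
 have C: "(U i, ph i) \<in> atlas X" "al i > 0" "!!w. w \<in> ball (?z (t i)) de ==> E w \<in> U i & ph i (E w) = cr (al i) * w + b i" if "i <= n" for i using Q[OF that] unfolding U_def ph_def al_def b_def by blast+
 \<comment> \<open>Chart number \<open>n\<close> is replaced by number 0 to make the chain cyclic;
   \<open>be n\<close> is the scale that this chart shows at the end of the loop.\<close>
 define m where "m i = (if i = n then 0 else i)" for i
 define be where "be i = (if i = n then nu * al 0 else al i)" for i
 have tf: "transition_factor X (U i, ph i) (U (m (Suc i)), ph (m (Suc i))) (?c (t (Suc i))) (be (Suc i) / al i)" if i: "i < n" for i proof -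
  have il: "i <= n" "Suc i <= n" using i by auto
  have le: "t i <= t (Suc i)" by (simp add: t_def divide_right_mono)
  let ?w = "?z (t (Suc i))"
  have wB: "?w \<in> ball (?z (t i)) de" by (rule piece[OF le order_refl])
  have dw: "dimm_at E ?w" using tS[OF il(2)] SD dimm_atD[OF D] by blast
  obtain r where r: "r > 0" "ball ?w r \<subseteq> ball (?z (t i)) de" using wB open_contains_ball[of "ball (?z (t i)) de"] by blast
  show ?thesis proof (cases "Suc i = n")
   case False
   hence mi: "m (Suc i) = Suc i" "be (Suc i) = al (Suc i)" by (auto simp: m_def be_def)
   show ?thesis unfolding mi proof (rule transition_factorI[OF C(1)[OF il(1)] C(1)[OF il(2)] dw _ C(2)[OF il(1)]])
    show "min r de > 0" using r del by simp
    fix z assume z: "z \<in> ball ?w (min r de)"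
    show "E z \<in> U i & ph i (E z) = cr (al i) * z + b i" by (rule C(3)[OF il(1)]) (use z r(2) in auto)
    show "E z \<in> U (Suc i) & ph (Suc i) (E z) = cr (al (Suc i)) * z + b (Suc i)" by (rule C(3)[OF il(2)]) (use z in auto)
   qed
  next case True
   hence mi: "m (Suc i) = 0" "be (Suc i) = nu * al 0" by (auto simp: m_def be_def)
   have t1: "t (Suc i) = 1" "t 0 = 0" unfolding True using n(1) by (simp_all add: t_def)
   have we: "?w = q + cr s * d" unfolding t1 by simp
   define r' where "r' = min r (min e0 (de / nu))"
   have r': "r' > 0" using r hol del by (simp add: r'_def)
   show ?thesis unfolding mi proof (rule transition_factorI[OF C(1)[OF il(1)] C(1)[of 0] dw r' C(2)[OF il(1)]])
    fix z assume z: "z \<in> ball ?w r'"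
    show "E z \<in> U i & ph i (E z) = cr (al i) * z + b i" by (rule C(3)[OF il(1)]) (use z r(2) in \<open>auto simp: r'_def\<close>)
    define h where "h = z - ?w"
    have h: "norm h < e0" "norm h < de / nu" using z by (auto simp: h_def r'_def dist_norm norm_minus_commute)
    have zh: "z = q + cr s * d + h" using we by (simp add: h_def)
    have Ez: "E z = E (q + cr nu * h)" unfolding zh by (rule hol(4)[OF h(1)])
    have "q + cr nu * h \<in> ball (?z (t 0)) de" using h(2) hol(2) unfolding t1 by (simp add: norm_mult pos_less_divide_eq mult.commute dist_norm)
    hence "E z \<in> U 0 & ph 0 (E z) = cr (al 0) * (q + cr nu * h) + b 0" unfolding Ez by (intro C(3)) auto
    moreover have "cr (al 0) * (q + cr nu * h) + b 0 = cr (nu * al 0) * z + (cr (al 0) * (q - cr nu * ?w) + b 0)" unfolding h_def by (simp add: algebra_simps)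
    ultimately show "E z \<in> U 0 & ph 0 (E z) = cr (nu * al 0) * z + (cr (al 0) * (q - cr nu * ?w) + b 0)" by (simp only:)
   qed simp
  qed
 qed
 have "holonomy_ratio X ?c nu" unfolding holonomy_ratio_def proof (rule exI[of _ n], rule exI[of _ t], rule exI[of _ "%i. (U (m i), ph (m i))"], rule exI[of _ "%i. be (Suc i) / al i"], intro conjI allI impI)
  show "t 0 = 0" "t n = 1" using n(1) by (auto simp: t_def)
  show "(U (m n), ph (m n)) = (U (m 0), ph (m 0))" using n(1) by (simp add: m_def)
  fix i assume i: "i < n"
  hence mi: "m i = i" by (simp add: m_def)
  show "t i < t (Suc i)" using n(1) by (simp add: t_def divide_strict_right_mono)
  show "(U (m i), ph (m i)) \<in> atlas X" unfolding mi using C(1) i by simp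
  show "?c ` {t i..t (Suc i)} \<subseteq> fst (U (m i), ph (m i))" unfolding mi fst_conv proof
   fix y assume "y \<in> ?c ` {t i..t (Suc i)}"
   then obtain u where u: "t i <= u" "u <= t (Suc i)" "y = ?c u" by auto
   show "y \<in> U i" unfolding u(3) using C(3)[OF _ piece[OF u(1,2)]] i by simp
  qed
  show "transition_factor X (U (m i), ph (m i)) (U (m (Suc i)), ph (m (Suc i))) (?c (t (Suc i))) (be (Suc i) / al i)" using tf[OF i] unfolding mi .
 next
  have bp: "be i ~= 0" if "i <= n" for i using C(2)[of 0] C(2)[OF that] hol(2) unfolding be_def by auto
  have tele: "(\<Prod>i<k. be (Suc i) / be i) = be k / be 0" if "k <= n" for k using that proof (induction k)
   case 0
   thus ?case using bp[of 0] by simp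
  next case (Suc k)
   thus ?case using bp[of k] by simp
  qed
  have "(\<Prod>i<n. be (Suc i) / al i) = (\<Prod>i<n. be (Suc i) / be i)" by (rule prod.cong) (auto simp: be_def)
  also have "... = be n / be 0" by (rule tele) simp
  also have "... = nu" using n(1) C(2)[of 0] by (simp add: be_def)
  finally show "nu = (\<Prod>i<n. be (Suc i) / al i)" by simp
 qed
 thus ?thesis unfolding hyperbolic_closed_geodesic_def using cg hol(3) by blast
qed

lemma homothety_power:
 assumes C: "ocone C" "l > 0" "!!z. z - z0 \<in> C ==> F (z0 + cr l * (z - z0)) = F z" and z: "z - z0 \<in> C"
 shows "F (z0 + cr (l ^ n) * (z - z0)) = F z"
proof (induction n)
 case 0
 thus ?case by simp
next case (Suc n)
 let ?w = "z0 + cr (l ^ n) * (z - z0)"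
 have 1: "F (z0 + cr l * (?w - z0)) = F ?w" by (rule C(3)) (use oconeD(5)[OF C(1) z, of "l ^ n"] C(2) in simp)
 show ?case using 1 Suc by (simp add: mult.assoc)
qed

text \<open>Pulling \<open>p + s * d\<close> back by \<open>n\<close> steps of the homothety divides
  its deviation \<open>p - z0\<close> from the ray at \<open>z0\<close> by \<open>l ^ n\<close>. So
  the trajectory approaches the image of the ray, which is a closed geodesic of ratio different from
  1.\<close>

lemma accumulates_forward:
 assumes C: "ocone C" "dimm {z. z - z0 \<in> C} F" "l > 1" "!!z. z - z0 \<in> C ==> F (z0 + cr l * (z - z0)) = F z"
  and d: "d \<in> C" and mu: "mu > 0" and ga: "!!s. s >= S0 ==> t0 + s / mu \<in> I & ga (t0 + s / mu) = F (p + cr s * d)"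
 shows "\<exists>c. hyperbolic_closed_geodesic X d c & accumulates_on X I ga c"
proof (intro exI conjI)
 \<comment> \<open>One period of the ray, from \<open>z0 + d\<close> to
   \<open>z0 + l * d\<close>.\<close>
 let ?c = "%u. F (z0 + d + cr ((l - 1) * (u - 0)) * d)"
 have on: "z0 + d + cr ((l - 1) * (u - 0)) * d = z0 + cr (1 + (l - 1) * u) * d" for u by (simp add: algebra_simps)
 have inC: "z0 + cr (1 + (l - 1) * u) * d - z0 \<in> C" if "0 <= u" for u proof -
  have "(l - 1) * u >= 0" using that C(3) by simp
  thus ?thesis using oconeD(5)[OF C(1) d, of "1 + (l - 1) * u"] by (simp del: of_real_add of_real_mult)
 qed
 have l0: "l > 0" using C(3) by simp
 obtain e where e: "e > 0" "ball d e \<subseteq> C" using d oconeD(1)[OF C(1)] open_contains_ball by blast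
 show "hyperbolic_closed_geodesic X d ?c" proof (rule hyperbolic_geodesic[OF C(2), of _ _ _ "e * l" "1 / l"])
  show "l - 1 > 0" using C(3) by simp
  show "z0 + d + cr ((l - 1) * (u - 0)) * d \<in> {z. z - z0 \<in> C}" if "0 <= u" for u unfolding on using inC[OF that] by blast
  show "e * l > 0" using e l0 by simp
  show "1 / l > 0" "1 / l ~= 1" using C(3) by auto
  fix h :: complex assume h: "norm h < e * l"
  have "(z0 + d + cr (1 / l) * h) - z0 \<in> C" using h l0 e(2) by (auto simp: norm_mult norm_divide pos_divide_less_eq dist_norm algebra_simps)
  hence "F (z0 + cr l * ((z0 + d + cr (1 / l) * h) - z0)) = F (z0 + d + cr (1 / l) * h)" by (rule C(4))
  moreover have "z0 + cr l * ((z0 + d + cr (1 / l) * h) - z0) = z0 + d + cr (l - 1) * d + h" using l0 by (simp add: algebra_simps)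
  ultimately show "F (z0 + d + cr (l - 1) * d + h) = F (z0 + d + cr (1 / l) * h)" by (simp only:)
 qed
 show "accumulates_on X I ga ?c" unfolding accumulates_on_def proof (intro ballI allI impI)
  fix x W t0' assume x: "x \<in> ?c ` {0..1}" and W: "openin topX W & x \<in> W" and t0': "t0' \<in> I"
  obtain u where u: "0 <= u" "x = ?c u" using x by auto
  define si where "si = 1 + (l - 1) * u"
  have sg: "si >= 1" using u(1) C(3) by (simp add: si_def)
  have xF: "x = F (z0 + cr si * d)" unfolding u(2) on si_def ..
  have op: "open {z\<in>{z. z - z0 \<in> C}. F z \<in> W}" by (rule dimm_open_vimage[OF C(2)]) (use W in blast)
  have "z0 + cr si * d \<in> {z\<in>{z. z - z0 \<in> C}. F z \<in> W}" using inC[OF u(1)] W unfolding xF[symmetric] si_def by (simp add: xF si_def)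
  then obtain e where e: "e > 0" "ball (z0 + cr si * d) e \<subseteq> {z\<in>{z. z - z0 \<in> C}. F z \<in> W}" using op open_contains_ball by blast
  define N where "N = max (norm (p - z0) / e) (max S0 (mu * (t0' - t0)))"
  obtain n where n: "l ^ n > N" using real_arch_pow[OF C(3)] by blast
  have ln: "l ^ n > norm (p - z0) / e" "l ^ n > S0" "l ^ n > mu * (t0' - t0)" "l ^ n > 0" using n l0 by (auto simp: N_def)
  define s where "s = l ^ n * si"
  have s: "s >= l ^ n" unfolding s_def using sg ln(4) by simp
  let ?z = "z0 + cr si * d + cr (1 / l ^ n) * (p - z0)"
  have "norm (cr (1 / l ^ n) * (p - z0)) < e" proof -
   show ?thesis using ln(1) e(1) ln(4) l0 by (simp add: norm_mult norm_divide norm_power pos_divide_less_eq mult.commute)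
  qed
  hence "?z \<in> ball (z0 + cr si * d) e" by (simp add: dist_norm)
  hence z: "?z - z0 \<in> C" "F ?z \<in> W" using e(2) by blast+
  have b: "cr (l ^ n) * (cr (1 / l ^ n) * (p - z0)) = p - z0" using l0 by simp
  have "?z - z0 = cr si * d + cr (1 / l ^ n) * (p - z0)" by simp
  hence "z0 + cr (l ^ n) * (?z - z0) = z0 + (cr (l ^ n) * (cr si * d) + (p - z0))" by (simp only: distrib_left b)
  also have "... = p + cr s * d" by (simp add: s_def mult.assoc)
  finally have 1: "t0 + s / mu \<in> I" "ga (t0 + s / mu) \<in> W" using homothety_power[of C l z0 F ?z n, OF C(1) l0 C(4) z(1)] ga[of s] s ln(2) z(2) by auto
  have "t0' - t0 <= s / mu" using ln(3) s mu by (simp add: pos_le_divide_eq mult.commute)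
  thus "\<exists>t\<in>I. t0' <= t & ga t \<in> W" using 1 by (intro bexI[of _ "t0 + s / mu"]) auto
 qed
qed

lemma straight_continuous:
 assumes "straight_path X d I ga" shows "continuous_map (top_of_set I) topX ga" unfolding continuous_map_def
proof (intro conjI allI impI)
 show "ga \<in> topspace (top_of_set I) \<rightarrow> topspace topX" using assms Reg_topspace unfolding straight_path_def by fastforce
 fix W assume W: "openin topX W"
 show "openin (top_of_set I) {t \<in> topspace (top_of_set I). ga t \<in> W}" proof (subst openin_subopen, intro ballI)
  fix t assume "t \<in> {t \<in> topspace (top_of_set I). ga t \<in> W}"
  hence t: "t \<in> I" "ga t \<in> W" by auto
  obtain E e where E: "dimm_at E (cr t * d)" "e > 0" "!!u. u \<in> I ==> \<bar>u - t\<bar> < e ==> ga u = E (cr u * d)" using assms t(1) unfolding straight_iff by blast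
  obtain r where r: "r > 0" "dimm (ball (cr t * d) r) E" using dimm_at_ball[OF E(1)] by blast
  define O' where "O' = {z\<in>ball (cr t * d) r. E z \<in> W}"
  have oO: "open O'" unfolding O'_def by (rule dimm_open_vimage[OF r(2) W])
  have "continuous_on UNIV (%u::real. cr u * d)" by (intro continuous_intros)
  hence oT: "open {u::real. cr u * d \<in> O'}" using open_vimage[OF oO] by (simp add: vimage_def)
  let ?T = "I Int ({u. cr u * d \<in> O'} Int ball t e)"
  have "?T \<subseteq> {t \<in> topspace (top_of_set I). ga t \<in> W}" proof
   fix u assume u: "u \<in> ?T"
   thus "u \<in> {t \<in> topspace (top_of_set I). ga t \<in> W}" using E(3) u using u unfolding O'_def by (simp add: dist_real_def abs_minus_commute)
  qed
  moreover have "openin (top_of_set I) ?T" by (rule openin_open_Int) (use oT in blast)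
  moreover have "t \<in> ?T" unfolding O'_def using r(1) E(3)[OF t(1)] E(2) t(2) using t E(2) by simp
  ultimately show "\<exists>T. openin (top_of_set I) T & t \<in> T & T \<subseteq> {t \<in> topspace (top_of_set I). ga t \<in> W}" by blast
 qed
qed

text \<open>The fixed point is \<open>- k\<close>, and the segment from \<open>c\<close> to 0 is one
  period of the ray that starts there. A neighbourhood of it in \<open>D\<close> contains a
  fundamental piece of a thin cone around \<open>k\<close>; the powers of the homothety fill this
  cone, and \<open>cone_extension\<close> fills \<open>K\<close>.\<close>

lemma spread:
 assumes dec: "decided K G" and D: "convex D" "dimm D E" "0 \<in> D" and l: "0 < l" "l < 1"
  and inv: "!!w. w \<in> D ==> cr l * w + c \<in> D ==> E (cr l * w + c) = E w" and c: "c \<in> D"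
  and k: "k \<in> K" "c = cr (l - 1) * k"
 obtains H where "dimm {z. z + k \<in> K} H" "\<exists>e>0. \<forall>z\<in>ball 0 e. H z = E z"
proof -
 have K: "ocone K" using decidedD(1)[OF dec] .
 let ?z0 = "- k"
 have A: "?z0 + cr l * (w - ?z0) = cr l * w + c" for w unfolding k(2) by (simp add: algebra_simps)
 obtain F where F: "dimm (\<Union>n::int. {z. ?z0 + cr (l powi n) * (z - ?z0) \<in> D}) F"
  "!!n z. ?z0 + cr (l powi n) * (z - ?z0) \<in> D ==> F z = E (?z0 + cr (l powi n) * (z - ?z0))" by (rule glue_homothety[OF D(1,2) l(1), of ?z0]) (use inv in \<open>unfold A, blast+\<close>)
 let ?s = "%x::real. ?z0 + cr x * k"
 have seg: "?s x \<in> D" if "l <= x" "x <= 1" for x proof (rule convex_line_mem[OF D(1) _ _ that])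
  have "?s l = c" unfolding k(2) by (simp add: algebra_simps)
  thus "?s l \<in> D" using c by simp
  show "?s 1 \<in> D" using D(3) by simp
 qed
 have cc: "compact (?s ` {l..1})" by (intro compact_continuous_image continuous_intros) simp
 have sD: "?s ` {l..1} \<subseteq> D" using seg by auto
 obtain ep where eps: "ep > 0" "(\<Union>x\<in>?s ` {l..1}. ball x ep) \<subseteq> D" using compact_subset_open_imp_ball_epsilon_subset[OF cc dimm_open[OF D(2)] sD] by blast
 have near: "?s x + h \<in> D" if "l <= x" "x <= 1" "norm h < ep" for x h proof -
  show ?thesis using that eps(2) by (fastforce simp: dist_norm)
 qed
 obtain K' where K': "ocone K'" "K' \<subseteq> K" "k \<in> K'" "!!z. z \<in> K' ==> \<exists>t>0. \<exists>x\<in>K. norm (x - k) < ep & z = cr t * x" using ocone_around[OF K k(1) eps(1)] by blast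
 have win: "\<exists>n::int. ?z0 + cr (l powi n) * w \<in> D" if w: "w \<in> K'" for w proof -
  obtain t x where x: "t > 0" "norm (x - k) < ep" "w = cr t * x" using K'(4)[OF w] by blast
  have "1 / l > 1" "t / l > 0" using l x(1) by auto
  then obtain n :: int where n: "1 < (1 / l) powi n * (t / l)" "(1 / l) powi n * (t / l) <= 1 / l" by (rule powi_window)
  define y where "y = l powi (- n) * t"
  have "(1 / l) powi n * (t / l) = y / l" using l by (simp add: power_int_minus power_int_divide_distrib divide_inverse power_int_inverse y_def)
  hence "1 < y / l" "y / l <= 1 / l" using n by (simp_all only:)
  hence y: "l <= y" "y <= 1" using l by (simp_all add: pos_less_divide_eq divide_le_cancel)
  have "norm (cr y * (x - k)) < ep" proof -
   have "y * norm (x - k) <= 1 * norm (x - k)" using y by (intro mult_right_mono) auto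
   thus ?thesis using x(2) y l by (simp add: norm_mult)
  qed
  hence "?s y + cr y * (x - k) \<in> D" by (rule near[OF y])
  moreover have "?s y + cr y * (x - k) = ?z0 + cr (l powi (- n)) * w" unfolding x(3) y_def by (simp add: algebra_simps)
  ultimately show ?thesis by metis
 qed
 let ?F' = "%w. F (w + ?z0)"
 have dF': "dimm K' ?F'" proof (rule dimm_subset[OF dimm_shift[OF F(1), of ?z0] oconeD(1)[OF K'(1)]])
  show "K' \<subseteq> {z. z + ?z0 \<in> (\<Union>n::int. {z. ?z0 + cr (l powi n) * (z - ?z0) \<in> D})}" proof
   fix w assume "w \<in> K'"
   then obtain n :: int where n: "?z0 + cr (l powi n) * w \<in> D" using win by blast
   have "?z0 + cr (l powi n) * (w + ?z0 - ?z0) \<in> D" using n by simp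
   thus "w \<in> {z. z + ?z0 \<in> (\<Union>n::int. {z. ?z0 + cr (l powi n) * (z - ?z0) \<in> D})}" by blast
  qed
 qed
 have L1: "1 / l > 1" using l by simp
 have invF: "?F' (cr (1 / l) * w) = ?F' w" if w: "w \<in> K'" for w proof -
  obtain n :: int where n: "?z0 + cr (l powi n) * w \<in> D" using win[OF w] by blast
  have e: "?z0 + cr (l powi (n + 1)) * ((cr (1 / l) * w + ?z0) - ?z0) = ?z0 + cr (l powi n) * w" using l by (simp add: power_int_add)
  have e2: "?z0 + cr (l powi n) * ((w + ?z0) - ?z0) = ?z0 + cr (l powi n) * w" by simp
  have "?F' (cr (1 / l) * w) = E (?z0 + cr (l powi (n + 1)) * ((cr (1 / l) * w + ?z0) - ?z0))" by (rule F(2)[of "n + 1" "cr (1 / l) * w + ?z0"]) (unfold e, rule n)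
  moreover have "?F' w = E (?z0 + cr (l powi n) * ((w + ?z0) - ?z0))" by (rule F(2)[of n "w + ?z0"]) (unfold e2, rule n)
  ultimately show ?thesis unfolding e e2 by (simp only:)
 qed
 obtain H where H: "dimm K H" "!!z. z \<in> K' ==> H z = ?F' z" "!!z. z \<in> K ==> H (cr (1 / l) * z) = H z" by (rule cone_extension[OF dec K'(1,2) dF' L1 invF], assumption, rule that)
 show ?thesis proof (rule that[OF dimm_shift[OF H(1), of k]])
  have "0 \<in> D Int {z. z + k \<in> K'}" using D(3) K'(3) by simp
  moreover have "open (D Int {z. z + k \<in> K'})" using dimm_open[OF D(2)] open_translate_preimage[OF oconeD(1)[OF K'(1)], of "- k"] by auto
  ultimately obtain e where e: "e > 0" "ball 0 e \<subseteq> D Int {z. z + k \<in> K'}" using open_contains_ball by blast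
  have "H (z + k) = E z" if "z \<in> ball 0 e" for z proof -
   have z: "z \<in> D" "z + k \<in> K'" using e(2) that by blast+
   have "H (z + k) = F z" using H(2)[OF z(2)] by simp
   also have "F z = E z" using F(2)[of 0 z] z(1) by simp
   finally show ?thesis .
  qed
  thus "\<exists>e>0. \<forall>z\<in>ball 0 e. H (z + k) = E z" using e(1) by blast
 qed
qed

text \<open>The past of each return near 0 is a ray in the immersed cone. Two returns give a
  similarity, which must fix the apex \<open>z0\<close> of the invariant cone. As the returns
  approach 0 while the length \<open>ta\<close> between them stays at least \<open>rh\<close>,
  \<open>z0\<close> has to lie on the line through 0 in direction \<open>d\<close>. This line then
  projects to a hyperbolic closed geodesic, to which the trajectory comes back.\<close>

lemma accumulates_backward:
 assumes K: "ocone K" and d: "norm d = 1" "- d \<in> K" and b: "b \<in> K" and H: "dimm {z. z + b \<in> K} H" and tr: "trajectory X d I ga"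
  and near: "!!ep t. ep > 0 ==> t \<in> I ==> \<exists>t'\<in>I. t <= t' & (\<exists>p. norm p < ep & ga t' = H p)"
 shows "\<exists>c. hyperbolic_closed_geodesic X d c & accumulates_on X I ga c"
proof -
 let ?Q = "{z. z + b \<in> K}"
 have KQ: "K \<subseteq> ?Q" using ocone_add[OF K _ b] by blast
 have cQ: "convex ?Q" using convex_affine_preimage[OF oconeD(2)[OF K], of 1 b] by simp
 have Q0: "0 \<in> ?Q" using b by simp
 have d0: "d ~= 0" using d(1) by auto
 have dK: "dimm K H" by (rule dimm_subset[OF H oconeD(1)[OF K] KQ])
 obtain l z0 FC where C: "l > 1" "dimm {z. z - z0 \<in> K} FC" "!!z. z - z0 \<in> K ==> FC (z0 + cr l * (z - z0)) = FC z"
   "!!z. z \<in> K ==> z - z0 \<in> K ==> FC z = H z" using ocone_homothety[OF K dK] by metis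
 have cC: "convex {z. z - z0 \<in> K}" using convex_translate_preimage[OF oconeD(2)[OF K]] .
 have oC: "open {z. z - z0 \<in> K}" using dimm_open[OF C(2)] .
 have oQ: "open ?Q" using dimm_open[OF H] .
 have FCH: "FC z = H z" if z: "z \<in> ?Q" "z - z0 \<in> K" for z proof (rule convex_agree[OF cC C(2) cQ H, of "K Int {z. z - z0 \<in> K}"])
  obtain T where T: "T > 0" "!!t. t >= T ==> - z0 + cr t * (- d) \<in> K" using ocone_far[OF K d(2)] by metis
  show "K Int {z. z - z0 \<in> K} ~= {}" using oconeD(5)[OF K d(2) T(1)] T(2)[of T, unfolded uminus_add_conv_diff] by blast
  show "open (K Int {z. z - z0 \<in> K})" using oconeD(1)[OF K] oC by blast
 qed (use z KQ C(4) in auto)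
 \<comment> \<open>Inside the domain of \<open>H\<close> the homothety about \<open>z0\<close> would
   contradict the injectivity of \<open>H\<close> near \<open>z0\<close>.\<close>
 have z0Q: "z0 ~: ?Q" proof
  assume zQ: "z0 \<in> ?Q"
  obtain e1 where e1: "e1 > 0" "inj_on H (ball z0 e1)" by (rule dimm_at_inj[OF dimm_atD[OF H zQ]], rule that)
  obtain e2 where e2: "e2 > 0" "ball z0 e2 \<subseteq> ?Q" using oQ zQ open_contains_ball by blast
  have m: "min e1 e2 / l > 0" using e1 e2 C(1) by simp
  obtain t where t: "0 < t" "cr t * (- d) \<in> K" "norm (cr t * (- d)) < min e1 e2 / l" using ocone_small[OF K m d(2)] by blast
  define k where "k = cr t * (- d)"
  have k: "k \<in> K" "norm k < min e1 e2 / l" "k ~= 0" using t d0 by (auto simp: k_def)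
  have "1 * norm k <= l * norm k" using C(1) by (intro mult_right_mono) auto
  hence sm: "norm k < min e1 e2" "norm (cr l * k) < min e1 e2" using k(2) C(1) C(1) by (auto simp: pos_less_divide_eq mult.commute norm_mult)
  have b1: "z0 + k \<in> ball z0 e1" "z0 + cr l * k \<in> ball z0 e1" using sm by (auto simp: dist_norm)
  have "z0 + k \<in> ball z0 e2" "z0 + cr l * k \<in> ball z0 e2" using sm by (auto simp: dist_norm)
  hence q: "z0 + k \<in> ?Q" "z0 + cr l * k \<in> ?Q" using e2(2) by blast+
  have lkK: "cr l * k \<in> K" using oconeD(5)[OF K k(1)] C(1) by simp
  have "H (z0 + cr l * k) = H (z0 + k)" using C(3)[of "z0 + k"] k(1) FCH[OF q(1)] FCH[OF q(2)] k(1) lkK by simp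
  hence "z0 + cr l * k = z0 + k" by (rule inj_onD[OF e1(2)]) (use b1 in auto)
  thus False using k(3) C(1) by (simp del: of_real_diff)
 qed
 obtain e1 where e1: "e1 > 0" "inj_on H (ball 0 e1)" by (rule dimm_at_inj[OF dimm_atD[OF H Q0]], rule that)
 obtain e2 where e2: "e2 > 0" "ball 0 e2 \<subseteq> ?Q" using oQ Q0 open_contains_ball by blast
 define rh where "rh = min e1 e2 / 3"
 have rho: "rh > 0" "3 * rh <= e1" "3 * rh <= e2" using e1 e2 by (auto simp: rh_def)
 have backw: "\<exists>mu>0. \<forall>s\<le>rh. t + s / mu \<in> I & ga (t + s / mu) = H (p + cr s * d)" if t: "t \<in> I" "ga t = H p" "norm p < rh" for t p proof -
  have pQ: "p + cr s * d \<in> ?Q" if s: "s \<in> {..rh}" for s proof (cases "s < 0")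
   case True
   have "p \<in> ball 0 e2" using t(3) rho by simp
   hence "p + b \<in> K" using e2(2) by blast
   hence "(p + b) + cr (- s) * (- d) \<in> K" by (rule ocone_add[OF K _ oconeD(5)[OF K d(2)]]) (use True in simp)
   thus ?thesis by (simp add: algebra_simps)
  next case False
   have "norm (p + cr s * d) < e2" using s False d(1) norm_triangle_ineq[of p "cr s * d"] t(3) rho by (simp add: norm_mult)
   thus ?thesis using e2(2) by auto
  qed
  have i: "is_interval {..rh}" "0 \<in> {..rh}" using rho by (auto simp: is_interval_ic)
  obtain mu where "mu > 0" "!!s. s \<in> {..rh} ==> t + s / mu \<in> I & ga (t + s / mu) = H (p + cr s * d)" by (rule follow[OF tr d0 t(1) H i pQ t(2)], assumption, rule that)
  thus ?thesis by blast
 qed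
 \<comment> \<open>\<open>ta\<close> is the length from the first return to the second, measured in
   the coordinate of the second. The equation says that the similarity that takes \<open>p\<close>
   to \<open>q - ta * d\<close> fixes \<open>z0\<close>.\<close>
 have pairs: "\<exists>p q ta mu. norm p < et & norm q < et & rh <= ta & 0 < mu & cr ta * d = cr mu * (z0 - p) - (z0 - q)"
  if eta: "0 < et" "et <= rh" for et proof -
  obtain t where "t \<in> I" using tr unfolding trajectory_def by blast
  then obtain t1 p where t1: "t1 \<in> I" "norm p < et" "ga t1 = H p" using near[OF eta(1)] by blast
  obtain mu1 where m1: "mu1 > 0" "!!s. s <= rh ==> t1 + s / mu1 \<in> I & ga (t1 + s / mu1) = H (p + cr s * d)" using backw[OF t1(1,3)] t1(2) eta(2) by auto
  obtain t2 q where t2: "t2 \<in> I" "t1 + rh / mu1 <= t2" "norm q < et" "ga t2 = H q" using m1(2)[of rh] near[OF eta(1)] by blast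
  obtain mu2 where m2: "mu2 > 0" "!!s. s <= rh ==> t2 + s / mu2 \<in> I & ga (t2 + s / mu2) = H (q + cr s * d)" using backw[OF t2(1,4)] t2(3) eta(2) by auto
  define ta where "ta = (t2 - t1) * mu2"
  have tt: "t2 - t1 > 0" using t2(2) rho(1) m1(1) by (smt (verit) divide_pos_pos)
  have tau: "ta > 0" using tt m2(1) by (simp add: ta_def)
  have at: "H (q + cr (x * mu2 - ta) * d) = ga (t1 + x)" if "x * mu2 - ta <= rh" for x proof -
   have "t2 + (x * mu2 - ta) / mu2 = t1 + x" using m2(1) by (simp add: ta_def field_simps)
   thus ?thesis using m2(2)[OF that] by simp
  qed
  have ret: "H (q + cr (- ta) * d) = H p" using at[of 0] tau rho(1) t1(3) by simp
  \<comment> \<open>Otherwise both returns lie on one line in a disc where \<open>H\<close> is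
    injective. Their scales then agree, and the time between them is below \<open>rh / mu1\<close>,
    against the choice of \<open>t2\<close>.\<close>
  have "rh <= ta" proof (rule ccontr)
   assume "\<not> rh <= ta"
   hence tr: "ta < rh" by simp
   have inb: "q + cr (y - ta) * d \<in> ball 0 e1" if "0 <= y" "y <= rh" for y proof -
    have "norm (cr (y - ta) * d) <= rh" unfolding norm_mult norm_of_real d(1) using that tr tau by auto
    thus ?thesis using norm_triangle_ineq[of q "cr (y - ta) * d"] t2(3) eta(2) rho by simp
   qed
   have inp: "p + cr y * d \<in> ball 0 e1" if "0 <= y" "y <= rh" for y proof -
    have "norm (cr y * d) <= rh" unfolding norm_mult norm_of_real d(1) using that by auto
    thus ?thesis using norm_triangle_ineq[of p "cr y * d"] t1(2) eta(2) rho by simp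
   qed
   have qp: "q + cr (- ta) * d = p" by (rule inj_onD[OF e1(2) ret]) (use inb[of 0] inp[of 0] rho(1) in auto)
   define x where "x = min (rh / mu1) (rh / mu2)"
   have x: "x > 0" "x * mu1 <= rh" "x * mu2 <= rh" using rho(1) m1(1) m2(1) by (auto simp: x_def pos_le_divide_eq[symmetric])
   have "H (p + cr (x * mu1) * d) = ga (t1 + x)" using m1(2)[OF x(2)] m1(1) by simp
   also have "... = H (q + cr (x * mu2 - ta) * d)" using at[of x] x(3) tau by simp
   finally have "p + cr (x * mu1) * d = q + cr (x * mu2 - ta) * d" by (rule inj_onD[OF e1(2)]) (use inp[of "x * mu1"] inb[of "x * mu2"] x m1(1) m2(1) in simp_all)
   also have "... = p + cr (x * mu2) * d" unfolding qp[symmetric] by (simp add: algebra_simps)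
   finally have "t2 - t1 = ta / mu1" using d0 x(1) m1(1) by (simp add: ta_def)
   also have "... < rh / mu1" using tr m1(1) by (simp add: divide_strict_right_mono)
   finally show False using t2(2) by simp
  qed
  have pQ: "p \<in> ?Q" using e2(2) t1(2) eta(2) rho by (intro subsetD[OF e2(2)]) simp
  have qQ: "q + cr (- ta) * d \<in> ?Q" proof -
   have "q \<in> ball 0 e2" using t2(3) eta(2) rho by simp
   hence "q + b \<in> K" using e2(2) by blast
   hence "(q + b) + cr ta * (- d) \<in> K" by (rule ocone_add[OF K _ oconeD(5)[OF K d(2) tau]])
   thus ?thesis by (simp add: algebra_simps)
  qed
  obtain mu e where m: "mu > 0" "e > 0" "!!h. norm h < e ==> H (p + h) = H (q + cr (- ta) * d + cr mu * h)" using dimm_germ[OF dimm_atD[OF H pQ] dimm_atD[OF H qQ] ret[symmetric]] by blast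
  define be where "be = q + cr (- ta) * d - cr mu * p"
  have Bw: "cr mu * w + be = q + cr (- ta) * d + cr mu * (w - p)" for w by (simp add: be_def algebra_simps)
  have HB: "H (cr mu * w + be) = H w" if w: "w \<in> ?Q" "cr mu * w + be \<in> ?Q" for w proof (rule dimm_affine_unique[OF cQ H cQ H m(1), of "?Q Int {w. cr mu * w + be \<in> ?Q} Int ball p e"])
   show "open (?Q Int {w. cr mu * w + be \<in> ?Q} Int ball p e)" using oQ open_affine_preimage[OF oQ] by (intro open_Int open_ball)
   show "?Q Int {w. cr mu * w + be \<in> ?Q} Int ball p e ~= {}" using pQ qQ m(2) unfolding Bw by auto
   fix v assume v: "v \<in> ?Q Int {w. cr mu * w + be \<in> ?Q} Int ball p e"
   hence "norm (v - p) < e" by (auto simp: dist_norm norm_minus_commute)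
   from m(3)[OF this] show "v \<in> ?Q & cr mu * v + be \<in> ?Q & H (cr mu * v + be) = H v" using v unfolding Bw by simp
  qed (use w in auto)
  have FB: "FC (cr mu * w + be) = FC w" if w: "w - z0 \<in> K" "cr mu * w + be - z0 \<in> K" for w proof (rule dimm_affine_unique[OF cC C(2) cC C(2) m(1), of "K Int {w. w - z0 \<in> K} Int {w. cr mu * w + be \<in> K} Int {w. cr mu * w + (be - z0) \<in> K}"])
   let ?V = "K Int {w. w - z0 \<in> K} Int {w. cr mu * w + be \<in> K} Int {w. cr mu * w + (be - z0) \<in> K}"
   show "open ?V" using oconeD(1)[OF K] oC open_affine_preimage[OF oconeD(1)[OF K]] by (intro open_Int)
   obtain T1 where T1: "!!t. t >= T1 ==> - z0 + cr t * (- d) \<in> K" using ocone_far[OF K d(2)] by metis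
   obtain T2 where T2: "!!t. t >= T2 ==> be + cr t * (- d) \<in> K" using ocone_far[OF K d(2)] by metis
   obtain T3 where T3: "!!t. t >= T3 ==> (be - z0) + cr t * (- d) \<in> K" using ocone_far[OF K d(2)] by metis
   define t where "t = max (max 1 T1) (max (T2/mu) (T3/mu))"
   have "t >= 1" "t >= T1" "T2 / mu <= t" "T3 / mu <= t" by (auto simp: t_def)
   thus "?V ~= {}" using m(1) T1[of t, unfolded uminus_add_conv_diff] T2[of "mu*t"] T3[of "mu*t"] oconeD(5)[OF K d(2), of t] by (auto simp: pos_divide_le_eq mult.commute algebra_simps)
   fix v assume v: "v \<in> ?V"
   have v': "v \<in> K" "v - z0 \<in> K" "cr mu * v + be \<in> K" "cr mu * v + be - z0 \<in> K" using v by (auto simp: algebra_simps)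
   have "H (cr mu * v + be) = H v" by (rule HB) (use v' KQ in auto)
   thus "v \<in> {z. z - z0 \<in> K} & cr mu * v + be \<in> {z. z - z0 \<in> K} & FC (cr mu * v + be) = FC v" using C(4)[OF v'(1,2)] C(4)[OF v'(3,4)] v' by simp
  qed (use w in auto)
  have l01: "0 < l" "l ~= 1" using C(1) by auto
  have "cr mu * z0 + be = z0" by (rule common_fixed_point[OF K C(2) l01 C(3) m(1) FB])
  thus ?thesis unfolding be_def using t1(2) t2(3) \<open>rh <= ta\<close> m(1) by (fastforce simp: algebra_simps)
 qed
 define f where "f z = Im (cnj d * z)" for z
 define g where "g z = Re (cnj d * z)" for z
 have fg: "\<bar>f z\<bar> <= norm z" "\<bar>g z\<bar> <= norm z" for z using abs_Im_le_cmod[of "cnj d * z"] abs_Re_le_cmod[of "cnj d * z"] d(1) by (auto simp: f_def g_def norm_mult)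
 have cdd: "cnj d * d = 1" using complex_norm_square[of d] d(1) by (simp add: mult.commute)
 \<comment> \<open>If \<open>z0\<close> had a nonzero offset from the line, the component of the
   equation orthogonal to \<open>d\<close> would force \<open>mu\<close> close to 1, and then the
   component along \<open>d\<close> would make \<open>ta\<close> smaller than \<open>rh\<close>. The
   choice of \<open>et\<close> quantifies this.\<close>
 have f0: "f z0 = 0" proof (rule ccontr)
  assume fn: "f z0 ~= 0"
  define ph where "ph = \<bar>f z0\<bar>"
  define N where "N = norm z0 + 1"
  have ph: "ph > 0" "N > 0" "norm z0 <= N" using fn by (auto simp: ph_def N_def add_nonneg_pos)
  define et where "et = min (rh / 8) (min (ph / 4) (rh * ph / (8 * N)))"
  have et: "et > 0" "et <= rh / 8" "et <= ph / 4" "et <= rh * ph / (8 * N)" using rho ph by (auto simp: et_def)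
  obtain p q ta mu where P: "norm p < et" "norm q < et" "rh <= ta" "0 < mu" "cr ta * d = cr mu * (z0 - p) - (z0 - q)" using et rho pairs[OF et(1)] by auto
  have "cnj d * (cr ta * d) = cr ta" using cdd by (simp add: mult.left_commute)
  hence im: "0 = mu * (f z0 - f p) - (f z0 - f q)" and re: "ta = mu * (g z0 - g p) - (g z0 - g q)" unfolding P(5) unfolding f_def g_def complex_eq_iff by (auto simp: algebra_simps)
  have "(mu - 1) * (f z0 - f p) = f p - f q" using im by (simp add: algebra_simps)
  hence "\<bar>mu - 1\<bar> * \<bar>f z0 - f p\<bar> = \<bar>f p - f q\<bar>" by (metis abs_mult)
  moreover have "\<bar>f p - f q\<bar> <= 2 * et" using fg(1)[of p] fg(1)[of q] P(1,2) by linarith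
  moreover have "\<bar>f z0 - f p\<bar> >= 3 / 4 * ph" using fg(1)[of p] P(1) et(3) unfolding ph_def by linarith
  hence "\<bar>mu - 1\<bar> * (3 / 4 * ph) <= \<bar>mu - 1\<bar> * \<bar>f z0 - f p\<bar>" by (intro mult_left_mono) auto
  ultimately have m1: "\<bar>mu - 1\<bar> * (3 / 4 * ph) <= 2 * et" by linarith
  have "\<bar>mu - 1\<bar> * (3 / 4 * ph) <= 2 / 3 * (3 / 4 * ph)" using m1 et(3) by linarith
  hence m2: "\<bar>mu - 1\<bar> <= 2 / 3" using ph by (simp add: mult_le_cancel_right)
  have "\<bar>mu - 1\<bar> * (3 / 4 * ph) <= (rh / (3 * N)) * (3 / 4 * ph)" proof -
   have "2 * (rh * ph / (8 * N)) = (rh / (3 * N)) * (3 / 4 * ph)" using ph by (simp add: field_simps)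
   thus ?thesis using m1 et(4) by linarith
  qed
  hence "\<bar>mu - 1\<bar> <= rh / (3 * N)" by (rule mult_right_le_imp_le) (use ph in simp)
  hence "\<bar>mu - 1\<bar> * \<bar>g z0\<bar> <= rh / (3 * N) * N" using fg(2)[of z0] ph rho by (intro mult_mono) auto
  hence a1: "\<bar>(mu - 1) * g z0\<bar> <= rh / 3" using ph by (simp add: abs_mult)
  have "mu <= 2" using m2 by linarith
  hence "mu * \<bar>g p\<bar> <= 2 * et" using P(1,4) fg(2)[of p] by (intro mult_mono) auto
  hence a2: "\<bar>mu * g p\<bar> <= 2 * et" using P(4) by (simp add: abs_mult)
  show False using re a1 a2 fg(2)[of q] P(2) P(3) et(2) rho by (simp add: algebra_simps)
 qed
 define x where "x = g z0"
 have z0x: "z0 = cr x * d" proof -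
  have "(d * cnj d) * z0 = cr x * d" using f0 unfolding f_def g_def x_def by (simp add: complex_eq_iff mult_ac)
  moreover have "d * cnj d = 1" using cdd by (simp add: mult.commute)
  ultimately show ?thesis by simp
 qed
 have x: "x > 0" proof (rule ccontr)
  assume "\<not> x > 0"
  then consider "x = 0" | "x < 0" by linarith
  hence "z0 \<in> ?Q" proof cases
   case 1
   thus ?thesis using z0x Q0 by simp
  next case 2
   hence "cr (- x) * (- d) \<in> K" by (intro oconeD(5)[OF K d(2)]) simp
   thus ?thesis using KQ z0x by auto
  qed
  thus False using z0Q by blast
 qed
 have mz0: "- z0 \<in> K" proof -
  have "cr x * (- d) \<in> K" by (rule oconeD(5)[OF K d(2) x])
  thus ?thesis unfolding z0x by simp
 qed
 define s where "s = (l - 1) * x"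
 have sp: "s > 0" using C(1) x by (simp add: s_def)
 \<comment> \<open>The image of 0 under the homothety about \<open>z0\<close>; the segment from
   \<open>q0\<close> to 0 is one period.\<close>
 define q0 where "q0 = - (cr s * d)"
 have q0z: "q0 = z0 - cr l * z0" unfolding q0_def s_def z0x by (simp add: algebra_simps)
 have seg: "q0 + cr si * d - z0 \<in> K" if "si <= s" for si proof -
  have "cr (s - si + x) * (- d) \<in> K" by (rule oconeD(5)[OF K d(2)]) (use that x in simp)
  moreover have "cr (s - si + x) * (- d) = q0 + cr si * d - z0" unfolding q0_def z0x by (simp add: algebra_simps)
  ultimately show ?thesis by simp
 qed
 obtain e0 where e0: "e0 > 0" "ball (- z0) e0 \<subseteq> K" using mz0 oconeD(1)[OF K] open_contains_ball by blast
 have hK: "h - z0 \<in> K" if "norm h < e0" for h using that e0(2) by (auto simp: dist_norm norm_minus_commute)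
 have hl: "FC (q0 + cr l * h) = FC h" if "norm h < e0" for h unfolding q0z using C(3)[OF hK[OF that]] by (simp add: algebra_simps)
 let ?c = "%u. FC (q0 + cr (s * (u - 0)) * d)"
 have hyp: "hyperbolic_closed_geodesic X d ?c" proof (rule hyperbolic_geodesic[OF C(2) sp, of _ _ e0 l])
  show "q0 + cr (s * (u - 0)) * d \<in> {z. z - z0 \<in> K}" if "0 <= u" "u <= 1" for u proof -
   have "s * (u - 0) <= s" using that sp by (simp add: mult_left_le)
   from seg[OF this] show ?thesis by blast
  qed
  show "FC (q0 + cr s * d + h) = FC (q0 + cr l * h)" if "norm h < e0" for h using hl[OF that] by (simp add: q0_def)
 qed (use e0 C(1) in auto)
 have "accumulates_on X I ga ?c" unfolding accumulates_on_def proof (intro ballI allI impI)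
  fix y W t0' assume y: "y \<in> ?c ` {0..1}" and W: "openin topX W & y \<in> W" and t0': "t0' \<in> I"
  obtain u where u: "0 <= u" "u <= 1" "y = ?c u" using y by auto
  define si where "si = s * u"
  have sg: "0 <= si" "si <= s" using u sp by (auto simp: si_def mult_left_le)
  have yF: "y = FC (q0 + cr si * d)" unfolding u(3) si_def by simp
  have op: "open {z\<in>{z. z - z0 \<in> K}. FC z \<in> W}" by (rule dimm_open_vimage[OF C(2)]) (use W in blast)
  obtain e4 where e4: "e4 > 0" "ball (q0 + cr si * d) e4 \<subseteq> {z\<in>{z. z - z0 \<in> K}. FC z \<in> W}" using seg[OF sg(2)] W yF op open_contains_ball by blast
  have cc: "compact ((%v. q0 + cr v * d) ` {0..s})" by (intro compact_continuous_image continuous_intros) simp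
  have cs: "(%v. q0 + cr v * d) ` {0..s} \<subseteq> {z. z - z0 \<in> K}" using seg by auto
  obtain e3 where e3: "e3 > 0" "(\<Union>x\<in>(%v. q0 + cr v * d) ` {0..s}. ball x e3) \<subseteq> {z. z - z0 \<in> K}" using compact_subset_open_imp_ball_epsilon_subset[OF cc oC cs] by blast
  define ep where "ep = min (min e0 e2) (min e3 e4 / l)"
  have ep: "ep > 0" using e0 e2 e3 e4 C(1) by (simp add: ep_def)
  obtain t1 p where t1: "t1 \<in> I" "t0' <= t1" "norm p < ep" "ga t1 = H p" using near[OF ep t0'] by blast
  have pe: "norm p < e0" "norm p < e2" "norm p < min e3 e4 / l" using t1(3) by (auto simp: ep_def)
  have lp: "norm (cr l * p) < e3" "norm (cr l * p) < e4" using pe(3) C(1) by (auto simp: norm_mult pos_less_divide_eq mult.commute)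
  have "p \<in> ball 0 e2" using pe(2) by simp
  hence pQ: "p \<in> ?Q" using e2(2) by blast
  have g1: "ga t1 = FC (q0 + cr l * p)" using t1(4) FCH[OF pQ hK[OF pe(1)]] hl[OF pe(1)] by simp
  have on: "q0 + cr l * p + cr v * d \<in> {z. z - z0 \<in> K}" if v: "v \<in> {0..s}" for v proof -
   have "q0 + cr l * p + cr v * d \<in> ball (q0 + cr v * d) e3" using lp(1) by (simp add: dist_norm)
   thus ?thesis using v e3(2) by blast
  qed
  have iv: "is_interval {0..s}" "0 \<in> {0..s}" using sp by (auto simp: is_interval_cc)
  obtain mu where mu: "mu > 0" "!!v. v \<in> {0..s} ==> t1 + v / mu \<in> I & ga (t1 + v / mu) = FC (q0 + cr l * p + cr v * d)" by (rule follow[OF tr d0 t1(1) C(2) iv on g1], assumption, rule that)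
  have "q0 + cr l * p + cr si * d \<in> ball (q0 + cr si * d) e4" using lp(2) by (simp add: dist_norm)
  hence "FC (q0 + cr l * p + cr si * d) \<in> W" using e4(2) by blast
  moreover have "si / mu >= 0" using sg mu(1) by simp
  ultimately show "\<exists>t\<in>I. t0' <= t & ga t \<in> W" using mu(2)[of si] sg t1(2) by (intro bexI[of _ "t1 + si / mu"]) auto
 qed
 thus ?thesis using hyp by blast
qed

text \<open>At a regular limit point the forward directions \<open>-K\<close> are probed with
  \<open>cap\<close>. If they are immersed as a whole, the trajectory runs in a complete cone and
  \<open>accumulates_forward\<close> applies. Otherwise an obstacle yields an immersed cone with
  directions \<open>K\<close> around the limit point, from a complete germ or by
  \<open>spread\<close>, and \<open>accumulates_backward\<close> applies.\<close>

lemma morse_smale_direction: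
 assumes dec: "decided K G" and comp: "!!g. g \<in> G ==> complete g K" and d: "norm d = 1" "- d \<in> K"
 shows "Morse_Smale X d" unfolding Morse_Smale_def
proof (intro allI impI)
 fix I ga assume tr: "trajectory X d I ga"
 have K: "ocone K" using decidedD(1)[OF dec] .
 have d0: "d ~= 0" using d(1) by auto
 have I: "I ~= {}" "is_interval I" "straight_path X d I ga" using tr unfolding trajectory_def by blast+
 consider "\<exists>s\<in>Sing. ends_at I ga s" | "\<exists>y\<in>Reg. clusters I ga y" using cluster_or_end[OF I(2,1) straight_continuous[OF I(3)]] by blast
 thus "hits_singularity X I ga \<or> (\<exists>c. hyperbolic_closed_geodesic X d c & accumulates_on X I ga c)" proof cases
  case 1
  thus ?thesis unfolding hits_singularity_def ends_at_def by blast
 next case 2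
  then obtain y where y: "y \<in> Reg" "clusters I ga y" by blast
  obtain U ph ps r0 where U: "(U,ph) \<in> atlas X" "y \<in> U" "r0 > 0" "dimm (ball (ph y) (4*r0)) ps"
   "!!v. v \<in> ball (ph y) (4*r0) ==> ps v \<in> U & ph (ps v) = v" "!!x. x \<in> U ==> ps (ph x) = x" by (rule chart_inverse[OF y(1)], rule that)
  let ?e = "%z. ps (z + ph y)"
  define rh where "rh = 4 * r0"
  have rho: "rh > 0" using U by (simp add: rh_def)
  have de: "dimm (ball 0 rh) ?e" proof (rule dimm_subset[OF dimm_shift[OF U(4)] open_ball])
   show "ball 0 rh \<subseteq> {z. z + ph y \<in> ball (ph y) (4 * r0)}" by (auto simp: rh_def dist_norm)
  qed
  have near: "\<exists>t'\<in>I. t <= t' & (\<exists>p. norm p < ep & ga t' = ?e p)" if h: "ep > 0" "t \<in> I" for ep t proof -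
   obtain t' where t': "t' \<in> I" "t <= t'" "ga t' \<in> U" "ph (ga t') \<in> ball (ph y) ep" by (rule cluster_points[OF y(2) U(1,2) h(2,1)], rule that)
   have "norm (ph (ga t') - ph y) < ep" using t'(4) by (simp add: dist_norm norm_minus_commute)
   moreover have "ga t' = ?e (ph (ga t') - ph y)" using U(6)[OF t'(3)] by simp
   ultimately show ?thesis using t'(1,2) by blast
  qed
  let ?N = "{z. - z \<in> K}"
  have N: "ocone ?N" by (rule ocone_uminus[OF K])
  have dN: "d \<in> ?N" using d(2) by simp
  have "\<exists>c. hyperbolic_closed_geodesic X d c & accumulates_on X I ga c" proof (rule cap[OF N rho de])
   fix F assume F: "dimm (?N Un ball 0 rh) F" "!!z. z \<in> ball 0 rh ==> F z = ?e z"
   obtain e1 where e1: "e1 > 0" "ball d e1 \<subseteq> ?N" using dN oconeD(1)[OF N] open_contains_ball by blast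
   \<comment> \<open>For \<open>norm p < ep\<close> the whole ray from \<open>p\<close> stays in the
     union of cone and disc: it is in the cone once \<open>s * e1\<close> exceeds
     \<open>norm p\<close>, and before that its norm is below \<open>rh\<close>.\<close>
   define ep where "ep = rh / (1 + 1 / e1)"
   have pos: "1 + 1 / e1 > 0" using e1 by (simp add: add_pos_pos)
   have ep: "ep > 0" "ep <= rh" using rho pos e1 by (auto simp: ep_def pos_divide_le_eq algebra_simps)
   obtain t where t: "t \<in> I" using I(1) by blast
   obtain t1 p where t1: "t1 \<in> I" "norm p < ep" "ga t1 = ?e p" using near[OF ep(1) t] by blast
   have on: "p + cr s * d \<in> ?N Un ball 0 rh" if s: "s \<in> {0..}" for s proof (cases "norm p < s * e1")
    case True
    have sp: "s > 0" using True s norm_ge_zero[of p] by (cases "s = 0") auto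
    have "d + p / cr s \<in> ball d e1" using True sp by (simp add: norm_divide pos_divide_less_eq mult.commute dist_norm)
    hence "cr s * (d + p / cr s) \<in> ?N" using e1(2) oconeD(5)[OF N _ sp] by blast
    moreover have "cr s * (d + p / cr s) = p + cr s * d" using sp by (simp add: distrib_left)
    ultimately show ?thesis by simp
   next case False
    hence "s <= norm p * (1 / e1)" using e1(1) by (simp add: pos_le_divide_eq)
    hence "norm (p + cr s * d) <= norm p + norm p * (1 / e1)" using norm_triangle_ineq[of p "cr s * d"] s d(1) by (simp add: norm_mult)
    also have "... = norm p * (1 + 1 / e1)" by (simp add: algebra_simps)
    also have "... < rh" using t1(2) pos unfolding ep_def by (simp add: pos_less_divide_eq)
    finally show ?thesis by simp
   qed
   have g1: "ga t1 = F p" using t1(2,3) F(2)[of p] ep by simp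
   have iv: "is_interval {0::real..}" "(0::real) \<in> {0..}" by (auto simp: is_interval_ci)
   obtain mu where mu: "mu > 0" "!!s. s \<in> {0..} ==> t1 + s / mu \<in> I & ga (t1 + s / mu) = F (p + cr s * d)" by (rule follow[OF tr d0 t1(1) F(1) iv on g1], assumption, rule that)
   have dFN: "dimm ?N F" by (rule dimm_subset[OF F(1) oconeD(1)[OF N]]) blast
   obtain l z0 FC where C: "l > 1" "dimm {z. z - z0 \<in> ?N} FC" "!!z. z - z0 \<in> ?N ==> FC (z0 + cr l * (z - z0)) = FC z"
    "!!z. z \<in> ?N ==> z - z0 \<in> ?N ==> FC z = F z" by (rule ocone_homothety[OF N dFN], rule that)
   obtain T1 where T1: "T1 > 0" "!!s. s >= T1 ==> p + cr s * d \<in> ?N" using ocone_far[OF N dN] by metis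
   obtain T2 where T2: "T2 > 0" "!!s. s >= T2 ==> (p - z0) + cr s * d \<in> ?N" using ocone_far[OF N dN] by metis
   have fin: "t1 + s / mu \<in> I & ga (t1 + s / mu) = FC (p + cr s * d)" if s: "s >= max T1 T2" for s proof -
    have "p + cr s * d \<in> ?N" using T1(2)[of s] s by simp
    moreover have "p + cr s * d - z0 \<in> ?N" using T2(2)[of s] s by (simp add: algebra_simps)
    ultimately have "FC (p + cr s * d) = F (p + cr s * d)" by (rule C(4))
    moreover have "s \<in> {0..}" using s T1(1) by auto
    ultimately show ?thesis using mu(2) by simp
   qed
   show ?thesis by (rule accumulates_forward[OF N C(2,1,3) dN mu(1) fin])
  next
   fix D E P assume D: "convex D" "0 \<in> D" "dimm D E" and nr: "\<exists>d>0. \<forall>z\<in>ball 0 d. E z = ?e z" and P: "P \<in> closure D" "P \<in> ?N" "\<not> extendable D E P"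
   have PK: "- P \<in> K" using P(2) by simp
   have "\<exists>b\<in>K. \<exists>H. dimm {z. z + b \<in> K} H & (\<exists>de>0. \<forall>z\<in>ball 0 de. H z = E z)" proof (cases "ends_radially E P 0")
    case True
    have qK: "0 - P \<in> K" using PK by simp
    obtain g where g: "g \<in> G" "matches K g D E P" using germ_familyD[OF decidedD(2)[OF dec] D(1,3) P(1) D(2) qK True] by blast
    obtain H where H: "dimm {z. z - P \<in> K} H" "!!z. z \<in> D ==> z - P \<in> K ==> H z = E z" by (rule matches_extends[OF K D(1,3) P(1) D(2) qK g(2) comp[OF g(1)]], rule that)
    have "open (D Int {z. z - P \<in> K})" using dimm_open[OF D(3)] dimm_open[OF H(1)] by blast
    moreover have "0 \<in> D Int {z. z - P \<in> K}" using D(2) PK by simp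
    ultimately obtain de where "de > 0" "ball 0 de \<subseteq> D Int {z. z - P \<in> K}" using open_contains_ball by blast
    thus ?thesis using H(2) PK H(1) by (intro bexI[of _ "- P"] exI[of _ H]) auto
   next case False
    hence ne: "\<not> ends_at {-1<..<0} (%t. E (P + cr (-t) * (0 - P))) s" if "s \<in> Sing" for s using that unfolding ends_radially_def by blast
    obtain rh' where rho': "rh' > 0" "ball (- P) rh' \<subseteq> K" using PK oconeD(1)[OF K] open_contains_ball by blast
    obtain l c where l: "0 < l" "l < 1" "!!w. w \<in> D ==> cr l * w + c \<in> D ==> E (cr l * w + c) = E w" "cr l * 0 + c \<in> D" "norm (c / cr (1 - l) - P) < rh'" by (rule end_trichotomy[OF D(1,3) P(1) D(2) ne P(3) rho'(1)], assumption, rule that)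
    define k where "k = - (c / cr (1 - l))"
    have kK: "k \<in> K" using l(5) unfolding k_def using rho'(2) by (auto simp: dist_norm)
    have m1: "cr (l - 1) * (- w) = cr (1 - l) * w" for w :: complex by (simp add: algebra_simps)
    have ck: "c = cr (l - 1) * k" using l(2) unfolding k_def using m1[of "c / cr (1 - l)"] by (simp del: of_real_diff)
    have cD: "c \<in> D" using l(4) by simp
    obtain H where H: "dimm {z. z + k \<in> K} H" "\<exists>e>0. \<forall>z\<in>ball 0 e. H z = E z" by (rule spread[OF dec D(1,3,2) l(1,2,3) cD kK ck], assumption, assumption, rule that)
    thus ?thesis using kK by blast
   qed
   then obtain b H de1 where b: "b \<in> K" "dimm {z. z + b \<in> K} H" "de1 > 0" "!!z. z \<in> ball 0 de1 ==> H z = E z" by blast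
   obtain de2 where d2: "de2 > 0" "!!z. z \<in> ball 0 de2 ==> E z = ?e z" using nr by blast
   have nearH: "\<exists>t'\<in>I. t <= t' & (\<exists>p. norm p < ep & ga t' = H p)" if h: "ep > 0" "t \<in> I" for ep t proof -
    have m: "min ep (min de1 de2) > 0" using h b d2 by simp
    obtain t' p where t': "t' \<in> I" "t <= t'" "norm p < min ep (min de1 de2)" "ga t' = ?e p" using near[OF m h(2)] by blast
    have "H p = ?e p" using b(4)[of p] d2(2)[of p] t'(3) by simp
    thus ?thesis using t'(3,4) t'(1,2) by fastforce
   qed
   show ?thesis by (rule accumulates_backward[OF K d b(1,2) tr nearH])
  qed
  thus ?thesis by blast
 qed
qed

section \<open>Density of the directions\<close>

lemma ocone_halfplane: assumes "v ~= 0" shows "ocone {z. Im (cnj z * v) > 0}"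
proof -
 have l: "linear (%z. - Im (cnj z * v))" by (rule linearI) (simp_all add: algebra_simps)
 have e: "{z. Im (cnj z * v) > 0} = {z. - Im (cnj z * v) < 0}" by auto
 have "Im (cnj (- \<i> * v) * v) > 0" proof -
  have "Im (cnj (- \<i> * v) * v) = (norm v)\<^sup>2" unfolding cmod_power2 by (simp add: power2_eq_square)
  thus ?thesis using assms by simp
 qed
 moreover have "Im (cnj (cr t * z) * v) = t * Im (cnj z * v)" for t z by (simp add: algebra_simps)
 moreover have "{z. Im (cnj z * v) > 0} ~= {}" using calculation(1) by blast
 ultimately show ?thesis unfolding ocone_def using halfplane[OF l, of 0] unfolding e[symmetric] by auto
qed

text \<open>The vector \<open>-d\<close> is moved off the line of \<open>v\<close> and surrounded by
  a narrow cone transversal to \<open>v\<close>. A decided subcone has good points by hypothesis,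
  and the direction sought is opposite to one of its vectors.\<close>

lemma directions_dense:
 assumes d: "norm d = 1" and v: "v ~= 0" and ep: "ep > 0"
  and good: "!!K. ocone K ==> (!!x. x \<in> K ==> Im (cnj x * v) ~= 0) ==> \<exists>x. good K x"
 shows "\<exists>d' K G. norm d' = 1 & norm (d' - d) < ep & decided K G & (\<exists>x. good K x) & - d' \<in> K"
proof -
 define de where "de = ep / 4"
 have del: "de > 0" using ep by (simp add: de_def)
 obtain x1 where x1: "Im (cnj x1 * v) ~= 0" "norm (x1 + d) < de" proof (cases "Im (cnj d * v) = 0")
  case False
  thus ?thesis using that[of "- d"] del by simp
 next case True
  define t where "t = de / (2 * norm v)"
  have "Im (cnj (- d + cr t * (\<i> * v)) * v) = - t * (norm v)\<^sup>2" unfolding cmod_power2 using True by (simp add: algebra_simps power2_eq_square)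
  moreover have "norm (cr t * (\<i> * v)) < de" using del v by (simp add: t_def norm_mult norm_divide)
  ultimately show ?thesis using that[of "- d + cr t * (\<i> * v)"] del v by (simp add: t_def)
 qed
 have ex: "\<exists>Hf. ocone Hf & x1 \<in> Hf & (\<forall>x\<in>Hf. Im (cnj x * v) ~= 0)" using ocone_halfplane[OF v] ocone_halfplane[of "- v"] v x1(1) by (cases "Im (cnj x1 * v) > 0") auto
 then obtain Hf where Hf: "ocone Hf" "x1 \<in> Hf" "!!x. x \<in> Hf ==> Im (cnj x * v) ~= 0" by blast
 obtain K0 where K0: "ocone K0" "K0 \<subseteq> Hf" "!!z. z \<in> K0 ==> \<exists>t>0. \<exists>x\<in>Hf. norm (x - x1) < de & z = cr t * x" using ocone_around[OF Hf(1,2) del] by metis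
 obtain K G where K: "K \<subseteq> K0" "decided K G" using decided_exists[OF K0(1)] by blast
 have oK: "ocone K" using decidedD(1)[OF K(2)] .
 have gx: "\<exists>x. good K x" by (rule good[OF oK]) (use Hf(3) K(1) K0(2) in blast)
 obtain k where k: "k \<in> K" using oconeD(3)[OF oK] by blast
 obtain t x where x: "t > 0" "norm (x - x1) < de" "k = cr t * x" using K0(3) K(1) k by blast
 have x0: "norm x > 0" using k oconeD(4)[OF oK] x(3) by auto
 define d' where "d' = - (cr (1 / norm x) * x)"
 have "cr (1 / (t * norm x)) * k \<in> K" by (rule oconeD(5)[OF oK k]) (use x0 x(1) in simp)
 hence mK: "- d' \<in> K" using x(1) unfolding x(3) d'_def by simp
 have n1: "norm d' = 1" using x0 by (simp add: d'_def norm_mult norm_divide)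
 have xd: "norm (x + d) < 2 * de" using norm_triangle_ineq[of "x - x1" "x1 + d"] x(2) x1(2) by simp
 have "norm (d' + x) = \<bar>norm x - 1\<bar>" proof -
  have "d' + x = cr ((norm x - 1) / norm x) * x" unfolding d'_def using x0 by (simp add: field_simps)
  thus ?thesis using x0 by (simp only: norm_mult norm_of_real) (simp add: abs_divide)
 qed
 also have "... <= norm (x + d)" using norm_triangle_ineq3[of x "- d"] d by simp
 finally show ?thesis using norm_triangle_ineq4[of "d' + x" "x + d"] xd n1 K(2) gx mK by (intro exI[of _ d'] exI[of _ K] exI[of _ G]) (simp add: de_def)
qed

end

section \<open>Morse-Smale directions\<close>

theorem theorem1p5:
  fixes X :: "'a dilation_structure"
  assumes "closed_dilation_surface X"
    and "\<exists>L. horizon_saddle_connection X L"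
  shows "\<exists>U. openin (top_of_set (sphere 0 1)) U \<and> sphere (0::complex) 1 \<subseteq> closure U \<and>
           (\<forall>d\<in>U. Morse_Smale X d)"
proof -
 obtain L dL k where sc: "saddle_connection X dL L"
  and bd: "\<forall>d I ga. d \<in> sphere 0 1 & d ~= dL & d ~= - dL & trajectory X d I ga -->
     finite {t\<in>I. ga t \<in> L ` {0<..<1}} & card {t\<in>I. ga t \<in> L ` {0<..<1}} <= k" using assms(2) unfolding horizon_saddle_connection_def by blast
 have "singularities X ~= {}" using sc unfolding saddle_connection_def by blast
 then interpret dilation_surface X using assms(1) by unfold_locales
 have dL: "norm dL = 1" using sc unfolding saddle_connection_def by simp
 hence dL0: "dL ~= 0" by auto
 have good: "\<exists>x. good K x" if gK: "ocone K" "!!x. x \<in> K ==> Im (cnj x * dL) ~= 0" for K proof -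
  have bd': "finite {t\<in>I. ga t \<in> L ` {0<..<1}} & card {t\<in>I. ga t \<in> L ` {0<..<1}} <= k"
   if "d \<in> sphere 0 1" "d ~= dL" "d ~= - dL" "trajectory X d I ga" for d I ga using bd that by blast
  show ?thesis by (rule horizon_good[OF sc, of k K]) (use bd' gK in blast)+
 qed
 \<comment> \<open>Membership is witnessed by an open cone that also serves for all nearby
   directions, so openness in the circle is immediate.\<close>
 define U where "U = {d. norm d = 1 & (\<exists>K G. decided K G & (\<exists>x. good K x) & - d \<in> K)}"
 have "openin (top_of_set (sphere 0 1)) U" proof (subst openin_subopen, intro ballI)
  fix d assume "d \<in> U"
  then obtain K G where K: "norm d = 1" "decided K G" "\<exists>x. good K x" "- d \<in> K" unfolding U_def by blast
  have "open {z. - z \<in> K}" using oconeD(1)[OF ocone_uminus[OF decidedD(1)[OF K(2)]]] .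
  hence "openin (top_of_set (sphere 0 1)) (sphere 0 1 Int {z. - z \<in> K})" by blast
  moreover have "sphere 0 1 Int {z. - z \<in> K} \<subseteq> U" using K(2,3) unfolding U_def by auto
  ultimately show "\<exists>T. openin (top_of_set (sphere 0 1)) T & d \<in> T & T \<subseteq> U" using K(1,4) by (intro exI[of _ "sphere 0 1 Int {z. - z \<in> K}"]) auto
 qed
 moreover have "sphere 0 1 \<subseteq> closure U" proof
  fix d :: complex assume "d \<in> sphere 0 1"
  hence d: "norm d = 1" by simp
  show "d \<in> closure U" unfolding closure_approachable proof (intro allI impI)
   fix e :: real assume "e > 0"
   then obtain d' K G where "norm d' = 1" "norm (d' - d) < e" "decided K G" "\<exists>x. good K x" "- d' \<in> K" using directions_dense[OF d dL0 _ good] by blast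
   thus "\<exists>y\<in>U. dist y d < e" unfolding U_def by (intro bexI[of _ d']) (auto simp: dist_norm)
  qed
 qed
 moreover have "Morse_Smale X d" if "d \<in> U" for d proof -
  obtain K G x where K: "norm d = 1" "decided K G" "good K x" "- d \<in> K" using \<open>d \<in> U\<close> unfolding U_def by blast
  have "complete g K" if "g \<in> G" for g by (rule all_complete[OF K(2) good_everywhere[OF K(2,3)] that])
  thus ?thesis by (rule morse_smale_direction[OF K(2) _ K(1,4)])
 qed
 ultimately show ?thesis by blast
qed

end
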